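(* Let $A$ be a local domain with quotient field $K$, and let $v_0$ be a valuation of $K$ which dominates $A$. Suppose that $f(x)\in A[x]$ is monic and irreducible in $K[x]$, that the characteristic $p$ of the residue field of $A$ does not divide $\deg f$, and that there is a unique extension $v$ of $v_0$ to the quotient field $K[x]/(f(x))$ of $A[x]/(f(x))$. Then ${\rm gr}_v(A[x]/(f(x)))$ is a finitely presented ${\rm gr}_{v_0}(A)$-algebra. Moreover, let $$S^A(v_0)=\{v_0(y)\mid y\in A\setminus\{0\}\}\quad\mbox{and}\quad S^{A[x]/(f(x))}(v)=\{v(z)\mid z\in A[x]/(f(x)),\ z\ne 0\}.$$ Then the semigroup $S^{A[x]/(f(x))}(v)$ is a finitely generated $S^A(v_0)$-module.
   Context: A local ring is a commutative ring with a unique maximal ideal (not necessarily Noetherian); $m_A$ denotes the maximal ideal of $A$. Valuations are Krull valuations of arbitrary rank, written additively. The valuation ring of $v_0$ is $\mathcal O_{v_0}$, with maximal ideal $m_{v_0}$; $v_0$ dominates $A$ if $A\subset\mathcal O_{v_0}$ and $m_{v_0}\cap A=m_A$. For a valuation $w$ of a field $F$ with value group $wF$ and a subring $R$ of $F$, the associated graded ring is ${\rm gr}_w(R)=\bigoplus_{\gamma\in wF}\mathcal P_\gamma(R)/\mathcal P_\gamma^+(R)$, where $\mathcal P_\gamma(R)=\{g\in R\mid w(g)\ge\gamma\}$ and $\mathcal P^+_\gamma(R)=\{g\in R\mid w(g)>\gamma\}$ (with $w(0)=\infty$). The ring ${\rm gr}_v(A[x]/(f(x)))$ is a graded ${\rm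 gr}_{v_0}(A)$-algebra via the inclusion $A\subset A[x]/(f(x))$. If $S\subset T$ are semigroups, $T$ is a finitely generated $S$-module if there exist finitely many elements $z_1,\ldots,z_l\in T$ such that $T=\bigcup_{i=1}^l(S+z_i)$. *)

theory Defs
  imports "HOL-Algebra.Algebra" "HOL-Algebra.Multiplicative_Group"
begin

section \<open>Valuations of arbitrary rank\<close>

text \<open>
  Value groups are ordered abelian groups with an explicit carrier. They are written
  multiplicatively, as all groups of HOL-Algebra are: \<open>\<gamma> \<otimes> \<delta>\<close> stands for \<open>\<gamma> + \<delta>\<close> and
  \<open>\<one>\<close> for the value \<open>0\<close>; the order is not reversed.
\<close>

record 'g ogroup = "'g monoid" +
  leq :: "'g \<Rightarrow> 'g \<Rightarrow> bool" (infixl "\<preceq>\<index>" 50)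

locale ordered_abelian_group = comm_group G for G :: "'g ogroup" (structure) +
  assumes leq_antisym: "\<lbrakk>x \<in> carrier G; y \<in> carrier G; x \<preceq> y; y \<preceq> x\<rbrakk> \<Longrightarrow> x = y"
    and leq_trans:
      "\<lbrakk>x \<in> carrier G; y \<in> carrier G; z \<in> carrier G; x \<preceq> y; y \<preceq> z\<rbrakk> \<Longrightarrow> x \<preceq> z"
    and leq_total: "\<lbrakk>x \<in> carrier G; y \<in> carrier G\<rbrakk> \<Longrightarrow> x \<preceq> y \<or> y \<preceq> x"
    and leq_mult:
      "\<lbrakk>x \<in> carrier G; y \<in> carrier G; z \<in> carrier G; x \<preceq> y\<rbrakk> \<Longrightarrow> z \<otimes> x \<preceq> z \<otimes> y"

definition order_embedding :: "'g ogroup \<Rightarrow> 'h ogroup \<Rightarrow> ('g \<Rightarrow> 'h) \<Rightarrow> bool" where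
  "order_embedding G H \<phi> \<longleftrightarrow> \<phi> \<in> mon G H \<and>
     (\<forall>x\<in>carrier G. \<forall>y\<in>carrier G. x \<preceq>\<^bsub>G\<^esub> y \<longleftrightarrow> \<phi> x \<preceq>\<^bsub>H\<^esub> \<phi> y)"

text \<open>
  The value \<open>\<infinity>\<close> of \<open>\<zero>\<close> is not represented: \<open>w\<close> is only considered on \<open>F - {\<zero>}\<close>, and wherever
  \<open>w(g) \<ge> \<gamma>\<close> or \<open>w(g) > \<gamma>\<close> occurs, the case \<open>g = \<zero>\<close> is listed separately. The group \<open>G\<close> is the
  value group \<open>wF\<close> itself, that is, \<open>w\<close> is onto.
\<close>

definition valuation :: "('a, 'm) ring_scheme \<Rightarrow> 'g ogroup \<Rightarrow> ('a \<Rightarrow> 'g) \<Rightarrow> bool" where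
  "valuation F G w \<longleftrightarrow> field F \<and> ordered_abelian_group G \<and> w \<in> epi (Multiplicative_Group.mult_of F) G \<and>
     (\<forall>x\<in>carrier F - {\<zero>\<^bsub>F\<^esub>}. \<forall>y\<in>carrier F - {\<zero>\<^bsub>F\<^esub>}. x \<oplus>\<^bsub>F\<^esub> y \<noteq> \<zero>\<^bsub>F\<^esub> \<longrightarrow>
        w x \<preceq>\<^bsub>G\<^esub> w (x \<oplus>\<^bsub>F\<^esub> y) \<or> w y \<preceq>\<^bsub>G\<^esub> w (x \<oplus>\<^bsub>F\<^esub> y))"

definition val_ge :: "('a, 'm) ring_scheme \<Rightarrow> 'g ogroup \<Rightarrow> ('a \<Rightarrow> 'g) \<Rightarrow> 'a set \<Rightarrow> 'g \<Rightarrow> 'a set"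
  where "val_ge F G w R \<gamma> = {g \<in> R. g = \<zero>\<^bsub>F\<^esub> \<or> \<gamma> \<preceq>\<^bsub>G\<^esub> w g}"

definition val_gt :: "('a, 'm) ring_scheme \<Rightarrow> 'g ogroup \<Rightarrow> ('a \<Rightarrow> 'g) \<Rightarrow> 'a set \<Rightarrow> 'g \<Rightarrow> 'a set"
  where "val_gt F G w R \<gamma> = {g \<in> R. g = \<zero>\<^bsub>F\<^esub> \<or> (\<gamma> \<preceq>\<^bsub>G\<^esub> w g \<and> w g \<noteq> \<gamma>)}"

definition valuation_ring :: "('a, 'm) ring_scheme \<Rightarrow> 'g ogroup \<Rightarrow> ('a \<Rightarrow> 'g) \<Rightarrow> 'a set" where
  "valuation_ring F G w = val_ge F G w (carrier F) \<one>\<^bsub>G\<^esub>"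

definition valuation_ideal :: "('a, 'm) ring_scheme \<Rightarrow> 'g ogroup \<Rightarrow> ('a \<Rightarrow> 'g) \<Rightarrow> 'a set" where
  "valuation_ideal F G w = val_gt F G w (carrier F) \<one>\<^bsub>G\<^esub>"

definition value_semigroup :: "('a, 'm) ring_scheme \<Rightarrow> ('a \<Rightarrow> 'g) \<Rightarrow> 'a set \<Rightarrow> 'g set" where
  "value_semigroup F w R = w ` (R - {\<zero>\<^bsub>F\<^esub>})"

text \<open>
  \<open>w\<close> extends \<open>w0\<close> along the field embedding \<open>j\<close>; \<open>\<iota>\<close> is the resulting inclusion of the value
  group of \<open>w0\<close> into that of \<open>w\<close>.
\<close>

definition extends_valuation ::
  "('a, 'm) ring_scheme \<Rightarrow> 'g ogroup \<Rightarrow> ('a \<Rightarrow> 'g) \<Rightarrow> ('b, 'n) ring_scheme \<Rightarrow> ('a \<Rightarrow> 'b) \<Rightarrow>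
   'h ogroup \<Rightarrow> ('b \<Rightarrow> 'h) \<Rightarrow> ('g \<Rightarrow> 'h) \<Rightarrow> bool" where
  "extends_valuation K G0 w0 L j G w \<iota> \<longleftrightarrow>
     valuation L G w \<and> order_embedding G0 G \<iota> \<and>
     (\<forall>a\<in>carrier K - {\<zero>\<^bsub>K\<^esub>}. w (j a) = \<iota> (w0 a))"

definition equivalent_valuations ::
  "('b, 'n) ring_scheme \<Rightarrow> 'g ogroup \<Rightarrow> ('b \<Rightarrow> 'g) \<Rightarrow> 'h ogroup \<Rightarrow> ('b \<Rightarrow> 'h) \<Rightarrow> bool" where
  "equivalent_valuations L G w G' w' \<longleftrightarrow>
     (\<exists>\<phi>. order_embedding G G' \<phi> \<and> \<phi> ` carrier G = carrier G' \<and>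
        (\<forall>x\<in>carrier L - {\<zero>\<^bsub>L\<^esub>}. w' x = \<phi> (w x)))"

text \<open>
  Uniqueness is up to equivalence of valuations, as usual. The competing valuations take values
  in groups whose elements are sets of elements of \<open>L\<close>. This loses nothing: the value group of
  \<open>w'\<close> is isomorphic to \<open>L\<^sup>* / O\<^sup>*\<close> for the valuation ring \<open>O\<close> of \<open>w'\<close>, and the elements of this
  quotient are cosets, so every valuation of \<open>L\<close> is equivalent to one of this kind.
\<close>

definition unique_extension ::
  "('a, 'm) ring_scheme \<Rightarrow> 'g ogroup \<Rightarrow> ('a \<Rightarrow> 'g) \<Rightarrow> ('b, 'n) ring_scheme \<Rightarrow> ('a \<Rightarrow> 'b) \<Rightarrow>
   'h ogroup \<Rightarrow> ('b \<Rightarrow> 'h) \<Rightarrow> ('g \<Rightarrow> 'h) \<Rightarrow> bool" where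
  "unique_extension K G0 w0 L j G w \<iota> \<longleftrightarrow>
     extends_valuation K G0 w0 L j G w \<iota> \<and>
     (\<forall>(G' :: 'b set ogroup) w' \<iota>'. extends_valuation K G0 w0 L j G' w' \<iota>' \<longrightarrow>
        equivalent_valuations L G w G' w')"


section \<open>Local domains\<close>

definition local_ring :: "('a, 'm) ring_scheme \<Rightarrow> bool" where
  "local_ring R \<longleftrightarrow> cring R \<and> (\<exists>!M. maximalideal M R)"

definition max_ideal :: "('a, 'm) ring_scheme \<Rightarrow> 'a set" where
  "max_ideal R = (THE M. maximalideal M R)"

definition residue_field :: "('a, 'm) ring_scheme \<Rightarrow> 'a set ring" where
  "residue_field R = R Quot max_ideal R"

text \<open>\<^const>\<open>group.ord\<close> is \<open>0\<close> on elements of infinite order.\<close>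

definition characteristic :: "('a, 'm) ring_scheme \<Rightarrow> nat" where
  "characteristic R = group.ord (add_monoid R) \<one>\<^bsub>R\<^esub>"

definition quotient_field_of :: "('a, 'm) ring_scheme \<Rightarrow> 'a set \<Rightarrow> bool" where
  "quotient_field_of K A \<longleftrightarrow> field K \<and> subdomain A K \<and>
     (\<forall>x\<in>carrier K. \<exists>a\<in>A. \<exists>b\<in>A - {\<zero>\<^bsub>K\<^esub>}. x = a \<otimes>\<^bsub>K\<^esub> inv\<^bsub>K\<^esub> b)"

definition dominates ::
  "('a, 'm) ring_scheme \<Rightarrow> 'g ogroup \<Rightarrow> ('a \<Rightarrow> 'g) \<Rightarrow> 'a set \<Rightarrow> bool" where
  "dominates K G w A \<longleftrightarrow> A \<subseteq> valuation_ring K G w \<and>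
     valuation_ideal K G w \<inter> A = max_ideal (K\<lparr>carrier := A\<rparr>)"


section \<open>Associated graded rings\<close>

definition gr_piece ::
  "('a, 'm) ring_scheme \<Rightarrow> 'g ogroup \<Rightarrow> ('a \<Rightarrow> 'g) \<Rightarrow> 'a set \<Rightarrow> 'g \<Rightarrow> 'a set monoid" where
  "gr_piece F G w R \<gamma> = (F\<lparr>carrier := val_ge F G w R \<gamma>\<rparr>) A_Mod (val_gt F G w R \<gamma>)"

text \<open>
  Elements are the finitely supported families of cosets indexed by the value group. In the
  product, the component of degree \<open>\<gamma>\<close> sums, in the abelian group \<open>gr_piece F G w R \<gamma>\<close>, the
  products \<open>h\<^sub>\<alpha> k\<^sub>\<gamma>\<^sub>-\<^sub>\<alpha>\<close> over the finitely many \<open>\<alpha>\<close> for which both factors are nonzero.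
\<close>

definition gr_mult ::
  "('a, 'm) ring_scheme \<Rightarrow> 'g ogroup \<Rightarrow> ('a \<Rightarrow> 'g) \<Rightarrow> 'a set \<Rightarrow>
   ('g \<Rightarrow> 'a set) \<Rightarrow> ('g \<Rightarrow> 'a set) \<Rightarrow> ('g \<Rightarrow> 'a set)" where
  "gr_mult F G w R h k = (\<lambda>\<gamma>\<in>carrier G.
     finprod (gr_piece F G w R \<gamma>)
       (\<lambda>\<alpha>. rcoset_mult F (val_gt F G w R \<gamma>) (h \<alpha>) (k (inv\<^bsub>G\<^esub> \<alpha> \<otimes>\<^bsub>G\<^esub> \<gamma>)))
       {\<alpha> \<in> carrier G. h \<alpha> \<noteq> val_gt F G w R \<alpha> \<and>
          k (inv\<^bsub>G\<^esub> \<alpha> \<otimes>\<^bsub>G\<^esub> \<gamma>) \<noteq> val_gt F G w R (inv\<^bsub>G\<^esub> \<alpha> \<otimes>\<^bsub>G\<^esub> \<gamma>)})"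

definition gr ::
  "('a, 'm) ring_scheme \<Rightarrow> 'g ogroup \<Rightarrow> ('a \<Rightarrow> 'g) \<Rightarrow> 'a set \<Rightarrow> ('g \<Rightarrow> 'a set) ring" where
  "gr F G w R =
     \<lparr> carrier = carrier (sum_group (carrier G) (gr_piece F G w R)),
       monoid.mult = gr_mult F G w R,
       one = (\<lambda>\<gamma>\<in>carrier G. if \<gamma> = \<one>\<^bsub>G\<^esub> then val_gt F G w R \<gamma> +>\<^bsub>F\<^esub> \<one>\<^bsub>F\<^esub>
                             else val_gt F G w R \<gamma>),
       ring.zero = (\<lambda>\<gamma>\<in>carrier G. val_gt F G w R \<gamma>),
       ring.add = monoid.mult (sum_group (carrier G) (gr_piece F G w R)) \<rparr>"

text \<open>
  The map of graded rings induced by a ring inclusion \<open>j\<close> of \<open>R0\<close> into \<open>R\<close> for which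
  \<open>w \<circ> j = \<iota> \<circ> w0\<close>. In degree \<open>\<iota> \<gamma>\<close> it sends the class of \<open>g\<close> to the class of \<open>j g\<close>; components
  of degree outside the image of \<open>\<iota>\<close> are zero. The ring \<open>R0\<close> itself does not enter the formula,
  only the elements of its graded ring do.
\<close>

definition gr_map ::
  "'g ogroup \<Rightarrow> ('b, 'n) ring_scheme \<Rightarrow> 'h ogroup \<Rightarrow> ('b \<Rightarrow> 'h) \<Rightarrow> 'b set \<Rightarrow>
   ('a \<Rightarrow> 'b) \<Rightarrow> ('g \<Rightarrow> 'h) \<Rightarrow> ('g \<Rightarrow> 'a set) \<Rightarrow> ('h \<Rightarrow> 'b set)" where
  "gr_map G0 L G w R j \<iota> h = (\<lambda>\<delta>\<in>carrier G.
     if \<delta> \<in> \<iota> ` carrier G0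
     then val_gt L G w R \<delta> <+>\<^bsub>L\<^esub> j ` h (inv_into (carrier G0) \<iota> \<delta>)
     else val_gt L G w R \<delta>)"


section \<open>Finite presentation and finite generation\<close>

text \<open>
  The polynomial ring over \<open>R\<close> in variables indexed by \<open>I\<close>, on the indexed polynomials of
  HOL-Algebra, which come without a multiplication: a monomial is a multiset of variables and a
  polynomial maps each monomial to its coefficient.
\<close>

definition mpoly_ring :: "('a, 'm) ring_scheme \<Rightarrow> 'c set \<Rightarrow> ('c multiset \<Rightarrow> 'a) ring" where
  "mpoly_ring R I =
     \<lparr> carrier = ring.indexed_pset R I (carrier R),
       monoid.mult = (\<lambda>P Q m. \<Oplus>\<^bsub>R\<^esub>u \<in> {u. u \<subseteq># m}. P u \<otimes>\<^bsub>R\<^esub> Q (m - u)),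
       one = ring.indexed_const R \<one>\<^bsub>R\<^esub>,
       ring.zero = ring.indexed_const R \<zero>\<^bsub>R\<^esub>,
       ring.add = ring.indexed_padd R \<rparr>"

text \<open>\<open>S\<close> is an \<open>R\<close>-algebra with structure map \<open>\<phi>\<close>.\<close>

definition finitely_presented_algebra ::
  "('a, 'm) ring_scheme \<Rightarrow> ('b, 'n) ring_scheme \<Rightarrow> ('a \<Rightarrow> 'b) \<Rightarrow> bool" where
  "finitely_presented_algebra R S \<phi> \<longleftrightarrow> cring R \<and> cring S \<and> \<phi> \<in> ring_hom R S \<and>
     (\<exists>(n :: nat) \<psi>. \<psi> \<in> ring_hom (mpoly_ring R {..<n}) S \<and>
        (\<forall>r\<in>carrier R. \<psi> (ring.indexed_const R r) = \<phi> r) \<and>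
        \<psi> ` carrier (mpoly_ring R {..<n}) = carrier S \<and>
        (\<exists>J. finite J \<and> J \<subseteq> carrier (mpoly_ring R {..<n}) \<and>
           a_kernel (mpoly_ring R {..<n}) S \<psi> = Idl\<^bsub>mpoly_ring R {..<n}\<^esub> J))"

text \<open>For subsemigroups \<open>S \<subseteq> T\<close> of \<open>G\<close>; \<open>S #> z\<close> is the translate \<open>S + z\<close>.\<close>

definition finitely_generated_over :: "('g, 'm) monoid_scheme \<Rightarrow> 'g set \<Rightarrow> 'g set \<Rightarrow> bool" where
  "finitely_generated_over G S T \<longleftrightarrow> S \<subseteq> T \<and>
     (\<exists>Z. finite Z \<and> Z \<subseteq> T \<and> T = (\<Union>z\<in>Z. S #>\<^bsub>G\<^esub> z))"


section \<open>The rings \<open>A[x]/(f)\<close> and \<open>K[x]/(f)\<close>\<close>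

text \<open>
  \<open>K[x]/(f)\<close> is \<^term>\<open>rupture K (carrier K) f\<close>. As subrings of this field, \<open>K\<close> is embedded through
  the classes of the constant polynomials, and \<open>A[x]/(f)\<close> is the set of classes of the polynomials
  with coefficients in \<open>A\<close>. That the latter is \<open>A[x]/(f)\<close> is the theorem below, where it matters
  that \<open>f\<close> is monic.
\<close>

definition rupture_const :: "('a, 'm) ring_scheme \<Rightarrow> 'a list \<Rightarrow> 'a \<Rightarrow> 'a list set" where
  "rupture_const K f a =
     (PIdl\<^bsub>poly_ring K\<^esub> f) +>\<^bsub>poly_ring K\<^esub> (ring.poly_of_const K a)"

definition rupture_subring :: "('a, 'm) ring_scheme \<Rightarrow> 'a set \<Rightarrow> 'a list \<Rightarrow> 'a list set set" where
  "rupture_subring K A f =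
     (\<lambda>q. (PIdl\<^bsub>poly_ring K\<^esub> f) +>\<^bsub>poly_ring K\<^esub> q) ` carrier (univ_poly K A)"

theorem rupture_subring_iso:
  assumes "field K" and A: "subring A K" and f: "f \<in> carrier (univ_poly K A)" "f \<noteq> []"
    and monic: "lead_coeff f = \<one>\<^bsub>K\<^esub>"
  shows "rupture K A f \<simeq> (rupture K (carrier K) f)\<lparr>carrier := rupture_subring K A f\<rparr>"
proof -
  interpret K: field K by fact
  let ?KX = "poly_ring K" and ?AX = "univ_poly K A" and ?L = "rupture K (carrier K) f"
  let ?\<pi> = "\<lambda>q. (PIdl\<^bsub>?KX\<^esub> f) +>\<^bsub>?KX\<^esub> q"
  interpret KX: domain ?KX
    using K.univ_poly_is_domain[OF K.carrier_is_subring] .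
  interpret AX: domain ?AX
    using K.univ_poly_is_domain[OF A] .
  have AK: "A \<subseteq> carrier K" using subringE(1)[OF A] .
  have sub: "carrier ?AX \<subseteq> carrier ?KX"
    using AK by (auto simp: univ_poly_def polynomial_def)
  have fK: "f \<in> carrier ?KX" using f(1) sub by blast
  interpret I: ideal "PIdl\<^bsub>?KX\<^esub> f" ?KX using KX.cgenideal_ideal[OF fK] .
  have ops: "monoid.mult ?AX = monoid.mult ?KX" "ring.add ?AX = ring.add ?KX"
    "monoid.one ?AX = monoid.one ?KX" "ring.zero ?AX = ring.zero ?KX"
    by (simp_all add: univ_poly_def)
  have \<pi>: "?\<pi> \<in> ring_hom ?KX ?L" and L: "ring ?L"
    using K.rupture_surj_hom[OF K.carrier_is_subring fK] ring_hom_ring.axioms(2) by auto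
  have \<pi>A: "?\<pi> \<in> ring_hom ?AX ?L"
    by (intro ring_hom_memI)
      (simp_all only: ops ring_hom_memE[OF \<pi>] subsetD[OF sub])
  interpret h: ring_hom_ring ?AX ?L ?\<pi>
    using ring_hom_ringI2[OF AX.ring_axioms L \<pi>A] .
  have L0: "\<zero>\<^bsub>?L\<^esub> = PIdl\<^bsub>?KX\<^esub> f" unfolding rupture_def FactRing_def by (simp only: ring.simps)
  have "a_kernel ?AX ?L ?\<pi> = PIdl\<^bsub>?AX\<^esub> f"
  proof
    show "PIdl\<^bsub>?AX\<^esub> f \<subseteq> a_kernel ?AX ?L ?\<pi>"
    proof
      fix q assume "q \<in> PIdl\<^bsub>?AX\<^esub> f"
      then obtain g where g: "g \<in> carrier ?AX" "q = g \<otimes>\<^bsub>?AX\<^esub> f"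
        unfolding cgenideal_def by blast
      have "q \<in> PIdl\<^bsub>?KX\<^esub> f" using g sub unfolding cgenideal_def ops by blast
      moreover have "q \<in> carrier ?AX" using g f by simp
      ultimately show "q \<in> a_kernel ?AX ?L ?\<pi>"
        unfolding a_kernel_def' L0 using I.a_rcos_const by blast
    qed
    show "a_kernel ?AX ?L ?\<pi> \<subseteq> PIdl\<^bsub>?AX\<^esub> f"
    proof
      fix q assume "q \<in> a_kernel ?AX ?L ?\<pi>"
      hence q: "q \<in> carrier ?AX" and "?\<pi> q = PIdl\<^bsub>?KX\<^esub> f"
        unfolding a_kernel_def' L0 by blast+
      hence "q \<in> PIdl\<^bsub>?KX\<^esub> f"
        using I.a_rcos_self[OF subsetD[OF sub q]] by simp
      then obtain g where g: "g \<in> carrier ?KX" "q = g \<otimes>\<^bsub>?KX\<^esub> f"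
        unfolding cgenideal_def by blast
      have "\<one>\<^bsub>K\<^esub> \<in> Units (K\<lparr>carrier := A\<rparr>)"
        using subringE(3)[OF A] by (auto simp: Units_def intro!: bexI[of _ "\<one>\<^bsub>K\<^esub>"])
      then obtain b r where b: "b \<in> carrier ?AX" and r: "r \<in> carrier ?AX"
        and d: "q = (f \<otimes>\<^bsub>?AX\<^esub> b) \<oplus>\<^bsub>?AX\<^esub> r" "r = [] \<or> degree r < degree f"
        using K.long_division_theorem[OF A, of q f] q f monic
        unfolding univ_poly_carrier by metis
      have "K.long_divides q f (b, r)"
        using d subsetD[OF sub b] subsetD[OF sub r] unfolding K.long_divides_def ops by simp
      moreover have "K.long_divides q f (g, [])"
        using g KX.m_comm[OF g(1) fK] KX.r_zero[OF KX.m_closed[OF fK g(1)]] KX.zero_closed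
        unfolding K.long_divides_def by (simp add: univ_poly_zero)
      ultimately have "g = b"
        using K.exists_unique_long_division
          [OF K.carrier_is_subfield subsetD[OF sub q] fK f(2)] by blast
      thus "q \<in> PIdl\<^bsub>?AX\<^esub> f" using g b unfolding cgenideal_def ops by blast
    qed
  qed
  thus ?thesis
    using h.FactRing_iso_set_aux unfolding is_ring_iso_def rupture_subring_def
    by (auto simp: rupture_def[of K A f])
qed

end

theory Submission
  imports Defs
begin

text \<open>
  Write \<open>B = A[x]/(f)\<close>, \<open>L = K[x]/(f)\<close> and \<open>n = deg f\<close>, and let \<open>v(p)\<close> be the value of the class of a
  polynomial \<open>p\<close> in \<open>L\<close>. The heart of the proof is that for every \<open>i < n\<close> there is a monic \<open>E\<^sub>i\<close> of
  degree \<open>i\<close> with coefficients in \<open>A\<close>, and not just in \<open>K\<close>, whose value is maximal among all monic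
  polynomials of degree \<open>i\<close> over \<open>K\<close> (\<open>max_mon_exists\<close>). Division by the \<open>E\<^sub>i\<close> shows that their classes
  are an \<open>A\<close>-basis of \<open>B\<close>, and maximality shows that \<open>v(\<Sum> a\<^sub>i E\<^sub>i) = min v(a\<^sub>i E\<^sub>i)\<close> for \<open>a\<^sub>i \<in> K\<close>: if \<open>k\<close> is
  the highest index with \<open>a\<^sub>k \<noteq> 0\<close>, then \<open>\<Sum> a\<^sub>i E\<^sub>i\<close> is \<open>a\<^sub>k\<close> times a monic polynomial of degree \<open>k\<close>, so
  that its value is at most \<open>v(a\<^sub>k E\<^sub>k)\<close>. Hence the initial forms of the \<open>E\<^sub>i\<close> are a basis of the
  graded ring of \<open>B\<close> as a module over that of \<open>A\<close>, and every value of \<open>B\<close> is the sum of a value of \<open>A\<close>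
  and some \<open>v(E\<^sub>i)\<close>. The second part of the theorem is now immediate. The first holds because an
  algebra that is finite and free as a module is finitely presented: the multiplication table of
  a basis is a complete set of relations.

  The \<open>E\<^sub>i\<close> are found by induction on the degree in the manner of Mac Lane's key polynomials,
  beginning in degree one. Suppose that \<open>g\<close> is one of them, of degree \<open>d\<close>, and that it is a key
  polynomial: reducing a product of two polynomials of degree below \<open>d\<close> modulo \<open>g\<close> does not change
  its value. Then \<open>w(\<Sum> c\<^sub>i g\<^sup>i) = min v(c\<^sub>i g\<^sup>i)\<close>, for \<open>c\<^sub>i\<close> of degree below \<open>d\<close>, defines a valuation \<open>w \<le> v\<close>
  (\<open>Lead_mult\<close>). If \<open>w\<close> and \<open>v\<close> agree on all polynomials of degree below \<open>n\<close>, then the products \<open>E\<^sub>r g\<^sup>q\<close>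
  with \<open>r < d\<close> are optimal and the search is over. Otherwise let \<open>d'\<close> be the least degree of a monic
  polynomial \<open>h\<close> with \<open>w(h) < v(h)\<close>. Below degree \<open>d'\<close> the products \<open>E\<^sub>r g\<^sup>q\<close> are still optimal, and each
  such \<open>h\<close> is a key polynomial (\<open>key_stage_step\<close>), but it need not have coefficients in \<open>A\<close>.

  This is where the hypotheses enter. As \<open>v\<close> is the only extension of \<open>v\<^sub>0\<close>, every nonzero \<open>y \<in> L\<close>
  satisfies an equation \<open>y\<^sup>N = \<Sum> a\<^sub>i y\<^sup>i\<close> with \<open>i < N\<close>, \<open>a\<^sub>i \<in> K\<close> and \<open>v(a\<^sub>i y\<^sup>i) \<ge> v(y\<^sup>N)\<close>
  (\<open>integral_relation\<close>); otherwise Chevalley's theorem would yield a second extension. For the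
  class \<open>y\<close> of \<open>h\<close> it says that \<open>h\<^sup>N - \<Sum> a\<^sub>i h\<^sup>i\<close> is a multiple of \<open>f\<close>, and comparing initial terms gives
  \<open>n = m d'\<close> and \<open>v(c) \<ge> v(h)\<close> for the coefficient \<open>c\<close> of \<open>h\<^sup>m\<^sup>-\<^sup>1\<close> in the \<open>h\<close>-adic expansion of \<open>f\<close>
  (\<open>key_degree\<close>). Since the residue characteristic does not divide \<open>n\<close>, the integer \<open>m\<close> is a unit of
  \<open>A\<close>, and the Tschirnhausen transformation that replaces \<open>h\<close> by \<open>h + c/m\<close> does not decrease the
  value. Iterating it leads to the \<open>m\<close>-th approximate root of \<open>f\<close>, the unique monic polynomial of
  degree \<open>d'\<close> with \<open>deg (f - h\<^sup>m) < n - d'\<close>. It does not depend on \<open>h\<close>, so it has maximal value, and it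
  has coefficients in \<open>A\<close> because \<open>f\<close> does and \<open>1/m \<in> A\<close> (\<open>approximate_root_max\<close>). This is the next key
  polynomial.
\<close>

section \<open>Valuation preorders on a field\<close>

text \<open>
  The relation is to be read as \<open>v(x) \<le> v(y)\<close>, where \<open>v(0) = \<infinity>\<close>. Only comparisons of values of field
  elements occur in the arguments on polynomials, so that the value group can be left out and \<open>\<zero>\<close>
  needs no special treatment.
\<close>

locale valuative_field = field L for L :: "('b, 'n) ring_scheme" (structure) +
  fixes le :: "'b \<Rightarrow> 'b \<Rightarrow> bool" (infix "\<lessapprox>" 50)
  assumes le_total: "\<lbrakk>x \<in> carrier L; y \<in> carrier L\<rbrakk> \<Longrightarrow> x \<lessapprox> y \<or> y \<lessapprox> x"
    and le_trans: "\<lbrakk>x \<lessapprox> y; y \<lessapprox> z; x \<in> carrier L; y \<in> carrier L; z \<in> carrier L\<rbrakk> \<Longrightarrow> x \<lessapprox> z"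
    and le_zero: "x \<in> carrier L \<Longrightarrow> x \<lessapprox> \<zero>"
    and zero_le: "\<lbrakk>\<zero> \<lessapprox> x; x \<in> carrier L\<rbrakk> \<Longrightarrow> x = \<zero>"
    and le_mult: "\<lbrakk>x \<lessapprox> y; x \<in> carrier L; y \<in> carrier L; z \<in> carrier L\<rbrakk> \<Longrightarrow> z \<otimes> x \<lessapprox> z \<otimes> y"
    and le_add: "\<lbrakk>z \<lessapprox> x; z \<lessapprox> y; x \<in> carrier L; y \<in> carrier L; z \<in> carrier L\<rbrakk> \<Longrightarrow> z \<lessapprox> x \<oplus> y"
begin

abbreviation lt (infix "\<lless>" 50) where "x \<lless> y \<equiv> \<not> y \<lessapprox> x"

lemma le_refl: "x \<in> carrier L \<Longrightarrow> x \<lessapprox> x"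
  using le_total by blast

lemma lt_imp_le: "\<lbrakk>x \<lless> y; x \<in> carrier L; y \<in> carrier L\<rbrakk> \<Longrightarrow> x \<lessapprox> y"
  using le_total by blast

lemma le_nonzero: "\<lbrakk>x \<lessapprox> y; y \<noteq> \<zero>; y \<in> carrier L\<rbrakk> \<Longrightarrow> x \<noteq> \<zero>"
  using zero_le by blast

lemma le_lt_trans: "\<lbrakk>x \<lessapprox> y; y \<lless> z; x \<in> carrier L; y \<in> carrier L; z \<in> carrier L\<rbrakk> \<Longrightarrow> x \<lless> z"
  using le_trans by blast

lemma lt_le_trans: "\<lbrakk>x \<lless> y; y \<lessapprox> z; x \<in> carrier L; y \<in> carrier L; z \<in> carrier L\<rbrakk> \<Longrightarrow> x \<lless> z"
  using le_trans by blast

lemma le_uminus: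
  assumes "z \<lessapprox> x" "x \<in> carrier L" "z \<in> carrier L"
  shows "z \<lessapprox> \<ominus> x"
proof -
  have "\<one> \<lessapprox> \<ominus> \<one>"
  proof -
    have "\<ominus> \<one> \<otimes> \<ominus> \<one> \<lessapprox> \<ominus> \<one> \<otimes> \<one>" if "\<ominus> \<one> \<lessapprox> \<one>"
      using le_mult[OF that, of "\<ominus> \<one>"] by simp
    then have "\<ominus> \<one> \<lessapprox> \<one> \<Longrightarrow> \<one> \<lessapprox> \<ominus> \<one>" by (simp add: l_minus r_minus)
    then show ?thesis using le_total[of \<one> "\<ominus> \<one>"] by auto
  qed
  from le_mult[OF this, of x] have "x \<lessapprox> \<ominus> x" using assms by (simp add: r_minus)
  then show ?thesis using le_trans[of z x "\<ominus> x"] assms by simp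
qed

lemma le_minus: "\<lbrakk>z \<lessapprox> x; z \<lessapprox> y; x \<in> carrier L; y \<in> carrier L; z \<in> carrier L\<rbrakk> \<Longrightarrow> z \<lessapprox> x \<ominus> y"
  by (simp add: a_minus_def le_add le_uminus)

lemma lt_add:
  assumes "z \<lless> x" "z \<lless> y" "x \<in> carrier L" "y \<in> carrier L" "z \<in> carrier L"
  shows "z \<lless> x \<oplus> y"
proof (cases "x \<lessapprox> y")
  case True
  then have "x \<lessapprox> x \<oplus> y" using le_add le_refl assms(3,4) by blast
  then show ?thesis using lt_le_trans assms by (meson a_closed)
next
  case False
  then have "y \<lessapprox> x" using le_total assms(3,4) by blast
  then have "y \<lessapprox> x \<oplus> y" using le_add le_refl assms(3,4) by blast
  then show ?thesis using lt_le_trans assms by (meson a_closed)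
qed

lemma le_cancel:
  assumes "z \<otimes> x \<lessapprox> z \<otimes> y" "x \<in> carrier L" "y \<in> carrier L" "z \<in> carrier L" "z \<noteq> \<zero>"
  shows "x \<lessapprox> y"
proof -
  have i: "inv z \<in> carrier L" "inv z \<otimes> z = \<one>" using assms field_Units by auto
  have "inv z \<otimes> (z \<otimes> x) \<lessapprox> inv z \<otimes> (z \<otimes> y)" using le_mult[OF assms(1)] assms i by simp
  then show ?thesis using assms i by (simp flip: m_assoc)
qed

lemma le_mult2:
  assumes "x \<lessapprox> y" "z \<lessapprox> w" "x \<in> carrier L" "y \<in> carrier L" "z \<in> carrier L" "w \<in> carrier L"
  shows "x \<otimes> z \<lessapprox> y \<otimes> w"
proof -
  have "x \<otimes> z \<lessapprox> x \<otimes> w" using le_mult assms by simp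
  moreover have "x \<otimes> w \<lessapprox> y \<otimes> w" using le_mult[of x y w] assms m_comm by simp
  ultimately show ?thesis using le_trans assms by (meson m_closed)
qed

lemma lt_mult2:
  assumes "x \<lessapprox> y" "z \<lless> w" "x \<noteq> \<zero>" "x \<in> carrier L" "y \<in> carrier L" "z \<in> carrier L" "w \<in> carrier L"
  shows "x \<otimes> z \<lless> y \<otimes> w"
proof
  assume a: "y \<otimes> w \<lessapprox> x \<otimes> z"
  have "x \<otimes> w \<lessapprox> y \<otimes> w" using le_mult2[OF assms(1) le_refl] assms by simp
  then have "x \<otimes> w \<lessapprox> x \<otimes> z" using le_trans[OF _ a] assms by simp
  then show False using le_cancel assms by blast
qed

lemma lt_mult2':
  assumes "x \<lless> y" "z \<lessapprox> w" "z \<noteq> \<zero>" "x \<in> carrier L" "y \<in> carrier L" "z \<in> carrier L" "w \<in> carrier L"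
  shows "x \<otimes> z \<lless> y \<otimes> w"
  using lt_mult2[OF assms(2,1,3,6,7,4,5)] assms by (simp add: m_comm)

lemma pow_nonzero: "\<lbrakk>x \<in> carrier L; x \<noteq> \<zero>\<rbrakk> \<Longrightarrow> x [^] (k::nat) \<noteq> \<zero>"
  by (induction k) (auto simp: integral_iff)

lemma le_finsum:
  assumes "finite I" "\<And>i. i \<in> I \<Longrightarrow> h i \<in> carrier L" "\<And>i. i \<in> I \<Longrightarrow> z \<lessapprox> h i" "z \<in> carrier L"
  shows "z \<lessapprox> (\<Oplus>i\<in>I. h i)"
  using assms
proof (induction I rule: finite_induct)
  case empty then show ?case using le_zero by simp
next
  case (insert i I)
  then have "(\<Oplus>i\<in>insert i I. h i) = h i \<oplus> (\<Oplus>i\<in>I. h i)"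
    by (intro finsum_insert) auto
  moreover have "z \<lessapprox> h i \<oplus> (\<Oplus>i\<in>I. h i)"
    using insert by (intro le_add insert.IH finsum_closed) auto
  ultimately show ?case by simp
qed

end

lemma (in valuative_field) lt_uminus:
  assumes "z \<lless> x" "x \<in> carrier L" "z \<in> carrier L"
  shows "z \<lless> \<ominus> x"
proof
  assume "\<ominus> x \<lessapprox> z"
  moreover have "x \<lessapprox> \<ominus> x" using le_uminus le_refl assms(2) by blast
  ultimately have "x \<lessapprox> z" using le_trans assms(2,3) by blast
  then show False using assms(1) by blast
qed

lemma (in valuative_field) lt_finsum:
  assumes "finite I" "\<And>i. i \<in> I \<Longrightarrow> h i \<in> carrier L" "\<And>i. i \<in> I \<Longrightarrow> z \<lless> h i" "z \<in> carrier L" "z \<noteq> \<zero>"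
  shows "z \<lless> (\<Oplus>i\<in>I. h i)"
  using assms
proof (induction I rule: finite_induct)
  case empty then show ?case using zero_le by auto
next
  case (insert i I)
  then have "(\<Oplus>i\<in>insert i I. h i) = h i \<oplus> (\<Oplus>i\<in>I. h i)"
    by (intro finsum_insert) auto
  moreover have "z \<lless> h i \<oplus> (\<Oplus>i\<in>I. h i)"
    using insert by (intro lt_add insert.IH finsum_closed) auto
  ultimately show ?case by simp
qed

text \<open>
  In a sum with value \<open>\<infinity>\<close> the smallest value must be attained twice.
\<close>

lemma (in valuative_field) vanishing_sum_tie:
  assumes I: "finite I" "\<And>i. i \<in> I \<Longrightarrow> h i \<in> carrier L" and sum: "(\<Oplus>i\<in>I. h i) = \<zero>"
    and nz: "i0 \<in> I" "h i0 \<noteq> \<zero>"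
  shows "\<exists>m\<in>I. \<exists>k\<in>I. m \<noteq> k \<and> h m \<noteq> \<zero> \<and> h k \<noteq> \<zero> \<and> h m \<lessapprox> h k \<and> h k \<lessapprox> h m"
proof -
  have min: "\<exists>m\<in>J. \<forall>i\<in>J. h m \<lessapprox> h i" if "finite J" "J \<noteq> {}" "J \<subseteq> I" for J
    using that
  proof (induction J rule: finite_ne_induct)
    case (singleton x) then show ?case using le_refl I by auto
  next
    case (insert x J)
    then obtain m where m: "m \<in> J" "\<And>i. i \<in> J \<Longrightarrow> h m \<lessapprox> h i" by auto
    have c: "h x \<in> carrier L" "h m \<in> carrier L" "\<And>i. i \<in> J \<Longrightarrow> h i \<in> carrier L" using insert m I by auto
    show ?case
    proof (cases "h m \<lessapprox> h x")
      case True then show ?thesis using m by auto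
    next
      case False
      then have xm: "h x \<lessapprox> h m" using le_total c by blast
      have "h x \<lessapprox> h i" if "i \<in> J" for i using le_trans[OF xm m(2)[OF that] c(1,2) c(3)[OF that]] .
      then show ?thesis using le_refl c by auto
    qed
  qed
  have "I \<noteq> {}" using nz by blast
  from min[OF I(1) this] obtain m where m: "m \<in> I" "\<And>i. i \<in> I \<Longrightarrow> h m \<lessapprox> h i" by auto
  have hm: "h m \<noteq> \<zero>" using le_nonzero[OF m(2)[OF nz(1)] nz(2)] I nz by blast
  have "\<exists>k\<in>I - {m}. h k \<lessapprox> h m"
  proof (rule ccontr)
    assume "\<not> ?thesis"
    then have lt: "h m \<lless> (\<Oplus>i\<in>I - {m}. h i)" using lt_finsum[of "I - {m}" h "h m"] I m hm by auto
    have s: "(\<Oplus>i\<in>I - {m}. h i) \<in> carrier L" using I by (intro finsum_closed) auto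
    have "(\<Oplus>i\<in>insert m (I - {m}). h i) = h m \<oplus> (\<Oplus>i\<in>I - {m}. h i)"
      using I m by (intro finsum_insert) auto
    then have "h m \<oplus> (\<Oplus>i\<in>I - {m}. h i) = \<zero>" using sum m by (simp add: insert_absorb)
    then have "(\<Oplus>i\<in>I - {m}. h i) = \<ominus> h m" using s I m minus_equality[of "\<Oplus>i\<in>I - {m}. h i" "h m"] by (simp add: a_comm)
    moreover have "\<ominus> h m \<lessapprox> h m" using le_uminus[OF le_refl, of "\<ominus> h m"] I m by simp
    ultimately show False using lt by simp
  qed
  then obtain k where k: "k \<in> I" "k \<noteq> m" "h k \<lessapprox> h m" by blast
  then have "h k \<noteq> \<zero>" using le_nonzero[OF k(3) hm] I m by blast
  then show ?thesis using m k hm by blast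
qed

lemma (in valuative_field) le_pow: "\<lbrakk>x \<lessapprox> y; x \<in> carrier L; y \<in> carrier L\<rbrakk> \<Longrightarrow> x [^] (k::nat) \<lessapprox> y [^] k"
  by (induction k) (simp_all add: le_refl le_mult2)

lemma (in valuative_field) inv_facts:
  assumes "x \<in> carrier L" "x \<noteq> \<zero>"
  shows "inv x \<in> carrier L" "inv x \<noteq> \<zero>" "x \<otimes> inv x = \<one>" "inv x \<otimes> x = \<one>"
proof -
  have u: "x \<in> Units L" using assms by (simp add: field_Units)
  show "inv x \<noteq> \<zero>" using Units_inv_Units[OF u] by (simp add: field_Units)
qed (use assms in \<open>simp_all add: field_Units\<close>)

lemma (in valuative_field) finsum_ge_some_term:
  assumes "finite I" "I \<noteq> {}" "x \<in> I \<rightarrow> carrier L"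
  shows "\<exists>i\<in>I. x i \<lessapprox> (\<Oplus>i\<in>I. x i)"
  using assms
proof (induction I rule: finite_ne_induct)
  case (singleton i)
  thus ?case by (auto intro: le_refl)
next
  case (insert i I)
  have c: "x i \<in> carrier L" "x \<in> I \<rightarrow> carrier L" using insert.prems by auto
  let ?s = "\<Oplus>i\<in>I. x i"
  have s: "?s \<in> carrier L" using c(2) by (rule finsum_closed)
  have eq: "(\<Oplus>i\<in>insert i I. x i) = x i \<oplus> ?s" using insert.hyps c by (intro finsum_insert) auto
  show ?case
  proof (cases "x i \<lessapprox> ?s")
    case True
    have "x i \<lessapprox> x i \<oplus> ?s" using le_add[OF le_refl True] c(1) s by blast
    thus ?thesis unfolding eq by blast
  next
    case False
    hence "?s \<lessapprox> x i" using le_total c(1) s by blast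
    hence "?s \<lessapprox> x i \<oplus> ?s" using le_add[OF _ le_refl] c(1) s by blast
    moreover obtain k where "k \<in> I" "x k \<lessapprox> ?s" using insert.IH c(2) by blast
    ultimately show ?thesis unfolding eq using le_trans[of "x k" ?s "x i \<oplus> ?s"] c s by blast
  qed
qed

section \<open>Approximate roots of a monic polynomial\<close>

lemma (in cring) binomial_step:
  assumes "M \<in> carrier R" "h \<in> carrier R" "G \<in> carrier R" "g \<in> carrier R" "T \<in> carrier R"
  shows "(G \<otimes> g \<oplus> M \<otimes> h \<otimes> G \<oplus> h \<otimes> h \<otimes> T) \<otimes> (g \<oplus> h) =
    G \<otimes> g \<otimes> g \<oplus> (M \<oplus> \<one>) \<otimes> h \<otimes> (G \<otimes> g) \<oplus> h \<otimes> h \<otimes> (T \<otimes> (g \<oplus> h) \<oplus> M \<otimes> G)"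
  using assms by (simp add: l_distr r_distr m_ac a_ac)

text \<open>
  An axiomatic form of \<open>K[x]\<close> that hides the representation of polynomials. Here \<open>len\<close> is the number
  of coefficients, that is, the degree plus one, and \<open>0\<close> for the zero polynomial; thus bounds on
  the degree need no exception for zero, and the nonzero constants are the elements with
  \<open>len c = 1\<close>. The predicate \<open>mon\<close> says that the leading coefficient is \<open>1\<close>.
\<close>

locale monic_ring = domain P for P :: "('p, 'm) ring_scheme" (structure) +
  fixes len :: "'p \<Rightarrow> nat" and mon :: "'p \<Rightarrow> bool"
  assumes len_zero: "p \<in> carrier P \<Longrightarrow> len p = 0 \<longleftrightarrow> p = \<zero>"
    and len_add: "\<lbrakk>p \<in> carrier P; q \<in> carrier P\<rbrakk> \<Longrightarrow> len (p \<oplus> q) \<le> max (len p) (len q)"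
    and len_uminus: "p \<in> carrier P \<Longrightarrow> len (\<ominus> p) = len p"
    and len_mult: "\<lbrakk>p \<in> carrier P; q \<in> carrier P; p \<noteq> \<zero>; q \<noteq> \<zero>\<rbrakk> \<Longrightarrow> Suc (len (p \<otimes> q)) = len p + len q"
    and mon_one: "mon \<one>"
    and mon_nonzero: "\<not> mon \<zero>"
    and mon_mult: "\<lbrakk>p \<in> carrier P; q \<in> carrier P; mon p; mon q\<rbrakk> \<Longrightarrow> mon (p \<otimes> q)"
    and mon_add: "\<lbrakk>p \<in> carrier P; q \<in> carrier P; mon p; len q < len p\<rbrakk> \<Longrightarrow> mon (p \<oplus> q)"
    and const_inv: "\<lbrakk>c \<in> carrier P; len c = 1\<rbrakk> \<Longrightarrow> \<exists>c'\<in>carrier P. len c' = 1 \<and> c \<otimes> c' = \<one>"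
    and scale: "\<lbrakk>p \<in> carrier P; p \<noteq> \<zero>\<rbrakk> \<Longrightarrow>
      \<exists>c\<in>carrier P. \<exists>q\<in>carrier P. len c = 1 \<and> mon q \<and> len q = len p \<and> p = c \<otimes> q"
    and mon_minus: "\<lbrakk>p \<in> carrier P; q \<in> carrier P; mon p; mon q; len p = len q\<rbrakk> \<Longrightarrow> len (p \<ominus> q) < len p"
begin

abbreviation natmult ("\<nu>") where "\<nu> k \<equiv> add_pow P (k::nat) \<one>"

text \<open>
  The polynomials over a subring of \<open>K\<close> are such a subring: division with remainder by a monic
  polynomial introduces no denominators.
\<close>

definition monic_subring :: "'p set \<Rightarrow> bool" where
  "monic_subring S \<longleftrightarrow> subring S P \<and>
     (\<forall>g\<in>S. \<forall>p\<in>S. mon g \<longrightarrow> (\<exists>q\<in>S. \<exists>r\<in>S. p = g \<otimes> q \<oplus> r \<and> len r < len g))"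

lemma len_minus: "\<lbrakk>p \<in> carrier P; q \<in> carrier P\<rbrakk> \<Longrightarrow> len (p \<ominus> q) \<le> max (len p) (len q)"
  using len_add[of p "\<ominus> q"] len_uminus by (simp add: a_minus_def)

lemma len_0 [simp]: "len \<zero> = 0" using len_zero by simp

lemma len_1 [simp]: "len \<one> = 1"
  using len_mult[of \<one> \<one>] one_not_zero by simp

lemma mon_pow: "\<lbrakk>g \<in> carrier P; mon g\<rbrakk> \<Longrightarrow> mon (g [^] (k::nat))"
  by (induction k) (auto simp: mon_one mon_mult)

lemma len_pow: "\<lbrakk>g \<in> carrier P; mon g; len g = Suc d\<rbrakk> \<Longrightarrow> len (g [^] (k::nat)) = Suc (k * d)"
proof (induction k)
  case (Suc k)
  have "mon (g [^] k)" using mon_pow Suc.prems by blast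
  then have "g [^] k \<noteq> \<zero>" "g \<noteq> \<zero>" using mon_nonzero Suc.prems by auto
  then show ?case using len_mult[of "g [^] k" g] Suc by simp
qed simp

lemma len_mult_le: "\<lbrakk>p \<in> carrier P; q \<in> carrier P\<rbrakk> \<Longrightarrow> len (p \<otimes> q) \<le> len p + len q - 1"
  using len_mult[of p q] by (cases "p = \<zero>"; cases "q = \<zero>") auto

lemma len_add_less:
  assumes "p \<in> carrier P" "q \<in> carrier P" "len q < len p"
  shows "len (p \<oplus> q) = len p"
proof -
  have "p = (p \<oplus> q) \<ominus> q" using assms by (simp add: a_minus_def a_assoc r_neg)
  then have "len p \<le> max (len (p \<oplus> q)) (len q)" using len_minus[of "p \<oplus> q" q] assms by simp
  then show ?thesis using len_add[OF assms(1,2)] assms(3) by linarith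
qed

lemma len_natmult: "len (\<nu> k) \<le> 1"
proof (induction k)
  case (Suc k) then show ?case using len_add[of "\<nu> k" \<one>] by simp
qed simp

text \<open>
  With \<open>deg h < deg g = d\<close>, the terms of \<open>(g + h)\<^sup>m\<^sup>+\<^sup>1\<close> from the second order on are collected in
  \<open>h\<^sup>2 T\<close>. The bound on \<open>deg T\<close> makes them smaller in degree than the linear term.
\<close>

lemma binomial_two_terms:
  assumes g: "g \<in> carrier P" "mon g" "len g = Suc d" and h: "h \<in> carrier P" "len h \<le> d"
  shows "\<exists>T\<in>carrier P. (g \<oplus> h) [^] Suc m = g [^] Suc m \<oplus> \<nu> (Suc m) \<otimes> h \<otimes> g [^] m \<oplus> h \<otimes> h \<otimes> T
    \<and> (T = \<zero> \<or> len T + d \<le> m * d + 1)"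
proof (induction m)
  case 0
  show ?case using g h by (intro bexI[of _ \<zero>]) auto
next
  case (Suc m)
  then obtain T where T: "T \<in> carrier P" "(g \<oplus> h) [^] Suc m = g [^] Suc m \<oplus> \<nu> (Suc m) \<otimes> h \<otimes> g [^] m \<oplus> h \<otimes> h \<otimes> T"
    "T = \<zero> \<or> len T + d \<le> m * d + 1" by blast
  let ?M = "\<nu> (Suc m)" and ?G = "g [^] m"
  let ?T = "T \<otimes> (g \<oplus> h) \<oplus> ?M \<otimes> ?G"
  have c: "?M \<in> carrier P" "?G \<in> carrier P" "g [^] Suc m \<in> carrier P" using g by auto
  have "(g \<oplus> h) [^] Suc (Suc m) = (g [^] Suc m \<oplus> ?M \<otimes> h \<otimes> ?G \<oplus> h \<otimes> h \<otimes> T) \<otimes> (g \<oplus> h)"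
    using T(2) by simp
  also have "\<dots> = g [^] Suc m \<otimes> g \<oplus> (?M \<oplus> \<one>) \<otimes> h \<otimes> (?G \<otimes> g) \<oplus> h \<otimes> h \<otimes> ?T"
    using binomial_step[OF c(1) h(1) c(2) g(1) T(1)] by simp
  also have "\<dots> = g [^] Suc (Suc m) \<oplus> \<nu> (Suc (Suc m)) \<otimes> h \<otimes> g [^] Suc m \<oplus> h \<otimes> h \<otimes> ?T" by simp
  finally have eq: "(g \<oplus> h) [^] Suc (Suc m) = g [^] Suc (Suc m) \<oplus> \<nu> (Suc (Suc m)) \<otimes> h \<otimes> g [^] Suc m \<oplus> h \<otimes> h \<otimes> ?T" .
  have gh: "len (g \<oplus> h) = Suc d" using len_add_less[of g h] g h by simp
  have "len (T \<otimes> (g \<oplus> h)) \<le> m * d + 1"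
  proof (cases "T = \<zero>")
    case False
    then have "len T + d \<le> m * d + 1" using T(3) by blast
    then show ?thesis using len_mult_le[OF T(1), of "g \<oplus> h"] gh g(1) h(1) by simp
  qed (use g(1) h(1) in simp)
  moreover have "len (?M \<otimes> ?G) \<le> m * d + 1"
  proof -
    show ?thesis using len_natmult[of "Suc m"] len_mult_le[OF c(1,2)] len_pow[OF g, of m] by linarith
  qed
  ultimately have "len ?T \<le> m * d + 1"
    using len_add[of "T \<otimes> (g \<oplus> h)" "?M \<otimes> ?G"] c(1,2) T(1) g(1) h(1) by simp
  then have "len ?T + d \<le> Suc m * d + 1" by simp
  then show ?case using eq c(1,2) T(1) g(1) h(1) by (intro bexI[of _ ?T] conjI disjI2) simp_all
qed

lemma len_unit_multiple:
  assumes "u \<in> carrier P" "u \<otimes> \<nu> m = \<one>"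
  shows "len u = 1" "len (\<nu> m) = 1"
proof -
  have "u \<noteq> \<zero>" "\<nu> m \<noteq> \<zero>" using assms one_not_zero by auto
  then have "Suc (len \<one>) = len u + len (\<nu> m)" "len u > 0" "len (\<nu> m) > 0"
    using len_mult[of u "\<nu> m"] assms len_zero[of u] len_zero[of "\<nu> m"] by auto
  then show "len u = 1" "len (\<nu> m) = 1" by simp_all
qed

lemma len_mult_const:
  assumes "u \<in> carrier P" "len u = 1" "p \<in> carrier P"
  shows "len (u \<otimes> p) = len p"
proof -
  have "u \<noteq> \<zero>" using assms(2) by auto
  then show ?thesis using len_mult[OF assms(1,3)] assms by (cases "p = \<zero>") auto
qed

lemma len_square_mult:
  assumes "h \<in> carrier P" "T \<in> carrier P" "h \<noteq> \<zero>" "T = \<zero> \<or> len T + d \<le> k * d + 1" "len h \<le> d"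
  shows "len (h \<otimes> h \<otimes> T) < len h + k * d"
proof (cases "T = \<zero>")
  case True
  then show ?thesis using assms len_zero[of h] by simp
next
  case False
  have "h \<otimes> h \<noteq> \<zero>" using assms(1,3) by (simp add: integral_iff)
  then have "Suc (len (h \<otimes> h \<otimes> T)) = len (h \<otimes> h) + len T" using len_mult False assms(1,2) by simp
  moreover have "Suc (len (h \<otimes> h)) = len h + len h" using len_mult assms(1,3) by simp
  ultimately show ?thesis using assms(4,5) False by linarith
qed

text \<open>
  If \<open>c\<close> is the coefficient of \<open>g\<^sup>k\<close> in the \<open>g\<close>-adic expansion of \<open>f\<close>, then adding \<open>c/(k+1)\<close> to \<open>g\<close> cancels
  it up to terms of lower degree, because \<open>(g + h)\<^sup>k\<^sup>+\<^sup>1 = g\<^sup>k\<^sup>+\<^sup>1 + (k+1) h g\<^sup>k + \<dots>\<close>.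
\<close>

lemma tschirnhausen_step:
  assumes S: "monic_subring S" and f: "f \<in> S" "mon f" "len f = Suc (Suc k * d)"
    and u: "u \<in> S" "u \<otimes> \<nu> (Suc k) = \<one>"
    and g: "g \<in> S" "mon g" "len g = Suc d" and big: "\<not> len (f \<ominus> g [^] Suc k) \<le> k * d"
  obtains c r where "c \<in> S" "r \<in> S" "f = g [^] Suc k \<oplus> c \<otimes> g [^] k \<oplus> r" "len r \<le> k * d"
    "len c \<le> d" "mon (g \<oplus> u \<otimes> c)" "len (g \<oplus> u \<otimes> c) = Suc d"
    "len (f \<ominus> (g \<oplus> u \<otimes> c) [^] Suc k) < len (f \<ominus> g [^] Suc k)"
proof -
  have sub: "subring S P" using S unfolding monic_subring_def by blast
  interpret S: subring S P by fact
  have SP: "S \<subseteq> carrier P" using subringE(1)[OF sub] .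
  have pw: "g [^] (i::nat) \<in> S" for i
    by (induction i) (auto intro: subringE(3,6)[OF sub] g(1))
  let ?D = "f \<ominus> g [^] Suc k"
  have "?D \<in> S" unfolding a_minus_def
    by (intro subringE(5,7)[OF sub] f(1) pw)
  moreover have "mon (g [^] k)" using mon_pow g SP by blast
  ultimately obtain c r where c: "c \<in> S" and r: "r \<in> S" and eq: "?D = g [^] k \<otimes> c \<oplus> r"
    and lr: "len r < len (g [^] k)"
    using S pw unfolding monic_subring_def by meson
  have cP: "c \<in> carrier P" "r \<in> carrier P" "f \<in> carrier P" "u \<in> carrier P" "g \<in> carrier P"
    "g [^] k \<in> carrier P" "g [^] Suc k \<in> carrier P"
    using SP c r f u g pw by blast+
  have lg: "len (g [^] i) = Suc (i * d)" for i :: nat using len_pow[OF cP(5) g(2,3)] .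
  have gk0: "g [^] k \<noteq> \<zero>" using mon_pow[OF cP(5) g(2)] mon_nonzero by metis
  have lr': "len r \<le> k * d" using lr lg by simp
  have c0: "c \<noteq> \<zero>"
  proof
    assume "c = \<zero>"
    then have "?D = r" using eq cP by simp
    then show False using big lr' by simp
  qed
  have lcg: "len (g [^] k \<otimes> c) = len c + k * d"
    using len_mult[OF cP(6,1) gk0 c0] lg[of k] by simp
  have lD: "len ?D = len c + k * d"
    using len_add_less[of "g [^] k \<otimes> c" r] eq cP lcg lr' c0 len_zero[of c] by simp
  have "len ?D < len f"
    by (rule mon_minus[OF cP(3,7) f(2) mon_pow[OF cP(5) g(2)]]) (simp only: f(3) lg)
  then have lc: "len c \<le> d" using lD f(3) by simp
  let ?h = "u \<otimes> c"
  have h: "?h \<in> carrier P" "len ?h = len c" "?h \<noteq> \<zero>"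
    using len_mult_const[OF cP(4) len_unit_multiple(1)[OF cP(4) u(2)] cP(1)] cP c0 u(2) len_zero by auto
  have nh: "\<nu> (Suc k) \<otimes> ?h = c"
  proof -
    have "\<nu> (Suc k) \<otimes> ?h = (u \<otimes> \<nu> (Suc k)) \<otimes> c" using cP by (simp add: m_ac del: add.nat_pow_Suc)
    then show ?thesis using u(2) cP by simp
  qed
  obtain T where T: "T \<in> carrier P"
    "(g \<oplus> ?h) [^] Suc k = g [^] Suc k \<oplus> \<nu> (Suc k) \<otimes> ?h \<otimes> g [^] k \<oplus> ?h \<otimes> ?h \<otimes> T"
    "T = \<zero> \<or> len T + d \<le> k * d + 1"
    using binomial_two_terms[OF cP(5) g(2,3) h(1)] lc h(2) by metis
  have feq: "f = g [^] Suc k \<oplus> c \<otimes> g [^] k \<oplus> r"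
  proof -
    have "f = g [^] Suc k \<oplus> ?D" using cP by (simp add: a_minus_def a_ac r_neg1 r_neg2 r_neg del: nat_pow_Suc)
    then show ?thesis using eq cP by (simp add: a_assoc m_comm del: nat_pow_Suc)
  qed
  have "f \<ominus> (g \<oplus> ?h) [^] Suc k = r \<ominus> ?h \<otimes> ?h \<otimes> T"
  proof -
    have aux: "(s \<oplus> t \<oplus> r) \<ominus> (s \<oplus> t \<oplus> w) = r \<ominus> w" if "s \<in> carrier P" "t \<in> carrier P" "w \<in> carrier P" for s t w
      using that cP(2) by (simp add: a_minus_def minus_add a_ac r_neg1 r_neg2)
    show ?thesis unfolding T(2) nh
      by (subst feq, rule aux) (use cP T(1) h(1) in auto)
  qed
  moreover have "len (r \<ominus> ?h \<otimes> ?h \<otimes> T) < len c + k * d"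
  proof -
    have "len (?h \<otimes> ?h \<otimes> T) < len c + k * d"
      using len_square_mult[OF h(1) T(1) h(3) T(3)] lc h(2) by simp
    moreover have "len r < len c + k * d" using lr' c0 len_zero[of c] cP by simp
    ultimately show ?thesis using len_minus[of r "?h \<otimes> ?h \<otimes> T"] cP h T by simp
  qed
  ultimately have less: "len (f \<ominus> (g \<oplus> ?h) [^] Suc k) < len ?D" using lD by metis
  have m: "mon (g \<oplus> ?h)" "len (g \<oplus> ?h) = Suc d"
    using mon_add[OF cP(5) h(1) g(2)] len_add_less[OF cP(5) h(1)] h(2) lc g(3) by auto
  show thesis by (rule that[OF c r feq lr' lc m less])
qed

lemma approximate_root_exists:
  assumes S: "monic_subring S" and f: "f \<in> S" "mon f" "len f = Suc (Suc k * d)"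
    and u: "u \<in> S" "u \<otimes> \<nu> (Suc k) = \<one>"
    and g: "g \<in> S" "mon g" "len g = Suc d"
  shows "\<exists>h\<in>S. mon h \<and> len h = Suc d \<and> len (f \<ominus> h [^] Suc k) \<le> k * d"
  using g
proof (induction "len (f \<ominus> g [^] Suc k)" arbitrary: g rule: less_induct)
  case less
  show ?case
  proof (cases "len (f \<ominus> g [^] Suc k) \<le> k * d")
    case False
    have sub: "subring S P" using S unfolding monic_subring_def by blast
    from tschirnhausen_step[OF S f u less.prems False] obtain c where
      "c \<in> S" "mon (g \<oplus> u \<otimes> c)" "len (g \<oplus> u \<otimes> c) = Suc d"
      "len (f \<ominus> (g \<oplus> u \<otimes> c) [^] Suc k) < len (f \<ominus> g [^] Suc k)" by blast
    with less.hyps show ?thesis using subringE(6,7)[OF sub] u(1) less.prems(1) by blast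
  qed (use less.prems in blast)
qed

text \<open>
  If \<open>g' = g + h\<close> with \<open>h \<noteq> 0\<close>, then the linear term \<open>(k+1) h g\<^sup>k\<close> dominates \<open>g'\<^sup>k\<^sup>+\<^sup>1 - g\<^sup>k\<^sup>+\<^sup>1\<close>, whose degree
  would be too large for a difference of two polynomials of degree below \<open>k d\<close>.
\<close>

lemma approximate_root_unique:
  assumes f: "f \<in> carrier P" and u: "u \<in> carrier P" "u \<otimes> \<nu> (Suc k) = \<one>"
    and g: "g \<in> carrier P" "mon g" "len g = Suc d" and g': "g' \<in> carrier P" "mon g'" "len g' = Suc d"
    and a: "len (f \<ominus> g [^] Suc k) \<le> k * d" "len (f \<ominus> g' [^] Suc k) \<le> k * d"
  shows "g' = g"
proof (rule ccontr)
  let ?h = "g' \<ominus> g"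
  assume "g' \<noteq> g"
  then have h0: "?h \<noteq> \<zero>" using g g' by simp
  have h: "?h \<in> carrier P" "len ?h \<le> d" using mon_minus[of g' g] g g' by auto
  have gh: "g \<oplus> ?h = g'" using g g' by (simp add: a_minus_def a_lcomm[of g g'] r_neg)
  obtain T where T: "T \<in> carrier P"
    "g' [^] Suc k = g [^] Suc k \<oplus> \<nu> (Suc k) \<otimes> ?h \<otimes> g [^] k \<oplus> ?h \<otimes> ?h \<otimes> T"
    "T = \<zero> \<or> len T + d \<le> k * d + 1"
    using binomial_two_terms[OF g h] gh by metis
  let ?X = "\<nu> (Suc k) \<otimes> ?h \<otimes> g [^] k" and ?Y = "?h \<otimes> ?h \<otimes> T"
  have cl: "?X \<in> carrier P" "?Y \<in> carrier P" "g [^] Suc k \<in> carrier P" "g' [^] Suc k \<in> carrier P" "\<nu> (Suc k) \<otimes> ?h \<in> carrier P"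
    using g g' h T(1) by auto
  have l1: "len (\<nu> (Suc k) \<otimes> ?h) = len ?h" 
    using len_mult_const[OF _ len_unit_multiple(2)[OF u] h(1)] by (simp del: add.nat_pow_Suc)
  have "g [^] k \<noteq> \<zero>" using mon_pow[OF g(1,2)] mon_nonzero by metis
  moreover have "\<nu> (Suc k) \<otimes> ?h \<noteq> \<zero>" using l1 h0 len_zero[OF h(1)] len_0 by metis
  ultimately have "len ?X = len ?h + k * d"
    using len_mult[OF cl(5), of "g [^] k"] len_pow[OF g, of k] l1 g by simp
  then have "len (?X \<oplus> ?Y) = len ?h + k * d"
    using len_square_mult[OF h(1) T(1) h0 T(3) h(2)] len_add_less[OF cl(1,2)] by simp
  moreover have "?X \<oplus> ?Y = (f \<ominus> g [^] Suc k) \<ominus> (f \<ominus> g' [^] Suc k)"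
  proof -
    have aux: "s \<oplus> t = (f \<ominus> w) \<ominus> (f \<ominus> (w \<oplus> s \<oplus> t))"
      if "s \<in> carrier P" "t \<in> carrier P" "w \<in> carrier P" for s t w
      using that f by (simp add: a_minus_def minus_add a_ac r_neg r_neg1 r_neg2)
    show ?thesis unfolding T(2) by (rule aux[OF cl(1-3)])
  qed
  then have "len (?X \<oplus> ?Y) \<le> k * d"
    using len_minus[of "f \<ominus> g [^] Suc k" "f \<ominus> g' [^] Suc k"] a f cl by simp
  ultimately show False using h0 len_zero[OF h(1)] by simp
qed

end

section \<open>Expansions in powers of a monic polynomial\<close>

context monic_ring
begin

definition divrem :: "'p \<Rightarrow> 'p \<Rightarrow> 'p \<times> 'p" where
  "divrem g p = (SOME qr. fst qr \<in> carrier P \<and> snd qr \<in> carrier P \<and> p = g \<otimes> fst qr \<oplus> snd qr \<and> len (snd qr) < len g)"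

definition quot :: "'p \<Rightarrow> 'p \<Rightarrow> 'p" where "quot g p = fst (divrem g p)"

text \<open>
  The coefficient of \<open>g\<^sup>i\<close> in the \<open>g\<close>-adic expansion of \<open>p\<close>.
\<close>

definition dig :: "'p \<Rightarrow> nat \<Rightarrow> 'p \<Rightarrow> 'p" where "dig g i p = snd (divrem g ((quot g ^^ i) p))"

end

locale g_adic = monic_ring +
  fixes g d
  assumes division: "monic_subring (carrier P)" and g: "g \<in> carrier P" and mon_g: "mon g" and len_g: "len g = Suc d"
begin

lemma divrem:
  assumes "p \<in> carrier P"
  shows "fst (divrem g p) \<in> carrier P" "snd (divrem g p) \<in> carrier P" "len (snd (divrem g p)) \<le> d"
    "p = g \<otimes> fst (divrem g p) \<oplus> snd (divrem g p)"
proof -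
  have "\<exists>q\<in>carrier P. \<exists>r\<in>carrier P. p = g \<otimes> q \<oplus> r \<and> len r < len g"
    using division g mon_g assms unfolding monic_subring_def by blast
  then obtain q r where "q \<in> carrier P" "r \<in> carrier P" "p = g \<otimes> q \<oplus> r" "len r < len g" by blast
  then have "\<exists>qr. fst qr \<in> carrier P \<and> snd qr \<in> carrier P \<and> p = g \<otimes> fst qr \<oplus> snd qr \<and> len (snd qr) < len g"
    by (intro exI[of _ "(q, r)"]) simp
  from someI_ex[OF this] show "fst (divrem g p) \<in> carrier P" "snd (divrem g p) \<in> carrier P" "len (snd (divrem g p)) \<le> d"
    "p = g \<otimes> fst (divrem g p) \<oplus> snd (divrem g p)"
    unfolding divrem_def using len_g by auto
qed

lemma g_nonzero: "g \<noteq> \<zero>" using mon_g mon_nonzero by auto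

lemma divrem_unique:
  assumes "q \<in> carrier P" "r \<in> carrier P" "len r \<le> d"
  shows "divrem g (g \<otimes> q \<oplus> r) = (q, r)"
proof -
  let ?p = "g \<otimes> q \<oplus> r"
  have p: "?p \<in> carrier P" using assms g by simp
  define q' where "q' = fst (divrem g ?p)"
  define r' where "r' = snd (divrem g ?p)"
  have c: "q' \<in> carrier P" "r' \<in> carrier P" "len r' \<le> d" "g \<otimes> q \<oplus> r = g \<otimes> q' \<oplus> r'"
    unfolding q'_def r'_def by (rule divrem[OF p])+
  have eq: "g \<otimes> (q \<ominus> q') = r' \<ominus> r"
  proof -
    have "g \<otimes> (q \<ominus> q') = (g \<otimes> q \<oplus> r) \<ominus> (g \<otimes> q' \<oplus> r)"
      using c(1-3) assms g by (simp add: a_minus_def minus_add r_distr r_minus a_ac r_neg r_neg1 r_neg2)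
    also have "\<dots> = r' \<ominus> r"
      unfolding c(4) using c(1-3) assms g by (simp add: a_minus_def minus_add r_distr r_minus a_ac r_neg r_neg1 r_neg2)
    finally show ?thesis .
  qed
  have "q \<ominus> q' = \<zero>"
  proof (rule ccontr)
    assume a: "q \<ominus> q' \<noteq> \<zero>"
    then have "Suc (len (r' \<ominus> r)) = Suc d + len (q \<ominus> q')"
      using len_mult[OF g _ g_nonzero a] c assms len_g unfolding eq by simp
    moreover have "len (q \<ominus> q') > 0" using a len_zero[of "q \<ominus> q'"] c assms by simp
    moreover have "len (r' \<ominus> r) \<le> d" using len_minus[of r' r] c(2,3) assms by simp
    ultimately show False by simp
  qed
  then have "q' = q" using c assms by simp
  moreover have "r' = r"
  proof -
    have "r' \<ominus> r = g \<otimes> \<zero>" using eq \<open>q \<ominus> q' = \<zero>\<close> by metis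
    then show ?thesis using g c(2) assms by simp
  qed
  ultimately show ?thesis unfolding q'_def r'_def by (simp add: prod_eq_iff)
qed

lemma quot_closed: "p \<in> carrier P \<Longrightarrow> quot g p \<in> carrier P"
  using divrem(1) by (simp add: quot_def)

lemma quot_pow_closed: "p \<in> carrier P \<Longrightarrow> (quot g ^^ i) p \<in> carrier P"
  by (induction i) (auto simp: quot_closed)

lemma dig_closed: "p \<in> carrier P \<Longrightarrow> dig g i p \<in> carrier P"
  using divrem(2)[OF quot_pow_closed] by (simp add: dig_def)

lemma len_dig: "p \<in> carrier P \<Longrightarrow> len (dig g i p) \<le> d"
  using divrem(3)[OF quot_pow_closed] by (simp add: dig_def)

lemma quot_dig: "p \<in> carrier P \<Longrightarrow> p = g \<otimes> quot g p \<oplus> dig g 0 p"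
  using divrem(4) by (simp add: quot_def dig_def)

lemma dig_Suc: "dig g (Suc i) p = dig g i (quot g p)"
  unfolding dig_def funpow_Suc_right comp_def ..

lemma dig_0_unique: "\<lbrakk>q \<in> carrier P; r \<in> carrier P; len r \<le> d\<rbrakk> \<Longrightarrow> dig g 0 (g \<otimes> q \<oplus> r) = r"
  by (simp add: dig_def divrem_unique)

lemma quot_unique: "\<lbrakk>q \<in> carrier P; r \<in> carrier P; len r \<le> d\<rbrakk> \<Longrightarrow> quot g (g \<otimes> q \<oplus> r) = q"
  by (simp add: quot_def divrem_unique)

lemma quot_small: "\<lbrakk>r \<in> carrier P; len r \<le> d\<rbrakk> \<Longrightarrow> quot g r = \<zero>"
  using quot_unique[of \<zero> r] g by simp

lemma dig_0_small: "\<lbrakk>r \<in> carrier P; len r \<le> d\<rbrakk> \<Longrightarrow> dig g 0 r = r"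
  using dig_0_unique[of \<zero> r] g by simp

lemma quot_mult: "q \<in> carrier P \<Longrightarrow> quot g (g \<otimes> q) = q"
  using quot_unique[of q \<zero>] g by simp

lemma dig_0_mult: "q \<in> carrier P \<Longrightarrow> dig g 0 (g \<otimes> q) = \<zero>"
  using dig_0_unique[of q \<zero>] g by simp

lemma quot_zero: "quot g \<zero> = \<zero>" using quot_small[of \<zero>] by simp

lemma dig_zero: "dig g i \<zero> = \<zero>"
  by (induction i) (simp_all add: dig_0_small dig_Suc quot_zero)

text \<open>
  Division by \<open>g\<close> commutes with multiplication by constants only, not with multiplication by
  arbitrary polynomials.
\<close>

lemma linear_step:
  assumes "p \<in> carrier P" "q \<in> carrier P" "c \<in> carrier P" "len c \<le> 1"
  shows "quot g (p \<oplus> c \<otimes> q) = quot g p \<oplus> c \<otimes> quot g q"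
    "dig g 0 (p \<oplus> c \<otimes> q) = dig g 0 p \<oplus> c \<otimes> dig g 0 q"
proof -
  let ?q = "quot g p \<oplus> c \<otimes> quot g q" and ?r = "dig g 0 p \<oplus> c \<otimes> dig g 0 q"
  note cl = assms(1-3) g quot_closed[OF assms(1)] quot_closed[OF assms(2)] dig_closed[OF assms(1), of 0] dig_closed[OF assms(2), of 0]
  have "p \<oplus> c \<otimes> q = (g \<otimes> quot g p \<oplus> dig g 0 p) \<oplus> c \<otimes> (g \<otimes> quot g q \<oplus> dig g 0 q)"
    using quot_dig assms(1,2) by simp
  also have "\<dots> = g \<otimes> ?q \<oplus> ?r"
    using cl by (simp add: r_distr l_distr a_ac m_ac)
  finally have eq: "p \<oplus> c \<otimes> q = g \<otimes> ?q \<oplus> ?r" .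
  have "len (c \<otimes> dig g 0 q) \<le> d"
    using len_mult_le[of c "dig g 0 q"] cl len_dig[OF assms(2), of 0] assms(4) by simp
  then have "len ?r \<le> d"
    using len_add[of "dig g 0 p" "c \<otimes> dig g 0 q"] cl len_dig[OF assms(1), of 0] by simp
  then show "quot g (p \<oplus> c \<otimes> q) = quot g p \<oplus> c \<otimes> quot g q"
    "dig g 0 (p \<oplus> c \<otimes> q) = dig g 0 p \<oplus> c \<otimes> dig g 0 q"
    unfolding eq using quot_unique[of ?q ?r] dig_0_unique[of ?q ?r] cl by simp_all
qed

lemma dig_linear:
  "\<lbrakk>p \<in> carrier P; q \<in> carrier P; c \<in> carrier P; len c \<le> 1\<rbrakk> \<Longrightarrow> dig g i (p \<oplus> c \<otimes> q) = dig g i p \<oplus> c \<otimes> dig g i q"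
  by (induction i arbitrary: p q) (simp_all add: linear_step dig_Suc quot_closed)

lemma dig_add: "\<lbrakk>p \<in> carrier P; q \<in> carrier P\<rbrakk> \<Longrightarrow> dig g i (p \<oplus> q) = dig g i p \<oplus> dig g i q"
  using dig_linear[of p q \<one> i] by (simp add: dig_closed)

lemma dig_scale: "\<lbrakk>q \<in> carrier P; c \<in> carrier P; len c \<le> 1\<rbrakk> \<Longrightarrow> dig g i (c \<otimes> q) = c \<otimes> dig g i q"
  using dig_linear[of \<zero> q c i] by (simp add: dig_closed dig_zero)

lemma dig_minus: "\<lbrakk>p \<in> carrier P; q \<in> carrier P\<rbrakk> \<Longrightarrow> dig g i (p \<ominus> q) = dig g i p \<ominus> dig g i q"
  using dig_linear[of p q "\<ominus> \<one>" i] by (simp add: dig_closed a_minus_def l_minus len_uminus)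

lemma dig_monomial:
  assumes "c \<in> carrier P" "len c \<le> d"
  shows "dig g i (c \<otimes> g [^] k) = (if i = k then c else \<zero>)"
proof (induction k arbitrary: i)
  case 0
  show ?case using assms by (cases i) (auto simp: dig_0_small dig_Suc quot_small dig_zero)
next
  case (Suc k)
  have eq: "c \<otimes> g [^] Suc k = g \<otimes> (c \<otimes> g [^] k)" using assms g by (simp add: m_ac)
  show ?case
    unfolding eq using assms g Suc by (cases i) (auto simp: dig_0_mult dig_Suc quot_mult)
qed

lemma len_quot: "p \<in> carrier P \<Longrightarrow> len (quot g p) \<le> len p - d"
proof (cases "quot g p = \<zero>")
  case False
  assume p: "p \<in> carrier P"
  have gq: "len (g \<otimes> quot g p) = d + len (quot g p)"
    using len_mult[OF g quot_closed[OF p] g_nonzero False] len_g by simp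
  have "g \<otimes> quot g p = p \<ominus> dig g 0 p"
    using quot_dig[OF p] g quot_closed[OF p] dig_closed[OF p, of 0] p
    by (metis add.inv_solve_right m_closed a_minus_def)
  then have "d + len (quot g p) \<le> max (len p) d"
    using gq len_minus[OF p dig_closed[OF p, of 0]] len_dig[OF p, of 0] by simp
  moreover have "len (quot g p) > 0" using False len_zero quot_closed[OF p] by blast
  ultimately show ?thesis by linarith
qed simp

lemma dig_beyond: "\<lbrakk>p \<in> carrier P; len p \<le> i * d\<rbrakk> \<Longrightarrow> dig g i p = \<zero>"
proof (induction i arbitrary: p)
  case 0
  then show ?case using len_zero[of p] by (simp add: dig_zero)
next
  case (Suc i)
  have "len (quot g p) \<le> i * d" using len_quot[of p] Suc.prems by simp
  then show ?case using Suc quot_closed by (simp add: dig_Suc)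
qed

lemma expansion:
  "\<lbrakk>p \<in> carrier P; len p \<le> Suc k * d\<rbrakk> \<Longrightarrow> p = (\<Oplus>i\<in>{..k}. dig g i p \<otimes> g [^] i)"
proof (induction k arbitrary: p)
  case 0
  then show ?case using dig_closed g by (simp add: dig_0_small)
next
  case (Suc k)
  have cl: "(\<lambda>i. dig g i p \<otimes> g [^] i) \<in> {..Suc k} \<rightarrow> carrier P" if "p \<in> carrier P" for k p
    using g that dig_closed by auto
  have q: "quot g p \<in> carrier P" using quot_closed Suc.prems by simp
  have "len (quot g p) \<le> Suc k * d" using len_quot[of p] Suc.prems by simp
  then have "quot g p = (\<Oplus>i\<in>{..k}. dig g i (quot g p) \<otimes> g [^] i)" using Suc.IH q by blast
  then have "g \<otimes> quot g p = g \<otimes> (\<Oplus>i\<in>{..k}. dig g i (quot g p) \<otimes> g [^] i)" by metis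
  also have "\<dots> = (\<Oplus>i\<in>{..k}. g \<otimes> (dig g i (quot g p) \<otimes> g [^] i))"
    by (rule finsum_rdistr) (use g q dig_closed in auto)
  also have "\<dots> = (\<Oplus>i\<in>{..k}. dig g (Suc i) p \<otimes> g [^] Suc i)"
    by (rule finsum_cong') (use g q dig_closed in \<open>auto simp: dig_Suc m_ac\<close>)
  finally have "p = (\<Oplus>i\<in>{..k}. dig g (Suc i) p \<otimes> g [^] Suc i) \<oplus> dig g 0 p"
    using quot_dig[OF Suc.prems(1)] by simp
  also have "\<dots> = (\<Oplus>i\<in>{..Suc k}. dig g i p \<otimes> g [^] i)"
    using finsum_Suc2[OF cl[OF Suc.prems(1)]] Suc.prems(1) dig_closed by simp
  finally show ?case .
qed

lemma quot_monic:
  assumes p: "p \<in> carrier P" "mon p" "len p = Suc (d + l)"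
  shows "mon (quot g p)" "len (quot g p) = Suc l"
proof -
  note q = quot_closed[OF p(1)] and r = dig_closed[OF p(1), of 0]
  have nz: "quot g p \<noteq> \<zero>"
  proof
    assume "quot g p = \<zero>"
    then have "p = dig g 0 p" using quot_dig[OF p(1)] g r by simp
    then show False using len_dig[OF p(1), of 0] p(3) by simp
  qed
  from scale[OF q nz] obtain c q1 where c: "c \<in> carrier P" "q1 \<in> carrier P" "len c = 1" "mon q1"
    "len q1 = len (quot g p)" "quot g p = c \<otimes> q1" by blast
  have q1: "q1 \<noteq> \<zero>" using c mon_nonzero by auto
  have lgq: "len (g \<otimes> q1) = d + len q1" using len_mult[OF g c(2) g_nonzero q1] len_g by simp
  have gq: "g \<otimes> quot g p = p \<ominus> dig g 0 p"
    using quot_dig[OF p(1)] g q r p(1) by (metis add.inv_solve_right m_closed a_minus_def)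
  have "len (p \<ominus> dig g 0 p) = len p"
    using len_add_less[of p "\<ominus> dig g 0 p"] len_dig[OF p(1), of 0] r p by (simp add: a_minus_def len_uminus)
  moreover have "len (g \<otimes> quot g p) = d + len (quot g p)"
    using len_mult[OF g q g_nonzero nz] len_g by simp
  ultimately show l: "len (quot g p) = Suc l" using gq p(3) by simp
  have lp: "len (g \<otimes> q1) = len p" using lgq c(5) l p(3) by simp
  have "len ((c \<ominus> \<one>) \<otimes> (g \<otimes> q1)) < len p"
  proof -
    have eq: "(c \<ominus> \<one>) \<otimes> (g \<otimes> q1) = (p \<ominus> g \<otimes> q1) \<ominus> dig g 0 p"
    proof -
      have "(c \<ominus> \<one>) \<otimes> (g \<otimes> q1) = g \<otimes> quot g p \<ominus> g \<otimes> q1"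
        using c g by (simp add: a_minus_def l_distr r_distr l_minus r_minus m_ac)
      then show ?thesis unfolding gq using p(1) r c g by (simp add: a_minus_def a_ac)
    qed
    have "len (p \<ominus> g \<otimes> q1) < len p"
      by (rule mon_minus) (use p c g lp mon_mult mon_g in auto)
    then show ?thesis unfolding eq
      using len_minus[of "p \<ominus> g \<otimes> q1" "dig g 0 p"] p c g r len_dig[OF p(1), of 0] by simp
  qed
  then have "c \<ominus> \<one> = \<zero>"
    using len_mult[of "c \<ominus> \<one>" "g \<otimes> q1"] lp c g q1 g_nonzero len_zero[of "c \<ominus> \<one>"]
    by (cases "c \<ominus> \<one> = \<zero>") (auto simp: integral_iff)
  then have "c = \<one>" using c by simp
  then show "mon (quot g p)" using c by simp
qed

lemma top_digit:
  assumes "p \<in> carrier P" "mon p" "len p = Suc (q * d + s)" "s < d"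
  shows "mon (dig g q p)" "len (dig g q p) = Suc s"
  using assms
proof (induction q arbitrary: p)
  case 0
  { case 1 then show ?case by (simp add: dig_0_small) }
  { case 2 then show ?case by (simp add: dig_0_small) }
next
  case (Suc q)
  { case 1 then show ?case using quot_monic[of p "q * d + s"] Suc quot_closed by (simp add: dig_Suc add.assoc) }
  { case 2 then show ?case using quot_monic[of p "q * d + s"] Suc quot_closed by (simp add: dig_Suc add.assoc) }
qed

end

section \<open>The valuation defined by a key polynomial\<close>

text \<open>
  The situation of \<open>K[x] \<rightarrow> K[x]/(f)\<close> with a valuation on the quotient, where \<open>n = deg f\<close>. The last
  assumption is all that is used of the uniqueness of the extension: every element of the
  quotient is a root of a polynomial over \<open>K\<close> whose leading term has minimal value.
\<close>

locale valued_quotient = monic_ring P len mon + L: valuative_field L le + e: ring_hom_cring P L e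
  for P :: "('p, 'm) ring_scheme" (structure) and len :: "'p \<Rightarrow> nat" and mon :: "'p \<Rightarrow> bool"
    and L :: "('b, 'n) ring_scheme" and le :: "'b \<Rightarrow> 'b \<Rightarrow> bool" (infix "\<lessapprox>" 50) and e :: "'p \<Rightarrow> 'b" +
  fixes n :: nat and f :: 'p
  assumes division: "monic_subring (carrier P)"
    and n: "n > 0" and f: "f \<in> carrier P" "mon f" "len f = Suc n"
    and e_inj: "\<lbrakk>p \<in> carrier P; len p \<le> n; e p = \<zero>\<^bsub>L\<^esub>\<rbrakk> \<Longrightarrow> p = \<zero>"
    and e_kernel: "\<lbrakk>p \<in> carrier P; e p = \<zero>\<^bsub>L\<^esub>\<rbrakk> \<Longrightarrow> \<exists>q\<in>carrier P. p = f \<otimes> q"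
    and integral_rel: "\<lbrakk>y \<in> carrier L; y \<noteq> \<zero>\<^bsub>L\<^esub>\<rbrakk> \<Longrightarrow>
      \<exists>N a. (\<forall>i<N. a i \<in> carrier P \<and> len (a i) \<le> 1 \<and> y [^]\<^bsub>L\<^esub> N \<lessapprox> e (a i) \<otimes>\<^bsub>L\<^esub> y [^]\<^bsub>L\<^esub> i)
        \<and> y [^]\<^bsub>L\<^esub> N = (\<Oplus>\<^bsub>L\<^esub>i\<in>{..<(N::nat)}. e (a i) \<otimes>\<^bsub>L\<^esub> y [^]\<^bsub>L\<^esub> i)"
begin

text \<open>
  With \<open>a b = g q + r\<close> the condition reads \<open>v(a b) < v(g q)\<close>, so that \<open>r\<close> has the same value as \<open>a b\<close>.
\<close>

definition is_key :: "'p \<Rightarrow> nat \<Rightarrow> bool" where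
  "is_key g d \<longleftrightarrow> (\<forall>a\<in>carrier P. \<forall>b\<in>carrier P. len a \<le> d \<and> len b \<le> d \<and> a \<noteq> \<zero> \<and> b \<noteq> \<zero> \<longrightarrow>
     e a \<otimes>\<^bsub>L\<^esub> e b \<lless> e g \<otimes>\<^bsub>L\<^esub> e (quot g (a \<otimes> b)))"

lemma e_nonzero: "\<lbrakk>p \<in> carrier P; len p \<le> n; p \<noteq> \<zero>\<rbrakk> \<Longrightarrow> e p \<noteq> \<zero>\<^bsub>L\<^esub>"
  using e_inj by blast

lemma e_pow: "p \<in> carrier P \<Longrightarrow> e (p [^] (k::nat)) = e p [^]\<^bsub>L\<^esub> k"
  by (induction k) auto

lemma len_finsum:
  "\<lbrakk>finite I; h \<in> I \<rightarrow> carrier P; \<And>i. i \<in> I \<Longrightarrow> len (h i) \<le> k\<rbrakk> \<Longrightarrow> len (\<Oplus>i\<in>I. h i) \<le> k"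
proof (induction I rule: finite_induct)
  case (insert i I)
  have "(\<Oplus>i\<in>insert i I. h i) = h i \<oplus> (\<Oplus>i\<in>I. h i)" by (rule finsum_insert) (use insert in auto)
  moreover have "len (h i \<oplus> (\<Oplus>i\<in>I. h i)) \<le> max (len (h i)) (len (\<Oplus>i\<in>I. h i))"
    by (rule len_add) (use insert in auto)
  moreover have "len (h i) \<le> k" "len (\<Oplus>i\<in>I. h i) \<le> k" using insert by auto
  ultimately show ?case by simp
qed simp

end

text \<open>
  The bound \<open>d < n\<close> ensures that \<open>g\<close> and all nonzero digits have nonzero classes.
\<close>

locale adic_valuation = valued_quotient P len mon L le e n f + g_adic P len mon g d
  for P :: "('p, 'm) ring_scheme" (structure) and len :: "'p \<Rightarrow> nat" and mon :: "'p \<Rightarrow> bool"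
    and L :: "('b, 'n) ring_scheme" and le :: "'b \<Rightarrow> 'b \<Rightarrow> bool" (infix "\<lessapprox>" 50) and e :: "'p \<Rightarrow> 'b"
    and n f g d +
  assumes d: "0 < d" "d < n"
begin

abbreviation G where "G \<equiv> e g"

lemma G: "G \<in> carrier L" "G \<noteq> \<zero>\<^bsub>L\<^esub>"
  using g e_nonzero[OF g] d len_g g_nonzero by auto

lemma G_pow: "G [^]\<^bsub>L\<^esub> (i::nat) \<in> carrier L" "G [^]\<^bsub>L\<^esub> (i::nat) \<noteq> \<zero>\<^bsub>L\<^esub>"
  using G L.pow_nonzero by auto

text \<open>
  The class in \<open>L\<close> of the term \<open>c\<^sub>i g\<^sup>i\<close> of the \<open>g\<close>-adic expansion of \<open>p\<close>.
\<close>

definition dv :: "nat \<Rightarrow> 'p \<Rightarrow> 'b" where "dv i p = e (dig g i p) \<otimes>\<^bsub>L\<^esub> G [^]\<^bsub>L\<^esub> i"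

text \<open>
  The polynomials negligible against a leading term with exponent \<open>k\<close> and the value of \<open>z\<close>: no term
  of the expansion has a smaller value, and the terms with exponent at least \<open>k\<close> have a strictly
  larger one.
\<close>

definition U :: "nat \<Rightarrow> 'b \<Rightarrow> 'p set" where
  "U k z = {p \<in> carrier P. \<forall>i. z \<lessapprox> dv i p \<and> (k \<le> i \<longrightarrow> z \<lless> dv i p)}"

text \<open>
  The minimum \<open>w(p)\<close> of the values of the terms of the expansion is that of \<open>z\<close>, and \<open>k\<close> is the
  largest exponent at which it is attained. This pair plays the role of the initial form of \<open>p\<close>.
\<close>

definition Lead :: "'p \<Rightarrow> nat \<Rightarrow> 'b \<Rightarrow> bool" where
  "Lead p k z \<longleftrightarrow> p \<in> carrier P \<and> z \<in> carrier L \<and> z \<noteq> \<zero>\<^bsub>L\<^esub> \<and> dv k p \<lessapprox> z \<and>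
     (\<forall>i. z \<lessapprox> dv i p \<and> (k < i \<longrightarrow> z \<lless> dv i p))"

abbreviation key :: bool where "key \<equiv> is_key g d"

lemma dv_closed: "p \<in> carrier P \<Longrightarrow> dv i p \<in> carrier L"
  using dig_closed G_pow by (simp add: dv_def)

lemma dv_add: "\<lbrakk>p \<in> carrier P; q \<in> carrier P\<rbrakk> \<Longrightarrow> dv i (p \<oplus> q) = dv i p \<oplus>\<^bsub>L\<^esub> dv i q"
  using dig_closed G_pow by (simp add: dv_def dig_add L.l_distr)

lemma dv_minus: "\<lbrakk>p \<in> carrier P; q \<in> carrier P\<rbrakk> \<Longrightarrow> dv i (p \<ominus> q) = dv i p \<ominus>\<^bsub>L\<^esub> dv i q"
  unfolding dv_def dig_minus using dig_closed G_pow by (simp add: a_minus_def L.l_distr L.l_minus)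

lemma dv_uminus: "p \<in> carrier P \<Longrightarrow> dv i (\<ominus> p) = \<ominus>\<^bsub>L\<^esub> dv i p"
  using dv_minus[of \<zero> p i] dv_closed[of p i] G_pow by (simp add: a_minus_def dv_def[of i \<zero>] dig_zero)

lemma dv_monomial: "\<lbrakk>a \<in> carrier P; len a \<le> d\<rbrakk> \<Longrightarrow> dv i (a \<otimes> g [^] k) = (if i = k then e a \<otimes>\<^bsub>L\<^esub> G [^]\<^bsub>L\<^esub> k else \<zero>\<^bsub>L\<^esub>)"
  using G_pow by (simp add: dv_def dig_monomial)

lemma e_monomial: "a \<in> carrier P \<Longrightarrow> e (a \<otimes> g [^] (k::nat)) = e a \<otimes>\<^bsub>L\<^esub> G [^]\<^bsub>L\<^esub> k"
  using g by (simp add: e_pow)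

lemma dv_beyond: "\<lbrakk>p \<in> carrier P; len p \<le> i * d\<rbrakk> \<Longrightarrow> dv i p = \<zero>\<^bsub>L\<^esub>"
  using G_pow by (simp add: dv_def dig_beyond)

lemma dig_nonzero_dv: "\<lbrakk>p \<in> carrier P; dig g i p \<noteq> \<zero>\<rbrakk> \<Longrightarrow> dv i p \<noteq> \<zero>\<^bsub>L\<^esub>"
  using e_nonzero[OF dig_closed, of p i] len_dig[of p i] d G_pow dig_closed[of p i]
  by (simp add: dv_def L.integral_iff)

lemma e_expansion:
  assumes "p \<in> carrier P" "len p \<le> Suc k * d"
  shows "e p = (\<Oplus>\<^bsub>L\<^esub>i\<in>{..k}. dv i p)"
proof -
  have cl: "(\<lambda>i. dig g i p \<otimes> g [^] i) \<in> {..k} \<rightarrow> carrier P" using assms dig_closed g by auto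
  have "e p = e (\<Oplus>i\<in>{..k}. dig g i p \<otimes> g [^] i)" using expansion[OF assms] by simp
  also have "\<dots> = (\<Oplus>\<^bsub>L\<^esub>i\<in>{..k}. (e \<circ> (\<lambda>i. dig g i p \<otimes> g [^] i)) i)" using e.hom_finsum[OF cl] by (simp add: comp_def)
  also have "\<dots> = (\<Oplus>\<^bsub>L\<^esub>i\<in>{..k}. dv i p)"
    by (rule L.finsum_cong') (use assms dv_closed dig_closed in \<open>auto simp: dv_def e_monomial\<close>)
  finally show ?thesis .
qed

lemma U_carrier: "p \<in> U k z \<Longrightarrow> p \<in> carrier P" by (simp add: U_def)

lemma U_zero: "\<lbrakk>z \<in> carrier L; z \<noteq> \<zero>\<^bsub>L\<^esub>\<rbrakk> \<Longrightarrow> \<zero> \<in> U k z"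
  using L.zero_le L.le_zero G_pow by (auto simp: U_def dv_def dig_zero)

lemma U_add: "\<lbrakk>p \<in> U k z; q \<in> U k z; z \<in> carrier L\<rbrakk> \<Longrightarrow> p \<oplus> q \<in> U k z"
  using L.le_add L.lt_add by (simp add: U_def dv_add dv_closed)

lemma U_uminus:
  assumes "p \<in> U k z" "z \<in> carrier L" "z \<noteq> \<zero>\<^bsub>L\<^esub>"
  shows "\<ominus> p \<in> U k z"
proof -
  have p: "p \<in> carrier P" using assms U_carrier by blast
  then show ?thesis using assms L.le_uminus L.lt_uminus dv_closed by (simp add: U_def dv_uminus)
qed

lemma U_finsum:
  assumes "finite I" "\<And>i. i \<in> I \<Longrightarrow> h i \<in> U k z" "z \<in> carrier L" "z \<noteq> \<zero>\<^bsub>L\<^esub>"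
  shows "(\<Oplus>i\<in>I. h i) \<in> U k z"
  using assms
proof (induction I rule: finite_induct)
  case empty then show ?case using U_zero by simp
next
  case (insert i I)
  have "(\<Oplus>i\<in>insert i I. h i) = h i \<oplus> (\<Oplus>i\<in>I. h i)" by (rule finsum_insert) (use insert U_carrier in auto)
  then show ?case using insert U_add by simp
qed

lemma U_monomial:
  assumes "a \<in> carrier P" "len a \<le> d" "z \<lessapprox> e a \<otimes>\<^bsub>L\<^esub> G [^]\<^bsub>L\<^esub> i" "i < k \<or> z \<lless> e a \<otimes>\<^bsub>L\<^esub> G [^]\<^bsub>L\<^esub> i"
    "z \<in> carrier L" "z \<noteq> \<zero>\<^bsub>L\<^esub>"
  shows "a \<otimes> g [^] i \<in> U k z"
  using assms g L.zero_le L.le_zero by (auto simp: U_def dv_monomial)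

lemma LeadI:
  assumes "a \<in> carrier P" "len a \<le> d" "z \<lessapprox> e a \<otimes>\<^bsub>L\<^esub> G [^]\<^bsub>L\<^esub> k" "e a \<otimes>\<^bsub>L\<^esub> G [^]\<^bsub>L\<^esub> k \<lessapprox> z"
    "z \<in> carrier L" "z \<noteq> \<zero>\<^bsub>L\<^esub>" "W \<in> U k z"
  shows "Lead (a \<otimes> g [^] k \<oplus> W) k z"
proof -
  let ?p = "a \<otimes> g [^] k \<oplus> W"
  have W: "W \<in> carrier P" using assms U_carrier by blast
  have av: "e a \<otimes>\<^bsub>L\<^esub> G [^]\<^bsub>L\<^esub> k \<in> carrier L" using assms(1) G_pow by simp
  have dvs: "dv i ?p = (if i = k then e a \<otimes>\<^bsub>L\<^esub> G [^]\<^bsub>L\<^esub> k \<oplus>\<^bsub>L\<^esub> dv i W else dv i W)" for i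
    using assms(1,2) g W dv_closed[OF W] by (simp add: dv_add dv_monomial)
  have *: "z \<lessapprox> dv i W" "k \<le> i \<Longrightarrow> z \<lless> dv i W" for i using assms(7) by (auto simp: U_def)
  have "dv k ?p \<lessapprox> z"
  proof (rule ccontr)
    assume a: "z \<lless> dv k ?p"
    have "z \<lless> dv k W" using * by blast
    then have "z \<lless> dv k ?p \<ominus>\<^bsub>L\<^esub> dv k W"
    proof -
      have "z \<lless> \<ominus>\<^bsub>L\<^esub> dv k W" using L.lt_uminus * dv_closed[OF W] assms(5) by blast
      then show ?thesis using a L.lt_add dv_closed W assms(1,5) g by (simp add: a_minus_def)
    qed
    moreover have "dv k ?p \<ominus>\<^bsub>L\<^esub> dv k W = e a \<otimes>\<^bsub>L\<^esub> G [^]\<^bsub>L\<^esub> k"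
      using av dv_closed[OF W] by (simp add: dvs a_minus_def L.a_assoc L.r_neg)
    ultimately show False using assms(4) by simp
  qed
  moreover have "z \<lessapprox> dv i ?p" for i
    using * L.le_add assms av dv_closed[OF W] by (simp add: dvs)
  ultimately show ?thesis using * assms W g by (auto simp: Lead_def dvs)
qed

lemma Lead_decomp:
  assumes "Lead p k z"
  obtains W where "W \<in> U k z" "p = dig g k p \<otimes> g [^] k \<oplus> W"
proof
  let ?W = "p \<ominus> dig g k p \<otimes> g [^] k"
  have p: "p \<in> carrier P" using assms by (simp add: Lead_def)
  note c = dig_closed[OF p, of k]
  show "p = dig g k p \<otimes> g [^] k \<oplus> ?W" using p c g by (simp add: a_minus_def a_lcomm r_neg)
  have "dv i ?W = (if i = k then \<zero>\<^bsub>L\<^esub> else dv i p)" for i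
    using p c g len_dig[OF p] dv_closed[OF p]
    by (subst dv_minus) (auto simp: dv_monomial dv_def[symmetric] a_minus_def L.r_neg)
  then show "?W \<in> U k z" using assms p c g L.zero_le L.le_zero by (auto simp: U_def Lead_def)
qed

lemma Lead_index_unique:
  assumes "Lead p k z" "Lead p k' z'"
  shows "k = k'"
proof -
  have False if "Lead p k z" "Lead p k' z'" "k < k'" for k k' z z'
  proof -
    have c: "p \<in> carrier P" "z \<in> carrier L" "z' \<in> carrier L" "dv k p \<in> carrier L" "dv k' p \<in> carrier L"
      using that dv_closed by (auto simp: Lead_def)
    have "z \<lless> dv k' p" "dv k' p \<lessapprox> z'" "z' \<lessapprox> dv k p" "dv k p \<lessapprox> z" using that by (auto simp: Lead_def)
    then show False using L.le_trans c by metis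
  qed
  from this[OF assms] this[OF assms(2,1)] show ?thesis by (meson linorder_neqE_nat)
qed

lemma Lead_len:
  assumes "Lead p k z"
  shows "k * d < len p"
proof (rule ccontr)
  assume "\<not> k * d < len p"
  then have "dv k p = \<zero>\<^bsub>L\<^esub>" using dv_beyond assms by (simp add: Lead_def)
  then show False using assms L.zero_le by (auto simp: Lead_def)
qed

text \<open>
  This is the inequality \<open>w \<le> v\<close>.
\<close>

lemma Lead_le:
  assumes "Lead p k z"
  shows "z \<lessapprox> e p"
proof -
  have p: "p \<in> carrier P" using assms by (simp add: Lead_def)
  have "len p \<le> Suc (len p) * d" using d by (simp add: trans_le_add2)
  then have "e p = (\<Oplus>\<^bsub>L\<^esub>i\<in>{..len p}. dv i p)" by (rule e_expansion[OF p])
  then show ?thesis using L.le_finsum[of "{..len p}" "\<lambda>i. dv i p" z] assms p dv_closed by (auto simp: Lead_def)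
qed

lemma Lead_exists:
  assumes p: "p \<in> carrier P" "p \<noteq> \<zero>"
  shows "\<exists>k z. Lead p k z"
proof -
  have "\<exists>k<Suc N. \<forall>i<Suc N. dv k p \<lessapprox> dv i p \<and> (k < i \<longrightarrow> dv k p \<lless> dv i p)" for N
  proof (induction N)
    case 0 show ?case using L.le_refl dv_closed[OF p(1)] by auto
  next
    case (Suc N)
    then obtain k where k: "k < Suc N" "\<And>i. i < Suc N \<Longrightarrow> dv k p \<lessapprox> dv i p" "\<And>i. i < Suc N \<Longrightarrow> k < i \<Longrightarrow> dv k p \<lless> dv i p"
      by blast
    show ?case
    proof (cases "dv (Suc N) p \<lessapprox> dv k p")
      case True
      have "dv (Suc N) p \<lessapprox> dv i p" if "i < Suc (Suc N)" for i
      proof (cases "i = Suc N")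
        case False
        then show ?thesis using L.le_trans[OF True k(2)] that dv_closed[OF p(1)] by simp
      qed (use L.le_refl dv_closed[OF p(1)] in simp)
      then show ?thesis by (intro exI[of _ "Suc N"]) auto
    next
      case False
      then have "dv k p \<lessapprox> dv (Suc N) p" using L.lt_imp_le dv_closed[OF p(1)] by blast
      then show ?thesis using k False by (intro exI[of _ k]) (auto simp: less_Suc_eq)
    qed
  qed
  from this[of "len p"] obtain k where k: "k < Suc (len p)" "\<And>i. i < Suc (len p) \<Longrightarrow> dv k p \<lessapprox> dv i p"
     "\<And>i. i < Suc (len p) \<Longrightarrow> k < i \<Longrightarrow> dv k p \<lless> dv i p" by blast
  have big: "dv i p = \<zero>\<^bsub>L\<^esub>" if "i \<ge> Suc (len p)" for i
  proof (rule dv_beyond[OF p(1)])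
    have "len p \<le> i * 1" using that by simp
    also have "\<dots> \<le> i * d" using d by (intro mult_le_mono2) simp
    finally show "len p \<le> i * d" .
  qed
  have nz: "dv k p \<noteq> \<zero>\<^bsub>L\<^esub>"
  proof
    assume z: "dv k p = \<zero>\<^bsub>L\<^esub>"
    have "dig g i p = \<zero>" for i
    proof (rule ccontr)
      assume a: "dig g i p \<noteq> \<zero>"
      then have nz: "dv i p \<noteq> \<zero>\<^bsub>L\<^esub>" using dig_nonzero_dv p by blast
      then have "i < Suc (len p)" using big[of i] by (meson not_less)
      then show False using k(2)[of i] nz z L.zero_le dv_closed[OF p(1)] by auto
    qed
    then have "(\<Oplus>i\<in>{..len p}. dig g i p \<otimes> g [^] i) = (\<Oplus>i\<in>{..len p}. \<zero>)"
      by (intro finsum_cong') (use g in auto)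
    moreover have "len p \<le> Suc (len p) * d" using d by (simp add: trans_le_add2)
    ultimately have "p = (\<Oplus>i\<in>{..len p}. \<zero>)" using expansion[OF p(1)] by simp
    then show False using p by (simp add: finsum_zero)
  qed
  have "Lead p k (dv k p)" unfolding Lead_def
  proof (intro conjI allI impI)
    show "dv k p \<lessapprox> dv k p" using L.le_refl dv_closed[OF p(1)] by blast
    fix i
    show "dv k p \<lessapprox> dv i p" using k(2)[of i] big[of i] L.le_zero dv_closed[OF p(1)] by (cases "i < Suc (len p)") auto
    show "dv k p \<lless> dv i p" if "k < i"
      using k(3)[of i] big[of i] nz L.zero_le dv_closed[OF p(1)] that by (cases "i < Suc (len p)") auto
  qed (use p dv_closed[OF p(1)] nz L.le_refl in auto)
  then show ?thesis by blast
qed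

lemma key_product:
  assumes key and a: "a \<in> carrier P" "len a \<le> d" "a \<noteq> \<zero>" and b: "b \<in> carrier P" "len b \<le> d" "b \<noteq> \<zero>"
  obtains Q R where "Q \<in> carrier P" "R \<in> carrier P" "len Q \<le> d" "len R \<le> d" "a \<otimes> b = g \<otimes> Q \<oplus> R"
    "e a \<otimes>\<^bsub>L\<^esub> e b \<lless> G \<otimes>\<^bsub>L\<^esub> e Q" "e a \<otimes>\<^bsub>L\<^esub> e b \<lessapprox> e R" "e R \<lessapprox> e a \<otimes>\<^bsub>L\<^esub> e b"
proof -
  let ?Q = "quot g (a \<otimes> b)" and ?R = "dig g 0 (a \<otimes> b)"
  have ab: "a \<otimes> b \<in> carrier P" using a b by simp
  note Q = quot_closed[OF ab] and R = dig_closed[OF ab, of 0]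
  have lt: "e a \<otimes>\<^bsub>L\<^esub> e b \<lless> G \<otimes>\<^bsub>L\<^esub> e ?Q" using assms unfolding is_key_def by blast
  have "len ?Q \<le> d" using len_quot[OF ab] len_mult_le[OF a(1) b(1)] a b by simp
  moreover have eq: "a \<otimes> b = g \<otimes> ?Q \<oplus> ?R" using quot_dig ab by simp
  have cl: "e a \<otimes>\<^bsub>L\<^esub> e b \<in> carrier L" "G \<otimes>\<^bsub>L\<^esub> e ?Q \<in> carrier L" "e ?R \<in> carrier L"
    using a b Q R g by auto
  have ev: "e a \<otimes>\<^bsub>L\<^esub> e b = G \<otimes>\<^bsub>L\<^esub> e ?Q \<oplus>\<^bsub>L\<^esub> e ?R"
    using arg_cong[OF eq, of e] a b Q R g by simp
  have eR: "e ?R = e a \<otimes>\<^bsub>L\<^esub> e b \<ominus>\<^bsub>L\<^esub> G \<otimes>\<^bsub>L\<^esub> e ?Q"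
    unfolding ev using cl(2,3) by (simp add: a_minus_def L.a_ac L.r_neg L.r_neg1 L.r_neg2)
  have "e a \<otimes>\<^bsub>L\<^esub> e b \<lessapprox> e ?R" unfolding eR
    using L.le_minus[OF L.le_refl L.lt_imp_le[OF lt]] cl by blast
  moreover have "e ?R \<lessapprox> e a \<otimes>\<^bsub>L\<^esub> e b"
  proof (rule ccontr)
    assume "e a \<otimes>\<^bsub>L\<^esub> e b \<lless> e ?R"
    from L.lt_add[OF lt this] ev L.le_refl[OF cl(1)] cl show False by simp
  qed
  ultimately show thesis using that[OF Q R _ _ eq lt] len_dig[OF ab] by blast
qed

text \<open>
  The product of two monomials is \<open>r g\<^sup>i\<^sup>+\<^sup>j + q g\<^sup>i\<^sup>+\<^sup>j\<^sup>+\<^sup>1\<close>, where \<open>a b = g q + r\<close>. The first term has the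
  value of the product and the second a strictly larger one, because \<open>g\<close> is a key polynomial.
\<close>

lemma monomial_mult_in_U:
  assumes key and a: "a \<in> carrier P" "len a \<le> d" and b: "b \<in> carrier P" "len b \<le> d"
    and z: "z \<lessapprox> e a \<otimes>\<^bsub>L\<^esub> G [^]\<^bsub>L\<^esub> i" "z \<in> carrier L" "z \<noteq> \<zero>\<^bsub>L\<^esub>"
    and w: "w \<lessapprox> e b \<otimes>\<^bsub>L\<^esub> G [^]\<^bsub>L\<^esub> j" "w \<in> carrier L" "w \<noteq> \<zero>\<^bsub>L\<^esub>"
    and strict: "i + j < k \<or> z \<lless> e a \<otimes>\<^bsub>L\<^esub> G [^]\<^bsub>L\<^esub> i \<or> w \<lless> e b \<otimes>\<^bsub>L\<^esub> G [^]\<^bsub>L\<^esub> j"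
  shows "(a \<otimes> g [^] i) \<otimes> (b \<otimes> g [^] j) \<in> U k (z \<otimes>\<^bsub>L\<^esub> w)"
proof (cases "a = \<zero> \<or> b = \<zero>")
  case True
  then have "(a \<otimes> g [^] i) \<otimes> (b \<otimes> g [^] j) = \<zero>" using a b g by auto
  then show ?thesis using U_zero z w by (simp add: L.integral_iff)
next
  case False
  from key_product[OF \<open>key\<close> a _ b] False obtain Q R where
    QR: "Q \<in> carrier P" "R \<in> carrier P" "len Q \<le> d" "len R \<le> d" "a \<otimes> b = g \<otimes> Q \<oplus> R"
    "e a \<otimes>\<^bsub>L\<^esub> e b \<lless> G \<otimes>\<^bsub>L\<^esub> e Q" "e a \<otimes>\<^bsub>L\<^esub> e b \<lessapprox> e R" "e R \<lessapprox> e a \<otimes>\<^bsub>L\<^esub> e b" by blast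
  have zw: "z \<otimes>\<^bsub>L\<^esub> w \<in> carrier L" "z \<otimes>\<^bsub>L\<^esub> w \<noteq> \<zero>\<^bsub>L\<^esub>" using z w by (auto simp: L.integral_iff)
  let ?ab = "e a \<otimes>\<^bsub>L\<^esub> e b" and ?g = "G [^]\<^bsub>L\<^esub> (i + j)"
  have cl: "?ab \<in> carrier L" "?g \<in> carrier L" "e a \<otimes>\<^bsub>L\<^esub> G [^]\<^bsub>L\<^esub> i \<in> carrier L" "e b \<otimes>\<^bsub>L\<^esub> G [^]\<^bsub>L\<^esub> j \<in> carrier L"
    "e Q \<in> carrier L" "e R \<in> carrier L" "G \<in> carrier L"
    using a b G G_pow QR by auto
  have prod: "(e a \<otimes>\<^bsub>L\<^esub> G [^]\<^bsub>L\<^esub> i) \<otimes>\<^bsub>L\<^esub> (e b \<otimes>\<^bsub>L\<^esub> G [^]\<^bsub>L\<^esub> j) = ?ab \<otimes>\<^bsub>L\<^esub> ?g"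
    using a b G G_pow by (simp add: L.nat_pow_mult[symmetric] L.m_ac)
  have le: "z \<otimes>\<^bsub>L\<^esub> w \<lessapprox> ?ab \<otimes>\<^bsub>L\<^esub> ?g" unfolding prod[symmetric] by (rule L.le_mult2) (use z w cl in auto)
  have lt: "z \<otimes>\<^bsub>L\<^esub> w \<lless> ?ab \<otimes>\<^bsub>L\<^esub> ?g" if "\<not> i + j < k"
    unfolding prod[symmetric] using strict that L.lt_mult2[OF z(1) _ z(3)] L.lt_mult2'[OF _ w(1,3)] z w cl by blast
  have leR: "?ab \<otimes>\<^bsub>L\<^esub> ?g \<lessapprox> e R \<otimes>\<^bsub>L\<^esub> ?g" using L.le_mult2[OF QR(7) L.le_refl] cl by blast
  have ltQ: "?ab \<otimes>\<^bsub>L\<^esub> ?g \<lless> e Q \<otimes>\<^bsub>L\<^esub> G [^]\<^bsub>L\<^esub> Suc (i + j)"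
  proof -
    have "?ab \<otimes>\<^bsub>L\<^esub> ?g \<lless> (G \<otimes>\<^bsub>L\<^esub> e Q) \<otimes>\<^bsub>L\<^esub> ?g"
      by (rule L.lt_mult2'[OF QR(6) L.le_refl G_pow(2)]) (use cl in auto)
    then show ?thesis using cl by (simp add: L.m_ac)
  qed
  have RU: "R \<otimes> g [^] (i + j) \<in> U k (z \<otimes>\<^bsub>L\<^esub> w)"
  proof (rule U_monomial[OF QR(2,4) _ _ zw])
    show "z \<otimes>\<^bsub>L\<^esub> w \<lessapprox> e R \<otimes>\<^bsub>L\<^esub> ?g" using L.le_trans[OF le leR] zw cl by blast
    show "i + j < k \<or> z \<otimes>\<^bsub>L\<^esub> w \<lless> e R \<otimes>\<^bsub>L\<^esub> ?g" using L.lt_le_trans[OF lt leR] zw cl by blast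
  qed
  have QU: "Q \<otimes> g [^] Suc (i + j) \<in> U k (z \<otimes>\<^bsub>L\<^esub> w)"
  proof (rule U_monomial[OF QR(1,3) _ _ zw])
    have "z \<otimes>\<^bsub>L\<^esub> w \<lless> e Q \<otimes>\<^bsub>L\<^esub> G [^]\<^bsub>L\<^esub> Suc (i + j)" using L.le_lt_trans[OF le ltQ] zw cl by blast
    then show "z \<otimes>\<^bsub>L\<^esub> w \<lessapprox> e Q \<otimes>\<^bsub>L\<^esub> G [^]\<^bsub>L\<^esub> Suc (i + j)" "Suc (i + j) < k \<or> z \<otimes>\<^bsub>L\<^esub> w \<lless> e Q \<otimes>\<^bsub>L\<^esub> G [^]\<^bsub>L\<^esub> Suc (i + j)"
      using L.lt_imp_le zw cl by auto
  qed
  have "(a \<otimes> g [^] i) \<otimes> (b \<otimes> g [^] j) = (a \<otimes> b) \<otimes> g [^] (i + j)"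
    using a b g by (simp add: nat_pow_mult[symmetric] m_ac)
  also have "\<dots> = R \<otimes> g [^] (i + j) \<oplus> Q \<otimes> g [^] Suc (i + j)"
    unfolding QR(5) using g QR(1,2) by (simp add: l_distr r_distr m_ac a_ac)
  finally show ?thesis using U_add[OF RU QU zw(1)] by simp
qed

lemma expansion_len: "p \<in> carrier P \<Longrightarrow> p = (\<Oplus>i\<in>{..len p}. dig g i p \<otimes> g [^] i)"
  using expansion[of p "len p"] d by (simp add: trans_le_add2)

lemma monomial_mult_U:
  assumes key and a: "a \<in> carrier P" "len a \<le> d"
    and z: "z \<lessapprox> e a \<otimes>\<^bsub>L\<^esub> G [^]\<^bsub>L\<^esub> l" "z \<in> carrier L" "z \<noteq> \<zero>\<^bsub>L\<^esub>"
    and i: "l \<le> i \<or> z \<lless> e a \<otimes>\<^bsub>L\<^esub> G [^]\<^bsub>L\<^esub> l"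
    and q: "q \<in> U j w" and w: "w \<in> carrier L" "w \<noteq> \<zero>\<^bsub>L\<^esub>"
  shows "(a \<otimes> g [^] l) \<otimes> q \<in> U (i + j) (z \<otimes>\<^bsub>L\<^esub> w)"
proof -
  have qP: "q \<in> carrier P" using q U_carrier by blast
  have dvq: "w \<lessapprox> dv m q" "j \<le> m \<Longrightarrow> w \<lless> dv m q" for m using q by (auto simp: U_def)
  have "(a \<otimes> g [^] l) \<otimes> q = (a \<otimes> g [^] l) \<otimes> (\<Oplus>m\<in>{..len q}. dig g m q \<otimes> g [^] m)"
    using expansion_len[OF qP] by simp
  also have "\<dots> = (\<Oplus>m\<in>{..len q}. (a \<otimes> g [^] l) \<otimes> (dig g m q \<otimes> g [^] m))"
    by (rule finsum_rdistr) (use a g dig_closed[OF qP] in auto)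
  also have "\<dots> \<in> U (i + j) (z \<otimes>\<^bsub>L\<^esub> w)"
  proof (rule U_finsum)
    fix m assume "m \<in> {..len q}"
    show "(a \<otimes> g [^] l) \<otimes> (dig g m q \<otimes> g [^] m) \<in> U (i + j) (z \<otimes>\<^bsub>L\<^esub> w)"
    proof (rule monomial_mult_in_U[OF \<open>key\<close> a dig_closed[OF qP] len_dig[OF qP] z _ w])
      show "w \<lessapprox> e (dig g m q) \<otimes>\<^bsub>L\<^esub> G [^]\<^bsub>L\<^esub> m" using dvq by (simp add: dv_def)
      show "l + m < i + j \<or> z \<lless> e a \<otimes>\<^bsub>L\<^esub> G [^]\<^bsub>L\<^esub> l \<or> w \<lless> e (dig g m q) \<otimes>\<^bsub>L\<^esub> G [^]\<^bsub>L\<^esub> m"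
        using i dvq(2)[of m] unfolding dv_def by linarith
    qed
  qed (use z w in \<open>auto simp: L.integral_iff\<close>)
  finally show ?thesis .
qed

lemma U_mult:
  assumes key and p: "p \<in> U i z" and z: "z \<in> carrier L" "z \<noteq> \<zero>\<^bsub>L\<^esub>"
    and q: "q \<in> U j w" and w: "w \<in> carrier L" "w \<noteq> \<zero>\<^bsub>L\<^esub>"
  shows "p \<otimes> q \<in> U (i + j) (z \<otimes>\<^bsub>L\<^esub> w)"
proof -
  have P: "p \<in> carrier P" "q \<in> carrier P" using p q U_carrier by blast+
  have "p \<otimes> q = (\<Oplus>l\<in>{..len p}. dig g l p \<otimes> g [^] l) \<otimes> q"
    using expansion_len[OF P(1)] by simp
  also have "\<dots> = (\<Oplus>l\<in>{..len p}. (dig g l p \<otimes> g [^] l) \<otimes> q)"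
    by (rule finsum_ldistr) (use P g dig_closed[OF P(1)] in auto)
  also have "\<dots> \<in> U (i + j) (z \<otimes>\<^bsub>L\<^esub> w)"
  proof (rule U_finsum)
    fix l assume "l \<in> {..len p}"
    have "z \<lessapprox> dv l p" "l \<le> i \<or> z \<lless> dv l p" using p by (auto simp: U_def)
    then show "(dig g l p \<otimes> g [^] l) \<otimes> q \<in> U (i + j) (z \<otimes>\<^bsub>L\<^esub> w)"
      unfolding dv_def by (intro monomial_mult_U[OF \<open>key\<close> dig_closed[OF P(1)] len_dig[OF P(1)] _ z _ q w])
  qed (use z w in \<open>auto simp: L.integral_iff\<close>)
  finally show ?thesis .
qed

text \<open>
  For a key polynomial \<open>g\<close>, initial forms multiply: the value \<open>w\<close> is additive, and so is the
  exponent of the leading term.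
\<close>

lemma Lead_mult:
  assumes key and p: "Lead p i z" and q: "Lead q j w"
  shows "Lead (p \<otimes> q) (i + j) (z \<otimes>\<^bsub>L\<^esub> w)"
proof -
  define a where "a = dig g i p"
  define b where "b = dig g j q"
  obtain p' where p': "p' \<in> U i z" "p = a \<otimes> g [^] i \<oplus> p'" using Lead_decomp[OF p] unfolding a_def by blast
  obtain q' where q': "q' \<in> U j w" "q = b \<otimes> g [^] j \<oplus> q'" using Lead_decomp[OF q] unfolding b_def by blast
  have P: "p \<in> carrier P" "q \<in> carrier P" "p' \<in> carrier P" "q' \<in> carrier P"
    using p q p' q' U_carrier by (auto simp: Lead_def)
  have ab: "a \<in> carrier P" "b \<in> carrier P" "len a \<le> d" "len b \<le> d"
    using dig_closed len_dig P unfolding a_def b_def by auto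
  have z: "z \<in> carrier L" "z \<noteq> \<zero>\<^bsub>L\<^esub>" "z \<lessapprox> e a \<otimes>\<^bsub>L\<^esub> G [^]\<^bsub>L\<^esub> i" "e a \<otimes>\<^bsub>L\<^esub> G [^]\<^bsub>L\<^esub> i \<lessapprox> z"
    using p unfolding Lead_def dv_def a_def by auto
  have w: "w \<in> carrier L" "w \<noteq> \<zero>\<^bsub>L\<^esub>" "w \<lessapprox> e b \<otimes>\<^bsub>L\<^esub> G [^]\<^bsub>L\<^esub> j" "e b \<otimes>\<^bsub>L\<^esub> G [^]\<^bsub>L\<^esub> j \<lessapprox> w"
    using q unfolding Lead_def dv_def b_def by auto
  have zw: "z \<otimes>\<^bsub>L\<^esub> w \<in> carrier L" "z \<otimes>\<^bsub>L\<^esub> w \<noteq> \<zero>\<^bsub>L\<^esub>" using z w by (auto simp: L.integral_iff)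
  have cl: "e a \<otimes>\<^bsub>L\<^esub> G [^]\<^bsub>L\<^esub> i \<in> carrier L" "e b \<otimes>\<^bsub>L\<^esub> G [^]\<^bsub>L\<^esub> j \<in> carrier L" using ab G_pow by auto
  have "a \<noteq> \<zero>" using z(4) z(1,2) L.zero_le G_pow by auto
  moreover have "b \<noteq> \<zero>" using w(4) w(1,2) L.zero_le G_pow by auto
  ultimately obtain Q R where
    QR: "Q \<in> carrier P" "R \<in> carrier P" "len Q \<le> d" "len R \<le> d" "a \<otimes> b = g \<otimes> Q \<oplus> R"
    "e a \<otimes>\<^bsub>L\<^esub> e b \<lless> G \<otimes>\<^bsub>L\<^esub> e Q" "e a \<otimes>\<^bsub>L\<^esub> e b \<lessapprox> e R" "e R \<lessapprox> e a \<otimes>\<^bsub>L\<^esub> e b"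
    using key_product[OF \<open>key\<close> ab(1,3) _ ab(2,4)] by blast
  let ?ab = "e a \<otimes>\<^bsub>L\<^esub> e b" and ?g = "G [^]\<^bsub>L\<^esub> (i + j)"
  have cl2: "?ab \<in> carrier L" "?g \<in> carrier L" "e R \<in> carrier L" "e Q \<in> carrier L" "e R \<otimes>\<^bsub>L\<^esub> ?g \<in> carrier L"
    "?ab \<otimes>\<^bsub>L\<^esub> ?g \<in> carrier L"
    using ab G_pow QR by auto
  have prod: "(e a \<otimes>\<^bsub>L\<^esub> G [^]\<^bsub>L\<^esub> i) \<otimes>\<^bsub>L\<^esub> (e b \<otimes>\<^bsub>L\<^esub> G [^]\<^bsub>L\<^esub> j) = ?ab \<otimes>\<^bsub>L\<^esub> ?g"
    using ab G G_pow by (simp add: L.nat_pow_mult[symmetric] L.m_ac)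
  have le1: "z \<otimes>\<^bsub>L\<^esub> w \<lessapprox> ?ab \<otimes>\<^bsub>L\<^esub> ?g" "?ab \<otimes>\<^bsub>L\<^esub> ?g \<lessapprox> z \<otimes>\<^bsub>L\<^esub> w"
    unfolding prod[symmetric] using L.le_mult2 z w cl by simp_all
  have le2: "?ab \<otimes>\<^bsub>L\<^esub> ?g \<lessapprox> e R \<otimes>\<^bsub>L\<^esub> ?g" "e R \<otimes>\<^bsub>L\<^esub> ?g \<lessapprox> ?ab \<otimes>\<^bsub>L\<^esub> ?g"
    using L.le_mult2[OF QR(7) L.le_refl] L.le_mult2[OF QR(8) L.le_refl] cl2 by auto
  have RL: "z \<otimes>\<^bsub>L\<^esub> w \<lessapprox> e R \<otimes>\<^bsub>L\<^esub> ?g" "e R \<otimes>\<^bsub>L\<^esub> ?g \<lessapprox> z \<otimes>\<^bsub>L\<^esub> w"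
    using L.le_trans[OF le1(1) le2(1)] L.le_trans[OF le2(2) le1(2)] zw cl2 by auto
  have QU: "Q \<otimes> g [^] Suc (i + j) \<in> U (i + j) (z \<otimes>\<^bsub>L\<^esub> w)"
  proof (rule U_monomial[OF QR(1,3) _ _ zw])
    have "?ab \<otimes>\<^bsub>L\<^esub> ?g \<lless> (G \<otimes>\<^bsub>L\<^esub> e Q) \<otimes>\<^bsub>L\<^esub> ?g"
      by (rule L.lt_mult2'[OF QR(6) L.le_refl G_pow(2)]) (use cl2 G in auto)
    then have "?ab \<otimes>\<^bsub>L\<^esub> ?g \<lless> e Q \<otimes>\<^bsub>L\<^esub> G [^]\<^bsub>L\<^esub> Suc (i + j)" using cl2 G by (simp add: L.m_ac)
    then have "z \<otimes>\<^bsub>L\<^esub> w \<lless> e Q \<otimes>\<^bsub>L\<^esub> G [^]\<^bsub>L\<^esub> Suc (i + j)" using L.le_lt_trans[OF le1(1)] zw cl2 G by simp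
    then show "z \<otimes>\<^bsub>L\<^esub> w \<lessapprox> e Q \<otimes>\<^bsub>L\<^esub> G [^]\<^bsub>L\<^esub> Suc (i + j)" "Suc (i + j) < i + j \<or> z \<otimes>\<^bsub>L\<^esub> w \<lless> e Q \<otimes>\<^bsub>L\<^esub> G [^]\<^bsub>L\<^esub> Suc (i + j)"
      using L.lt_imp_le zw cl2 G_pow[of "Suc (i + j)"] by auto
  qed
  have r1: "(a \<otimes> g [^] i) \<otimes> q' \<in> U (i + j) (z \<otimes>\<^bsub>L\<^esub> w)"
    by (rule monomial_mult_U[OF \<open>key\<close> ab(1,3) z(3,1,2) _ q'(1) w(1,2)]) simp
  have r2: "(b \<otimes> g [^] j) \<otimes> p' \<in> U (i + j) (z \<otimes>\<^bsub>L\<^esub> w)"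
    using monomial_mult_U[OF \<open>key\<close> ab(2,4) w(3,1,2) _ p'(1) z(1,2), of j] z w by (simp add: add.commute L.m_comm)
  have r3: "p' \<otimes> q' \<in> U (i + j) (z \<otimes>\<^bsub>L\<^esub> w)" by (rule U_mult[OF \<open>key\<close> p'(1) z(1,2) q'(1) w(1,2)])
  let ?W = "Q \<otimes> g [^] Suc (i + j) \<oplus> ((a \<otimes> g [^] i) \<otimes> q' \<oplus> ((b \<otimes> g [^] j) \<otimes> p' \<oplus> p' \<otimes> q'))"
  have W: "?W \<in> U (i + j) (z \<otimes>\<^bsub>L\<^esub> w)" by (intro U_add QU r1 r2 r3 zw)
  have gi: "g [^] i \<in> carrier P" "g [^] j \<in> carrier P" using g by auto
  have "p \<otimes> q = (a \<otimes> b) \<otimes> (g [^] i \<otimes> g [^] j) \<oplus> ((a \<otimes> g [^] i) \<otimes> q' \<oplus> ((b \<otimes> g [^] j) \<otimes> p' \<oplus> p' \<otimes> q'))"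
    unfolding p'(2) q'(2) using ab gi P(3,4) by (simp add: l_distr r_distr m_ac a_ac)
  also have "(a \<otimes> b) \<otimes> (g [^] i \<otimes> g [^] j) = R \<otimes> g [^] (i + j) \<oplus> Q \<otimes> g [^] Suc (i + j)"
    unfolding QR(5) nat_pow_mult[OF g] using g QR(1,2) by (simp add: l_distr r_distr m_ac a_ac)
  also have "R \<otimes> g [^] (i + j) \<oplus> Q \<otimes> g [^] Suc (i + j) \<oplus> ((a \<otimes> g [^] i) \<otimes> q' \<oplus> ((b \<otimes> g [^] j) \<otimes> p' \<oplus> p' \<otimes> q'))
     = R \<otimes> g [^] (i + j) \<oplus> ?W"
    by (rule a_assoc) (use QR g ab P in auto)
  finally show ?thesis using LeadI[OF QR(2,4) RL zw W] by simp
qed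

text \<open>
  Let \<open>y\<close> be the class of \<open>g\<close> and \<open>y\<^sup>N = \<Sum> a\<^sub>i y\<^sup>i\<close> its integral relation. The polynomial \<open>g\<^sup>N - \<Sum> a\<^sub>i g\<^sup>i\<close>
  vanishes in the quotient, hence is a product \<open>f q\<close>; its leading exponent \<open>N\<close> is as large as its
  degree permits. As leading exponents add up, the same is true of the factors, so that \<open>f\<close> has
  leading exponent \<open>n/d\<close>. The leading term is therefore \<open>g\<^sup>k\<^sup>+\<^sup>1\<close>, and comparing it with the next term
  \<open>c g\<^sup>k\<close> gives \<open>v(g) \<le> v(c)\<close>.
\<close>

lemma key_degree:
  assumes key
  shows "\<exists>k. n = Suc k * d \<and> (\<forall>c\<in>carrier P. \<forall>r\<in>carrier P. f = g [^] Suc k \<oplus> c \<otimes> g [^] k \<oplus> r \<and> len c \<le> d \<and> len r \<le> k * d \<longrightarrow> G \<lessapprox> e c)"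
proof -
  obtain N a where a: "\<And>i. i < N \<Longrightarrow> a i \<in> carrier P" "\<And>i. i < N \<Longrightarrow> len (a i) \<le> 1"
    "\<And>i. i < N \<Longrightarrow> G [^]\<^bsub>L\<^esub> (N::nat) \<lessapprox> e (a i) \<otimes>\<^bsub>L\<^esub> G [^]\<^bsub>L\<^esub> i"
    and rel: "G [^]\<^bsub>L\<^esub> N = (\<Oplus>\<^bsub>L\<^esub>i\<in>{..<N}. e (a i) \<otimes>\<^bsub>L\<^esub> G [^]\<^bsub>L\<^esub> i)"
    using integral_rel[OF G] by blast
  define s where "s = (\<Oplus>i\<in>{..<N}. a i \<otimes> g [^] i)"
  define p where "p = \<one> \<otimes> g [^] N \<oplus> \<ominus> s"
  have cl: "(\<lambda>i. a i \<otimes> g [^] i) \<in> {..<N} \<rightarrow> carrier P" using a g by auto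
  have sP: "s \<in> carrier P" unfolding s_def using cl by (rule finsum_closed)
  have sU: "s \<in> U N (G [^]\<^bsub>L\<^esub> N)" unfolding s_def
    by (rule U_finsum) (use a G_pow d in \<open>auto intro!: U_monomial intro: order_trans[of _ 1]\<close>)
  have Lp: "Lead p N (G [^]\<^bsub>L\<^esub> N)" unfolding p_def
    by (rule LeadI) (use d G_pow L.le_refl U_uminus[OF sU] in auto)
  have pP: "p \<in> carrier P" using Lp by (simp add: Lead_def)
  have "e s = (\<Oplus>\<^bsub>L\<^esub>i\<in>{..<N}. (e \<circ> (\<lambda>i. a i \<otimes> g [^] i)) i)"
    unfolding s_def using e.hom_finsum[OF cl] by (simp add: comp_def)
  also have "\<dots> = G [^]\<^bsub>L\<^esub> N" unfolding rel
    by (rule L.finsum_cong') (use a G_pow in \<open>auto simp: e_monomial\<close>)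
  finally have "e p = \<zero>\<^bsub>L\<^esub>" unfolding p_def using g sP G_pow by (simp add: e_pow L.r_neg)
  from e_kernel[OF pP this] obtain q where q: "q \<in> carrier P" "p = f \<otimes> q" by blast
  have "p \<noteq> \<zero>" using Lead_len[OF Lp] by auto
  then have nz: "f \<noteq> \<zero>" "q \<noteq> \<zero>" using q f by auto
  obtain i z where Lf: "Lead f i z" using Lead_exists[OF f(1) nz(1)] by blast
  obtain j w where Lq: "Lead q j w" using Lead_exists[OF q(1) nz(2)] by blast
  have ij: "i + j = N" using Lead_index_unique[OF Lp] Lead_mult[OF \<open>key\<close> Lf Lq] q(2) by metis
  have "len s \<le> N * d + 1" unfolding s_def
  proof (rule len_finsum[OF _ cl])
    fix i assume i: "i \<in> {..<N}"
    have "len (a i \<otimes> g [^] i) \<le> len (a i) + len (g [^] i) - 1" by (rule len_mult_le) (use a g i in auto)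
    also have "\<dots> \<le> i * d + 1" using a(2)[of i] i len_pow[OF g mon_g len_g, of i] by simp
    also have "\<dots> \<le> N * d + 1" using i by (auto intro!: mult_le_mono1)
    finally show "len (a i \<otimes> g [^] i) \<le> N * d + 1" .
  qed simp
  then have "len p \<le> N * d + 1" unfolding p_def
    using len_add[of "\<one> \<otimes> g [^] N" "\<ominus> s"] sP g len_pow[OF g mon_g len_g, of N] by (simp add: len_uminus)
  then have "n + len q \<le> N * d + 1" using len_mult[OF f(1) q(1) nz] q(2) f(3) by simp
  moreover have id: "i * d \<le> n" "j * d < len q" using Lead_len[OF Lf] Lead_len[OF Lq] f(3) by simp_all
  moreover have "N * d = i * d + j * d" using ij by (simp add: add_mult_distrib[symmetric])
  ultimately have ni: "n = i * d" by linarith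
  then obtain k where k: "i = Suc k" using n by (cases i) auto
  have "G \<lessapprox> e c" if c: "c \<in> carrier P" "r \<in> carrier P" "len c \<le> d" "len r \<le> k * d"
    and fe: "f = g [^] Suc k \<oplus> c \<otimes> g [^] k \<oplus> r" for c r
  proof -
    have dr: "dig g k r = \<zero>" "dig g (Suc k) r = \<zero>" using dig_beyond[OF c(2)] c(4) by auto
    have d1: "dig g i (g [^] l) = (if i = l then \<one> else \<zero>)" for i l
      using dig_monomial[of \<one> i l] g d by simp
    have gk: "g [^] Suc k \<in> carrier P" "c \<otimes> g [^] k \<in> carrier P" using g c by auto
    have "dig g i' f = (if i' = Suc k then \<one> else \<zero>) \<oplus> (if i' = k then c else \<zero>) \<oplus> dig g i' r" for i'
      unfolding fe by (simp only: dig_add[OF a_closed[OF gk] c(2)] dig_add[OF gk] d1 dig_monomial[OF c(1,3)])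
    then have "dig g (Suc k) f = \<one>" "dig g k f = c"
      using dr c by simp_all
    then have 1: "dv (Suc k) f = G [^]\<^bsub>L\<^esub> Suc k" "dv k f = e c \<otimes>\<^bsub>L\<^esub> G [^]\<^bsub>L\<^esub> k"
      using G_pow[of "Suc k"] by (simp_all add: dv_def del: L.nat_pow_Suc)
    have "z \<in> carrier L" "dv (Suc k) f \<lessapprox> z" "z \<lessapprox> dv k f" using Lf by (auto simp: Lead_def k)
    then have "dv (Suc k) f \<lessapprox> dv k f" using L.le_trans dv_closed f(1) by blast
    then have "G [^]\<^bsub>L\<^esub> k \<otimes>\<^bsub>L\<^esub> G \<lessapprox> G [^]\<^bsub>L\<^esub> k \<otimes>\<^bsub>L\<^esub> e c"
      unfolding 1 using G_pow[of k] c by (simp add: L.m_comm)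
    then show ?thesis using L.le_cancel G_pow[of k] G c by blast
  qed
  then show ?thesis using ni k by blast
qed

end

section \<open>Monic polynomials of maximal value\<close>

text \<open>
  Here \<open>S\<close> stands for \<open>A[x]\<close>. The last assumption encodes that \<open>deg f\<close> is prime to the residue
  characteristic, namely that its divisors are invertible in \<open>A\<close>.
\<close>

locale tame_quotient = valued_quotient P len mon L le e n f
  for P :: "('p, 'm) ring_scheme" (structure) and len :: "'p \<Rightarrow> nat" and mon :: "'p \<Rightarrow> bool"
    and L :: "('b, 'n) ring_scheme" and le :: "'b \<Rightarrow> 'b \<Rightarrow> bool" (infix "\<lessapprox>" 50) and e :: "'p \<Rightarrow> 'b"
    and n f +
  fixes S :: "'p set"
  assumes S: "monic_subring S" "f \<in> S"
    and monic_exists: "\<exists>x\<in>S. mon x \<and> len x = Suc d"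
    and divisor_unit: "m dvd n \<Longrightarrow> \<exists>u\<in>S. u \<otimes> \<nu> m = \<one> \<and> \<one>\<^bsub>L\<^esub> \<lessapprox> e u"
begin

lemma S_sub: "subring S P" using S unfolding monic_subring_def by blast

lemma S_closed: "x \<in> S \<Longrightarrow> x \<in> carrier P" using subringE(1)[OF S_sub] by blast

definition mon_deg :: "nat \<Rightarrow> 'p \<Rightarrow> bool" where
  "mon_deg d g \<longleftrightarrow> g \<in> carrier P \<and> mon g \<and> len g = Suc d"

definition max_mon :: "nat \<Rightarrow> 'p \<Rightarrow> bool" where
  "max_mon d g \<longleftrightarrow> g \<in> S \<and> mon_deg d g \<and> (\<forall>h. mon_deg d h \<longrightarrow> e h \<lessapprox> e g)"

lemma adic: "\<lbrakk>mon_deg d g; 0 < d; d < n\<rbrakk> \<Longrightarrow> adic_valuation P len mon L le e n f g d"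
  by (intro adic_valuation.intro adic_valuation_axioms.intro g_adic.intro g_adic_axioms.intro
      valued_quotient_axioms monic_ring_axioms division) (auto simp: mon_deg_def)

text \<open>
  Tschirnhausen steps starting from \<open>g\<close> do not decrease the value, as long as the polynomials that
  they produce are key polynomials. This is guaranteed by requiring the key property of every \<open>g'\<close>
  whose value is at least that of \<open>g\<close>. All chains of steps end in the same polynomial, the
  approximate root of \<open>f\<close>, which can also be reached within \<open>S\<close>.
\<close>

lemma approximate_root_max:
  assumes d: "0 < d" "d < n"
    and ex: "mon_deg d g0" "\<And>g'. mon_deg d g' \<Longrightarrow> e g0 \<lessapprox> e g' \<Longrightarrow> is_key g' d"
  shows "\<exists>h\<in>S. mon_deg d h \<and> (\<forall>g. mon_deg d g \<and> (\<forall>g'. mon_deg d g' \<and> e g \<lessapprox> e g' \<longrightarrow> is_key g' d) \<longrightarrow> e g \<lessapprox> e h)"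
proof -
  have refl: "e g \<lessapprox> e g" if "mon_deg d g" for g
    using that L.le_refl by (auto simp: mon_deg_def)
  have kd: "\<exists>k. n = Suc k * d \<and> (\<forall>c\<in>carrier P. \<forall>r\<in>carrier P. f = g [^] Suc k \<oplus> c \<otimes> g [^] k \<oplus> r \<and> len c \<le> d \<and> len r \<le> k * d \<longrightarrow> e g \<lessapprox> e c)"
    if "mon_deg d g" "is_key g d" for g
    using adic_valuation.key_degree[OF adic[OF that(1) d] that(2)] .
  obtain k where nk: "n = Suc k * d" using kd[OF ex(1)] ex refl by blast
  have "Suc k dvd n" unfolding nk by (rule dvd_triv_left)
  then obtain u where u: "u \<in> S" "u \<otimes> \<nu> (Suc k) = \<one>" "\<one>\<^bsub>L\<^esub> \<lessapprox> e u" using divisor_unit by blast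
  note uP = S_closed[OF u(1)]
  have lf: "len f = Suc (Suc k * d)" using f nk by simp
  obtain x where "x \<in> S" "mon x" "len x = Suc d" using monic_exists by blast
  from approximate_root_exists[OF S f(2) lf u(1,2) this] obtain h where
    h: "h \<in> S" "mon h" "len h = Suc d" "len (f \<ominus> h [^] Suc k) \<le> k * d" by blast
  have "e g \<lessapprox> e h" if "mon_deg d g" "\<And>g'. mon_deg d g' \<Longrightarrow> e g \<lessapprox> e g' \<Longrightarrow> is_key g' d" for g
    using that
  proof (induction "len (f \<ominus> g [^] Suc k)" arbitrary: g rule: less_induct)
    case less
    have g: "g \<in> carrier P" "mon g" "len g = Suc d" using less.prems(1) by (auto simp: mon_deg_def)
    show ?case
    proof (cases "len (f \<ominus> g [^] Suc k) \<le> k * d")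
      case True
      have "h = g"
        by (rule approximate_root_unique[OF f(1) uP u(2) g S_closed[OF h(1)] h(2,3) True h(4)])
      then show ?thesis using refl less.prems(1) by simp
    next
      case False
      obtain c r where c: "c \<in> carrier P" "r \<in> carrier P" "f = g [^] Suc k \<oplus> c \<otimes> g [^] k \<oplus> r" "len r \<le> k * d"
        "len c \<le> d" "mon (g \<oplus> u \<otimes> c)" "len (g \<oplus> u \<otimes> c) = Suc d"
        "len (f \<ominus> (g \<oplus> u \<otimes> c) [^] Suc k) < len (f \<ominus> g [^] Suc k)"
        using tschirnhausen_step[OF division f(1,2) lf uP u(2) g False] by metis
      let ?g = "g \<oplus> u \<otimes> c"
      have g': "mon_deg d ?g" using c g uP by (simp add: mon_deg_def)
      obtain k' where k': "n = Suc k' * d" "\<forall>c\<in>carrier P. \<forall>r\<in>carrier P. f = g [^] Suc k' \<oplus> c \<otimes> g [^] k' \<oplus> r \<and> len c \<le> d \<and> len r \<le> k' * d \<longrightarrow> e g \<lessapprox> e c"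
        using kd[OF less.prems(1)] less.prems refl by blast
      have "Suc k' = Suc k" using k'(1) nk d(1) by (metis mult_cancel2 less_not_refl2)
      then have k'k: "k' = k" by simp
      have "e g \<lessapprox> e c" using k'(2) c(1-5) unfolding k'k by blast
      then have "\<one>\<^bsub>L\<^esub> \<otimes>\<^bsub>L\<^esub> e g \<lessapprox> e u \<otimes>\<^bsub>L\<^esub> e c"
        by (intro L.le_mult2 u(3)) (use g c uP in auto)
      then have "e g \<lessapprox> e g \<oplus>\<^bsub>L\<^esub> e u \<otimes>\<^bsub>L\<^esub> e c"
        by (intro L.le_add L.le_refl) (use g c uP in auto)
      then have gg': "e g \<lessapprox> e ?g" using g c uP by simp
      have "e ?g \<lessapprox> e h"
      proof (rule less.hyps[OF c(8) g'])
        fix g' assume a: "mon_deg d g'" "e ?g \<lessapprox> e g'"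
        have "e g \<lessapprox> e g'" using L.le_trans[OF gg' a(2)] g g' a(1) by (auto simp: mon_deg_def)
        then show "is_key g' d" using less.prems a by blast
      qed
      then show ?thesis using L.le_trans[OF gg'] g g' S_closed[OF h(1)] by (auto simp: mon_deg_def)
    qed
  qed
  moreover have "mon_deg d h" using h S_closed by (auto simp: mon_deg_def)
  ultimately show ?thesis using h(1) by blast
qed

text \<open>
  The induction hypothesis of the construction.
\<close>

definition key_stage :: "nat \<Rightarrow> 'p \<Rightarrow> bool" where
  "key_stage d g \<longleftrightarrow> 0 < d \<and> d < n \<and> max_mon d g \<and> is_key g d \<and> (\<forall>i<d. \<exists>E. max_mon i E)"

lemma max_mon_0: "max_mon 0 \<one>"
proof -
  have "h = \<one>" if "mon_deg 0 h" for h
  proof -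
    have "len (h \<ominus> \<one>) < 1" using mon_minus[of h \<one>] that mon_one by (auto simp: mon_deg_def)
    then show ?thesis using that len_zero[of "h \<ominus> \<one>"] by (simp add: mon_deg_def)
  qed
  then show ?thesis using L.le_refl mon_one subringE(3)[OF S_sub] by (auto simp: max_mon_def mon_deg_def)
qed

text \<open>
  A product of two constants is a constant, so every monic polynomial of degree one is a key
  polynomial.
\<close>

lemma key_stage_1:
  assumes "1 < n"
  shows "\<exists>g. key_stage 1 g"
proof -
  have key: "is_key g 1" if "mon_deg 1 g" for g
  proof -
    interpret A: adic_valuation P len mon L le e n f g 1 using adic[OF that] assms by simp
    show ?thesis unfolding is_key_def
    proof (intro ballI impI)
      fix a b assume a: "a \<in> carrier P" "b \<in> carrier P" "len a \<le> 1 \<and> len b \<le> 1 \<and> a \<noteq> \<zero> \<and> b \<noteq> \<zero>"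
      have "len (a \<otimes> b) \<le> 1" using len_mult_le[OF a(1,2)] a(3) by linarith
      then have q: "quot g (a \<otimes> b) = \<zero>" using A.quot_small a by simp
      have "e a \<noteq> \<zero>\<^bsub>L\<^esub>" "e b \<noteq> \<zero>\<^bsub>L\<^esub>" using e_nonzero[OF a(1)] e_nonzero[OF a(2)] a(3) n by auto
      then have "e a \<otimes>\<^bsub>L\<^esub> e b \<noteq> \<zero>\<^bsub>L\<^esub>" using a by (simp add: L.integral_iff)
      then show "e a \<otimes>\<^bsub>L\<^esub> e b \<lless> e g \<otimes>\<^bsub>L\<^esub> e (quot g (a \<otimes> b))"
        unfolding q using A.G L.zero_le a by auto
    qed
  qed
  obtain x where "x \<in> S" "mon x" "len x = Suc 1" using monic_exists by blast
  then have x: "mon_deg 1 x" using S_closed by (simp add: mon_deg_def)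
  from approximate_root_max[OF _ assms x] key obtain h where
    "h \<in> S" "mon_deg 1 h" "\<And>g. mon_deg 1 g \<Longrightarrow> e g \<lessapprox> e h" by force
  then have "key_stage 1 h" using assms key max_mon_0 by (auto simp: key_stage_def max_mon_def)
  then show ?thesis by blast
qed

text \<open>
  Either the \<open>g\<close>-adic valuation \<open>w\<close> computes \<open>v\<close> in all degrees below \<open>n\<close>, and the products \<open>E\<^sub>r g\<^sup>q\<close> are
  optimal, or the least degree in which it fails to do so contains the next key polynomial.
\<close>

lemma key_stage_step:
  assumes st: "key_stage d g"
  shows "(\<forall>i<n. \<exists>E. max_mon i E) \<or> (\<exists>d'>d. \<exists>g'. key_stage d' g')"
proof -
  have d: "0 < d" "d < n" and g: "max_mon d g" "is_key g d" using st by (auto simp: key_stage_def)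
  have gm: "mon_deg d g" using g by (simp add: max_mon_def)
  interpret A: adic_valuation P len mon L le e n f g d using adic[OF gm d] .
  obtain E where E: "\<And>i. i < d \<Longrightarrow> max_mon i (E i)" using st unfolding key_stage_def by metis
  define F where "F i = E (i mod d) \<otimes> g [^] (i div d)" for i
  have Ei: "E (i mod d) \<in> S" "mon_deg (i mod d) (E (i mod d))" "len (E (i mod d)) \<le> d" for i
  proof -
    have "i mod d < d" using d by simp
    then show "E (i mod d) \<in> S" "mon_deg (i mod d) (E (i mod d))" "len (E (i mod d)) \<le> d"
      using E[of "i mod d"] by (auto simp: max_mon_def mon_deg_def)
  qed
  have F: "F i \<in> S" "mon_deg i (F i)" for i
  proof -
    have "g [^] k \<in> S" for k :: nat using g subringE(3,6)[OF S_sub] by (induction k) (auto simp: max_mon_def)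
    then show "F i \<in> S" unfolding F_def using Ei subringE(6)[OF S_sub] by blast
    have m: "mon (E (i mod d))" "mon (g [^] (i div d))" "E (i mod d) \<in> carrier P" "g [^] (i div d) \<in> carrier P"
      using Ei mon_pow[OF A.g A.mon_g] A.g by (auto simp: mon_deg_def)
    then have nz: "E (i mod d) \<noteq> \<zero>" "g [^] (i div d) \<noteq> \<zero>" using mon_nonzero by auto
    have "Suc (len (F i)) = Suc (i mod d) + Suc (i div d * d)"
      unfolding F_def using len_mult[OF m(3,4) nz] len_pow[OF A.g A.mon_g A.len_g] Ei[of i] by (simp add: mon_deg_def)
    then show "mon_deg i (F i)" using m mon_mult unfolding mon_deg_def F_def by simp
  qed
  have eF: "e (F i) = e (E (i mod d)) \<otimes>\<^bsub>L\<^esub> A.G [^]\<^bsub>L\<^esub> (i div d)" for i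
    unfolding F_def using A.e_monomial Ei by (simp add: mon_deg_def)
  have FP: "F i \<in> carrier P" "e (F i) \<in> carrier L" for i using F[of i] by (auto simp: mon_deg_def)
  have dvF: "e (F i) \<lessapprox> A.dv l (F i)" for i l
    using A.dv_monomial[of "E (i mod d)" l "i div d"] Ei[of i] eF[of i] L.le_refl L.le_zero FP[of i]
    by (auto simp: F_def[symmetric] mon_deg_def)
  \<comment> \<open>\<open>w(h) = v(h)\<close>\<close>
  define exact where "exact h \<longleftrightarrow> (\<forall>l. e h \<lessapprox> A.dv l h)" for h
  have exact_small: "exact h" if "h \<in> carrier P" "len h \<le> d" for h
  proof -
    have "A.dv l h = (if l = 0 then e h else \<zero>\<^bsub>L\<^esub>)" for l
      using A.dv_monomial[OF that, of l 0] that by simp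
    then show ?thesis using L.le_refl L.le_zero that by (simp add: exact_def)
  qed
  \<comment> \<open>the top digit of a monic polynomial is monic, so it is beaten by the corresponding \<open>E\<^sub>r\<close>\<close>
  have exact_le: "e h \<lessapprox> e (F i)" if "mon_deg i h" "exact h" for h i
  proof -
    have h: "h \<in> carrier P" "mon h" "len h = Suc (i div d * d + i mod d)" using that(1) by (auto simp: mon_deg_def)
    have im: "i mod d < d" using d by simp
    have "mon_deg (i mod d) (dig g (i div d) h)"
      using A.top_digit[OF h im] A.dig_closed[OF h(1)] by (simp add: mon_deg_def)
    then have "e (dig g (i div d) h) \<lessapprox> e (E (i mod d))" using E[OF im] by (simp add: max_mon_def)
    then have "A.dv (i div d) h \<lessapprox> e (F i)" unfolding eF A.dv_def
      by (intro L.le_mult2 L.le_refl A.G_pow) (use A.dig_closed h Ei A.G_pow in \<open>auto simp: mon_deg_def\<close>)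
    moreover have "e h \<lessapprox> A.dv (i div d) h" using that(2) by (simp add: exact_def)
    ultimately show ?thesis using L.le_trans A.dv_closed[OF h(1)] FP h(1) by (meson e.hom_closed)
  qed
  show ?thesis
  proof (cases "\<forall>i<n. \<forall>h. mon_deg i h \<longrightarrow> exact h")
    case True
    then have "max_mon i (F i)" if "i < n" for i using that F exact_le by (simp add: max_mon_def)
    then show ?thesis by blast
  next
    case False
    define d' where "d' = (LEAST i. \<exists>h. mon_deg i h \<and> \<not> exact h)"
    have ex: "\<exists>i. \<exists>h. mon_deg i h \<and> \<not> exact h" using False by blast
    obtain g1 where g1: "mon_deg d' g1" "\<not> exact g1" using LeastI_ex[OF ex] unfolding d'_def by blast
    have below: "exact h" if "mon_deg i h" "i < d'" for i h
      using not_less_Least that unfolding d'_def by blast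
    have d'n: "d' < n"
    proof -
      obtain i h where "i < n" "mon_deg i h" "\<not> exact h" using False by blast
      then show ?thesis using below by (meson leI order.strict_trans1)
    qed
    have exactd': "exact h" if h: "h \<in> carrier P" "len h \<le> d'" for h
    proof (cases "h = \<zero>")
      case True
      then show ?thesis using exact_small by simp
    next
      case False
      from scale[OF h(1) False] obtain c q where c: "c \<in> carrier P" "q \<in> carrier P" "len c = 1" "mon q" "len q = len h" "h = c \<otimes> q"
        by blast
      have "mon_deg (len h - 1) q" "len h - 1 < d'" using c h False len_zero[OF h(1)] by (auto simp: mon_deg_def)
      then have "exact q" using below by blast
      then have "e c \<otimes>\<^bsub>L\<^esub> e q \<lessapprox> e c \<otimes>\<^bsub>L\<^esub> A.dv l q" for l
        using L.le_mult A.dv_closed c unfolding exact_def by simp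
      moreover have "A.dv l h = e c \<otimes>\<^bsub>L\<^esub> A.dv l q" for l
        using c A.dig_scale[OF c(2,1)] A.dig_closed A.G_pow by (simp add: A.dv_def L.m_assoc)
      ultimately show ?thesis using c by (simp add: exact_def)
    qed
    \<comment> \<open>otherwise \<open>h\<close> is the difference of two polynomials, \<open>F d'\<close> and one of lower degree, whose terms
      all have values at least \<open>v(h)\<close>\<close>
    have inexact_gt: "e (F d') \<lless> e h" if h: "mon_deg d' h" "\<not> exact h" for h
    proof
      assume a: "e h \<lessapprox> e (F d')"
      have hP: "h \<in> carrier P" "e h \<in> carrier L" using h by (auto simp: mon_deg_def)
      have "len (F d' \<ominus> h) < len (F d')"
        by (rule mon_minus) (use F[of d'] h in \<open>auto simp: mon_deg_def\<close>)
      then have "exact (F d' \<ominus> h)" using exactd' F[of d'] hP FP by (simp add: mon_deg_def)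
      then have "e (F d' \<ominus> h) \<lessapprox> A.dv l (F d' \<ominus> h)" for l by (simp add: exact_def)
      moreover have "e h \<lessapprox> e (F d') \<ominus>\<^bsub>L\<^esub> e h" using L.le_minus[OF a L.le_refl] FP hP by simp
      then have "e h \<lessapprox> e (F d' \<ominus> h)" using FP hP by (simp add: a_minus_def)
      ultimately have 1: "e h \<lessapprox> A.dv l (F d' \<ominus> h)" for l
        using L.le_trans FP hP A.dv_closed by (meson e.hom_closed minus_closed)
      have 2: "e h \<lessapprox> A.dv l (F d')" for l using L.le_trans[OF a dvF] FP hP A.dv_closed by simp
      have "A.dv l h = A.dv l (F d') \<ominus>\<^bsub>L\<^esub> A.dv l (F d' \<ominus> h)" for l
        unfolding A.dv_minus[OF FP(1) hP(1)] using A.dv_closed[OF FP(1)] A.dv_closed[OF hP(1)]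
        by (simp add: a_minus_def L.minus_add L.a_ac L.r_neg L.r_neg1 L.r_neg2)
      then have "exact h" unfolding exact_def using L.le_minus[OF 2 1] A.dv_closed FP hP by simp
      then show False using h by blast
    qed
    \<comment> \<open>in degree \<open>d\<close> itself \<open>g\<close> is already optimal\<close>
    have dd': "d < d'"
    proof (rule ccontr)
      assume "\<not> d < d'"
      moreover have "\<not> d' < d" using exact_small[of g1] g1 by (auto simp: mon_deg_def)
      ultimately have eq: "d' = d" by simp
      have e0: "E 0 \<in> carrier P" using Ei[of 0] by (simp add: mon_deg_def)
      have "mon_deg 0 \<one>" using max_mon_0 by (simp add: max_mon_def)
      then have "e \<one> \<lessapprox> e (E 0)" using E[OF d(1)] unfolding max_mon_def by blast
      then have "\<one>\<^bsub>L\<^esub> \<lessapprox> e (E 0)" by simp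
      then have "\<one>\<^bsub>L\<^esub> \<otimes>\<^bsub>L\<^esub> A.G \<lessapprox> e (E 0) \<otimes>\<^bsub>L\<^esub> A.G"
        by (intro L.le_mult2 L.le_refl) (use A.G e0 in auto)
      then have "A.G \<lessapprox> e (F d)" using eF[of d] d A.G e0 by simp
      moreover have "e g1 \<lessapprox> A.G" using g g1 eq by (simp add: max_mon_def)
      ultimately have "e g1 \<lessapprox> e (F d')" using L.le_trans A.G FP g1 eq by (auto simp: mon_deg_def)
      then show False using inexact_gt g1 by blast
    qed
    \<comment> \<open>if \<open>a b = Q h + R\<close> with \<open>v(Q h) \<le> v(a b)\<close>, then \<open>w(Q h) < v(Q h)\<close>; the terms that realize \<open>w(Q h)\<close>
      have to cancel against \<open>R\<close>, which is impossible as \<open>v(R) = w(R)\<close>\<close>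
    have inexact_key: "is_key h d'" if h: "mon_deg d' h" "\<not> exact h" for h unfolding is_key_def
    proof (intro ballI impI)
      fix a b assume ab: "a \<in> carrier P" "b \<in> carrier P" "len a \<le> d' \<and> len b \<le> d' \<and> a \<noteq> \<zero> \<and> b \<noteq> \<zero>"
      interpret H: adic_valuation P len mon L le e n f h d' using adic[OF h(1) _ d'n] dd' by simp
      let ?Q = "quot h (a \<otimes> b)" and ?R = "dig h 0 (a \<otimes> b)"
      have abP: "a \<otimes> b \<in> carrier P" using ab by simp
      note QR = H.quot_closed[OF abP] H.dig_closed[OF abP, of 0] H.len_dig[OF abP, of 0]
      have inU: "\<exists>k. c \<in> A.U k (e c)" if c: "c \<in> carrier P" "len c \<le> d'" "c \<noteq> \<zero>" for c
      proof -
        have ec: "e c \<noteq> \<zero>\<^bsub>L\<^esub>" using e_nonzero c d'n by simp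
        have "e c \<lless> A.dv l c" if "len c \<le> l" for l
        proof -
          have "len c * 1 \<le> l * d" using that d by (intro mult_le_mono) auto
          then have "A.dv l c = \<zero>\<^bsub>L\<^esub>" using A.dv_beyond[OF c(1)] by simp
          then show ?thesis using L.zero_le ec c(1) by auto
        qed
        then have "c \<in> A.U (len c) (e c)" using exactd'[OF c(1,2)] c(1) by (simp add: A.U_def exact_def)
        then show ?thesis by blast
      qed
      have nz: "e a \<noteq> \<zero>\<^bsub>L\<^esub>" "e b \<noteq> \<zero>\<^bsub>L\<^esub>" using e_nonzero[OF ab(1)] e_nonzero[OF ab(2)] ab(3) d'n by auto
      obtain ka kb where "a \<in> A.U ka (e a)" "b \<in> A.U kb (e b)" using inU ab by meson
      from A.U_mult[OF g(2) this(1) _ nz(1) this(2) _ nz(2)] ab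
      have "a \<otimes> b \<in> A.U (ka + kb) (e a \<otimes>\<^bsub>L\<^esub> e b)" by simp
      then have dvab: "e a \<otimes>\<^bsub>L\<^esub> e b \<lessapprox> A.dv l (a \<otimes> b)" for l by (simp add: A.U_def)
      have cl: "e a \<otimes>\<^bsub>L\<^esub> e b \<in> carrier L" "e ?Q \<in> carrier L" "e h \<in> carrier L" "e ?R \<in> carrier L"
        using ab QR H.G by auto
      show "e a \<otimes>\<^bsub>L\<^esub> e b \<lless> e h \<otimes>\<^bsub>L\<^esub> e ?Q"
      proof
        assume ge: "e h \<otimes>\<^bsub>L\<^esub> e ?Q \<lessapprox> e a \<otimes>\<^bsub>L\<^esub> e b"
        have "?Q \<noteq> \<zero>"
        proof
          assume "?Q = \<zero>"
          then have "e a \<otimes>\<^bsub>L\<^esub> e b = \<zero>\<^bsub>L\<^esub>" using ge L.zero_le cl by simp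
          then show False using nz ab by (simp add: L.integral_iff)
        qed
        from A.Lead_exists[OF QR(1) this] obtain i z1 where L1: "A.Lead ?Q i z1" by blast
        from A.Lead_exists[OF H.g H.g_nonzero] obtain j z2 where L2: "A.Lead h j z2" by blast
        let ?z = "z1 \<otimes>\<^bsub>L\<^esub> z2" and ?t = "i + j"
        have L3: "A.Lead (?Q \<otimes> h) ?t ?z" using A.Lead_mult[OF g(2) L1 L2] .
        have z: "z1 \<in> carrier L" "z1 \<noteq> \<zero>\<^bsub>L\<^esub>" "z2 \<in> carrier L" "?z \<in> carrier L" "A.dv ?t (?Q \<otimes> h) \<lessapprox> ?z"
          using L1 L2 L3 by (auto simp: A.Lead_def)
        have "z2 \<lless> e h"
        proof -
          obtain l where "A.dv l h \<lless> e h" using h(2) by (auto simp: exact_def)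
          moreover have "z2 \<lessapprox> A.dv l h" using L2 by (simp add: A.Lead_def)
          ultimately show ?thesis using L.le_lt_trans z A.dv_closed[OF H.g] H.G by blast
        qed
        then have zlt: "?z \<lless> e ?Q \<otimes>\<^bsub>L\<^esub> e h" using L.lt_mult2[OF A.Lead_le[OF L1]] z cl by blast
        have hq: "e h \<otimes>\<^bsub>L\<^esub> e ?Q = e ?Q \<otimes>\<^bsub>L\<^esub> e h" using cl by (simp add: L.m_comm)
        have cl': "A.dv ?t (a \<otimes> b) \<in> carrier L" "A.dv ?t (?Q \<otimes> h) \<in> carrier L" "A.dv ?t ?R \<in> carrier L"
          "e ?Q \<otimes>\<^bsub>L\<^esub> e h \<in> carrier L"
          using A.dv_closed abP QR H.g cl by auto
        have "e ?Q \<otimes>\<^bsub>L\<^esub> e h \<lessapprox> A.dv ?t (a \<otimes> b)"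
          using L.le_trans[OF ge[unfolded hq] dvab] cl cl' by blast
        then have lt1: "?z \<lless> A.dv ?t (a \<otimes> b)" using L.lt_le_trans[OF zlt] z cl' by blast
        have abeq: "a \<otimes> b = ?Q \<otimes> h \<oplus> ?R" using H.quot_dig[OF abP] QR H.g by (simp add: m_comm)
        have dveq: "A.dv ?t (a \<otimes> b) = A.dv ?t (?Q \<otimes> h) \<oplus>\<^bsub>L\<^esub> A.dv ?t ?R"
          using arg_cong[OF abeq, of "A.dv ?t"] A.dv_add QR H.g by simp
        have "A.dv ?t ?R \<lessapprox> ?z"
        proof (rule ccontr)
          assume "?z \<lless> A.dv ?t ?R"
          then have "?z \<lless> \<ominus>\<^bsub>L\<^esub> A.dv ?t ?R" using L.lt_uminus cl' z by blast
          then have "?z \<lless> A.dv ?t (a \<otimes> b) \<oplus>\<^bsub>L\<^esub> \<ominus>\<^bsub>L\<^esub> A.dv ?t ?R" using L.lt_add lt1 cl' z by simp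
          moreover have "A.dv ?t (a \<otimes> b) \<oplus>\<^bsub>L\<^esub> \<ominus>\<^bsub>L\<^esub> A.dv ?t ?R = A.dv ?t (?Q \<otimes> h)"
            unfolding dveq using cl' by (simp add: L.a_assoc L.r_neg)
          ultimately show False using z by simp
        qed
        moreover have "e ?R \<lessapprox> A.dv ?t ?R" using exactd'[OF QR(2,3)] by (simp add: exact_def)
        ultimately have "e ?R \<lessapprox> ?z" using L.le_trans z cl cl' by blast
        then have lt2: "e ?R \<lless> e ?Q \<otimes>\<^bsub>L\<^esub> e h" using L.le_lt_trans zlt z cl cl' by blast
        have "e a \<otimes>\<^bsub>L\<^esub> e b = e ?Q \<otimes>\<^bsub>L\<^esub> e h \<oplus>\<^bsub>L\<^esub> e ?R"
          using arg_cong[OF abeq, of e] ab QR H.g by simp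
        then have "e ?R = e a \<otimes>\<^bsub>L\<^esub> e b \<ominus>\<^bsub>L\<^esub> e ?Q \<otimes>\<^bsub>L\<^esub> e h"
          using cl cl' by (simp add: a_minus_def L.a_ac L.r_neg L.r_neg1 L.r_neg2)
        then show False using lt2 L.le_minus[OF ge[unfolded hq] L.le_refl] cl cl' by simp
      qed
    qed
    have allkey: "is_key g' d'" if "mon_deg d' h" "\<not> exact h" "mon_deg d' g'" "e h \<lessapprox> e g'" for h g'
    proof (rule inexact_key[OF that(3)])
      show "\<not> exact g'"
      proof
        assume "exact g'"
        from exact_le[OF that(3) this] have "e h \<lessapprox> e (F d')"
          using L.le_trans[OF that(4)] that FP by (auto simp: mon_deg_def)
        then show False using inexact_gt that by blast
      qed
    qed
    have d'0: "0 < d'" using dd' by simp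
    \<comment> \<open>this polynomial is inexact as well, being at least as good as \<open>g1\<close>\<close>
    from approximate_root_max[OF d'0 d'n g1(1) allkey[OF g1]] obtain h where
      h: "h \<in> S" "mon_deg d' h" "\<And>g. mon_deg d' g \<Longrightarrow> (\<And>g'. mon_deg d' g' \<Longrightarrow> e g \<lessapprox> e g' \<Longrightarrow> is_key g' d') \<Longrightarrow> e g \<lessapprox> e h"
      by blast
    have cl: "e x \<in> carrier L" if "mon_deg i x" for i x using that by (auto simp: mon_deg_def)
    have dom: "e x \<lessapprox> e h" if "mon_deg d' x" "\<not> exact x" for x using h(3)[OF that(1) allkey[OF that]] by blast
    have Fh: "e (F d') \<lless> e h"
      using L.lt_le_trans[OF inexact_gt[OF g1] dom[OF g1]] FP cl g1 h by blast
    then have "\<not> exact h" using exact_le[OF h(2)] by blast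
    then have "is_key h d'" using inexact_key h(2) by blast
    moreover have "max_mon d' h" unfolding max_mon_def
    proof (intro conjI allI impI h(1,2))
      fix x assume x: "mon_deg d' x"
      show "e x \<lessapprox> e h"
      proof (cases "exact x")
        case True
        then show ?thesis using L.le_trans[OF exact_le[OF x True] L.lt_imp_le[OF Fh]] FP cl x h by blast
      qed (use dom x in blast)
    qed
    moreover have "max_mon i (F i)" if "i < d'" for i
      using F exact_le below that by (simp add: max_mon_def)
    ultimately have "key_stage d' h" using d'0 d'n by (auto simp: key_stage_def)
    then show ?thesis using dd' by blast
  qed
qed

theorem max_mon_exists: "i < n \<Longrightarrow> \<exists>E. max_mon i E"
proof (cases "1 < n")
  case False
  assume "i < n"
  then show ?thesis using False max_mon_0 by (cases i) auto
next
  case True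
  have "\<forall>i<n. \<exists>E. max_mon i E" if "key_stage d g" for d g
    using that
  proof (induction "n - d" arbitrary: d g rule: less_induct)
    case less
    from key_stage_step[OF less.prems] show ?case
    proof
      assume "\<exists>d'>d. \<exists>g'. key_stage d' g'"
      then obtain d' g' where s: "d' > d" "key_stage d' g'" by blast
      then have "n - d' < n - d" using less.prems by (auto simp: key_stage_def)
      then show ?thesis using less.hyps s by blast
    qed
  qed
  moreover assume "i < n"
  ultimately show ?thesis using key_stage_1[OF True] by blast
qed

text \<open>
  The term with the highest index is bounded by maximality of \<open>E\<^sub>k\<close>, applied to the sum divided by
  \<open>a\<^sub>k\<close>. It can then be subtracted.
\<close>

lemma max_mon_independent:
  assumes "\<And>i. i < k \<Longrightarrow> max_mon i (E i)" "\<And>i. i < k \<Longrightarrow> a i \<in> carrier P" "\<And>i. i < k \<Longrightarrow> len (a i) \<le> 1"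
    and "z \<in> carrier L" "z \<lessapprox> e (\<Oplus>i\<in>{..<k}. a i \<otimes> E i)" "i < k"
  shows "z \<lessapprox> e (a i \<otimes> E i)"
  using assms
proof (induction k)
  case (Suc k)
  have E: "E i \<in> carrier P" "mon_deg i (E i)" if "i < Suc k" for i
    using Suc.prems(1)[OF that] by (auto simp: max_mon_def mon_deg_def)
  let ?s = "\<Oplus>i\<in>{..<k}. a i \<otimes> E i" and ?c = "a k"
  have cl: "(\<lambda>i. a i \<otimes> E i) \<in> {..<k} \<rightarrow> carrier P" using Suc.prems(2) E by auto
  have sP: "?s \<in> carrier P" by (rule finsum_closed[OF cl])
  have c: "?c \<in> carrier P" "len ?c \<le> 1" "E k \<in> carrier P" using Suc.prems(2,3) E by auto
  have split: "(\<Oplus>i\<in>{..<Suc k}. a i \<otimes> E i) = ?c \<otimes> E k \<oplus> ?s"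
    unfolding lessThan_Suc by (rule finsum_insert) (use cl c in auto)
  have "len ?s \<le> k"
  proof (rule len_finsum[OF _ cl])
    fix i assume i: "i \<in> {..<k}"
    have "len (a i \<otimes> E i) \<le> len (a i) + len (E i) - 1" by (rule len_mult_le) (use Suc.prems(2) E i in auto)
    then show "len (a i \<otimes> E i) \<le> k" using Suc.prems(3)[of i] E[of i] i by (simp add: mon_deg_def)
  qed simp
  have top: "z \<lessapprox> e (?c \<otimes> E k)"
  proof (cases "?c = \<zero>")
    case True
    then show ?thesis using c Suc.prems(4) L.le_zero by simp
  next
    case False
    then have lc: "len ?c = 1" using c len_zero[OF c(1)] by linarith
    from const_inv[OF c(1) this] obtain c' where c': "c' \<in> carrier P" "len c' = 1" "?c \<otimes> c' = \<one>" by blast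
    let ?h = "E k \<oplus> c' \<otimes> ?s"
    have l: "len (c' \<otimes> ?s) < len (E k)"
      using len_mult_const[OF c'(1,2) sP] \<open>len ?s \<le> k\<close> E[of k] by (simp add: mon_deg_def)
    have "mon_deg k ?h"
      using mon_add[OF c(3) _ _ l] len_add_less[OF c(3) _ l] E[of k] c' sP by (simp add: mon_deg_def)
    then have "e ?h \<lessapprox> e (E k)" using Suc.prems(1)[of k] by (simp add: max_mon_def)
    then have "e ?c \<otimes>\<^bsub>L\<^esub> e ?h \<lessapprox> e ?c \<otimes>\<^bsub>L\<^esub> e (E k)"
      by (rule L.le_mult) (use c c' sP in auto)
    moreover have "e ?c \<otimes>\<^bsub>L\<^esub> e ?h = e (?c \<otimes> E k \<oplus> ?s)"
    proof -
      have "?c \<otimes> ?h = ?c \<otimes> E k \<oplus> (?c \<otimes> c') \<otimes> ?s" using c c'(1) sP by (simp add: r_distr m_assoc)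
      then have "?c \<otimes> ?h = ?c \<otimes> E k \<oplus> ?s" using c'(3) sP by simp
      then show ?thesis using c c'(1) sP by (metis a_closed e.hom_mult m_closed)
    qed
    ultimately show ?thesis using L.le_trans[of z "e (?c \<otimes> E k \<oplus> ?s)"] Suc.prems(4,5) c sP split by simp
  qed
  show ?case
  proof (cases "i = k")
    case False
    have ik: "i < k" using False Suc.prems(6) by simp
    have "z \<lessapprox> e (?c \<otimes> E k \<oplus> ?s) \<ominus>\<^bsub>L\<^esub> e (?c \<otimes> E k)"
      using L.le_minus[OF _ top] Suc.prems(4,5) split c sP by simp
    moreover have "e (?c \<otimes> E k \<oplus> ?s) \<ominus>\<^bsub>L\<^esub> e (?c \<otimes> E k) = e ?s"
      using c sP by (simp add: a_minus_def L.a_ac L.r_neg1 L.r_neg2 L.r_neg)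
    ultimately have "z \<lessapprox> e ?s" by simp
    from Suc.IH[OF _ _ _ Suc.prems(4) this ik] Suc.prems(1-3) show ?thesis by simp
  qed (use top in simp)
qed simp

lemma max_mon_span:
  assumes "\<And>i. i < k \<Longrightarrow> max_mon i (E i)" "p \<in> S" "len p \<le> k"
  shows "\<exists>a. (\<forall>i<k. a i \<in> S \<and> len (a i) \<le> 1) \<and> p = (\<Oplus>i\<in>{..<k}. a i \<otimes> E i)"
  using assms
proof (induction k arbitrary: p)
  case 0
  then have "p = \<zero>" using len_zero S_closed by auto
  then show ?case by simp
next
  case (Suc k)
  have E: "E i \<in> carrier P" "mon_deg i (E i)" "E i \<in> S" if "i < Suc k" for i
    using Suc.prems(1)[OF that] by (auto simp: max_mon_def mon_deg_def)
  have "mon (E k)" using E[of k] by (simp add: mon_deg_def)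
  then obtain q r where qr: "q \<in> S" "r \<in> S" "p = E k \<otimes> q \<oplus> r" "len r < len (E k)"
    using S(1) E(3)[of k] Suc.prems(2) unfolding monic_subring_def by blast
  have qrP: "q \<in> carrier P" "r \<in> carrier P" "E k \<in> carrier P" using qr S_closed E by auto
  have lr: "len r \<le> k" using qr(4) E[of k] by (simp add: mon_deg_def)
  have lq: "len q \<le> 1"
  proof (cases "q = \<zero>")
    case False
    have "E k \<noteq> \<zero>" using E[of k] mon_nonzero by (auto simp: mon_deg_def)
    then have lEq: "len (E k \<otimes> q) = k + len q"
      using len_mult[OF qrP(3,1) _ False] E[of k] by (simp add: mon_deg_def)
    then have "len p = k + len q"
      unfolding qr(3) using len_add_less[of "E k \<otimes> q" r] lr qrP False len_zero[of q] by simp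
    then show ?thesis using Suc.prems(3) by simp
  qed simp
  obtain a where a: "\<And>i. i < k \<Longrightarrow> a i \<in> S \<and> len (a i) \<le> 1" "r = (\<Oplus>i\<in>{..<k}. a i \<otimes> E i)"
    using Suc.IH[OF _ qr(2) lr] Suc.prems(1) by force
  let ?a = "a(k := q)"
  have "(\<Oplus>i\<in>{..<Suc k}. ?a i \<otimes> E i) = ?a k \<otimes> E k \<oplus> (\<Oplus>i\<in>{..<k}. ?a i \<otimes> E i)"
    unfolding lessThan_Suc by (rule finsum_insert) (use a E qrP S_closed in auto)
  also have "(\<Oplus>i\<in>{..<k}. ?a i \<otimes> E i) = r" unfolding a(2)
    by (rule finsum_cong') (use a E S_closed in auto)
  also have "?a k \<otimes> E k \<oplus> r = p" unfolding qr(3) using qrP by (simp add: m_comm)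
  finally show ?case using a(1) qr(1) lq by (intro exI[of _ ?a]) (auto simp: less_Suc_eq)
qed

end

section \<open>Chevalley's theorem on valuation rings\<close>

context cring
begin

text \<open>
  Polynomial expressions with the constant coefficient first. Lists of coefficients of
  prescribed length, which may end in zeros, are more convenient here than normalized
  polynomials.
\<close>

primrec horner :: "'a \<Rightarrow> 'a list \<Rightarrow> 'a" where
  "horner x [] = \<zero>"
| "horner x (a # as) = a \<oplus> x \<otimes> horner x as"

lemma horner_closed: "\<lbrakk>x \<in> carrier R; set as \<subseteq> carrier R\<rbrakk> \<Longrightarrow> horner x as \<in> carrier R"
  by (induction as) auto

lemma horner_add:
  assumes "x \<in> carrier R" "C \<subseteq> carrier R" "\<And>a b. a \<in> C \<Longrightarrow> b \<in> C \<Longrightarrow> a \<oplus> b \<in> C"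
  shows "\<lbrakk>set as \<subseteq> C; set bs \<subseteq> C\<rbrakk> \<Longrightarrow>
    \<exists>cs. set cs \<subseteq> C \<and> length cs = max (length as) (length bs) \<and> horner x cs = horner x as \<oplus> horner x bs"
proof (induction as arbitrary: bs)
  case Nil
  then show ?case using horner_closed[of x bs] assms by (intro exI[of _ bs]) auto
next
  case (Cons a as)
  show ?case
  proof (cases bs)
    case Nil
    moreover have "horner x (a # as) \<in> carrier R"
      using horner_closed[OF assms(1), of "a # as"] assms(2) Cons.prems(1) by (meson subset_trans)
    ultimately show ?thesis using Cons.prems by (intro exI[of _ "a # as"]) auto
  next
    case (Cons b bs')
    then obtain cs where cs: "set cs \<subseteq> C" "length cs = max (length as) (length bs')"
      "horner x cs = horner x as \<oplus> horner x bs'" using Cons.IH[of bs'] Cons.prems by auto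
    have c: "a \<in> C" "b \<in> C" "horner x as \<in> carrier R" "horner x bs' \<in> carrier R" "a \<in> carrier R" "b \<in> carrier R"
      using horner_closed assms(1,2) Cons.prems Cons by auto
    then show ?thesis using cs assms(1,3) Cons
      by (intro exI[of _ "(a \<oplus> b) # cs"]) (auto simp: r_distr a_ac)
  qed
qed

lemma horner_scale:
  "\<lbrakk>x \<in> carrier R; r \<in> carrier R; set as \<subseteq> carrier R\<rbrakk> \<Longrightarrow> horner x (map (\<lambda>a. r \<otimes> a) as) = r \<otimes> horner x as"
  by (induction as) (auto simp: horner_closed r_distr m_ac)

lemma horner_mult:
  assumes "x \<in> carrier R" "D \<subseteq> carrier R" "C \<subseteq> carrier R" "\<zero> \<in> C" "\<And>a b. a \<in> C \<Longrightarrow> b \<in> C \<Longrightarrow> a \<oplus> b \<in> C"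
    "\<And>r a. r \<in> D \<Longrightarrow> a \<in> C \<Longrightarrow> r \<otimes> a \<in> C"
  shows "\<lbrakk>set as \<subseteq> D; set bs \<subseteq> C\<rbrakk> \<Longrightarrow> \<exists>cs. set cs \<subseteq> C \<and> horner x cs = horner x as \<otimes> horner x bs"
proof (induction as)
  case Nil
  then show ?case using horner_closed[of x bs] assms by (intro exI[of _ "[]"]) auto
next
  case (Cons a as)
  then obtain cs where cs: "set cs \<subseteq> C" "horner x cs = horner x as \<otimes> horner x bs" by auto
  have a: "a \<in> D" "a \<in> carrier R" "horner x as \<in> carrier R" "horner x bs \<in> carrier R"
    using horner_closed assms(1-3) Cons.prems by auto
  have s: "set (map (\<lambda>b. a \<otimes> b) bs) \<subseteq> C" "set (\<zero> # cs) \<subseteq> C" using assms Cons.prems cs a by auto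
  from horner_add[OF assms(1,3,5) s] obtain ds where ds: "set ds \<subseteq> C"
    "horner x ds = horner x (map (\<lambda>b. a \<otimes> b) bs) \<oplus> horner x (\<zero> # cs)" by blast
  moreover have "horner x (map (\<lambda>b. a \<otimes> b) bs) = a \<otimes> horner x bs" 
    by (rule horner_scale) (use assms Cons.prems a in auto)
  ultimately have "horner x ds = horner x (a # as) \<otimes> horner x bs"
    using a assms(1) by (simp add: cs l_distr r_distr m_ac)
  then show ?case using ds by blast
qed

lemma horner_replicate: "x \<in> carrier R \<Longrightarrow> set as \<subseteq> carrier R \<Longrightarrow> horner x (replicate k \<zero> @ as) = x [^] k \<otimes> horner x as"
  by (induction k) (auto simp: horner_closed m_ac)

lemma horner_append: "x \<in> carrier R \<Longrightarrow> set as \<subseteq> carrier R \<Longrightarrow> set bs \<subseteq> carrier R \<Longrightarrow>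
   horner x (as @ bs) = horner x as \<oplus> x [^] length as \<otimes> horner x bs"
  by (induction as) (auto simp: horner_closed r_distr m_ac a_ac)

lemma horner_inverse:
  assumes "x \<in> carrier R" "y \<in> carrier R" "x \<otimes> y = \<one>" "C \<subseteq> carrier R" "\<zero> \<in> C" "\<And>a b. a \<in> C \<Longrightarrow> b \<in> C \<Longrightarrow> a \<oplus> b \<in> C"
  shows "\<lbrakk>set cs \<subseteq> C; length cs \<le> Suc k\<rbrakk> \<Longrightarrow> \<exists>ds. set ds \<subseteq> C \<and> length ds \<le> Suc k \<and> x [^] k \<otimes> horner y cs = horner x ds"
proof (induction cs arbitrary: k)
  case Nil
  then show ?case using assms by (intro exI[of _ "[]"]) auto
next
  case (Cons c cs)
  have cC: "c \<in> C" "c \<in> carrier R" "horner y cs \<in> carrier R" "set cs \<subseteq> carrier R" using Cons.prems horner_closed assms by auto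
  let ?c = "replicate k \<zero> @ [c]"
  have c: "set ?c \<subseteq> C" "horner x ?c = x [^] k \<otimes> c" "length ?c = Suc k"
    using assms cC horner_replicate[of x "[c]" k] by auto
  show ?case
  proof (cases k)
    case 0
    then have "cs = []" using Cons.prems by simp
    then show ?thesis using cC assms 0 by (intro exI[of _ "[c]"]) auto
  next
    case (Suc k')
    then obtain ds where ds: "set ds \<subseteq> C" "length ds \<le> Suc k'" "x [^] k' \<otimes> horner y cs = horner x ds"
      using Cons.IH[of k'] Cons.prems by auto
    from horner_add[OF assms(1,4,6) c(1) ds(1)] obtain es where es: "set es \<subseteq> C"
      "length es = max (length ?c) (length ds)" "horner x es = horner x ?c \<oplus> horner x ds" by blast
    have "x [^] k \<otimes> horner y (c # cs) = x [^] k \<otimes> c \<oplus> x [^] k' \<otimes> (x \<otimes> y) \<otimes> horner y cs"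
      using assms(1,2) cC Suc by (simp add: r_distr m_ac)
    also have "\<dots> = horner x es" using es(3) c(2) ds(3) assms(1,2,3) cC by simp
    finally show ?thesis using es(1,2) c(3) ds(2) Suc by (intro exI[of _ es]) auto
  qed
qed

lemma horner_sum:
  assumes "x \<in> carrier R" 
  shows "set as \<subseteq> carrier R \<Longrightarrow> horner x as = (\<Oplus>i\<in>{..<length as}. as ! i \<otimes> x [^] i)"
proof (induction as rule: rev_induct)
  case (snoc a as)
  have nth: "as ! i \<in> carrier R" if "i < length as" for i
    using nth_mem[OF that] snoc.prems by auto
  have "horner x (as @ [a]) = horner x as \<oplus> x [^] length as \<otimes> a"
    using horner_append[of x as "[a]"] assms snoc.prems by simp
  also have "horner x as = (\<Oplus>i\<in>{..<length as}. as ! i \<otimes> x [^] i)" using snoc by simp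
  also have "\<dots> = (\<Oplus>i\<in>{..<length as}. (as @ [a]) ! i \<otimes> x [^] i)"
    by (rule finsum_cong') (use assms nth in \<open>auto simp: nth_append\<close>)
  also have "\<dots> \<oplus> x [^] length as \<otimes> a = (\<Oplus>i\<in>insert (length as) {..<length as}. (as @ [a]) ! i \<otimes> x [^] i)"
  proof (subst finsum_insert)
    show "(\<lambda>i. (as @ [a]) ! i \<otimes> x [^] i) \<in> {..<length as} \<rightarrow> carrier R"
      using assms nth by (auto simp: nth_append)
    then have "(\<Oplus>i\<in>{..<length as}. (as @ [a]) ! i \<otimes> x [^] i) \<in> carrier R" by (rule finsum_closed)
    then show "(\<Oplus>i\<in>{..<length as}. (as @ [a]) ! i \<otimes> x [^] i) \<oplus> x [^] length as \<otimes> a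
      = (as @ [a]) ! length as \<otimes> x [^] length as \<oplus> (\<Oplus>i\<in>{..<length as}. (as @ [a]) ! i \<otimes> x [^] i)"
      using assms snoc.prems by (simp add: m_comm a_comm)
  qed (use assms snoc.prems in auto)
  finally show ?case by (simp add: lessThan_Suc)
qed simp

lemma horner_subring:
  assumes sub: "subring S R" and x: "x \<in> carrier R"
  shows "subring {horner x as | as. set as \<subseteq> S} R" (is "subring ?H R")
proof -
  have SR: "S \<subseteq> carrier R" using subringE(1)[OF sub] .
  note Sc = subringE(2,3,5,6,7)[OF sub]
  have HI: "horner x as \<in> ?H" if "set as \<subseteq> S" for as using that by blast
  have one: "c \<in> ?H" if "c \<in> S" for c
  proof -
    have "c \<in> carrier R" using that SR by blast
    then have "horner x [c] = c" using x by simp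
    then show ?thesis using HI[of "[c]"] that by simp
  qed
  have add: "p \<oplus> q \<in> ?H" if "p \<in> ?H" "q \<in> ?H" for p q
  proof -
    from that obtain as bs where ab: "set as \<subseteq> S" "set bs \<subseteq> S" "p = horner x as" "q = horner x bs" by blast
    obtain cs where "set cs \<subseteq> S" "horner x cs = p \<oplus> q"
      using horner_add[OF x SR Sc(5) ab(1,2)] unfolding ab(3,4) by blast
    then show ?thesis using HI[of cs] by simp
  qed
  have mult: "p \<otimes> q \<in> ?H" if "p \<in> ?H" "q \<in> ?H" for p q
  proof -
    from that obtain as bs where ab: "set as \<subseteq> S" "set bs \<subseteq> S" "p = horner x as" "q = horner x bs" by blast
    obtain cs where "set cs \<subseteq> S" "horner x cs = p \<otimes> q"
      using horner_mult[OF x SR SR Sc(1,5,4) ab(1,2)] unfolding ab(3,4) by blast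
    then show ?thesis using HI[of cs] by simp
  qed
  have HR: "?H \<subseteq> carrier R" using horner_closed x SR by auto
  show ?thesis
  proof (rule ring.subringI[OF ring_axioms HR])
    show "\<one> \<in> ?H" using one Sc by blast
    fix h1 assume h1: "h1 \<in> ?H"
    have "\<ominus> \<one> \<otimes> h1 \<in> ?H" using mult one Sc h1 by blast
    moreover have "\<ominus> \<one> \<otimes> h1 = \<ominus> h1" using h1 HR by (auto simp: l_minus)
    ultimately show "\<ominus> h1 \<in> ?H" by simp
    fix h2 assume "h2 \<in> ?H"
    then show "h1 \<otimes> h2 \<in> ?H" "h1 \<oplus> h2 \<in> ?H" using h1 mult add by blast+
  qed
qed

end

text \<open>
  The objects to which Zorn's lemma is applied in Chevalley's theorem: a subring and a proper
  ideal of it.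
\<close>

definition ring_ideal_pair :: "('a, 'm) ring_scheme \<Rightarrow> 'a set \<Rightarrow> 'a set \<Rightarrow> bool" where
  "ring_ideal_pair F R I \<longleftrightarrow> subring R F \<and> I \<subseteq> R \<and> \<zero>\<^bsub>F\<^esub> \<in> I \<and> \<one>\<^bsub>F\<^esub> \<notin> I \<and>
     (\<forall>a\<in>I. \<forall>b\<in>I. a \<oplus>\<^bsub>F\<^esub> b \<in> I) \<and> (\<forall>r\<in>R. \<forall>a\<in>I. r \<otimes>\<^bsub>F\<^esub> a \<in> I)"

text \<open>
  A pair is represented by the disjoint union of its two components, so that pairs are ordered
  by inclusion of sets.
\<close>

lemma (in field) maximal_pair_exists:
  assumes "ring_ideal_pair R R0 I0"
  shows "\<exists>S I. ring_ideal_pair R S I \<and> R0 \<subseteq> S \<and> I0 \<subseteq> I \<and>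
    (\<forall>S' I'. ring_ideal_pair R S' I' \<and> S \<subseteq> S' \<and> I \<subseteq> I' \<longrightarrow> S' = S)"
proof -
  define ri where "ri Z = {x. (x, False) \<in> Z}" for Z :: "('a \<times> bool) set"
  define id where "id Z = {x. (x, True) \<in> Z}" for Z :: "('a \<times> bool) set"
  define \<A> where "\<A> = {Z. ring_ideal_pair R (ri Z) (id Z) \<and> R0 \<subseteq> ri Z \<and> I0 \<subseteq> id Z}"
  define pr where "pr S I = S \<times> {False} \<union> I \<times> {True}" for S I :: "'a set"
  have pr: "ri (pr S I) = S" "id (pr S I) = I" for S I by (auto simp: ri_def id_def pr_def)
  have "\<exists>M\<in>\<A>. \<forall>Z\<in>\<A>. M \<subseteq> Z \<longrightarrow> Z = M"
  proof (rule subset_Zorn_nonempty)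
    have "pr R0 I0 \<in> \<A>" using assms by (simp add: \<A>_def pr)
    then show "\<A> \<noteq> {}" by blast
  next
    fix C assume C: "C \<noteq> {}" "subset.chain \<A> C"
    then obtain Z0 where Z0: "Z0 \<in> C" by blast
    have CA: "Z \<in> \<A>" if "Z \<in> C" for Z using C that by (auto simp: subset.chain_def)
    have pair: "\<exists>Z\<in>C. p \<in> Z \<and> q \<in> Z" if "p \<in> \<Union>C" "q \<in> \<Union>C" for p q
    proof -
      from that obtain Z1 Z2 where Z: "Z1 \<in> C" "p \<in> Z1" "Z2 \<in> C" "q \<in> Z2" by blast
      then have "Z1 \<subseteq> Z2 \<or> Z2 \<subseteq> Z1" using C(2) unfolding subset_chain_def by blast
      then show ?thesis using Z by blast
    qed
    have good: "ring_ideal_pair R (ri Z) (id Z)" "R0 \<subseteq> ri Z" "I0 \<subseteq> id Z" if "Z \<in> C" for Z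
      using CA[OF that] by (auto simp: \<A>_def)
    note sub = good(1)[unfolded ring_ideal_pair_def]
    have "subring (ri (\<Union>C)) R"
    proof (rule ring.subringI[OF ring_axioms])
      show "ri (\<Union>C) \<subseteq> carrier R" using sub subringE(1) by (fastforce simp: ri_def)
      show "\<one> \<in> ri (\<Union>C)" using sub[OF Z0] subringE(3) Z0 by (fastforce simp: ri_def)
      fix h1 assume h1: "h1 \<in> ri (\<Union>C)"
      then obtain Z where "Z \<in> C" "h1 \<in> ri Z" by (auto simp: ri_def)
      then show "\<ominus> h1 \<in> ri (\<Union>C)" using sub subringE(5) by (fastforce simp: ri_def)
      fix h2 assume "h2 \<in> ri (\<Union>C)"
      then obtain Z where Z: "Z \<in> C" "h1 \<in> ri Z" "h2 \<in> ri Z"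
        using pair[of "(h1, False)" "(h2, False)"] h1 by (auto simp: ri_def)
      then have "h1 \<otimes> h2 \<in> ri Z" "h1 \<oplus> h2 \<in> ri Z" using sub[OF Z(1)] subringE(6,7) by metis+
      then show "h1 \<otimes> h2 \<in> ri (\<Union>C)" "h1 \<oplus> h2 \<in> ri (\<Union>C)" using Z(1) by (auto simp: ri_def)
    qed
    moreover have "id (\<Union>C) \<subseteq> ri (\<Union>C)" using sub by (fastforce simp: ri_def id_def)
    moreover have "\<zero> \<in> id (\<Union>C)" using sub[OF Z0] Z0 by (auto simp: id_def)
    moreover have "\<one> \<notin> id (\<Union>C)" using sub by (auto simp: id_def)
    moreover have "a \<oplus> b \<in> id (\<Union>C)" if "a \<in> id (\<Union>C)" "b \<in> id (\<Union>C)" for a b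
    proof -
      from that obtain Z where Z: "Z \<in> C" "a \<in> id Z" "b \<in> id Z"
        using pair[of "(a, True)" "(b, True)"] by (auto simp: id_def)
      then have "a \<oplus> b \<in> id Z" using sub[OF Z(1)] by blast
      then show ?thesis using Z(1) by (auto simp: id_def)
    qed
    moreover have "r \<otimes> a \<in> id (\<Union>C)" if "r \<in> ri (\<Union>C)" "a \<in> id (\<Union>C)" for r a
    proof -
      from that obtain Z where Z: "Z \<in> C" "r \<in> ri Z" "a \<in> id Z"
        using pair[of "(r, False)" "(a, True)"] by (auto simp: id_def ri_def)
      then have "r \<otimes> a \<in> id Z" using sub[OF Z(1)] by blast
      then show ?thesis using Z(1) by (auto simp: id_def)
    qed
    moreover have "R0 \<subseteq> ri (\<Union>C)" "I0 \<subseteq> id (\<Union>C)" using good(2,3)[OF Z0] Z0 by (auto simp: ri_def id_def)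
    ultimately show "\<Union>C \<in> \<A>" by (auto simp: \<A>_def ring_ideal_pair_def)
  qed
  then obtain M where M: "M \<in> \<A>" "\<And>Z. Z \<in> \<A> \<Longrightarrow> M \<subseteq> Z \<Longrightarrow> Z = M" by blast
  have "S' = ri M" if "ring_ideal_pair R S' I'" "ri M \<subseteq> S'" "id M \<subseteq> I'" for S' I'
  proof -
    have "pr S' I' \<in> \<A>" using that M(1) by (auto simp: \<A>_def pr)
    moreover have "M \<subseteq> pr S' I'"
    proof
      fix p assume "p \<in> M"
      then show "p \<in> pr S' I'" using that(2,3) by (cases p; cases "snd p") (auto simp: ri_def id_def pr_def)
    qed
    ultimately have "pr S' I' = M" by (rule M(2))
    then show ?thesis using pr by metis
  qed
  then show ?thesis using M(1) unfolding \<A>_def by blast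
qed

text \<open>
  If \<open>I[x]\<close> and \<open>I[1/x]\<close> both contain \<open>1\<close>, then the relation for \<open>1/x\<close> expresses \<open>(1 - b\<^sub>0)\<close> by positive
  powers of \<open>1/x\<close>, and this removes the highest term of the relation for \<open>x\<close> when the latter is
  multiplied by \<open>1 - b\<^sub>0\<close>.
\<close>

lemma (in field) horner_shorten:
  assumes p: "ring_ideal_pair R S I" and x: "x \<in> carrier R" "y \<in> carrier R" "x \<otimes> y = \<one>"
    and as: "set as \<subseteq> I" "horner x as = \<one>" and bs: "set bs \<subseteq> I" "horner y bs = \<one>" "length bs \<le> length as"
  shows "\<exists>as'. set as' \<subseteq> I \<and> horner x as' = \<one> \<and> length as' < length as"
proof -
  have sub: "subring S R" and I: "I \<subseteq> S" "\<zero> \<in> I" "\<one> \<notin> I"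
    "\<And>a b. a \<in> I \<Longrightarrow> b \<in> I \<Longrightarrow> a \<oplus> b \<in> I" "\<And>r a. r \<in> S \<Longrightarrow> a \<in> I \<Longrightarrow> r \<otimes> a \<in> I"
    using p by (auto simp: ring_ideal_pair_def)
  have SR: "S \<subseteq> carrier R" using subringE(1)[OF sub] .
  have IR: "I \<subseteq> carrier R" using I(1) SR by blast
  obtain b0 bs' where b: "bs = b0 # bs'" using bs(2) by (cases bs) auto
  obtain as1 an where a: "as = as1 @ [an]" using as(2) by (cases as rule: rev_cases) auto
  have c: "b0 \<in> I" "set bs' \<subseteq> I" "an \<in> I" "set as1 \<subseteq> I" using as bs a b by auto
  have cR: "b0 \<in> carrier R" "an \<in> carrier R" "horner y bs' \<in> carrier R" "horner x as1 \<in> carrier R"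
    "set as1 \<subseteq> carrier R" "set bs' \<subseteq> carrier R"
    using c IR horner_closed x by auto
  define k where "k = length as1"
  have "as1 \<noteq> []"
  proof
    assume "as1 = []"
    then have "\<one> = an" using as a x cR by simp
    then show False using I c by simp
  qed
  then obtain k' where k': "k = Suc k'" unfolding k_def by (cases as1) auto
  have lb: "length bs' \<le> Suc k'" using bs(3) a b k' k_def by simp
  let ?r = "\<one> \<ominus> b0"
  have rS: "?r \<in> S" unfolding a_minus_def using subringE(3,5,7)[OF sub] c I(1) by blast
  have rR: "?r \<in> carrier R" using cR by simp
  have b1: "?r = y \<otimes> horner y bs'"
  proof -
    have "?r = (b0 \<oplus> y \<otimes> horner y bs') \<ominus> b0" using bs(2) b by simp
    then show ?thesis using cR x by (simp add: a_minus_def a_ac r_neg1 r_neg2 r_neg)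
  qed
  have a1: "horner x as1 \<oplus> x [^] k \<otimes> an = \<one>"
    using as(2) horner_append[OF x(1) cR(5), of "[an]"] a cR x k_def by simp
  obtain ds where ds: "set ds \<subseteq> I" "length ds \<le> Suc k'" "x [^] k' \<otimes> horner y bs' = horner x ds"
    using horner_inverse[OF x IR I(2,4) c(2) lb] by blast
  have dR: "set ds \<subseteq> carrier R" "horner x ds \<in> carrier R" using ds IR horner_closed x by auto
  let ?A = "map (\<lambda>a. ?r \<otimes> a) as1" and ?D = "map (\<lambda>a. an \<otimes> a) ds"
  have sA: "set ?A \<subseteq> I" using rS c I(5) by auto
  have "an \<in> S" using c(3) I(1) by blast
  then have sD: "set ?D \<subseteq> I" using I(5) ds(1) by auto
  have sb: "set [b0] \<subseteq> I" using c by simp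
  obtain es where es: "set es \<subseteq> I" "length es = max (length ?A) (length ?D)" "horner x es = horner x ?A \<oplus> horner x ?D"
    using horner_add[OF x(1) IR I(4) sA sD] by blast
  obtain fs where fs: "set fs \<subseteq> I" "length fs = max (length [b0]) (length es)" "horner x fs = horner x [b0] \<oplus> horner x es"
    using horner_add[OF x(1) IR I(4) sb es(1)] by blast
  have hA: "horner x ?A = ?r \<otimes> horner x as1" by (rule horner_scale[OF x(1) rR cR(5)])
  have hD: "horner x ?D = an \<otimes> horner x ds" by (rule horner_scale[OF x(1) cR(2) dR(1)])
  have xk: "x [^] k' \<in> carrier R" using x by simp
  have "x [^] k \<otimes> an \<otimes> ?r = an \<otimes> (x [^] k' \<otimes> (x \<otimes> y) \<otimes> horner y bs')"
    unfolding b1 k' using x(1,2) cR xk by (simp add: m_ac)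
  also have "\<dots> = an \<otimes> horner x ds" unfolding x(3) using ds(3) xk by simp
  finally have e1: "x [^] k \<otimes> an \<otimes> ?r = an \<otimes> horner x ds" .
  have "horner x fs = b0 \<oplus> (?r \<otimes> horner x as1 \<oplus> x [^] k \<otimes> an \<otimes> ?r)"
    unfolding fs(3) es(3) hA hD e1 using x cR by simp
  also have "\<dots> = b0 \<oplus> ?r \<otimes> (horner x as1 \<oplus> x [^] k \<otimes> an)"
    using rR cR x by (simp add: r_distr m_ac)
  also have "\<dots> = b0 \<oplus> ?r" unfolding a1 using rR by simp
  also have "\<dots> = \<one>" using cR by (simp add: a_minus_def a_lcomm[of b0 \<one>] r_neg)
  finally have "horner x fs = \<one>" .
  moreover have "length fs < length as" using fs(2) es(2) ds(2) a k_def k' by simp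
  ultimately show ?thesis using fs(1) by blast
qed

text \<open>
  The ring of a maximal pair is a valuation ring. If neither \<open>x\<close> nor \<open>1/x\<close> belonged to it, then by
  maximality the ideal would generate the unit ideal after adjoining \<open>x\<close>, and also after adjoining
  \<open>1/x\<close>; two such relations of minimal length contradict each other.
\<close>

theorem (in field) chevalley:
  assumes "ring_ideal_pair R R0 I0"
  obtains S I where "ring_ideal_pair R S I" "R0 \<subseteq> S" "I0 \<subseteq> I" "\<And>x. x \<in> carrier R \<Longrightarrow> x \<noteq> \<zero> \<Longrightarrow> x \<in> S \<or> inv x \<in> S"
proof -
  obtain S I where SI: "ring_ideal_pair R S I" "R0 \<subseteq> S" "I0 \<subseteq> I"
    and max0: "\<forall>S' I'. ring_ideal_pair R S' I' \<and> S \<subseteq> S' \<and> I \<subseteq> I' \<longrightarrow> S' = S"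
    using maximal_pair_exists[OF assms] by (elim exE conjE)
  have max: "S' = S" if "ring_ideal_pair R S' I'" "S \<subseteq> S'" "I \<subseteq> I'" for S' I'
    using max0[rule_format, of S' I'] that by simp
  have sub: "subring S R" and I: "I \<subseteq> S" "\<zero> \<in> I" "\<one> \<notin> I"
    "\<And>a b. a \<in> I \<Longrightarrow> b \<in> I \<Longrightarrow> a \<oplus> b \<in> I" "\<And>r a. r \<in> S \<Longrightarrow> a \<in> I \<Longrightarrow> r \<otimes> a \<in> I"
    using SI by (auto simp: ring_ideal_pair_def)
  have SR: "S \<subseteq> carrier R" using subringE(1)[OF sub] .
  have IR: "I \<subseteq> carrier R" using I(1) SR by blast
  note Sc = subringE(2,3,5,6,7)[OF sub]
  have gen: "\<exists>as. set as \<subseteq> I \<and> horner x as = \<one>" if x: "x \<in> carrier R" "x \<notin> S" for x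
  proof (rule ccontr)
    assume no: "\<not> ?thesis"
    define H where "H C = {horner x as | as. set as \<subseteq> C}" for C
    have HI: "horner x as \<in> H C" if "set as \<subseteq> C" for as C using that by (auto simp: H_def)
    have one: "c \<in> H C" if "c \<in> C" "C \<subseteq> carrier R" for c C
      using HI[of "[c]" C] that x by auto
    have Hadd: "p \<oplus> q \<in> H C" if "p \<in> H C" "q \<in> H C" "C \<subseteq> carrier R" "\<And>a b. a \<in> C \<Longrightarrow> b \<in> C \<Longrightarrow> a \<oplus> b \<in> C" for p q C
    proof -
      from that(1,2) obtain as bs where ab: "set as \<subseteq> C" "set bs \<subseteq> C" "p = horner x as" "q = horner x bs"
        by (auto simp: H_def)
      from horner_add[OF x(1) that(3,4) ab(1,2)] obtain cs where "set cs \<subseteq> C" "horner x cs = p \<oplus> q"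
        unfolding ab(3,4) by blast
      then show ?thesis using HI[of cs C] by simp
    qed
    have Hmult: "p \<otimes> q \<in> H C" if "p \<in> H S" "q \<in> H C" "C \<subseteq> carrier R" "\<zero> \<in> C" "\<And>a b. a \<in> C \<Longrightarrow> b \<in> C \<Longrightarrow> a \<oplus> b \<in> C"
      "\<And>r a. r \<in> S \<Longrightarrow> a \<in> C \<Longrightarrow> r \<otimes> a \<in> C" for p q C
    proof -
      from that(1,2) obtain as bs where ab: "set as \<subseteq> S" "set bs \<subseteq> C" "p = horner x as" "q = horner x bs"
        by (auto simp: H_def)
      from horner_mult[OF x(1) SR that(3-6) ab(1,2)] obtain cs where "set cs \<subseteq> C" "horner x cs = p \<otimes> q"
        unfolding ab(3,4) by blast
      then show ?thesis using HI[of cs C] by simp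
    qed
    have "subring (H S) R" unfolding H_def by (rule horner_subring[OF sub x(1)])
    moreover have "H I \<subseteq> H S" using I(1) by (auto simp: H_def)
    moreover have "\<zero> \<in> H I" using one I(2) IR by blast
    moreover have "\<one> \<notin> H I" using no by (auto simp: H_def)
    ultimately have "ring_ideal_pair R (H S) (H I)"
      unfolding ring_ideal_pair_def using Hadd Hmult I IR by blast
    then have "H S = S" using max one SR IR by blast
    moreover have "x \<in> H S" using HI[of "[\<zero>, \<one>]" S] Sc x by auto
    ultimately show False using x by simp
  qed
  have "x \<in> S \<or> inv x \<in> S" if x: "x \<in> carrier R" "x \<noteq> \<zero>" for x
  proof (rule ccontr)
    assume no: "\<not> ?thesis"
    have y: "inv x \<in> carrier R" "x \<otimes> inv x = \<one>" "inv x \<otimes> x = \<one>" using x field_Units by auto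
    define lens where "lens z = {length as | as. set as \<subseteq> I \<and> horner z as = \<one>}" for z
    define n where "n z = (LEAST l. l \<in> lens z)" for z
    have nz: "n z \<in> lens z" "\<And>l. l \<in> lens z \<Longrightarrow> n z \<le> l" if "z \<in> carrier R" "z \<notin> S" for z
    proof -
      from gen[OF that] obtain l where "l \<in> lens z" by (auto simp: lens_def)
      then show "n z \<in> lens z" unfolding n_def by (rule LeastI)
      show "\<And>l. l \<in> lens z \<Longrightarrow> n z \<le> l" unfolding n_def by (rule Least_le)
    qed
    obtain as where as: "set as \<subseteq> I" "horner x as = \<one>" "length as = n x"
      using nz(1)[of x] no x by (auto simp: lens_def)
    obtain bs where bs: "set bs \<subseteq> I" "horner (inv x) bs = \<one>" "length bs = n (inv x)"
      using nz(1)[of "inv x"] no y by (auto simp: lens_def)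
    show False
    proof (cases "length bs \<le> length as")
      case True
      from horner_shorten[OF SI(1) x(1) y(1,2) as(1,2) bs(1,2) True] obtain cs where
        "set cs \<subseteq> I" "horner x cs = \<one>" "length cs < length as" by blast
      then have "length cs \<in> lens x" "length cs < n x" using as by (auto simp: lens_def)
      then show False using nz(2)[of x] x no by (auto dest: leD)
    next
      case False
      from horner_shorten[OF SI(1) y(1) x(1) y(3) bs(1,2) as(1,2)] False obtain cs where
        "set cs \<subseteq> I" "horner (inv x) cs = \<one>" "length cs < length bs" by auto
      then have "length cs \<in> lens (inv x)" "length cs < n (inv x)" using bs by (auto simp: lens_def)
      then show False using nz(2)[of "inv x"] y no by (auto dest: leD)
    qed
  qed
  then show thesis using that SI by blast
qed

section \<open>Valuations and valuation rings\<close>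

definition vle :: "('a, 'm) ring_scheme \<Rightarrow> 'g ogroup \<Rightarrow> ('a \<Rightarrow> 'g) \<Rightarrow> 'a \<Rightarrow> 'a \<Rightarrow> bool" where
  "vle F G w x y \<longleftrightarrow> y = \<zero>\<^bsub>F\<^esub> \<or> (x \<noteq> \<zero>\<^bsub>F\<^esub> \<and> w x \<preceq>\<^bsub>G\<^esub> w y)"

locale valued_field = F: field F + G: ordered_abelian_group G
  for F :: "('a, 'm) ring_scheme" and G :: "'g ogroup" and w :: "'a \<Rightarrow> 'g" +
  assumes epi: "w \<in> epi (Multiplicative_Group.mult_of F) G"
    and ultra: "\<lbrakk>x \<in> carrier F - {\<zero>\<^bsub>F\<^esub>}; y \<in> carrier F - {\<zero>\<^bsub>F\<^esub>}; x \<oplus>\<^bsub>F\<^esub> y \<noteq> \<zero>\<^bsub>F\<^esub>\<rbrakk> \<Longrightarrow>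
        w x \<preceq>\<^bsub>G\<^esub> w (x \<oplus>\<^bsub>F\<^esub> y) \<or> w y \<preceq>\<^bsub>G\<^esub> w (x \<oplus>\<^bsub>F\<^esub> y)"
begin

lemma w_closed: "\<lbrakk>x \<in> carrier F; x \<noteq> \<zero>\<^bsub>F\<^esub>\<rbrakk> \<Longrightarrow> w x \<in> carrier G"
  using epi by (auto simp: epi_def hom_def)

lemma w_mult: "\<lbrakk>x \<in> carrier F; x \<noteq> \<zero>\<^bsub>F\<^esub>; y \<in> carrier F; y \<noteq> \<zero>\<^bsub>F\<^esub>\<rbrakk> \<Longrightarrow> w (x \<otimes>\<^bsub>F\<^esub> y) = w x \<otimes>\<^bsub>G\<^esub> w y"
  using epi by (auto simp: epi_def hom_def)

lemma w_surj: "\<gamma> \<in> carrier G \<Longrightarrow> \<exists>x\<in>carrier F. x \<noteq> \<zero>\<^bsub>F\<^esub> \<and> w x = \<gamma>"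
  using epi by (force simp: epi_def)

lemma w_one: "w \<one>\<^bsub>F\<^esub> = \<one>\<^bsub>G\<^esub>"
proof -
  have "w \<one>\<^bsub>F\<^esub> \<otimes>\<^bsub>G\<^esub> w \<one>\<^bsub>F\<^esub> = w \<one>\<^bsub>F\<^esub>" using w_mult[of "\<one>\<^bsub>F\<^esub>" "\<one>\<^bsub>F\<^esub>"] by simp
  then show ?thesis using w_closed[of "\<one>\<^bsub>F\<^esub>"] by (simp add: G.l_cancel_one)
qed

lemma leq_refl: "x \<in> carrier G \<Longrightarrow> x \<preceq>\<^bsub>G\<^esub> x" using G.leq_total by blast

sublocale valuative_field F "vle F G w"
proof
  show "x \<in> carrier F \<Longrightarrow> y \<in> carrier F \<Longrightarrow> vle F G w x y \<or> vle F G w y x" for x y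
    using G.leq_total w_closed by (auto simp: vle_def)
  show "vle F G w x z" if "vle F G w x y" "vle F G w y z" "x \<in> carrier F" "y \<in> carrier F" "z \<in> carrier F" for x y z
    using that G.leq_trans[of "w x" "w y" "w z"] w_closed by (auto simp: vle_def)
  show "vle F G w (z \<otimes>\<^bsub>F\<^esub> x) (z \<otimes>\<^bsub>F\<^esub> y)" if "vle F G w x y" "x \<in> carrier F" "y \<in> carrier F" "z \<in> carrier F" for x y z
    using that w_closed w_mult G.leq_mult by (auto simp: vle_def F.integral_iff)
  show "vle F G w z (x \<oplus>\<^bsub>F\<^esub> y)" if "vle F G w z x" "vle F G w z y" "x \<in> carrier F" "y \<in> carrier F" "z \<in> carrier F" for x y z
  proof (cases "x = \<zero>\<^bsub>F\<^esub> \<or> y = \<zero>\<^bsub>F\<^esub> \<or> x \<oplus>\<^bsub>F\<^esub> y = \<zero>\<^bsub>F\<^esub>")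
    case True
    then show ?thesis using that by (auto simp: vle_def)
  next
    case False
    then have "w x \<preceq>\<^bsub>G\<^esub> w (x \<oplus>\<^bsub>F\<^esub> y) \<or> w y \<preceq>\<^bsub>G\<^esub> w (x \<oplus>\<^bsub>F\<^esub> y)" using ultra that by blast
    then show ?thesis using that False G.leq_trans w_closed unfolding vle_def by (meson F.a_closed)
  qed
qed (auto simp: vle_def)

end

lemma valuation_iff_valued_field: "valuation F G w \<longleftrightarrow> valued_field F G w"
  unfolding valuation_def valued_field_def valued_field_axioms_def by blast

definition ring_units :: "('b, 'n) ring_scheme \<Rightarrow> 'b set \<Rightarrow> 'b set" where
  "ring_units L S = {x \<in> S. x \<noteq> \<zero>\<^bsub>L\<^esub> \<and> inv\<^bsub>L\<^esub> x \<in> S}"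

text \<open>
  The value group of a valuation ring \<open>S\<close> is \<open>L\<^sup>*/S\<^sup>*\<close>, with classes ordered by divisibility in \<open>S\<close>. Its
  elements are cosets, which is the kind of value group over which uniqueness of extensions
  quantifies.
\<close>

definition ring_value_group :: "('b, 'n) ring_scheme \<Rightarrow> 'b set \<Rightarrow> 'b set ogroup" where
  "ring_value_group L S = \<lparr>carrier = rcosets\<^bsub>Multiplicative_Group.mult_of L\<^esub> (ring_units L S), monoid.mult = set_mult (Multiplicative_Group.mult_of L),
     one = ring_units L S, leq = (\<lambda>C1 C2. \<exists>x\<in>C1. \<exists>y\<in>C2. y \<otimes>\<^bsub>L\<^esub> inv\<^bsub>L\<^esub> x \<in> S)\<rparr>"

definition ring_value :: "('b, 'n) ring_scheme \<Rightarrow> 'b set \<Rightarrow> 'b \<Rightarrow> 'b set" where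
  "ring_value L S x = ring_units L S #>\<^bsub>Multiplicative_Group.mult_of L\<^esub> x"

lemma comm_group_add_order:
  assumes "comm_group \<lparr>carrier = c, monoid.mult = m, one = o'\<rparr>"
  shows "comm_group \<lparr>carrier = c, monoid.mult = m, one = o', leq = l\<rparr>"
proof -
  interpret C: comm_group "\<lparr>carrier = c, monoid.mult = m, one = o'\<rparr>" by fact
  show ?thesis
    by (rule comm_groupI)
      (use C.m_closed C.one_closed C.m_assoc C.m_comm C.l_one C.l_inv_ex in simp_all)
qed

locale valuation_subring = field L for L :: "('b, 'n) ring_scheme" (structure) +
  fixes S
  assumes sub: "subring S L" and dichotomy: "\<lbrakk>x \<in> carrier L; x \<noteq> \<zero>\<rbrakk> \<Longrightarrow> x \<in> S \<or> inv x \<in> S"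
begin

lemma S_carrier: "x \<in> S \<Longrightarrow> x \<in> carrier L" using subringE(1)[OF sub] by blast

lemma inv_facts: "\<lbrakk>x \<in> carrier L; x \<noteq> \<zero>\<rbrakk> \<Longrightarrow> inv x \<in> carrier L \<and> inv x \<noteq> \<zero> \<and> x \<otimes> inv x = \<one> \<and> inv x \<otimes> x = \<one> \<and> inv (inv x) = x"
proof -
  assume x: "x \<in> carrier L" "x \<noteq> \<zero>"
  then have u: "x \<in> Units L" by (simp add: field_Units)
  have "inv x \<noteq> \<zero>" using Units_inv_Units[OF u] by (simp add: field_Units)
  then show ?thesis using u by simp
qed

lemma mult_of_comm_group: "comm_group (Multiplicative_Group.mult_of L)"
  using units_comm_group by (simp add: mult_of_is_Units)

lemma inv_mult: "\<lbrakk>x \<in> carrier L; x \<noteq> \<zero>; y \<in> carrier L; y \<noteq> \<zero>\<rbrakk> \<Longrightarrow> inv (x \<otimes> y) = inv x \<otimes> inv y"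
proof -
  assume x: "x \<in> carrier L" "x \<noteq> \<zero>" and y: "y \<in> carrier L" "y \<noteq> \<zero>"
  note i = inv_facts[OF x] inv_facts[OF y]
  have "(x \<otimes> y) \<otimes> (inv x \<otimes> inv y) = (x \<otimes> inv x) \<otimes> (y \<otimes> inv y)" using x y i by (simp add: m_ac)
  then have "(x \<otimes> y) \<otimes> (inv x \<otimes> inv y) = \<one>" using i by simp
  then show ?thesis using x y i comm_inv_char by simp
qed

lemma units_subgroup: "subgroup (ring_units L S) (Multiplicative_Group.mult_of L)"
proof (rule group.subgroupI[OF field_mult_group])
  show "ring_units L S \<subseteq> carrier (Multiplicative_Group.mult_of L)" using S_carrier by (auto simp: ring_units_def)
  show "ring_units L S \<noteq> {}" using subringE(3)[OF sub] by (auto simp: ring_units_def intro!: exI[of _ \<one>])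
  fix a assume a: "a \<in> ring_units L S"
  then have aL: "a \<in> carrier L" "a \<noteq> \<zero>" using S_carrier by (auto simp: ring_units_def)
  then show "inv\<^bsub>Multiplicative_Group.mult_of L\<^esub> a \<in> ring_units L S"
    using a inv_facts[OF aL] by (simp add: m_inv_mult_of ring_units_def)
  fix b assume b: "b \<in> ring_units L S"
  then have bL: "b \<in> carrier L" "b \<noteq> \<zero>" using S_carrier by (auto simp: ring_units_def)
  then show "a \<otimes>\<^bsub>Multiplicative_Group.mult_of L\<^esub> b \<in> ring_units L S"
    using a b aL subringE(6)[OF sub] by (simp add: ring_units_def inv_mult integral_iff)
qed

lemma quotient_closed: "\<lbrakk>x \<in> carrier L; x \<noteq> \<zero>; y \<in> carrier L; y \<noteq> \<zero>; y \<otimes> inv x \<in> S; u \<in> ring_units L S; t \<in> ring_units L S\<rbrakk>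
  \<Longrightarrow> (u \<otimes> y) \<otimes> inv (t \<otimes> x) \<in> S"
proof -
  assume x: "x \<in> carrier L" "x \<noteq> \<zero>" and y: "y \<in> carrier L" "y \<noteq> \<zero>" and yx: "y \<otimes> inv x \<in> S"
    and u: "u \<in> ring_units L S" and t: "t \<in> ring_units L S"
  have uL: "u \<in> carrier L" "u \<in> S" and tL: "t \<in> carrier L" "t \<noteq> \<zero>" "inv t \<in> S"
    using u t S_carrier by (auto simp: ring_units_def)
  have "(u \<otimes> y) \<otimes> inv (t \<otimes> x) = (u \<otimes> inv t) \<otimes> (y \<otimes> inv x)"
    using x y uL tL inv_facts[OF x] inv_facts[OF tL(1,2)] by (simp add: inv_mult m_ac)
  then show ?thesis using subringE(6)[OF sub] uL tL yx by simp
qed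

lemma ring_value_leq_iff:
  assumes x: "x \<in> carrier L" "x \<noteq> \<zero>" and y: "y \<in> carrier L" "y \<noteq> \<zero>"
  shows "ring_value L S x \<preceq>\<^bsub>ring_value_group L S\<^esub> ring_value L S y \<longleftrightarrow> y \<otimes> inv x \<in> S"
proof
  have one: "\<one> \<in> ring_units L S" using subringE(3)[OF sub] by (simp add: ring_units_def)
  show "ring_value L S x \<preceq>\<^bsub>ring_value_group L S\<^esub> ring_value L S y" if "y \<otimes> inv x \<in> S"
    using that x y one by (auto simp: ring_value_group_def ring_value_def r_coset_def intro!: bexI[of _ \<one>])
  assume "ring_value L S x \<preceq>\<^bsub>ring_value_group L S\<^esub> ring_value L S y"
  then obtain s t where st: "s \<in> ring_units L S" "t \<in> ring_units L S" "(t \<otimes> y) \<otimes> inv (s \<otimes> x) \<in> S"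
    by (auto simp: ring_value_group_def ring_value_def r_coset_def)
  have sL: "s \<in> carrier L" "s \<noteq> \<zero>" "t \<in> carrier L" "t \<noteq> \<zero>" using st S_carrier by (auto simp: ring_units_def)
  have i: "inv s \<in> ring_units L S" "inv t \<in> ring_units L S"
    using st inv_facts sL S_carrier by (auto simp: ring_units_def)
  have sx: "s \<otimes> x \<in> carrier L" "s \<otimes> x \<noteq> \<zero>" "t \<otimes> y \<in> carrier L" "t \<otimes> y \<noteq> \<zero>" using sL x y by (auto simp: integral_iff)
  have "(inv t \<otimes> (t \<otimes> y)) \<otimes> inv (inv s \<otimes> (s \<otimes> x)) \<in> S" by (rule quotient_closed[OF sx st(3) i(2,1)])
  moreover have "inv t \<otimes> (t \<otimes> y) = y" "inv s \<otimes> (s \<otimes> x) = x"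
    using inv_facts sL x y by (simp_all flip: m_assoc)
  ultimately show "y \<otimes> inv x \<in> S" by simp
qed

lemma value_group_carrier: "C1 \<in> carrier (ring_value_group L S) \<longleftrightarrow> (\<exists>x\<in>carrier L. x \<noteq> \<zero> \<and> C1 = ring_value L S x)"
  by (auto simp: ring_value_group_def RCOSETS_def ring_value_def)

lemma value_group_comm_group: "comm_group (ring_value_group L S)"
proof -
  interpret M: comm_group "Multiplicative_Group.mult_of L" by (rule mult_of_comm_group)
  have "comm_group (Multiplicative_Group.mult_of L Mod ring_units L S)"
    using M.abelian_FactGroup[OF units_subgroup] .
  then show ?thesis unfolding ring_value_group_def FactGroup_def by (rule comm_group_add_order)
qed

lemma ring_value_mult:
  assumes "x \<in> carrier L" "x \<noteq> \<zero>" "y \<in> carrier L" "y \<noteq> \<zero>"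
  shows "ring_value L S (x \<otimes> y) = ring_value L S x \<otimes>\<^bsub>ring_value_group L S\<^esub> ring_value L S y"
proof -
  interpret M: comm_group "Multiplicative_Group.mult_of L" by (rule mult_of_comm_group)
  have n: "ring_units L S \<lhd> Multiplicative_Group.mult_of L" using units_subgroup M.normal_iff_subgroup by blast
  show ?thesis using normal.rcos_sum[OF n, of x y] assms by (simp add: ring_value_group_def ring_value_def)
qed

lemma ring_value_valuation: "valuation L (ring_value_group L S) (ring_value L S)"
  unfolding valuation_iff_valued_field
proof (intro valued_field.intro ordered_abelian_group.intro valued_field_axioms.intro ordered_abelian_group_axioms.intro)
  let ?G = "ring_value_group L S" and ?w = "ring_value L S"
  show "field L" by (rule field_axioms)
  show "comm_group ?G" by (rule value_group_comm_group)
  show "?w \<in> epi (Multiplicative_Group.mult_of L) ?G"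
    using value_group_carrier ring_value_mult by (auto simp: epi_def hom_def)
  have key: "(y \<otimes> inv x) \<otimes> (x \<otimes> inv z) = y \<otimes> inv z" if "x \<in> carrier L" "y \<in> carrier L" "z \<in> carrier L" "x \<noteq> \<zero>" "z \<noteq> \<zero>" for x y z
  proof -
    note i = inv_facts[OF that(1,4)] inv_facts[OF that(3,5)]
    have "inv x \<in> carrier L" "inv z \<in> carrier L" using i by auto
    then have "(y \<otimes> inv x) \<otimes> (x \<otimes> inv z) = (inv x \<otimes> x) \<otimes> (y \<otimes> inv z)" using that(1-3) by (simp add: m_ac)
    then show ?thesis using that i by simp
  qed
  show "C1 = C2" if XY: "C1 \<in> carrier ?G" "C2 \<in> carrier ?G" and le: "C1 \<preceq>\<^bsub>?G\<^esub> C2" "C2 \<preceq>\<^bsub>?G\<^esub> C1" for C1 C2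
  proof -
    interpret M: comm_group "Multiplicative_Group.mult_of L" by (rule mult_of_comm_group)
    obtain x y where x: "x \<in> carrier L" "x \<noteq> \<zero>" "C1 = ?w x" and y: "y \<in> carrier L" "y \<noteq> \<zero>" "C2 = ?w y"
      using XY value_group_carrier by auto
    have m: "y \<otimes> inv x \<in> S" "x \<otimes> inv y \<in> S" using le ring_value_leq_iff x y by auto
    note i = inv_facts[OF x(1,2)] inv_facts[OF y(1,2)]
    have "inv (y \<otimes> inv x) = x \<otimes> inv y" using i x y by (simp add: inv_mult m_comm)
    then have "y \<otimes> inv x \<in> ring_units L S" using m i y by (simp add: ring_units_def integral_iff)
    then have "(y \<otimes> inv x) \<otimes> x \<in> ring_units L S #>\<^bsub>Multiplicative_Group.mult_of L\<^esub> x" by (auto simp: r_coset_def)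
    moreover have "(y \<otimes> inv x) \<otimes> x = y" using x y i by (simp add: m_assoc)
    ultimately show ?thesis unfolding x(3) y(3) ring_value_def
      using M.repr_independence[OF _ _ units_subgroup, of y x] x by simp
  qed
  show "C1 \<preceq>\<^bsub>?G\<^esub> C3" if XY: "C1 \<in> carrier ?G" "C2 \<in> carrier ?G" "C3 \<in> carrier ?G" and le: "C1 \<preceq>\<^bsub>?G\<^esub> C2" "C2 \<preceq>\<^bsub>?G\<^esub> C3" for C1 C2 C3
  proof -
    obtain x y z where x: "x \<in> carrier L" "x \<noteq> \<zero>" "C1 = ?w x" and y: "y \<in> carrier L" "y \<noteq> \<zero>" "C2 = ?w y"
      and z: "z \<in> carrier L" "z \<noteq> \<zero>" "C3 = ?w z"
      using XY value_group_carrier by auto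
    have "(z \<otimes> inv y) \<otimes> (y \<otimes> inv x) \<in> S" using le ring_value_leq_iff x y z subringE(6)[OF sub] by simp
    then show ?thesis using key[of y z x] ring_value_leq_iff x y z by simp
  qed
  show "C1 \<preceq>\<^bsub>?G\<^esub> C2 \<or> C2 \<preceq>\<^bsub>?G\<^esub> C1" if XY: "C1 \<in> carrier ?G" "C2 \<in> carrier ?G" for C1 C2
  proof -
    obtain x y where x: "x \<in> carrier L" "x \<noteq> \<zero>" "C1 = ?w x" and y: "y \<in> carrier L" "y \<noteq> \<zero>" "C2 = ?w y"
      using XY value_group_carrier by auto
    note i = inv_facts[OF x(1,2)] inv_facts[OF y(1,2)]
    have "inv (y \<otimes> inv x) = x \<otimes> inv y" using i x y by (simp add: inv_mult m_comm)
    then show ?thesis using dichotomy[of "y \<otimes> inv x"] ring_value_leq_iff x y i by (auto simp: integral_iff)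
  qed
  show "C3 \<otimes>\<^bsub>?G\<^esub> C1 \<preceq>\<^bsub>?G\<^esub> C3 \<otimes>\<^bsub>?G\<^esub> C2" if XY: "C1 \<in> carrier ?G" "C2 \<in> carrier ?G" "C3 \<in> carrier ?G" and le: "C1 \<preceq>\<^bsub>?G\<^esub> C2" for C1 C2 C3
  proof -
    obtain x y z where x: "x \<in> carrier L" "x \<noteq> \<zero>" "C1 = ?w x" and y: "y \<in> carrier L" "y \<noteq> \<zero>" "C2 = ?w y"
      and z: "z \<in> carrier L" "z \<noteq> \<zero>" "C3 = ?w z"
      using XY value_group_carrier by auto
    note i = inv_facts[OF x(1,2)] inv_facts[OF z(1,2)]
    have "(z \<otimes> y) \<otimes> inv (z \<otimes> x) = (z \<otimes> inv z) \<otimes> (y \<otimes> inv x)" using i x y z by (simp add: inv_mult m_ac)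
    then have "(z \<otimes> y) \<otimes> inv (z \<otimes> x) = y \<otimes> inv x" using i y by simp
    then show ?thesis using le x y z ring_value_leq_iff by (simp add: ring_value_mult[symmetric] integral_iff)
  qed
  show "?w x \<preceq>\<^bsub>?G\<^esub> ?w (x \<oplus> y) \<or> ?w y \<preceq>\<^bsub>?G\<^esub> ?w (x \<oplus> y)"
    if xy: "x \<in> carrier L - {\<zero>}" "y \<in> carrier L - {\<zero>}" "x \<oplus> y \<noteq> \<zero>" for x y
  proof -
    have main: "?w x \<preceq>\<^bsub>?G\<^esub> ?w (x \<oplus> y)" if x: "x \<in> carrier L" "x \<noteq> \<zero>" and y: "y \<in> carrier L" "y \<noteq> \<zero>"
      and s: "x \<oplus> y \<noteq> \<zero>" "y \<otimes> inv x \<in> S" for x y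
    proof -
      note i = inv_facts[OF x(1,2)]
      have "(x \<oplus> y) \<otimes> inv x = \<one> \<oplus> y \<otimes> inv x" using i x y by (simp add: l_distr)
      then show ?thesis using s x y ring_value_leq_iff[of x "x \<oplus> y"] subringE(3,7)[OF sub] by simp
    qed
    have i: "inv (y \<otimes> inv x) = x \<otimes> inv y" using inv_facts xy by (simp add: inv_mult m_comm)
    have "y \<otimes> inv x \<in> S \<or> x \<otimes> inv y \<in> S"
      using dichotomy[of "y \<otimes> inv x"] inv_facts xy unfolding i by (auto simp: integral_iff)
    then show ?thesis using main[of x y] main[of y x] xy by (auto simp: a_comm)
  qed
qed

end

section \<open>Integrality from uniqueness of the extension\<close>

locale unique_ext = V0: valued_field K \<Gamma>\<^sub>0 v\<^sub>0 + V: valued_field L \<Gamma> v + j: ring_hom_cring K L j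
  for K :: "('a, 'm) ring_scheme" and \<Gamma>\<^sub>0 :: "'g ogroup" and v\<^sub>0
    and L :: "('b, 'n) ring_scheme" and \<Gamma> :: "'h ogroup" and v and j +
  fixes \<iota>
  assumes unique: "unique_extension K \<Gamma>\<^sub>0 v\<^sub>0 L j \<Gamma> v \<iota>"
begin

abbreviation le0 where "le0 \<equiv> vle K \<Gamma>\<^sub>0 v\<^sub>0"
abbreviation le where "le \<equiv> vle L \<Gamma> v"

lemma j_nonzero: "\<lbrakk>a \<in> carrier K; a \<noteq> \<zero>\<^bsub>K\<^esub>\<rbrakk> \<Longrightarrow> j a \<noteq> \<zero>\<^bsub>L\<^esub>"
proof
  assume a: "a \<in> carrier K" "a \<noteq> \<zero>\<^bsub>K\<^esub>" "j a = \<zero>\<^bsub>L\<^esub>"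
  note i = V0.inv_facts[OF a(1,2)]
  have "j (a \<otimes>\<^bsub>K\<^esub> inv\<^bsub>K\<^esub> a) = \<zero>\<^bsub>L\<^esub>" using a i(1) by simp
  then show False using i(3) by simp
qed

lemma v_j: "\<lbrakk>a \<in> carrier K; a \<noteq> \<zero>\<^bsub>K\<^esub>\<rbrakk> \<Longrightarrow> v (j a) = \<iota> (v\<^sub>0 a)"
  using unique by (simp add: unique_extension_def extends_valuation_def)

lemma \<iota>_leq: "\<lbrakk>x \<in> carrier \<Gamma>\<^sub>0; y \<in> carrier \<Gamma>\<^sub>0\<rbrakk> \<Longrightarrow> \<iota> x \<preceq>\<^bsub>\<Gamma>\<^esub> \<iota> y \<longleftrightarrow> x \<preceq>\<^bsub>\<Gamma>\<^sub>0\<^esub> y"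
  using unique by (simp add: unique_extension_def extends_valuation_def order_embedding_def)

lemma le_j: "\<lbrakk>a \<in> carrier K; b \<in> carrier K\<rbrakk> \<Longrightarrow> le (j a) (j b) \<longleftrightarrow> le0 a b"
  using j_nonzero[of a] j_nonzero[of b] v_j[of a] v_j[of b] \<iota>_leq[OF V0.w_closed V0.w_closed, of a b]
  by (cases "a = \<zero>\<^bsub>K\<^esub>"; cases "b = \<zero>\<^bsub>K\<^esub>") (auto simp: vle_def)

lemma le0_inv:
  assumes "a \<in> carrier K" "\<not> le0 \<one>\<^bsub>K\<^esub> a"
  shows "a \<noteq> \<zero>\<^bsub>K\<^esub>" "\<not> le0 (inv\<^bsub>K\<^esub> a) \<one>\<^bsub>K\<^esub>"
proof -
  show a: "a \<noteq> \<zero>\<^bsub>K\<^esub>" using assms V0.le_zero by auto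
  note i = V0.inv_facts[OF assms(1) a]
  show "\<not> le0 (inv\<^bsub>K\<^esub> a) \<one>\<^bsub>K\<^esub>"
  proof
    assume "le0 (inv\<^bsub>K\<^esub> a) \<one>\<^bsub>K\<^esub>"
    from V0.le_mult[OF this, of a] show False using assms i by simp
  qed
qed

definition O0 where "O0 = {a \<in> carrier K. le0 \<one>\<^bsub>K\<^esub> a}"

lemma O0_subring: "subring (j ` O0) L"
proof (rule ring.subringI[OF V.F.ring_axioms])
  have one: "\<one>\<^bsub>K\<^esub> \<in> O0" using V0.le_refl by (simp add: O0_def)
  show "j ` O0 \<subseteq> carrier L" by (auto simp: O0_def)
  show "\<one>\<^bsub>L\<^esub> \<in> j ` O0" using one by (force intro: image_eqI[of _ _ "\<one>\<^bsub>K\<^esub>"])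
  fix h1 assume "h1 \<in> j ` O0"
  then obtain a where a: "a \<in> carrier K" "le0 \<one>\<^bsub>K\<^esub> a" "h1 = j a" by (auto simp: O0_def)
  have "\<ominus>\<^bsub>K\<^esub> a \<in> O0" using a V0.le_uminus by (simp add: O0_def)
  then show "\<ominus>\<^bsub>L\<^esub> h1 \<in> j ` O0" using a by (force intro: image_eqI[of _ _ "\<ominus>\<^bsub>K\<^esub> a"])
  fix h2 assume "h2 \<in> j ` O0"
  then obtain b where b: "b \<in> carrier K" "le0 \<one>\<^bsub>K\<^esub> b" "h2 = j b" by (auto simp: O0_def)
  have "a \<oplus>\<^bsub>K\<^esub> b \<in> O0" "a \<otimes>\<^bsub>K\<^esub> b \<in> O0"
    using a b V0.le_add V0.le_mult2[of "\<one>\<^bsub>K\<^esub>" a "\<one>\<^bsub>K\<^esub>" b] by (auto simp: O0_def)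
  then show "h1 \<oplus>\<^bsub>L\<^esub> h2 \<in> j ` O0" "h1 \<otimes>\<^bsub>L\<^esub> h2 \<in> j ` O0"
    using a b by (force intro: image_eqI[of _ _ "a \<oplus>\<^bsub>K\<^esub> b"] image_eqI[of _ _ "a \<otimes>\<^bsub>K\<^esub> b"])+
qed

text \<open>
  A valuation ring \<open>S\<close> of \<open>L\<close> that lies over the valuation ring of \<open>v\<^sub>0\<close> defines a valuation that
  restricts to one equivalent to \<open>v\<^sub>0\<close>. By uniqueness this valuation is \<open>v\<close>, so \<open>S\<close> contains all
  elements with nonnegative value.
\<close>

lemma valuation_ring_unique:
  assumes "valuation_subring L S" and meet: "\<And>a. a \<in> carrier K \<Longrightarrow> j a \<in> S \<longleftrightarrow> le0 \<one>\<^bsub>K\<^esub> a"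
    and x: "x \<in> carrier L" "x \<noteq> \<zero>\<^bsub>L\<^esub>" "le \<one>\<^bsub>L\<^esub> x"
  shows "x \<in> S"
proof -
  interpret W: valuation_subring L S by fact
  let ?G = "ring_value_group L S" and ?w = "ring_value L S"
  define pick where "pick \<gamma> = (SOME a. a \<in> carrier K \<and> a \<noteq> \<zero>\<^bsub>K\<^esub> \<and> v\<^sub>0 a = \<gamma>)" for \<gamma>
  have pick: "pick \<gamma> \<in> carrier K" "pick \<gamma> \<noteq> \<zero>\<^bsub>K\<^esub>" "v\<^sub>0 (pick \<gamma>) = \<gamma>" if "\<gamma> \<in> carrier \<Gamma>\<^sub>0" for \<gamma>
  proof -
    have "\<exists>a. a \<in> carrier K \<and> a \<noteq> \<zero>\<^bsub>K\<^esub> \<and> v\<^sub>0 a = \<gamma>" using V0.w_surj[OF that] by blast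
    from someI_ex[OF this] show "pick \<gamma> \<in> carrier K" "pick \<gamma> \<noteq> \<zero>\<^bsub>K\<^esub>" "v\<^sub>0 (pick \<gamma>) = \<gamma>"
      unfolding pick_def by auto
  qed
  define \<kappa> where "\<kappa> \<gamma> = ?w (j (pick \<gamma>))" for \<gamma>
  interpret WV: valued_field L ?G ?w using W.ring_value_valuation by (simp add: valuation_iff_valued_field)
  have leq: "?w (j a) \<preceq>\<^bsub>?G\<^esub> ?w (j b) \<longleftrightarrow> v\<^sub>0 a \<preceq>\<^bsub>\<Gamma>\<^sub>0\<^esub> v\<^sub>0 b"
    if a: "a \<in> carrier K" "a \<noteq> \<zero>\<^bsub>K\<^esub>" and b: "b \<in> carrier K" "b \<noteq> \<zero>\<^bsub>K\<^esub>" for a b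
  proof -
    note i = V0.inv_facts[OF a]
    have jj: "j (inv\<^bsub>K\<^esub> a) = inv\<^bsub>L\<^esub> (j a)"
    proof -
      have "j a \<otimes>\<^bsub>L\<^esub> j (inv\<^bsub>K\<^esub> a) = \<one>\<^bsub>L\<^esub>" using a i by (metis j.hom_mult j.hom_one)
      then show ?thesis using a i V.F.comm_inv_char[of "j a" "j (inv\<^bsub>K\<^esub> a)"] by simp
    qed
    have "?w (j a) \<preceq>\<^bsub>?G\<^esub> ?w (j b) \<longleftrightarrow> j b \<otimes>\<^bsub>L\<^esub> inv\<^bsub>L\<^esub> (j a) \<in> S"
      using W.ring_value_leq_iff j_nonzero a b by simp
    also have "\<dots> \<longleftrightarrow> le0 \<one>\<^bsub>K\<^esub> (b \<otimes>\<^bsub>K\<^esub> inv\<^bsub>K\<^esub> a)"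
      using meet[of "b \<otimes>\<^bsub>K\<^esub> inv\<^bsub>K\<^esub> a"] a b i jj by simp
    also have "\<dots> \<longleftrightarrow> le0 a b"
    proof
      assume "le0 \<one>\<^bsub>K\<^esub> (b \<otimes>\<^bsub>K\<^esub> inv\<^bsub>K\<^esub> a)"
      then have "le0 (a \<otimes>\<^bsub>K\<^esub> \<one>\<^bsub>K\<^esub>) (a \<otimes>\<^bsub>K\<^esub> (b \<otimes>\<^bsub>K\<^esub> inv\<^bsub>K\<^esub> a))" by (rule V0.le_mult) (use a b i in auto)
      moreover have "a \<otimes>\<^bsub>K\<^esub> (b \<otimes>\<^bsub>K\<^esub> inv\<^bsub>K\<^esub> a) = b"
        using a b i V0.F.m_lcomm[of a b "inv\<^bsub>K\<^esub> a"] by simp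
      ultimately show "le0 a b" using a by simp
    next
      assume "le0 a b"
      then have "le0 (inv\<^bsub>K\<^esub> a \<otimes>\<^bsub>K\<^esub> a) (inv\<^bsub>K\<^esub> a \<otimes>\<^bsub>K\<^esub> b)" by (rule V0.le_mult) (use a b i in auto)
      then show "le0 \<one>\<^bsub>K\<^esub> (b \<otimes>\<^bsub>K\<^esub> inv\<^bsub>K\<^esub> a)" using a b i by (simp add: V0.F.m_comm)
    qed
    finally show ?thesis using a b by (simp add: vle_def)
  qed
  have w_eq: "?w (j a) = ?w (j b)" if "a \<in> carrier K" "a \<noteq> \<zero>\<^bsub>K\<^esub>" "b \<in> carrier K" "b \<noteq> \<zero>\<^bsub>K\<^esub>" "v\<^sub>0 a = v\<^sub>0 b" for a b
    using leq[of a b] leq[of b a] that V0.leq_refl V0.w_closed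
    by (intro WV.G.leq_antisym WV.w_closed) (auto simp: j_nonzero)
  have \<kappa>v: "\<kappa> (v\<^sub>0 a) = ?w (j a)" if "a \<in> carrier K" "a \<noteq> \<zero>\<^bsub>K\<^esub>" for a
    unfolding \<kappa>_def using w_eq pick[OF V0.w_closed[OF that]] that by blast
  have "order_embedding \<Gamma>\<^sub>0 ?G \<kappa>" unfolding order_embedding_def
  proof (intro conjI ballI)
    show le\<kappa>: "x \<preceq>\<^bsub>\<Gamma>\<^sub>0\<^esub> y \<longleftrightarrow> \<kappa> x \<preceq>\<^bsub>?G\<^esub> \<kappa> y" if "x \<in> carrier \<Gamma>\<^sub>0" "y \<in> carrier \<Gamma>\<^sub>0" for x y
      unfolding \<kappa>_def using leq pick that by simp
    have cl: "\<kappa> x \<in> carrier ?G" if "x \<in> carrier \<Gamma>\<^sub>0" for x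
      unfolding \<kappa>_def using pick[OF that] j_nonzero by (intro WV.w_closed) auto
    have "\<kappa> (x \<otimes>\<^bsub>\<Gamma>\<^sub>0\<^esub> y) = \<kappa> x \<otimes>\<^bsub>?G\<^esub> \<kappa> y" if "x \<in> carrier \<Gamma>\<^sub>0" "y \<in> carrier \<Gamma>\<^sub>0" for x y
    proof -
      note p = pick[OF that(1)] pick[OF that(2)]
      have "\<kappa> (x \<otimes>\<^bsub>\<Gamma>\<^sub>0\<^esub> y) = \<kappa> (v\<^sub>0 (pick x \<otimes>\<^bsub>K\<^esub> pick y))" using p by (simp add: V0.w_mult)
      also have "\<dots> = ?w (j (pick x) \<otimes>\<^bsub>L\<^esub> j (pick y))" using p by (subst \<kappa>v) (auto simp: V0.F.integral_iff)
      also have "\<dots> = \<kappa> x \<otimes>\<^bsub>?G\<^esub> \<kappa> y" unfolding \<kappa>_def using p j_nonzero by (simp add: WV.w_mult)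
      finally show ?thesis .
    qed
    moreover have "inj_on \<kappa> (carrier \<Gamma>\<^sub>0)"
    proof (rule inj_onI)
      fix x y assume xy: "x \<in> carrier \<Gamma>\<^sub>0" "y \<in> carrier \<Gamma>\<^sub>0" "\<kappa> x = \<kappa> y"
      then show "x = y" using le\<kappa>[of x y] le\<kappa>[of y x] WV.leq_refl[OF cl] V0.G.leq_antisym by simp
    qed
    ultimately show "\<kappa> \<in> mon \<Gamma>\<^sub>0 ?G" using cl by (simp add: mon_def hom_def)
  qed
  then have "extends_valuation K \<Gamma>\<^sub>0 v\<^sub>0 L j ?G ?w \<kappa>"
    unfolding extends_valuation_def using W.ring_value_valuation \<kappa>v by auto
  then have "equivalent_valuations L \<Gamma> v ?G ?w" using unique unfolding unique_extension_def by blast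
  then obtain \<phi> where \<phi>: "order_embedding \<Gamma> ?G \<phi>" "\<forall>x\<in>carrier L - {\<zero>\<^bsub>L\<^esub>}. ?w x = \<phi> (v x)"
    unfolding equivalent_valuations_def by (elim exE conjE)
  have "v \<one>\<^bsub>L\<^esub> \<preceq>\<^bsub>\<Gamma>\<^esub> v x" using x by (simp add: vle_def)
  moreover have "\<forall>x\<in>carrier \<Gamma>. \<forall>y\<in>carrier \<Gamma>. x \<preceq>\<^bsub>\<Gamma>\<^esub> y \<longleftrightarrow> \<phi> x \<preceq>\<^bsub>?G\<^esub> \<phi> y"
    using \<phi>(1) by (simp add: order_embedding_def)
  ultimately have "\<phi> (v \<one>\<^bsub>L\<^esub>) \<preceq>\<^bsub>?G\<^esub> \<phi> (v x)" using x(1,2) V.w_closed V.F.one_closed V.F.one_not_zero by blast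
  then have "?w \<one>\<^bsub>L\<^esub> \<preceq>\<^bsub>?G\<^esub> ?w x" using \<phi>(2) x(1,2) by simp
  then show ?thesis using W.ring_value_leq_iff[of "\<one>\<^bsub>L\<^esub>" x] x by simp
qed

text \<open>
  The valuation ring of \<open>v\<close> is integral over that of \<open>v\<^sub>0\<close>. If \<open>u\<close> is not integral, then \<open>1/u\<close> and the
  maximal ideal of \<open>O\<^sub>0\<close> generate a proper ideal of \<open>O\<^sub>0[1/u]\<close>, and Chevalley's theorem yields a
  valuation ring over \<open>O\<^sub>0\<close> with \<open>1/u\<close> in its maximal ideal. It does not contain \<open>u\<close>, which contradicts
  uniqueness.
\<close>

theorem integral:
  assumes u: "u \<in> carrier L" "le \<one>\<^bsub>L\<^esub> u" "u \<noteq> \<zero>\<^bsub>L\<^esub>"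
  shows "\<exists>as. set as \<subseteq> O0 \<and> u [^]\<^bsub>L\<^esub> length as = V.F.horner u (map j as)"
proof (rule ccontr)
  assume no: "\<not> ?thesis"
  let ?h = "V.F.horner"
  define y where "y = inv\<^bsub>L\<^esub> u"
  note uf = V.inv_facts[OF u(1,3), folded y_def]
  define R0 where "R0 = {?h y as | as. set as \<subseteq> j ` O0}"
  define M where "M = j ` {a \<in> carrier K. \<not> le0 a \<one>\<^bsub>K\<^esub>}"
  define I0 where "I0 = {m \<oplus>\<^bsub>L\<^esub> y \<otimes>\<^bsub>L\<^esub> r | m r. m \<in> M \<and> r \<in> R0}"
  have R0: "subring R0 L" unfolding R0_def by (rule V.F.horner_subring[OF O0_subring uf(1)])
  note R0c = subringE(2,3,5,6,7)[OF R0]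
  have R0L: "x \<in> carrier L" if "x \<in> R0" for x using subringE(1)[OF R0] that by blast
  have MO: "M \<subseteq> j ` O0" using V0.lt_imp_le by (auto simp: M_def O0_def)
  have OR: "j ` O0 \<subseteq> R0"
  proof
    fix x assume x: "x \<in> j ` O0"
    then have "x \<in> carrier L" using subringE(1)[OF O0_subring] by blast
    then have "?h y [x] = x" using uf by simp
    then have "x = ?h y [x] \<and> set [x] \<subseteq> j ` O0" using x by simp
    then show "x \<in> R0" unfolding R0_def by blast
  qed
  have Mcar: "m \<in> carrier L" if "m \<in> M" for m using that by (auto simp: M_def)
  have yR: "y \<in> R0"
  proof -
    have "?h y [\<zero>\<^bsub>L\<^esub>, \<one>\<^bsub>L\<^esub>] = y" using uf by simp
    moreover have "set [\<zero>\<^bsub>L\<^esub>, \<one>\<^bsub>L\<^esub>] \<subseteq> j ` O0" using subringE(2,3)[OF O0_subring] by simp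
    ultimately have "y = ?h y [\<zero>\<^bsub>L\<^esub>, \<one>\<^bsub>L\<^esub>] \<and> set [\<zero>\<^bsub>L\<^esub>, \<one>\<^bsub>L\<^esub>] \<subseteq> j ` O0" by metis
    then show ?thesis unfolding R0_def by blast
  qed
  have M0: "\<zero>\<^bsub>L\<^esub> \<in> M"
  proof -
    have "\<not> le0 \<zero>\<^bsub>K\<^esub> \<one>\<^bsub>K\<^esub>" using V0.zero_le[of "\<one>\<^bsub>K\<^esub>"] V0.F.one_not_zero by auto
    then show ?thesis unfolding M_def by (force intro: image_eqI[of _ _ "\<zero>\<^bsub>K\<^esub>"])
  qed
  have Madd: "m \<oplus>\<^bsub>L\<^esub> m' \<in> M" if m: "m \<in> M" "m' \<in> M" for m m'
  proof -
    from m obtain a b where ab: "a \<in> carrier K" "\<not> le0 a \<one>\<^bsub>K\<^esub>" "m = j a" "b \<in> carrier K" "\<not> le0 b \<one>\<^bsub>K\<^esub>" "m' = j b"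
      by (auto simp: M_def)
    have "\<not> le0 (a \<oplus>\<^bsub>K\<^esub> b) \<one>\<^bsub>K\<^esub>" using V0.lt_add[OF ab(2,5,1,4)] by simp
    then show ?thesis unfolding M_def using ab by (force intro: image_eqI[of _ _ "a \<oplus>\<^bsub>K\<^esub> b"])
  qed
  have Mmult: "d \<otimes>\<^bsub>L\<^esub> m \<in> M" if m: "d \<in> j ` O0" "m \<in> M" for d m
  proof -
    from m obtain a b where ab: "a \<in> carrier K" "le0 \<one>\<^bsub>K\<^esub> a" "d = j a" "b \<in> carrier K" "\<not> le0 b \<one>\<^bsub>K\<^esub>" "m = j b"
      by (auto simp: M_def O0_def)
    have "\<not> le0 (a \<otimes>\<^bsub>K\<^esub> b) \<one>\<^bsub>K\<^esub>" using V0.lt_mult2[OF ab(2,5) _ _ ab(1) _ ab(4)] by simp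
    then show ?thesis unfolding M_def using ab by (force intro: image_eqI[of _ _ "a \<otimes>\<^bsub>K\<^esub> b"])
  qed
  have one: "\<one>\<^bsub>L\<^esub> \<notin> I0"
  proof
    assume "\<one>\<^bsub>L\<^esub> \<in> I0"
    then obtain m as where m: "m \<in> M" "set as \<subseteq> j ` O0" "\<one>\<^bsub>L\<^esub> = m \<oplus>\<^bsub>L\<^esub> y \<otimes>\<^bsub>L\<^esub> ?h y as"
      by (auto simp: I0_def R0_def)
    have asL: "set as \<subseteq> carrier L" using m(2) subringE(1)[OF O0_subring] by blast
    have hL: "?h y as \<in> carrier L" using V.F.horner_closed uf asL by blast
    obtain a where a: "a \<in> carrier K" "\<not> le0 a \<one>\<^bsub>K\<^esub>" "m = j a" using m(1) by (auto simp: M_def)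
    let ?b = "\<one>\<^bsub>K\<^esub> \<ominus>\<^bsub>K\<^esub> a"
    have b: "?b \<in> carrier K" using a by simp
    have bl: "le0 ?b \<one>\<^bsub>K\<^esub>"
    proof (rule ccontr)
      assume "\<not> le0 ?b \<one>\<^bsub>K\<^esub>"
      from V0.lt_add[OF this a(2) b a(1)] have "\<not> le0 (?b \<oplus>\<^bsub>K\<^esub> a) \<one>\<^bsub>K\<^esub>" by simp
      moreover have "?b \<oplus>\<^bsub>K\<^esub> a = \<one>\<^bsub>K\<^esub>" using a by (simp add: a_minus_def V0.F.a_assoc V0.F.l_neg)
      ultimately show False using V0.le_refl by simp
    qed
    then have b0: "?b \<noteq> \<zero>\<^bsub>K\<^esub>" using V0.zero_le[of "\<one>\<^bsub>K\<^esub>"] by auto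
    note bi = V0.inv_facts[OF b b0]
    have "le0 (inv\<^bsub>K\<^esub> ?b \<otimes>\<^bsub>K\<^esub> ?b) (inv\<^bsub>K\<^esub> ?b \<otimes>\<^bsub>K\<^esub> \<one>\<^bsub>K\<^esub>)" by (rule V0.le_mult[OF bl]) (use b bi in auto)
    then have "inv\<^bsub>K\<^esub> ?b \<in> O0" using bi by (simp add: O0_def)
    then have wO: "j (inv\<^bsub>K\<^esub> ?b) \<in> j ` O0" by blast
    let ?w = "j (inv\<^bsub>K\<^esub> ?b)"
    have wL: "?w \<in> carrier L" using bi by simp
    have "j ?b = y \<otimes>\<^bsub>L\<^esub> ?h y as"
    proof -
      have "j ?b = (m \<oplus>\<^bsub>L\<^esub> y \<otimes>\<^bsub>L\<^esub> ?h y as) \<ominus>\<^bsub>L\<^esub> m" using a m(3) by (simp add: a_minus_def)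
      then show ?thesis using hL uf Mcar[OF m(1)]
        by (simp add: a_minus_def V.F.a_ac V.F.r_neg V.F.r_neg1 V.F.r_neg2)
    qed
    moreover have "?w \<otimes>\<^bsub>L\<^esub> j ?b = \<one>\<^bsub>L\<^esub>" using bi(1,4) b by (metis j.hom_mult j.hom_one)
    ultimately have "\<one>\<^bsub>L\<^esub> = y \<otimes>\<^bsub>L\<^esub> (?w \<otimes>\<^bsub>L\<^esub> ?h y as)" using wL hL uf by (simp add: V.F.m_lcomm)
    define bs where "bs = map (\<lambda>c. ?w \<otimes>\<^bsub>L\<^esub> c) as"
    have bs: "set bs \<subseteq> j ` O0" unfolding bs_def using m(2) wO subringE(6)[OF O0_subring] by auto
    have hb: "?h y bs = ?w \<otimes>\<^bsub>L\<^esub> ?h y as" unfolding bs_def by (rule V.F.horner_scale[OF uf(1) wL asL])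
    have hbL: "?h y bs \<in> carrier L" using hb wL hL by simp
    have e1: "\<one>\<^bsub>L\<^esub> = y \<otimes>\<^bsub>L\<^esub> ?h y bs" using \<open>\<one>\<^bsub>L\<^esub> = y \<otimes>\<^bsub>L\<^esub> (?w \<otimes>\<^bsub>L\<^esub> ?h y as)\<close> hb by simp
    obtain k where k: "length bs = Suc k" using e1 uf by (cases bs) auto
    have "length bs \<le> Suc k" using k by simp
    from V.F.horner_inverse[OF u(1) uf(1,3) subringE(1,2,7)[OF O0_subring] bs this]
    obtain ds where ds: "set ds \<subseteq> j ` O0" "length ds \<le> Suc k" "u [^]\<^bsub>L\<^esub> k \<otimes>\<^bsub>L\<^esub> ?h y bs = ?h u ds"
      by auto
    have "u [^]\<^bsub>L\<^esub> Suc k = u [^]\<^bsub>L\<^esub> Suc k \<otimes>\<^bsub>L\<^esub> (y \<otimes>\<^bsub>L\<^esub> ?h y bs)" unfolding e1[symmetric] using u by simp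
    also have "\<dots> = u [^]\<^bsub>L\<^esub> k \<otimes>\<^bsub>L\<^esub> ((u \<otimes>\<^bsub>L\<^esub> y) \<otimes>\<^bsub>L\<^esub> ?h y bs)" using u uf(1) hbL by (simp add: V.F.m_assoc)
    also have "\<dots> = ?h u ds" using ds(3) uf(3) hbL by simp
    finally have eq: "u [^]\<^bsub>L\<^esub> Suc k = ?h u ds" .
    define es where "es = ds @ replicate (Suc k - length ds) \<zero>\<^bsub>L\<^esub>"
    have es: "set es \<subseteq> j ` O0" "length es = Suc k" using ds(1,2) subringE(2)[OF O0_subring] by (auto simp: es_def)
    have "?h u es = ?h u ds"
    proof -
      have "?h u (replicate l \<zero>\<^bsub>L\<^esub>) = \<zero>\<^bsub>L\<^esub>" for l by (induction l) (use u in auto)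
      moreover have dL: "set ds \<subseteq> carrier L" using ds(1) subringE(1)[OF O0_subring] by blast
      moreover have "set (replicate (Suc k - length ds) \<zero>\<^bsub>L\<^esub>) \<subseteq> carrier L" by auto
      ultimately show ?thesis unfolding es_def
        using V.F.horner_append[OF u(1), of ds "replicate (Suc k - length ds) \<zero>\<^bsub>L\<^esub>"] V.F.horner_closed[OF u(1) dL] u(1)
        by simp
    qed
    moreover obtain as' where "set as' \<subseteq> O0" "es = map j as'"
    proof -
      have "\<exists>as'. set as' \<subseteq> O0 \<and> es = map j as'" using es(1)
      proof (induction es)
        case (Cons e es)
        then obtain x as' where "x \<in> O0" "e = j x" "set as' \<subseteq> O0" "es = map j as'" by auto
        then show ?case by (intro exI[of _ "x # as'"]) auto
      qed simp
      then show thesis using that by blast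
    qed
    ultimately show False using no es(2) eq by (metis length_map)
  qed
  have pair: "ring_ideal_pair L R0 I0" unfolding ring_ideal_pair_def
  proof (intro conjI ballI R0 one)
    have "M \<subseteq> R0" using MO OR by blast
    then show "I0 \<subseteq> R0" using yR by (auto simp: I0_def intro!: R0c(4,5))
    have "\<zero>\<^bsub>L\<^esub> = \<zero>\<^bsub>L\<^esub> \<oplus>\<^bsub>L\<^esub> y \<otimes>\<^bsub>L\<^esub> \<zero>\<^bsub>L\<^esub>" using uf(1) by simp
    then show "\<zero>\<^bsub>L\<^esub> \<in> I0" unfolding I0_def using M0 R0c(1) by blast
    fix a assume "a \<in> I0"
    then obtain m r where a: "m \<in> M" "r \<in> R0" "a = m \<oplus>\<^bsub>L\<^esub> y \<otimes>\<^bsub>L\<^esub> r" by (auto simp: I0_def)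
    note aL = Mcar[OF a(1)] R0L[OF a(2)]
    show "a \<oplus>\<^bsub>L\<^esub> b \<in> I0" if "b \<in> I0" for b
    proof -
      from that obtain m' r' where b: "m' \<in> M" "r' \<in> R0" "b = m' \<oplus>\<^bsub>L\<^esub> y \<otimes>\<^bsub>L\<^esub> r'" by (auto simp: I0_def)
      note bL = Mcar[OF b(1)] R0L[OF b(2)]
      have "a \<oplus>\<^bsub>L\<^esub> b = (m \<oplus>\<^bsub>L\<^esub> m') \<oplus>\<^bsub>L\<^esub> y \<otimes>\<^bsub>L\<^esub> (r \<oplus>\<^bsub>L\<^esub> r')"
        unfolding a b using aL bL uf(1) by (simp add: V.F.r_distr V.F.a_ac)
      then show ?thesis unfolding I0_def using Madd[OF a(1) b(1)] R0c(5)[OF a(2) b(2)] by blast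
    qed
    show "s \<otimes>\<^bsub>L\<^esub> a \<in> I0" if "s \<in> R0" for s
    proof -
      from that obtain cs where cs: "set cs \<subseteq> j ` O0" "s = ?h y cs" by (auto simp: R0_def)
      obtain d s' where s: "d \<in> j ` O0" "s' \<in> R0" "s = d \<oplus>\<^bsub>L\<^esub> y \<otimes>\<^bsub>L\<^esub> s'"
      proof (cases cs)
        case Nil
        then have "s = \<zero>\<^bsub>L\<^esub> \<oplus>\<^bsub>L\<^esub> y \<otimes>\<^bsub>L\<^esub> \<zero>\<^bsub>L\<^esub>" using cs uf(1) by simp
        then show thesis using that subringE(2)[OF O0_subring] R0c(1) by blast
      next
        case (Cons c cs')
        then have "?h y cs' \<in> R0" using cs by (auto simp: R0_def)
        then show thesis using that[of c "?h y cs'"] cs Cons by simp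
      qed
      have dR: "d \<in> R0" "m \<in> R0" using s(1) OR MO a(1) by auto
      note sL = R0L[OF dR(1)] R0L[OF s(2)]
      have "s \<otimes>\<^bsub>L\<^esub> a = d \<otimes>\<^bsub>L\<^esub> m \<oplus>\<^bsub>L\<^esub> y \<otimes>\<^bsub>L\<^esub> (d \<otimes>\<^bsub>L\<^esub> r \<oplus>\<^bsub>L\<^esub> s' \<otimes>\<^bsub>L\<^esub> (m \<oplus>\<^bsub>L\<^esub> y \<otimes>\<^bsub>L\<^esub> r))"
        unfolding s(3) a(3) using sL aL uf(1) by (simp add: V.F.r_distr V.F.l_distr V.F.m_ac V.F.a_ac)
      moreover have "d \<otimes>\<^bsub>L\<^esub> r \<oplus>\<^bsub>L\<^esub> s' \<otimes>\<^bsub>L\<^esub> (m \<oplus>\<^bsub>L\<^esub> y \<otimes>\<^bsub>L\<^esub> r) \<in> R0"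
        by (intro R0c(4,5) dR s(2) a(2) yR)
      ultimately show ?thesis unfolding I0_def using Mmult[OF s(1) a(1)] by blast
    qed
  qed
  obtain S I where SI: "ring_ideal_pair L S I" "R0 \<subseteq> S" "I0 \<subseteq> I"
    "\<And>x. x \<in> carrier L \<Longrightarrow> x \<noteq> \<zero>\<^bsub>L\<^esub> \<Longrightarrow> x \<in> S \<or> inv\<^bsub>L\<^esub> x \<in> S"
    using V.F.chevalley[OF pair] by blast
  have mI: "\<one>\<^bsub>L\<^esub> \<notin> I" "\<And>r a. r \<in> S \<Longrightarrow> a \<in> I \<Longrightarrow> r \<otimes>\<^bsub>L\<^esub> a \<in> I" "subring S L"
    using SI(1) by (auto simp: ring_ideal_pair_def)
  have MI: "M \<subseteq> I"
  proof
    fix m assume m: "m \<in> M"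
    then have "m = m \<oplus>\<^bsub>L\<^esub> y \<otimes>\<^bsub>L\<^esub> \<zero>\<^bsub>L\<^esub>" using Mcar uf(1) by simp
    then show "m \<in> I" using m R0c(1) SI(3) unfolding I0_def by blast
  qed
  have vs: "valuation_subring L S"
    by (intro valuation_subring.intro valuation_subring_axioms.intro V.F.field_axioms mI(3) SI(4))
  have "u \<in> S"
  proof (rule valuation_ring_unique[OF vs _ u(1,3,2)])
    fix a assume a: "a \<in> carrier K"
    show "j a \<in> S \<longleftrightarrow> le0 \<one>\<^bsub>K\<^esub> a"
    proof
      assume jS: "j a \<in> S"
      show "le0 \<one>\<^bsub>K\<^esub> a"
      proof (rule ccontr)
        assume n: "\<not> le0 \<one>\<^bsub>K\<^esub> a"
        note i = le0_inv[OF a n]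
        note ii = V0.inv_facts[OF a i(1)]
        have "j (inv\<^bsub>K\<^esub> a) \<in> M" using i(2) ii(1) by (auto simp: M_def)
        then have "j a \<otimes>\<^bsub>L\<^esub> j (inv\<^bsub>K\<^esub> a) \<in> I" using mI(2) jS MI by blast
        moreover have "j a \<otimes>\<^bsub>L\<^esub> j (inv\<^bsub>K\<^esub> a) = \<one>\<^bsub>L\<^esub>" using ii a by (metis j.hom_mult j.hom_one)
        ultimately show False using mI(1) by simp
      qed
    next
      assume "le0 \<one>\<^bsub>K\<^esub> a"
      then show "j a \<in> S" using a OR SI(2) by (auto simp: O0_def)
    qed
  qed
  moreover have "y \<in> I"
  proof -
    have "y = \<zero>\<^bsub>L\<^esub> \<oplus>\<^bsub>L\<^esub> y \<otimes>\<^bsub>L\<^esub> \<one>\<^bsub>L\<^esub>" using uf(1) by simp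
    then show ?thesis using M0 R0c(2) SI(3) unfolding I0_def by blast
  qed
  ultimately have "u \<otimes>\<^bsub>L\<^esub> y \<in> I" using mI(2) by blast
  then show False using uf(3) mI(1) by simp
qed

text \<open>
  As \<open>z\<close> is algebraic over \<open>K\<close>, two terms of an algebraic relation have the same value, so that
  \<open>v(z\<^sup>E) = v\<^sub>0(c)\<close> for some \<open>E > 0\<close> and \<open>c \<in> K\<close>. The element \<open>z\<^sup>E/c\<close> has value \<open>0\<close>, and its equation of
  integral dependence is the desired relation for \<open>z\<close> after clearing \<open>c\<close>; only exponents divisible
  by \<open>E\<close> occur in it.
\<close>

theorem integral_relation:
  assumes z: "z \<in> carrier L" "z \<noteq> \<zero>\<^bsub>L\<^esub>"
    and alg: "set ps \<subseteq> carrier K" "q \<in> set ps" "q \<noteq> \<zero>\<^bsub>K\<^esub>" "V.F.horner z (map j ps) = \<zero>\<^bsub>L\<^esub>"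
  shows "\<exists>N a. (\<forall>i<N. a i \<in> carrier K \<and> le (z [^]\<^bsub>L\<^esub> N) (j (a i) \<otimes>\<^bsub>L\<^esub> z [^]\<^bsub>L\<^esub> i))
     \<and> z [^]\<^bsub>L\<^esub> N = (\<Oplus>\<^bsub>L\<^esub>i\<in>{..<(N::nat)}. j (a i) \<otimes>\<^bsub>L\<^esub> z [^]\<^bsub>L\<^esub> i)"
proof -
  define h where "h i = map j ps ! i \<otimes>\<^bsub>L\<^esub> z [^]\<^bsub>L\<^esub> i" for i :: nat
  have zp: "z [^]\<^bsub>L\<^esub> i \<in> carrier L" "z [^]\<^bsub>L\<^esub> i \<noteq> \<zero>\<^bsub>L\<^esub>" for i :: nat using z V.pow_nonzero by auto
  have psK: "ps ! i \<in> carrier K" if "i < length ps" for i using that alg(1) nth_mem by blast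
  have hL: "h i \<in> carrier L" if "i < length ps" for i using psK[OF that] that zp by (simp add: h_def)
  have "set (map j ps) \<subseteq> carrier L" using alg(1) by auto
  then have "(\<Oplus>\<^bsub>L\<^esub>i\<in>{..<length ps}. h i) = \<zero>\<^bsub>L\<^esub>"
    using V.F.horner_sum[OF z(1), of "map j ps"] alg(4) by (simp add: h_def)
  moreover obtain i0 where i0: "i0 < length ps" "ps ! i0 = q" using alg(2) by (auto simp: in_set_conv_nth)
  have "h i0 \<noteq> \<zero>\<^bsub>L\<^esub>"
    using j_nonzero[of q] psK[OF i0(1)] i0 alg(3) zp by (simp add: h_def V.F.integral_iff)
  ultimately obtain m k where mk: "m < length ps" "k < length ps" "m \<noteq> k" "h m \<noteq> \<zero>\<^bsub>L\<^esub>" "h k \<noteq> \<zero>\<^bsub>L\<^esub>" "le (h m) (h k)" "le (h k) (h m)"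
    using V.vanishing_sum_tie[of "{..<length ps}" h i0] hL i0(1) by auto
  then obtain i k where ik: "i < k" "k < length ps" "h i \<noteq> \<zero>\<^bsub>L\<^esub>" "h k \<noteq> \<zero>\<^bsub>L\<^esub>" "le (h i) (h k)" "le (h k) (h i)"
    by (meson linorder_neqE_nat)
  have p: "ps ! i \<in> carrier K" "ps ! k \<in> carrier K" using psK ik by auto
  have nz: "ps ! i \<noteq> \<zero>\<^bsub>K\<^esub>" "ps ! k \<noteq> \<zero>\<^bsub>K\<^esub>"
    using ik p zp[of i] zp[of k] by (auto simp: h_def)
  define E where "E = k - i"
  have E: "E > 0" "k = i + E" using ik by (auto simp: E_def)
  define c where "c = ps ! i \<otimes>\<^bsub>K\<^esub> inv\<^bsub>K\<^esub> (ps ! k)"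
  note inv = V0.inv_facts[OF p(2) nz(2)]
  have c: "c \<in> carrier K" "c \<noteq> \<zero>\<^bsub>K\<^esub>" using p inv nz by (auto simp: c_def V0.F.integral_iff)
  have pc: "ps ! k \<otimes>\<^bsub>K\<^esub> c = ps ! i" unfolding c_def
    using p inv V0.F.m_lcomm[of "ps ! k" "ps ! i" "inv\<^bsub>K\<^esub> (ps ! k)"] by simp
  define b where "b = j c"
  define x where "x = z [^]\<^bsub>L\<^esub> E"
  have b: "b \<in> carrier L" "b \<noteq> \<zero>\<^bsub>L\<^esub>" using c j_nonzero by (auto simp: b_def)
  have x: "x \<in> carrier L" "x \<noteq> \<zero>\<^bsub>L\<^esub>" using zp by (auto simp: x_def)
  define y where "y = j (ps ! k) \<otimes>\<^bsub>L\<^esub> z [^]\<^bsub>L\<^esub> i"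
  have y: "y \<in> carrier L" "y \<noteq> \<zero>\<^bsub>L\<^esub>" using p zp j_nonzero[OF p(2) nz(2)] by (auto simp: y_def V.F.integral_iff)
  have "h k = y \<otimes>\<^bsub>L\<^esub> x"
    using ik p z zp by (simp add: h_def y_def x_def E(2) V.F.nat_pow_mult[symmetric] V.F.m_assoc)
  moreover have "h i = y \<otimes>\<^bsub>L\<^esub> b"
  proof -
    have "j (ps ! i) = j (ps ! k) \<otimes>\<^bsub>L\<^esub> b" using arg_cong[OF pc, of j] p c by (simp add: b_def)
    then show ?thesis using ik p zp b by (simp add: h_def y_def V.F.m_ac)
  qed
  ultimately have xb: "le x b" "le b x"
    using V.le_cancel[of y x b] V.le_cancel[of y b x] ik x b y by auto
  note bi = V.inv_facts[OF b]
  define u where "u = inv\<^bsub>L\<^esub> b \<otimes>\<^bsub>L\<^esub> x"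
  have u: "u \<in> carrier L" "u \<noteq> \<zero>\<^bsub>L\<^esub>" using bi x by (auto simp: u_def V.F.integral_iff)
  have "le \<one>\<^bsub>L\<^esub> u" using V.le_mult[OF xb(2) b(1) x(1) bi(1)] bi by (simp add: u_def)
  from integral[OF u(1) this u(2)] obtain as where as: "set as \<subseteq> O0" "u [^]\<^bsub>L\<^esub> length as = V.F.horner u (map j as)"
    by blast
  define N where "N = length as"
  have "u \<otimes>\<^bsub>L\<^esub> b = (b \<otimes>\<^bsub>L\<^esub> inv\<^bsub>L\<^esub> b) \<otimes>\<^bsub>L\<^esub> x" unfolding u_def using b(1) bi(1) x(1) by (simp add: V.F.m_ac)
  then have ub: "u \<otimes>\<^bsub>L\<^esub> b = x" using bi(3) x(1) by simp
  have asO: "as ! l \<in> O0" if "l < N" for l using that as(1) nth_mem by (auto simp: N_def)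
  have asK: "as ! l \<in> carrier K" "le \<one>\<^bsub>L\<^esub> (j (as ! l))" if "l < N" for l
    using asO[OF that] le_j[of "\<one>\<^bsub>K\<^esub>" "as ! l"] by (auto simp: O0_def)
  have "set (map j as) \<subseteq> carrier L" using as(1) by (auto simp: O0_def)
  then have uN: "u [^]\<^bsub>L\<^esub> N = (\<Oplus>\<^bsub>L\<^esub>l\<in>{..<N}. map j as ! l \<otimes>\<^bsub>L\<^esub> u [^]\<^bsub>L\<^esub> l)"
    using as(2) V.F.horner_sum[OF u(1), of "map j as"] by (simp add: N_def)
  define t where "t l = j (as ! l \<otimes>\<^bsub>K\<^esub> c [^]\<^bsub>K\<^esub> (N - l)) \<otimes>\<^bsub>L\<^esub> z [^]\<^bsub>L\<^esub> (E * l)" for l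
  have jpow: "j (c [^]\<^bsub>K\<^esub> l) = b [^]\<^bsub>L\<^esub> l" for l :: nat
    unfolding b_def using c by (induction l) auto
  have tt: "t l = j (as ! l) \<otimes>\<^bsub>L\<^esub> (b [^]\<^bsub>L\<^esub> (N - l) \<otimes>\<^bsub>L\<^esub> x [^]\<^bsub>L\<^esub> l)" if "l < N" for l
    using asK[OF that] c b z x by (simp add: t_def jpow x_def V.F.nat_pow_pow V.F.m_assoc)
  have tL: "t l \<in> carrier L" if "l < N" for l using tt[OF that] asK[OF that] b x by simp
  have t_sum: "z [^]\<^bsub>L\<^esub> (E * N) = (\<Oplus>\<^bsub>L\<^esub>l\<in>{..<N}. t l)"
  proof -
    have "z [^]\<^bsub>L\<^esub> (E * N) = b [^]\<^bsub>L\<^esub> N \<otimes>\<^bsub>L\<^esub> u [^]\<^bsub>L\<^esub> N"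
      using z ub u b V.F.nat_pow_distrib[of u b N] by (simp add: V.F.nat_pow_pow[symmetric] x_def[symmetric] V.F.m_comm)
    also have "\<dots> = (\<Oplus>\<^bsub>L\<^esub>l\<in>{..<N}. b [^]\<^bsub>L\<^esub> N \<otimes>\<^bsub>L\<^esub> (map j as ! l \<otimes>\<^bsub>L\<^esub> u [^]\<^bsub>L\<^esub> l))"
      unfolding uN by (rule V.F.finsum_rdistr) (use b u asK in \<open>auto simp: N_def\<close>)
    also have "\<dots> = (\<Oplus>\<^bsub>L\<^esub>l\<in>{..<N}. t l)"
    proof (rule V.F.finsum_cong')
      fix l assume "l \<in> {..<N}"
      then have l: "l < N" by simp
      have "b [^]\<^bsub>L\<^esub> N = b [^]\<^bsub>L\<^esub> (N - l) \<otimes>\<^bsub>L\<^esub> b [^]\<^bsub>L\<^esub> l" using b l by (simp add: V.F.nat_pow_mult)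
      moreover have "x [^]\<^bsub>L\<^esub> l = u [^]\<^bsub>L\<^esub> l \<otimes>\<^bsub>L\<^esub> b [^]\<^bsub>L\<^esub> l" using V.F.nat_pow_distrib[OF u(1) b(1)] ub by simp
      ultimately show "b [^]\<^bsub>L\<^esub> N \<otimes>\<^bsub>L\<^esub> (map j as ! l \<otimes>\<^bsub>L\<^esub> u [^]\<^bsub>L\<^esub> l) = t l"
        using tt[OF l] l asK[OF l] b u by (simp add: N_def V.F.m_ac)
    qed (use tL in auto)
    finally show ?thesis .
  qed
  define a where "a i = (if E dvd i then as ! (i div E) \<otimes>\<^bsub>K\<^esub> c [^]\<^bsub>K\<^esub> (N - i div E) else \<zero>\<^bsub>K\<^esub>)" for i
  have aE: "j (a (E * l)) \<otimes>\<^bsub>L\<^esub> z [^]\<^bsub>L\<^esub> (E * l) = t l" for l using E by (simp add: a_def t_def)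
  have div: "i div E < N" if "i < E * N" for i using that by (simp add: less_mult_imp_div_less mult.commute)
  have aK: "a i \<in> carrier K" if "i < E * N" for i using asK(1)[OF div[OF that]] c by (simp add: a_def)
  have inj: "inj_on (\<lambda>l. E * l) {..<N}" using E by (auto simp: inj_on_def)
  have sub: "(\<lambda>l. E * l) ` {..<N} \<subseteq> {..<E * N}" using E by auto
  have "(\<Oplus>\<^bsub>L\<^esub>i\<in>{..<E * N}. j (a i) \<otimes>\<^bsub>L\<^esub> z [^]\<^bsub>L\<^esub> i) = (\<Oplus>\<^bsub>L\<^esub>i\<in>(\<lambda>l. E * l) ` {..<N}. j (a i) \<otimes>\<^bsub>L\<^esub> z [^]\<^bsub>L\<^esub> i)"
  proof (rule V.F.add.finprod_mono_neutral_cong_right[OF _ sub])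
    show "j (a i) \<otimes>\<^bsub>L\<^esub> z [^]\<^bsub>L\<^esub> i = \<zero>\<^bsub>L\<^esub>" if "i \<in> {..<E * N} - (\<lambda>l. E * l) ` {..<N}" for i
    proof -
      have "\<not> E dvd i"
      proof
        assume "E dvd i"
        then obtain l where l: "i = E * l" by auto
        then have "l < N" using that E by auto
        then show False using that l by auto
      qed
      then show ?thesis using zp by (simp add: a_def)
    qed
  qed (use aK zp in auto)
  also have "\<dots> = (\<Oplus>\<^bsub>L\<^esub>l\<in>{..<N}. j (a (E * l)) \<otimes>\<^bsub>L\<^esub> z [^]\<^bsub>L\<^esub> (E * l))"
    by (rule V.F.finsum_reindex[OF _ inj]) (use aK zp sub in auto)
  finally have "z [^]\<^bsub>L\<^esub> (E * N) = (\<Oplus>\<^bsub>L\<^esub>i\<in>{..<E * N}. j (a i) \<otimes>\<^bsub>L\<^esub> z [^]\<^bsub>L\<^esub> i)"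
    using t_sum by (simp add: aE)
  moreover have "le (z [^]\<^bsub>L\<^esub> (E * N)) (j (a i) \<otimes>\<^bsub>L\<^esub> z [^]\<^bsub>L\<^esub> i)" if i: "i < E * N" for i
  proof (cases "E dvd i")
    case False
    then show ?thesis using zp V.le_zero by (simp add: a_def)
  next
    case True
    then obtain l where l: "i = E * l" by auto
    then have lN: "l < N" using i E by simp
    have "z [^]\<^bsub>L\<^esub> (E * N) = \<one>\<^bsub>L\<^esub> \<otimes>\<^bsub>L\<^esub> (x [^]\<^bsub>L\<^esub> (N - l) \<otimes>\<^bsub>L\<^esub> x [^]\<^bsub>L\<^esub> l)"
    proof -
      have "E * N = E * (N - l) + E * l" using lN by (simp flip: add_mult_distrib2)
      then show ?thesis using z x lN by (simp add: V.F.nat_pow_mult V.F.nat_pow_pow x_def)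
    qed
    moreover have "le (\<one>\<^bsub>L\<^esub> \<otimes>\<^bsub>L\<^esub> (x [^]\<^bsub>L\<^esub> (N - l) \<otimes>\<^bsub>L\<^esub> x [^]\<^bsub>L\<^esub> l)) (j (as ! l) \<otimes>\<^bsub>L\<^esub> (b [^]\<^bsub>L\<^esub> (N - l) \<otimes>\<^bsub>L\<^esub> x [^]\<^bsub>L\<^esub> l))"
      by (intro V.le_mult2 V.le_refl V.le_pow xb asK lN) (use x b asK[OF lN] in auto)
    ultimately show ?thesis unfolding l aE tt[OF lN] by simp
  qed
  ultimately show ?thesis using aK by blast
qed

end

section \<open>Associated graded rings\<close>

locale valued_subring = valued_field F G w for F :: "('a, 'm) ring_scheme" (structure) and G :: "'g ogroup" and w :: "'a \<Rightarrow> 'g" +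
  fixes R :: "'a set"
  assumes R: "subring R F"
begin

abbreviation ge where "ge \<equiv> val_ge F G w R"
abbreviation gt where "gt \<equiv> val_gt F G w R"
abbreviation piece where "piece \<equiv> gr_piece F G w R"
abbreviation GR where "GR \<equiv> gr F G w R"
abbreviation cl where "cl \<gamma> x \<equiv> gt \<gamma> +>\<^bsub>F\<^esub> x"

lemma R_carrier: "x \<in> R \<Longrightarrow> x \<in> carrier F" using subringE(1)[OF R] by blast

lemma ge_carrier: "x \<in> ge \<gamma> \<Longrightarrow> x \<in> carrier F" using R_carrier by (simp add: val_ge_def)

lemma gt_ge: "gt \<gamma> \<subseteq> ge \<gamma>" by (auto simp: val_ge_def val_gt_def)

lemma zero_gt: "\<zero> \<in> gt \<gamma>" using subringE(2)[OF R] by (simp add: val_gt_def)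

lemma zero_ge: "\<zero> \<in> ge \<gamma>" using zero_gt gt_ge by blast

lemma w_uminus: "\<lbrakk>x \<in> carrier F; x \<noteq> \<zero>\<rbrakk> \<Longrightarrow> w (\<ominus> x) = w x"
proof -
  assume x: "x \<in> carrier F" "x \<noteq> \<zero>"
  have n: "\<ominus> x \<noteq> \<zero>" using x by (metis F.minus_minus F.minus_zero)
  have "vle F G w x (\<ominus> x)" using le_uminus[OF le_refl] x by blast
  moreover have "vle F G w (\<ominus> x) x" using le_uminus[OF le_refl, of "\<ominus> x"] x by simp
  ultimately show ?thesis using x n G.leq_antisym w_closed by (auto simp: vle_def)
qed

lemma ge_uminus: "x \<in> ge \<gamma> \<Longrightarrow> \<ominus> x \<in> ge \<gamma>"
  using R_carrier subringE(5)[OF R] w_uminus by (cases "x = \<zero>") (auto simp: val_ge_def)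

lemma gt_uminus: "x \<in> gt \<gamma> \<Longrightarrow> \<ominus> x \<in> gt \<gamma>"
  using R_carrier subringE(5)[OF R] w_uminus by (cases "x = \<zero>") (auto simp: val_gt_def)

lemma lt_trans1: "\<lbrakk>\<gamma> \<in> carrier G; \<alpha> \<in> carrier G; \<beta> \<in> carrier G; \<gamma> \<preceq>\<^bsub>G\<^esub> \<alpha>; \<gamma> \<noteq> \<alpha>; \<alpha> \<preceq>\<^bsub>G\<^esub> \<beta>\<rbrakk> \<Longrightarrow> \<gamma> \<preceq>\<^bsub>G\<^esub> \<beta> \<and> \<beta> \<noteq> \<gamma>"
  using G.leq_trans G.leq_antisym by blast

lemma ge_add: "\<lbrakk>x \<in> ge \<gamma>; y \<in> ge \<gamma>; \<gamma> \<in> carrier G\<rbrakk> \<Longrightarrow> x \<oplus> y \<in> ge \<gamma>"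
proof -
  assume a: "x \<in> ge \<gamma>" "y \<in> ge \<gamma>" "\<gamma> \<in> carrier G"
  note c = ge_carrier[OF a(1)] ge_carrier[OF a(2)]
  have xy: "x \<oplus> y \<in> R" using a subringE(7)[OF R] by (simp add: val_ge_def)
  show ?thesis
  proof (cases "x = \<zero> \<or> y = \<zero> \<or> x \<oplus> y = \<zero>")
    case True
    then show ?thesis using a c xy by (auto simp: val_ge_def)
  next
    case False
    then have "w x \<preceq>\<^bsub>G\<^esub> w (x \<oplus> y) \<or> w y \<preceq>\<^bsub>G\<^esub> w (x \<oplus> y)" using ultra c by blast
    moreover have "\<gamma> \<preceq>\<^bsub>G\<^esub> w x" "\<gamma> \<preceq>\<^bsub>G\<^esub> w y" using a False by (auto simp: val_ge_def)
    ultimately have "\<gamma> \<preceq>\<^bsub>G\<^esub> w (x \<oplus> y)" using G.leq_trans[OF a(3)] w_closed c False by (meson F.a_closed)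
    then show ?thesis using xy by (simp add: val_ge_def)
  qed
qed

lemma gt_add: "\<lbrakk>x \<in> gt \<gamma>; y \<in> gt \<gamma>; \<gamma> \<in> carrier G\<rbrakk> \<Longrightarrow> x \<oplus> y \<in> gt \<gamma>"
proof -
  assume a: "x \<in> gt \<gamma>" "y \<in> gt \<gamma>" "\<gamma> \<in> carrier G"
  have c: "x \<in> carrier F" "y \<in> carrier F" using a gt_ge ge_carrier by blast+
  have xy: "x \<oplus> y \<in> R" using a subringE(7)[OF R] by (simp add: val_gt_def)
  show ?thesis
  proof (cases "x = \<zero> \<or> y = \<zero> \<or> x \<oplus> y = \<zero>")
    case True
    then show ?thesis using a c xy by (auto simp: val_gt_def)
  next
    case False
    then have "w x \<preceq>\<^bsub>G\<^esub> w (x \<oplus> y) \<or> w y \<preceq>\<^bsub>G\<^esub> w (x \<oplus> y)" using ultra c by blast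
    moreover have "\<gamma> \<preceq>\<^bsub>G\<^esub> w x" "\<gamma> \<noteq> w x" "\<gamma> \<preceq>\<^bsub>G\<^esub> w y" "\<gamma> \<noteq> w y" using a False by (auto simp: val_gt_def)
    moreover have "w x \<in> carrier G" "w y \<in> carrier G" "w (x \<oplus> y) \<in> carrier G" using w_closed c False by auto
    ultimately have "\<gamma> \<preceq>\<^bsub>G\<^esub> w (x \<oplus> y) \<and> w (x \<oplus> y) \<noteq> \<gamma>" using lt_trans1 a(3) by blast
    then show ?thesis using xy by (simp add: val_gt_def)
  qed
qed

lemma leq_mult2: "\<lbrakk>\<gamma> \<in> carrier G; \<delta> \<in> carrier G; \<alpha> \<in> carrier G; \<beta> \<in> carrier G; \<gamma> \<preceq>\<^bsub>G\<^esub> \<alpha>; \<delta> \<preceq>\<^bsub>G\<^esub> \<beta>\<rbrakk> \<Longrightarrow> \<gamma> \<otimes>\<^bsub>G\<^esub> \<delta> \<preceq>\<^bsub>G\<^esub> \<alpha> \<otimes>\<^bsub>G\<^esub> \<beta>"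
  using G.leq_mult[of \<delta> \<beta> \<gamma>] G.leq_mult[of \<gamma> \<alpha> \<beta>] G.leq_trans[of "\<gamma> \<otimes>\<^bsub>G\<^esub> \<delta>" "\<gamma> \<otimes>\<^bsub>G\<^esub> \<beta>" "\<alpha> \<otimes>\<^bsub>G\<^esub> \<beta>"]
  by (simp add: G.m_comm)

lemma ge_mult: "\<lbrakk>x \<in> ge \<gamma>; y \<in> ge \<delta>; \<gamma> \<in> carrier G; \<delta> \<in> carrier G\<rbrakk> \<Longrightarrow> x \<otimes> y \<in> ge (\<gamma> \<otimes>\<^bsub>G\<^esub> \<delta>)"
  using R_carrier[of x] R_carrier[of y] subringE(6)[OF R, of x y] w_mult[of x y] leq_mult2 w_closed
  by (cases "x = \<zero>"; cases "y = \<zero>") (auto simp: val_ge_def)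

lemma gt_mult:
  assumes "x \<in> gt \<gamma>" "y \<in> ge \<delta>" "\<gamma> \<in> carrier G" "\<delta> \<in> carrier G"
  shows "x \<otimes> y \<in> gt (\<gamma> \<otimes>\<^bsub>G\<^esub> \<delta>)"
proof -
  have x: "x \<in> ge \<gamma>" using assms gt_ge by blast
  have xy: "x \<otimes> y \<in> ge (\<gamma> \<otimes>\<^bsub>G\<^esub> \<delta>)" using ge_mult x assms by blast
  have c: "x \<in> carrier F" "y \<in> carrier F" using x assms ge_carrier by auto
  show ?thesis
  proof (cases "x \<otimes> y = \<zero>")
    case True then show ?thesis using zero_gt by simp
  next
    case False
    then have nz: "x \<noteq> \<zero>" "y \<noteq> \<zero>" using c by auto
    have "w (x \<otimes> y) \<noteq> \<gamma> \<otimes>\<^bsub>G\<^esub> \<delta>"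
    proof
      assume eq: "w (x \<otimes> y) = \<gamma> \<otimes>\<^bsub>G\<^esub> \<delta>"
      have g: "w x \<in> carrier G" "w y \<in> carrier G" using w_closed c nz by auto
      have l: "\<gamma> \<preceq>\<^bsub>G\<^esub> w x" "w x \<noteq> \<gamma>" "\<delta> \<preceq>\<^bsub>G\<^esub> w y" using assms nz by (auto simp: val_ge_def val_gt_def)
      have e: "w x \<otimes>\<^bsub>G\<^esub> w y = \<gamma> \<otimes>\<^bsub>G\<^esub> \<delta>" using eq w_mult c nz by simp
      have "w x \<otimes>\<^bsub>G\<^esub> \<delta> \<preceq>\<^bsub>G\<^esub> w x \<otimes>\<^bsub>G\<^esub> w y" using G.leq_mult g l assms by blast
      then have "w x \<otimes>\<^bsub>G\<^esub> \<delta> \<preceq>\<^bsub>G\<^esub> \<gamma> \<otimes>\<^bsub>G\<^esub> \<delta>" using e by simp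
      moreover have "\<gamma> \<otimes>\<^bsub>G\<^esub> \<delta> \<preceq>\<^bsub>G\<^esub> w x \<otimes>\<^bsub>G\<^esub> \<delta>" using leq_mult2 leq_refl g l assms by blast
      ultimately have "w x \<otimes>\<^bsub>G\<^esub> \<delta> = \<gamma> \<otimes>\<^bsub>G\<^esub> \<delta>"
        by (intro G.leq_antisym G.m_closed g assms(3,4))
      then show False using g(1) assms(3,4) l(2) G.right_cancel[of \<delta> "w x" \<gamma>] by blast
    qed
    then show ?thesis using xy False by (auto simp: val_ge_def val_gt_def)
  qed
qed

lemma gt_mult': "\<lbrakk>x \<in> ge \<gamma>; y \<in> gt \<delta>; \<gamma> \<in> carrier G; \<delta> \<in> carrier G\<rbrakk> \<Longrightarrow> x \<otimes> y \<in> gt (\<gamma> \<otimes>\<^bsub>G\<^esub> \<delta>)"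
  using gt_mult[of y \<delta> x \<gamma>] ge_carrier gt_ge F.m_comm G.m_comm by (metis subsetD)

lemma gt_subgroup: "\<gamma> \<in> carrier G \<Longrightarrow> abelian_subgroup (gt \<gamma>) F"
proof (intro abelian_subgroupI3 additive_subgroup.intro F.abelian_group_axioms)
  assume \<gamma>: "\<gamma> \<in> carrier G"
  show "subgroup (gt \<gamma>) (add_monoid F)"
  proof (rule F.add.subgroupI)
    show "gt \<gamma> \<subseteq> carrier F" using gt_ge ge_carrier by blast
    show "gt \<gamma> \<noteq> {}" using zero_gt by blast
    show "\<And>a. a \<in> gt \<gamma> \<Longrightarrow> \<ominus> a \<in> gt \<gamma>" by (rule gt_uminus)
    show "\<And>a b. a \<in> gt \<gamma> \<Longrightarrow> b \<in> gt \<gamma> \<Longrightarrow> a \<oplus> b \<in> gt \<gamma>" using gt_add \<gamma> by blast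
  qed
qed

lemma cl_eq_iff:
  assumes "\<gamma> \<in> carrier G" "x \<in> carrier F" "y \<in> carrier F"
  shows "cl \<gamma> x = cl \<gamma> y \<longleftrightarrow> x \<ominus> y \<in> gt \<gamma>"
proof -
  interpret I: abelian_subgroup "gt \<gamma>" F using gt_subgroup assms by blast
  show ?thesis
  proof
    assume "cl \<gamma> x = cl \<gamma> y"
    then have "x \<in> cl \<gamma> y" using I.a_rcos_self assms by blast
    then show "x \<ominus> y \<in> gt \<gamma>" using I.a_rcos_module_minus[OF F.ring_axioms] assms by blast
  next
    assume "x \<ominus> y \<in> gt \<gamma>"
    then have "x \<in> cl \<gamma> y" using I.a_rcos_module_minus[OF F.ring_axioms] assms by blast
    then show "cl \<gamma> x = cl \<gamma> y" using I.a_repr_independence' assms by blast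
  qed
qed

lemma cl_zero: "\<gamma> \<in> carrier G \<Longrightarrow> cl \<gamma> \<zero> = gt \<gamma>"
  using gt_ge ge_carrier by (intro F.a_coset_add_zero) blast

lemma cl_eq_zero: "\<lbrakk>\<gamma> \<in> carrier G; x \<in> carrier F\<rbrakk> \<Longrightarrow> cl \<gamma> x = gt \<gamma> \<longleftrightarrow> x \<in> gt \<gamma>"
  using cl_eq_iff[of \<gamma> x \<zero>] cl_zero by (simp add: a_minus_def)

lemma piece_carrier: "carrier (piece \<gamma>) = (\<lambda>x. cl \<gamma> x) ` ge \<gamma>"
  by (auto simp: gr_piece_def A_FactGroup_def FactGroup_def RCOSETS_def r_coset_def a_r_coset_def)

lemma piece_one: "\<one>\<^bsub>piece \<gamma>\<^esub> = gt \<gamma>"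
  by (simp add: gr_piece_def A_FactGroup_def FactGroup_def)

lemma piece_mult: "\<lbrakk>\<gamma> \<in> carrier G; x \<in> ge \<gamma>; y \<in> ge \<gamma>\<rbrakk> \<Longrightarrow> cl \<gamma> x \<otimes>\<^bsub>piece \<gamma>\<^esub> cl \<gamma> y = cl \<gamma> (x \<oplus> y)"
proof -
  assume a: "\<gamma> \<in> carrier G" "x \<in> ge \<gamma>" "y \<in> ge \<gamma>"
  interpret I: abelian_subgroup "gt \<gamma>" F using gt_subgroup a by blast
  have "cl \<gamma> x \<otimes>\<^bsub>piece \<gamma>\<^esub> cl \<gamma> y = cl \<gamma> x <+>\<^bsub>F\<^esub> cl \<gamma> y"
    by (simp add: gr_piece_def A_FactGroup_def FactGroup_def set_add_def set_mult_def)
  then show ?thesis using I.a_rcos_sum ge_carrier a by simp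
qed

lemma piece_comm_group: "\<gamma> \<in> carrier G \<Longrightarrow> comm_group (piece \<gamma>)"
proof -
  assume \<gamma>: "\<gamma> \<in> carrier G"
  note z = ge_carrier
  show ?thesis
  proof (rule comm_groupI)
    show "x \<otimes>\<^bsub>piece \<gamma>\<^esub> y \<in> carrier (piece \<gamma>)" if "x \<in> carrier (piece \<gamma>)" "y \<in> carrier (piece \<gamma>)" for x y
      using that \<gamma> by (auto simp: piece_carrier piece_mult ge_add)
    show "\<one>\<^bsub>piece \<gamma>\<^esub> \<in> carrier (piece \<gamma>)" using imageI[OF zero_ge, of "cl \<gamma>" \<gamma>] by (simp add: piece_one piece_carrier cl_zero \<gamma>)
    show "x \<otimes>\<^bsub>piece \<gamma>\<^esub> y \<otimes>\<^bsub>piece \<gamma>\<^esub> t = x \<otimes>\<^bsub>piece \<gamma>\<^esub> (y \<otimes>\<^bsub>piece \<gamma>\<^esub> t)"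
      if "x \<in> carrier (piece \<gamma>)" "y \<in> carrier (piece \<gamma>)" "t \<in> carrier (piece \<gamma>)" for x y t
      using that \<gamma> z by (auto simp: piece_carrier piece_mult ge_add F.a_assoc)
    show "x \<otimes>\<^bsub>piece \<gamma>\<^esub> y = y \<otimes>\<^bsub>piece \<gamma>\<^esub> x" if "x \<in> carrier (piece \<gamma>)" "y \<in> carrier (piece \<gamma>)" for x y
      using that \<gamma> z by (auto simp: piece_carrier piece_mult F.a_comm)
    show "\<one>\<^bsub>piece \<gamma>\<^esub> \<otimes>\<^bsub>piece \<gamma>\<^esub> x = x" if "x \<in> carrier (piece \<gamma>)" for x
    proof -
      from that obtain a where a: "a \<in> ge \<gamma>" "x = cl \<gamma> a" by (auto simp: piece_carrier)
      then show ?thesis using piece_mult[OF \<gamma> zero_ge a(1)] cl_zero[OF \<gamma>] z by (simp add: piece_one)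
    qed
    show "\<exists>y\<in>carrier (piece \<gamma>). y \<otimes>\<^bsub>piece \<gamma>\<^esub> x = \<one>\<^bsub>piece \<gamma>\<^esub>" if "x \<in> carrier (piece \<gamma>)" for x
    proof -
      from that obtain a where a: "a \<in> ge \<gamma>" "x = cl \<gamma> a" by (auto simp: piece_carrier)
      then have "cl \<gamma> (\<ominus> a) \<otimes>\<^bsub>piece \<gamma>\<^esub> x = \<one>\<^bsub>piece \<gamma>\<^esub>"
        using \<gamma> z ge_uminus by (simp add: piece_mult F.l_neg piece_one cl_zero)
      then show ?thesis using a ge_uminus by (auto simp: piece_carrier)
    qed
  qed
qed

lemma piece_finprod:
  "\<lbrakk>\<gamma> \<in> carrier G; finite I; \<And>i. i \<in> I \<Longrightarrow> x i \<in> ge \<gamma>\<rbrakk> \<Longrightarrow>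
    (\<Oplus>i\<in>I. x i) \<in> ge \<gamma> \<and> finprod (piece \<gamma>) (\<lambda>i. cl \<gamma> (x i)) I = cl \<gamma> (\<Oplus>i\<in>I. x i)"
proof (induction I rule: infinite_finite_induct)
  case empty
  interpret p: comm_group "piece \<gamma>" using piece_comm_group empty by blast
  show ?case using zero_ge cl_zero[OF empty(1)] by (simp add: piece_one)
next
  case (insert i I)
  interpret p: comm_group "piece \<gamma>" using piece_comm_group insert by blast
  have IH: "(\<Oplus>i\<in>I. x i) \<in> ge \<gamma>" "finprod (piece \<gamma>) (\<lambda>i. cl \<gamma> (x i)) I = cl \<gamma> (\<Oplus>i\<in>I. x i)" using insert by auto
  have "(\<Oplus>i\<in>insert i I. x i) = x i \<oplus> (\<Oplus>i\<in>I. x i)" by (rule F.finsum_insert) (use insert ge_carrier in auto)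
  moreover have "finprod (piece \<gamma>) (\<lambda>i. cl \<gamma> (x i)) (insert i I) = cl \<gamma> (x i) \<otimes>\<^bsub>piece \<gamma>\<^esub> finprod (piece \<gamma>) (\<lambda>i. cl \<gamma> (x i)) I"
    by (rule p.finprod_insert) (use insert in \<open>auto simp: piece_carrier\<close>)
  ultimately show ?case using IH insert ge_add piece_mult by simp
qed simp

lemma rcoset_mult_cl:
  assumes "\<alpha> \<in> carrier G" "\<beta> \<in> carrier G" "x \<in> ge \<alpha>" "y \<in> ge \<beta>"
  shows "rcoset_mult F (gt (\<alpha> \<otimes>\<^bsub>G\<^esub> \<beta>)) (cl \<alpha> x) (cl \<beta> y) = cl (\<alpha> \<otimes>\<^bsub>G\<^esub> \<beta>) (x \<otimes> y)"
proof -
  have xy: "x \<in> carrier F" "y \<in> carrier F" using assms ge_carrier by auto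
  have eq: "cl (\<alpha> \<otimes>\<^bsub>G\<^esub> \<beta>) (a \<otimes> b) = cl (\<alpha> \<otimes>\<^bsub>G\<^esub> \<beta>) (x \<otimes> y)" if ab: "a \<in> cl \<alpha> x" "b \<in> cl \<beta> y" for a b
  proof -
    obtain s t where s: "s \<in> gt \<alpha>" "a = s \<oplus> x" and t: "t \<in> gt \<beta>" "b = t \<oplus> y"
      using ab by (auto simp: a_r_coset_def')
    have c: "s \<in> carrier F" "t \<in> carrier F" using s t gt_ge ge_carrier by blast+
    have "s \<otimes> t \<oplus> (s \<otimes> y \<oplus> x \<otimes> t) \<in> gt (\<alpha> \<otimes>\<^bsub>G\<^esub> \<beta>)"
      using gt_add[OF gt_mult[OF s(1) subsetD[OF gt_ge t(1)] assms(1,2)]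
          gt_add[OF gt_mult[OF s(1) assms(4,1,2)] gt_mult'[OF assms(3) t(1) assms(1,2)]]] assms(1,2) by simp
    moreover have "a \<otimes> b \<ominus> x \<otimes> y = s \<otimes> t \<oplus> (s \<otimes> y \<oplus> x \<otimes> t)"
      unfolding s t using c xy by (simp add: F.l_distr F.r_distr a_minus_def F.a_ac F.r_neg F.r_neg1 F.r_neg2)
    ultimately show ?thesis using cl_eq_iff[of "\<alpha> \<otimes>\<^bsub>G\<^esub> \<beta>" "a \<otimes> b" "x \<otimes> y"] assms xy c s t by simp
  qed
  interpret I: abelian_subgroup "gt \<alpha>" F using gt_subgroup assms by blast
  interpret J: abelian_subgroup "gt \<beta>" F using gt_subgroup assms by blast
  have "x \<in> cl \<alpha> x" "y \<in> cl \<beta> y" using I.a_rcos_self J.a_rcos_self xy by auto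
  then show ?thesis unfolding rcoset_mult_def using eq by blast
qed

text \<open>
  A family of cosets is handled through a family of representatives, on which sums and products
  can be computed in the field.
\<close>

definition rep :: "('g \<Rightarrow> 'a set) \<Rightarrow> ('g \<Rightarrow> 'a) \<Rightarrow> bool" where
  "rep h x \<longleftrightarrow> (\<forall>\<alpha>\<in>carrier G. x \<alpha> \<in> ge \<alpha> \<and> h \<alpha> = cl \<alpha> (x \<alpha>))"

lemma GR_carrier: "carrier GR = {h \<in> (\<Pi>\<^sub>E \<alpha>\<in>carrier G. carrier (piece \<alpha>)). finite {\<alpha> \<in> carrier G. h \<alpha> \<noteq> gt \<alpha>}}"
proof -
  have "group (piece \<gamma>)" if "\<gamma> \<in> carrier G" for \<gamma> using piece_comm_group[OF that] comm_group.axioms(2) by blast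
  then show ?thesis by (simp add: gr_def carrier_sum_group piece_one)
qed

lemma rep_exists: "h \<in> carrier GR \<Longrightarrow> \<exists>x. rep h x"
proof -
  assume "h \<in> carrier GR"
  then have "\<forall>\<alpha>\<in>carrier G. \<exists>x\<in>ge \<alpha>. h \<alpha> = cl \<alpha> x" by (auto simp: GR_carrier piece_carrier PiE_def Pi_def)
  then obtain x where "\<forall>\<alpha>\<in>carrier G. x \<alpha> \<in> ge \<alpha> \<and> h \<alpha> = cl \<alpha> (x \<alpha>)" by metis
  then show ?thesis unfolding rep_def by blast
qed

lemma GR_eqI: "\<lbrakk>h \<in> carrier GR; k \<in> carrier GR; \<And>\<alpha>. \<alpha> \<in> carrier G \<Longrightarrow> h \<alpha> = k \<alpha>\<rbrakk> \<Longrightarrow> h = k"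
  by (auto simp: GR_carrier intro: PiE_ext)

lemma GR_zero: "\<alpha> \<in> carrier G \<Longrightarrow> \<zero>\<^bsub>GR\<^esub> \<alpha> = gt \<alpha>" by (simp add: gr_def)

lemma GR_add: "\<alpha> \<in> carrier G \<Longrightarrow> (h \<oplus>\<^bsub>GR\<^esub> k) \<alpha> = h \<alpha> \<otimes>\<^bsub>piece \<alpha>\<^esub> k \<alpha>" by (simp add: gr_def)

lemma GR_add_rep: "\<lbrakk>rep h x; rep k y\<rbrakk> \<Longrightarrow> rep (h \<oplus>\<^bsub>GR\<^esub> k) (\<lambda>\<alpha>. x \<alpha> \<oplus> y \<alpha>)"
  by (auto simp: rep_def GR_add piece_mult ge_add)

lemma GR_abelian_group: "abelian_group GR"
proof -
  have gp: "group (piece \<gamma>)" if "\<gamma> \<in> carrier G" for \<gamma> using piece_comm_group[OF that] comm_group.axioms(2) by blast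
  have sg: "group (sum_group (carrier G) piece)" using gp by simp
  interpret S: group "sum_group (carrier G) piece" by (rule sg)
  have cS: "carrier GR = carrier (sum_group (carrier G) piece)" by (simp add: gr_def)
  have aS: "x \<oplus>\<^bsub>GR\<^esub> y = x \<otimes>\<^bsub>sum_group (carrier G) piece\<^esub> y" for x y by (simp add: gr_def)
  have zS: "\<zero>\<^bsub>GR\<^esub> = \<one>\<^bsub>sum_group (carrier G) piece\<^esub>" by (simp add: gr_def piece_one restrict_def fun_eq_iff)
  show ?thesis
  proof (rule abelian_groupI)
    show "\<And>x y. x \<in> carrier GR \<Longrightarrow> y \<in> carrier GR \<Longrightarrow> x \<oplus>\<^bsub>GR\<^esub> y \<in> carrier GR"
      unfolding cS aS by (rule S.m_closed)
    show "\<zero>\<^bsub>GR\<^esub> \<in> carrier GR" unfolding cS zS by (rule S.one_closed)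
    show "\<And>x y z. x \<in> carrier GR \<Longrightarrow> y \<in> carrier GR \<Longrightarrow> z \<in> carrier GR \<Longrightarrow> x \<oplus>\<^bsub>GR\<^esub> y \<oplus>\<^bsub>GR\<^esub> z = x \<oplus>\<^bsub>GR\<^esub> (y \<oplus>\<^bsub>GR\<^esub> z)"
      unfolding cS aS by (rule S.m_assoc)
    show "\<And>x. x \<in> carrier GR \<Longrightarrow> \<zero>\<^bsub>GR\<^esub> \<oplus>\<^bsub>GR\<^esub> x = x" unfolding cS aS zS by (rule S.l_one)
    show "\<And>x. x \<in> carrier GR \<Longrightarrow> \<exists>y\<in>carrier GR. y \<oplus>\<^bsub>GR\<^esub> x = \<zero>\<^bsub>GR\<^esub>" unfolding cS aS zS by (rule S.l_inv_ex)
    fix x y assume "x \<in> carrier GR" "y \<in> carrier GR"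
    then show "x \<oplus>\<^bsub>GR\<^esub> y = y \<oplus>\<^bsub>GR\<^esub> x"
      unfolding aS using comm_groupE(4)[OF piece_comm_group] by (auto simp: GR_carrier PiE_def Pi_def fun_eq_iff restrict_def)
  qed
qed

text \<open>
  The set \<open>A\<close> may be any finite set that contains the support of \<open>h\<close>. This makes products of several
  elements comparable, although the definition of the product sums over supports that depend on
  both factors.
\<close>

lemma gr_mult_rep:
  assumes h: "rep h x" and k: "rep k y" and A: "finite A" "A \<subseteq> carrier G" "\<And>\<alpha>. \<alpha> \<in> carrier G - A \<Longrightarrow> h \<alpha> = gt \<alpha>"
    and \<gamma>: "\<gamma> \<in> carrier G"
  shows "(\<Oplus>\<alpha>\<in>A. x \<alpha> \<otimes> y (inv\<^bsub>G\<^esub> \<alpha> \<otimes>\<^bsub>G\<^esub> \<gamma>)) \<in> ge \<gamma>"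
    "(h \<otimes>\<^bsub>GR\<^esub> k) \<gamma> = cl \<gamma> (\<Oplus>\<alpha>\<in>A. x \<alpha> \<otimes> y (inv\<^bsub>G\<^esub> \<alpha> \<otimes>\<^bsub>G\<^esub> \<gamma>))"
proof -
  interpret p: comm_group "piece \<gamma>" using piece_comm_group \<gamma> by blast
  let ?t = "\<lambda>\<alpha>. x \<alpha> \<otimes> y (inv\<^bsub>G\<^esub> \<alpha> \<otimes>\<^bsub>G\<^esub> \<gamma>)"
  let ?S = "{\<alpha> \<in> carrier G. h \<alpha> \<noteq> gt \<alpha> \<and> k (inv\<^bsub>G\<^esub> \<alpha> \<otimes>\<^bsub>G\<^esub> \<gamma>) \<noteq> gt (inv\<^bsub>G\<^esub> \<alpha> \<otimes>\<^bsub>G\<^esub> \<gamma>)}"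
  have ab: "\<alpha> \<otimes>\<^bsub>G\<^esub> (inv\<^bsub>G\<^esub> \<alpha> \<otimes>\<^bsub>G\<^esub> \<gamma>) = \<gamma>" if "\<alpha> \<in> carrier G" for \<alpha>
    using that \<gamma> by (simp flip: G.m_assoc)
  have t: "?t \<alpha> \<in> ge \<gamma>" "rcoset_mult F (gt \<gamma>) (h \<alpha>) (k (inv\<^bsub>G\<^esub> \<alpha> \<otimes>\<^bsub>G\<^esub> \<gamma>)) = cl \<gamma> (?t \<alpha>)"
    "\<alpha> \<notin> ?S \<Longrightarrow> cl \<gamma> (?t \<alpha>) = gt \<gamma>" if \<alpha>: "\<alpha> \<in> carrier G" for \<alpha>
  proof -
    let ?b = "inv\<^bsub>G\<^esub> \<alpha> \<otimes>\<^bsub>G\<^esub> \<gamma>"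
    have b: "?b \<in> carrier G" using \<alpha> \<gamma> by simp
    have x: "x \<alpha> \<in> ge \<alpha>" "h \<alpha> = cl \<alpha> (x \<alpha>)" using h \<alpha> by (auto simp: rep_def)
    have y: "y ?b \<in> ge ?b" "k ?b = cl ?b (y ?b)" using k b by (auto simp: rep_def)
    show "?t \<alpha> \<in> ge \<gamma>" using ge_mult[OF x(1) y(1) \<alpha> b] ab[OF \<alpha>] by simp
    show "rcoset_mult F (gt \<gamma>) (h \<alpha>) (k ?b) = cl \<gamma> (?t \<alpha>)"
      using rcoset_mult_cl[OF \<alpha> b x(1) y(1)] ab[OF \<alpha>] x(2) y(2) by simp
    assume "\<alpha> \<notin> ?S"
    then have "x \<alpha> \<in> gt \<alpha> \<or> y ?b \<in> gt ?b"
      using x y \<alpha> b cl_eq_zero ge_carrier by auto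
    then have "?t \<alpha> \<in> gt \<gamma>" using gt_mult[of "x \<alpha>" \<alpha> "y ?b" ?b] gt_mult'[of "x \<alpha>" \<alpha> "y ?b" ?b] x y \<alpha> b ab[OF \<alpha>] by auto
    then show "cl \<gamma> (?t \<alpha>) = gt \<gamma>" using cl_eq_zero \<gamma> gt_ge ge_carrier by blast
  qed
  have SA: "?S \<subseteq> A" using A by blast
  have f: "(\<Oplus>\<alpha>\<in>A. ?t \<alpha>) \<in> ge \<gamma> \<and> finprod (piece \<gamma>) (\<lambda>\<alpha>. cl \<gamma> (?t \<alpha>)) A = cl \<gamma> (\<Oplus>\<alpha>\<in>A. ?t \<alpha>)"
    by (rule piece_finprod[OF \<gamma> A(1)]) (use t A in blast)
  then show "(\<Oplus>\<alpha>\<in>A. ?t \<alpha>) \<in> ge \<gamma>" by blast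
  have "(h \<otimes>\<^bsub>GR\<^esub> k) \<gamma> = finprod (piece \<gamma>) (\<lambda>\<alpha>. rcoset_mult F (gt \<gamma>) (h \<alpha>) (k (inv\<^bsub>G\<^esub> \<alpha> \<otimes>\<^bsub>G\<^esub> \<gamma>))) ?S"
    using \<gamma> by (simp add: gr_def gr_mult_def)
  also have "\<dots> = finprod (piece \<gamma>) (\<lambda>\<alpha>. cl \<gamma> (?t \<alpha>)) A"
  proof (rule p.finprod_mono_neutral_cong_left[OF A(1) SA])
    show "cl \<gamma> (?t i) = \<one>\<^bsub>piece \<gamma>\<^esub>" if "i \<in> A - ?S" for i
      using t(3)[of i] that A(2) unfolding piece_one by blast
    show "rcoset_mult F (gt \<gamma>) (h i) (k (inv\<^bsub>G\<^esub> i \<otimes>\<^bsub>G\<^esub> \<gamma>)) = cl \<gamma> (?t i)" if "i \<in> ?S" for i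
      using t(2)[of i] that by blast
    show "(\<lambda>\<alpha>. cl \<gamma> (?t \<alpha>)) \<in> A \<rightarrow> carrier (piece \<gamma>)"
      using t(1) A(2) by (auto simp: piece_carrier)
  qed
  finally show "(h \<otimes>\<^bsub>GR\<^esub> k) \<gamma> = cl \<gamma> (\<Oplus>\<alpha>\<in>A. ?t \<alpha>)" using f by simp
qed

definition homog :: "'g \<Rightarrow> 'a \<Rightarrow> 'g \<Rightarrow> 'a set" where
  "homog \<gamma> x = (\<lambda>\<alpha>\<in>carrier G. if \<alpha> = \<gamma> then cl \<gamma> x else gt \<alpha>)"

lemma homog_rep: "\<lbrakk>\<gamma> \<in> carrier G; x \<in> ge \<gamma>\<rbrakk> \<Longrightarrow> rep (homog \<gamma> x) (\<lambda>\<alpha>. if \<alpha> = \<gamma> then x else \<zero>)"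
  by (auto simp: rep_def homog_def zero_ge cl_zero)

lemma homog_closed: "\<lbrakk>\<gamma> \<in> carrier G; x \<in> ge \<gamma>\<rbrakk> \<Longrightarrow> homog \<gamma> x \<in> carrier GR"
proof -
  assume a: "\<gamma> \<in> carrier G" "x \<in> ge \<gamma>"
  have "gt \<alpha> \<in> carrier (piece \<alpha>)" if "\<alpha> \<in> carrier G" for \<alpha>
    using cl_zero[OF that] zero_ge by (force simp: piece_carrier)
  moreover have "finite {\<alpha> \<in> carrier G. homog \<gamma> x \<alpha> \<noteq> gt \<alpha>}"
    by (rule finite_subset[of _ "{\<gamma>}"]) (auto simp: homog_def)
  ultimately show ?thesis using a by (auto simp: GR_carrier homog_def piece_carrier)
qed

lemma homog_add: "\<lbrakk>\<gamma> \<in> carrier G; x \<in> ge \<gamma>; y \<in> ge \<gamma>\<rbrakk> \<Longrightarrow> homog \<gamma> (x \<oplus> y) = homog \<gamma> x \<oplus>\<^bsub>GR\<^esub> homog \<gamma> y"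
proof -
  assume a: "\<gamma> \<in> carrier G" "x \<in> ge \<gamma>" "y \<in> ge \<gamma>"
  interpret A: abelian_group GR by (rule GR_abelian_group)
  show ?thesis
  proof (rule GR_eqI)
    fix \<alpha> assume \<alpha>: "\<alpha> \<in> carrier G"
    interpret p: comm_group "piece \<alpha>" using piece_comm_group[OF \<alpha>] .
    have "gt \<alpha> \<otimes>\<^bsub>piece \<alpha>\<^esub> gt \<alpha> = gt \<alpha>" using p.l_one[OF p.one_closed] by (simp add: piece_one)
    then show "homog \<gamma> (x \<oplus> y) \<alpha> = (homog \<gamma> x \<oplus>\<^bsub>GR\<^esub> homog \<gamma> y) \<alpha>"
      using \<alpha> a by (auto simp: GR_add homog_def piece_mult)
  qed (use a homog_closed ge_add in auto)
qed

lemma homog_zero: "\<lbrakk>\<gamma> \<in> carrier G; x \<in> gt \<gamma>\<rbrakk> \<Longrightarrow> homog \<gamma> x = \<zero>\<^bsub>GR\<^esub>"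
proof -
  assume a: "\<gamma> \<in> carrier G" "x \<in> gt \<gamma>"
  then have "x \<in> carrier F" using gt_ge ge_carrier by blast
  then have "cl \<gamma> x = gt \<gamma>" using cl_eq_zero a by blast
  then show ?thesis by (simp add: homog_def gr_def restrict_def fun_eq_iff)
qed

text \<open>
  Every element is a finite sum of homogeneous ones. Identities that are additive in each
  variable therefore only have to be checked on homogeneous elements.
\<close>

lemma GR_induct [consumes 1, case_names zero homog add]:
  assumes "h \<in> carrier GR" and "P \<zero>\<^bsub>GR\<^esub>" and hm: "\<And>\<gamma> x. \<gamma> \<in> carrier G \<Longrightarrow> x \<in> ge \<gamma> \<Longrightarrow> P (homog \<gamma> x)"
    and add: "\<And>h k. h \<in> carrier GR \<Longrightarrow> k \<in> carrier GR \<Longrightarrow> P h \<Longrightarrow> P k \<Longrightarrow> P (h \<oplus>\<^bsub>GR\<^esub> k)"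
  shows "P h"
  using assms(1)
proof (induction "card {\<alpha> \<in> carrier G. h \<alpha> \<noteq> gt \<alpha>}" arbitrary: h)
  case 0
  interpret A: abelian_group GR by (rule GR_abelian_group)
  have "{\<alpha> \<in> carrier G. h \<alpha> \<noteq> gt \<alpha>} = {}" using 0 by (simp add: GR_carrier)
  then have "h = \<zero>\<^bsub>GR\<^esub>" using 0 by (intro GR_eqI) (auto simp: GR_zero)
  then show ?case using assms(2) by simp
next
  case (Suc n)
  interpret A: abelian_group GR by (rule GR_abelian_group)
  let ?S = "{\<alpha> \<in> carrier G. h \<alpha> \<noteq> gt \<alpha>}"
  have "card ?S \<noteq> 0" using Suc(2) by simp
  then have "?S \<noteq> {}" by (intro notI) simp
  then obtain \<gamma> where \<gamma>: "\<gamma> \<in> carrier G" "h \<gamma> \<noteq> gt \<gamma>" by blast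
  obtain x where x: "x \<in> ge \<gamma>" "h \<gamma> = cl \<gamma> x" using rep_exists[OF Suc(3)] \<gamma> by (auto simp: rep_def)
  define k where "k = h(\<gamma> := gt \<gamma>)"
  have fin: "finite ?S" using Suc(3) by (simp add: GR_carrier)
  have sk: "{\<alpha> \<in> carrier G. k \<alpha> \<noteq> gt \<alpha>} = ?S - {\<gamma>}" by (auto simp: k_def)
  have "gt \<gamma> \<in> carrier (piece \<gamma>)" using cl_zero[OF \<gamma>(1)] zero_ge by (force simp: piece_carrier)
  then have k: "k \<in> carrier GR" using Suc(3) \<gamma> fin sk by (auto simp: GR_carrier k_def PiE_def Pi_def extensional_def)
  have "card (?S - {\<gamma>}) = n" using Suc(2) \<gamma> fin by simp
  then have Pk: "P k" using Suc(1)[of k] k sk by simp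
  have "h = homog \<gamma> x \<oplus>\<^bsub>GR\<^esub> k"
  proof (rule GR_eqI[OF Suc(3)])
    fix \<alpha> assume \<alpha>: "\<alpha> \<in> carrier G"
    interpret p: comm_group "piece \<alpha>" using piece_comm_group[OF \<alpha>] .
    have "h \<alpha> \<in> carrier (piece \<alpha>)" using Suc(3) \<alpha> by (auto simp: GR_carrier)
    then have "gt \<alpha> \<otimes>\<^bsub>piece \<alpha>\<^esub> h \<alpha> = h \<alpha>" "h \<alpha> \<otimes>\<^bsub>piece \<alpha>\<^esub> gt \<alpha> = h \<alpha>"
      using p.l_one p.r_one by (simp_all add: piece_one)
    then show "h \<alpha> = (homog \<gamma> x \<oplus>\<^bsub>GR\<^esub> k) \<alpha>" using \<alpha> x by (auto simp: GR_add homog_def k_def)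
  qed (use \<gamma> x k homog_closed in auto)
  moreover have "P (homog \<gamma> x \<oplus>\<^bsub>GR\<^esub> k)"
    by (rule add[OF homog_closed[OF \<gamma>(1) x(1)] k hm[OF \<gamma>(1) x(1)] Pk])
  ultimately show ?case by simp
qed

lemma GR_one: "\<one>\<^bsub>GR\<^esub> = homog \<one>\<^bsub>G\<^esub> \<one>"
  by (auto simp: gr_def homog_def restrict_def fun_eq_iff)

lemma one_ge: "\<one> \<in> ge \<one>\<^bsub>G\<^esub>"
  using subringE(3)[OF R] leq_refl[OF G.one_closed] by (simp add: val_ge_def w_one)

lemma homog_mult_value:
  assumes \<gamma>: "\<gamma> \<in> carrier G" "x \<in> ge \<gamma>" and k: "rep k y" and \<delta>: "\<delta> \<in> carrier G"
  shows "(homog \<gamma> x \<otimes>\<^bsub>GR\<^esub> k) \<delta> = cl \<delta> (x \<otimes> y (inv\<^bsub>G\<^esub> \<gamma> \<otimes>\<^bsub>G\<^esub> \<delta>))"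
proof -
  have "y (inv\<^bsub>G\<^esub> \<gamma> \<otimes>\<^bsub>G\<^esub> \<delta>) \<in> carrier F" using k \<gamma> \<delta> ge_carrier by (auto simp: rep_def)
  then have s: "(\<Oplus>\<alpha>\<in>{\<gamma>}. (if \<alpha> = \<gamma> then x else \<zero>) \<otimes> y (inv\<^bsub>G\<^esub> \<alpha> \<otimes>\<^bsub>G\<^esub> \<delta>)) = x \<otimes> y (inv\<^bsub>G\<^esub> \<gamma> \<otimes>\<^bsub>G\<^esub> \<delta>)"
    using ge_carrier[OF \<gamma>(2)] by simp
  have "(homog \<gamma> x \<otimes>\<^bsub>GR\<^esub> k) \<delta> = cl \<delta> (\<Oplus>\<alpha>\<in>{\<gamma>}. (if \<alpha> = \<gamma> then x else \<zero>) \<otimes> y (inv\<^bsub>G\<^esub> \<alpha> \<otimes>\<^bsub>G\<^esub> \<delta>))"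
    by (rule gr_mult_rep(2)[OF homog_rep[OF \<gamma>] k _ _ _ \<delta>]) (use \<gamma> in \<open>auto simp: homog_def\<close>)
  then show ?thesis unfolding s .
qed

lemma GR_mult_outside: "\<alpha> \<notin> carrier G \<Longrightarrow> (h \<otimes>\<^bsub>GR\<^esub> k) \<alpha> = undefined"
  by (simp add: gr_def gr_mult_def)

lemma homog_mult:
  assumes \<gamma>: "\<gamma> \<in> carrier G" "x \<in> ge \<gamma>" and \<delta>: "\<delta> \<in> carrier G" "y \<in> ge \<delta>"
  shows "homog \<gamma> x \<otimes>\<^bsub>GR\<^esub> homog \<delta> y = homog (\<gamma> \<otimes>\<^bsub>G\<^esub> \<delta>) (x \<otimes> y)"
proof
  fix \<alpha>
  have xF: "x \<in> carrier F" using \<gamma> ge_carrier by blast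
  show "(homog \<gamma> x \<otimes>\<^bsub>GR\<^esub> homog \<delta> y) \<alpha> = homog (\<gamma> \<otimes>\<^bsub>G\<^esub> \<delta>) (x \<otimes> y) \<alpha>"
  proof (cases "\<alpha> \<in> carrier G")
    case True
    have "inv\<^bsub>G\<^esub> \<gamma> \<otimes>\<^bsub>G\<^esub> \<alpha> = \<delta> \<longleftrightarrow> \<alpha> = \<gamma> \<otimes>\<^bsub>G\<^esub> \<delta>" using G.inv_solve_left'[of \<delta> \<gamma> \<alpha>] \<gamma> \<delta> True by auto
    then show ?thesis
      unfolding homog_mult_value[OF \<gamma> homog_rep[OF \<delta>] True] using True xF cl_zero by (auto simp: homog_def)
  qed (simp add: GR_mult_outside homog_def)
qed

lemma GR_mult_closed:
  assumes "h \<in> carrier GR" "k \<in> carrier GR"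
  shows "h \<otimes>\<^bsub>GR\<^esub> k \<in> carrier GR"
proof -
  obtain x y where x: "rep h x" and y: "rep k y" using rep_exists assms by blast
  let ?A = "{\<alpha> \<in> carrier G. h \<alpha> \<noteq> gt \<alpha>}" and ?B = "{\<alpha> \<in> carrier G. k \<alpha> \<noteq> gt \<alpha>}"
  have fin: "finite ?A" "finite ?B" using assms by (auto simp: GR_carrier)
  have "{\<gamma> \<in> carrier G. (h \<otimes>\<^bsub>GR\<^esub> k) \<gamma> \<noteq> gt \<gamma>} \<subseteq> (\<lambda>(\<alpha>, \<beta>). \<alpha> \<otimes>\<^bsub>G\<^esub> \<beta>) ` (?A \<times> ?B)"
  proof
    fix \<gamma> assume "\<gamma> \<in> {\<gamma> \<in> carrier G. (h \<otimes>\<^bsub>GR\<^esub> k) \<gamma> \<noteq> gt \<gamma>}"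
    then have \<gamma>: "\<gamma> \<in> carrier G" "(h \<otimes>\<^bsub>GR\<^esub> k) \<gamma> \<noteq> gt \<gamma>" by auto
    interpret p: comm_group "piece \<gamma>" using piece_comm_group[OF \<gamma>(1)] .
    have "{\<alpha> \<in> carrier G. h \<alpha> \<noteq> gt \<alpha> \<and> k (inv\<^bsub>G\<^esub> \<alpha> \<otimes>\<^bsub>G\<^esub> \<gamma>) \<noteq> gt (inv\<^bsub>G\<^esub> \<alpha> \<otimes>\<^bsub>G\<^esub> \<gamma>)} \<noteq> {}"
    proof
      assume e: "{\<alpha> \<in> carrier G. h \<alpha> \<noteq> gt \<alpha> \<and> k (inv\<^bsub>G\<^esub> \<alpha> \<otimes>\<^bsub>G\<^esub> \<gamma>) \<noteq> gt (inv\<^bsub>G\<^esub> \<alpha> \<otimes>\<^bsub>G\<^esub> \<gamma>)} = {}"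
      have "(h \<otimes>\<^bsub>GR\<^esub> k) \<gamma> = \<one>\<^bsub>piece \<gamma>\<^esub>" using \<gamma>(1) p.finprod_empty by (simp add: gr_def gr_mult_def e)
      then show False using \<gamma>(2) by (simp add: piece_one)
    qed
    then obtain \<alpha> where \<alpha>: "\<alpha> \<in> carrier G" "h \<alpha> \<noteq> gt \<alpha>" "k (inv\<^bsub>G\<^esub> \<alpha> \<otimes>\<^bsub>G\<^esub> \<gamma>) \<noteq> gt (inv\<^bsub>G\<^esub> \<alpha> \<otimes>\<^bsub>G\<^esub> \<gamma>)" by auto
    have "\<alpha> \<otimes>\<^bsub>G\<^esub> (inv\<^bsub>G\<^esub> \<alpha> \<otimes>\<^bsub>G\<^esub> \<gamma>) = \<gamma>" using \<alpha>(1) \<gamma>(1) by (simp flip: G.m_assoc)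
    then show "\<gamma> \<in> (\<lambda>(\<alpha>, \<beta>). \<alpha> \<otimes>\<^bsub>G\<^esub> \<beta>) ` (?A \<times> ?B)"
      using \<alpha> \<gamma>(1) by (intro image_eqI[of _ _ "(\<alpha>, inv\<^bsub>G\<^esub> \<alpha> \<otimes>\<^bsub>G\<^esub> \<gamma>)"]) auto
  qed
  then have "finite {\<gamma> \<in> carrier G. (h \<otimes>\<^bsub>GR\<^esub> k) \<gamma> \<noteq> gt \<gamma>}" using fin by (meson finite_SigmaI finite_imageI finite_subset)
  moreover have "(h \<otimes>\<^bsub>GR\<^esub> k) \<gamma> \<in> carrier (piece \<gamma>)" if \<gamma>: "\<gamma> \<in> carrier G" for \<gamma>
  proof -
    let ?s = "\<Oplus>\<alpha>\<in>?A. x \<alpha> \<otimes> y (inv\<^bsub>G\<^esub> \<alpha> \<otimes>\<^bsub>G\<^esub> \<gamma>)"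
    have "?s \<in> ge \<gamma>" by (rule gr_mult_rep(1)[OF x y fin(1) _ _ \<gamma>]) auto
    moreover have "(h \<otimes>\<^bsub>GR\<^esub> k) \<gamma> = cl \<gamma> ?s" by (rule gr_mult_rep(2)[OF x y fin(1) _ _ \<gamma>]) auto
    ultimately show ?thesis unfolding piece_carrier by (rule rev_image_eqI)
  qed
  ultimately show ?thesis by (auto simp: GR_carrier GR_mult_outside PiE_def extensional_def)
qed

lemma GR_l_distr:
  assumes "h \<in> carrier GR" "h' \<in> carrier GR" "k \<in> carrier GR"
  shows "(h \<oplus>\<^bsub>GR\<^esub> h') \<otimes>\<^bsub>GR\<^esub> k = h \<otimes>\<^bsub>GR\<^esub> k \<oplus>\<^bsub>GR\<^esub> h' \<otimes>\<^bsub>GR\<^esub> k"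
proof (rule GR_eqI)
  interpret A: abelian_group GR by (rule GR_abelian_group)
  show "(h \<oplus>\<^bsub>GR\<^esub> h') \<otimes>\<^bsub>GR\<^esub> k \<in> carrier GR" "h \<otimes>\<^bsub>GR\<^esub> k \<oplus>\<^bsub>GR\<^esub> h' \<otimes>\<^bsub>GR\<^esub> k \<in> carrier GR"
    using GR_mult_closed assms by auto
  fix \<gamma> assume \<gamma>: "\<gamma> \<in> carrier G"
  obtain x x' y where r: "rep h x" "rep h' x'" "rep k y" using rep_exists assms by meson
  let ?A = "{\<alpha> \<in> carrier G. h \<alpha> \<noteq> gt \<alpha>} \<union> {\<alpha> \<in> carrier G. h' \<alpha> \<noteq> gt \<alpha>}"
  have fin: "finite ?A" "?A \<subseteq> carrier G" using assms by (auto simp: GR_carrier)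
  have gg: "gt \<alpha> \<otimes>\<^bsub>piece \<alpha>\<^esub> gt \<alpha> = gt \<alpha>" if "\<alpha> \<in> carrier G" for \<alpha>
    using piece_mult[OF that zero_ge zero_ge] cl_zero[OF that] by simp
  note e = gr_mult_rep[OF r(1,3) fin _ \<gamma>] gr_mult_rep[OF r(2,3) fin _ \<gamma>]
  have xs: "x \<alpha> \<in> carrier F" "x' \<alpha> \<in> carrier F" "y (inv\<^bsub>G\<^esub> \<alpha> \<otimes>\<^bsub>G\<^esub> \<gamma>) \<in> carrier F" if "\<alpha> \<in> carrier G" for \<alpha>
  proof -
    have b: "inv\<^bsub>G\<^esub> \<alpha> \<otimes>\<^bsub>G\<^esub> \<gamma> \<in> carrier G" using that \<gamma> by simp
    have "x \<alpha> \<in> ge \<alpha>" "x' \<alpha> \<in> ge \<alpha>" using r(1,2) that unfolding rep_def by blast+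
    moreover have "y (inv\<^bsub>G\<^esub> \<alpha> \<otimes>\<^bsub>G\<^esub> \<gamma>) \<in> ge (inv\<^bsub>G\<^esub> \<alpha> \<otimes>\<^bsub>G\<^esub> \<gamma>)"
      using r(3) b unfolding rep_def by blast
    ultimately show "x \<alpha> \<in> carrier F" "x' \<alpha> \<in> carrier F" "y (inv\<^bsub>G\<^esub> \<alpha> \<otimes>\<^bsub>G\<^esub> \<gamma>) \<in> carrier F"
      using ge_carrier by blast+
  qed
  have "((h \<oplus>\<^bsub>GR\<^esub> h') \<otimes>\<^bsub>GR\<^esub> k) \<gamma> = cl \<gamma> (\<Oplus>\<alpha>\<in>?A. (x \<alpha> \<oplus> x' \<alpha>) \<otimes> y (inv\<^bsub>G\<^esub> \<alpha> \<otimes>\<^bsub>G\<^esub> \<gamma>))"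
    by (rule gr_mult_rep(2)[OF GR_add_rep[OF r(1,2)] r(3) fin _ \<gamma>]) (use gg in \<open>auto simp: GR_add\<close>)
  also have "(\<Oplus>\<alpha>\<in>?A. (x \<alpha> \<oplus> x' \<alpha>) \<otimes> y (inv\<^bsub>G\<^esub> \<alpha> \<otimes>\<^bsub>G\<^esub> \<gamma>))
    = (\<Oplus>\<alpha>\<in>?A. x \<alpha> \<otimes> y (inv\<^bsub>G\<^esub> \<alpha> \<otimes>\<^bsub>G\<^esub> \<gamma>) \<oplus> x' \<alpha> \<otimes> y (inv\<^bsub>G\<^esub> \<alpha> \<otimes>\<^bsub>G\<^esub> \<gamma>))"
    by (rule F.finsum_cong') (use xs in \<open>auto simp: F.l_distr\<close>)
  also have "\<dots> = (\<Oplus>\<alpha>\<in>?A. x \<alpha> \<otimes> y (inv\<^bsub>G\<^esub> \<alpha> \<otimes>\<^bsub>G\<^esub> \<gamma>)) \<oplus> (\<Oplus>\<alpha>\<in>?A. x' \<alpha> \<otimes> y (inv\<^bsub>G\<^esub> \<alpha> \<otimes>\<^bsub>G\<^esub> \<gamma>))"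
    by (rule F.finsum_addf) (use xs in auto)
  finally show "((h \<oplus>\<^bsub>GR\<^esub> h') \<otimes>\<^bsub>GR\<^esub> k) \<gamma> = (h \<otimes>\<^bsub>GR\<^esub> k \<oplus>\<^bsub>GR\<^esub> h' \<otimes>\<^bsub>GR\<^esub> k) \<gamma>"
    using e \<gamma> by (simp add: GR_add piece_mult)
qed

lemma GR_r_distr_homog:
  assumes "\<gamma> \<in> carrier G" "x \<in> ge \<gamma>" "k \<in> carrier GR" "k' \<in> carrier GR"
  shows "homog \<gamma> x \<otimes>\<^bsub>GR\<^esub> (k \<oplus>\<^bsub>GR\<^esub> k') = homog \<gamma> x \<otimes>\<^bsub>GR\<^esub> k \<oplus>\<^bsub>GR\<^esub> homog \<gamma> x \<otimes>\<^bsub>GR\<^esub> k'"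
proof (rule GR_eqI)
  interpret A: abelian_group GR by (rule GR_abelian_group)
  note hc = homog_closed[OF assms(1,2)]
  show "homog \<gamma> x \<otimes>\<^bsub>GR\<^esub> (k \<oplus>\<^bsub>GR\<^esub> k') \<in> carrier GR" "homog \<gamma> x \<otimes>\<^bsub>GR\<^esub> k \<oplus>\<^bsub>GR\<^esub> homog \<gamma> x \<otimes>\<^bsub>GR\<^esub> k' \<in> carrier GR"
    using GR_mult_closed assms hc by auto
  fix \<delta> assume \<delta>: "\<delta> \<in> carrier G"
  obtain y y' where r: "rep k y" "rep k' y'" using rep_exists assms by meson
  let ?b = "inv\<^bsub>G\<^esub> \<gamma> \<otimes>\<^bsub>G\<^esub> \<delta>"
  have b: "?b \<in> carrier G" using \<delta> assms by simp
  have y: "y ?b \<in> ge ?b" "y' ?b \<in> ge ?b" using r b by (auto simp: rep_def)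
  have gb: "\<gamma> \<otimes>\<^bsub>G\<^esub> ?b = \<delta>" using \<delta> assms by (simp flip: G.m_assoc)
  have xy: "x \<otimes> y ?b \<in> ge \<delta>" "x \<otimes> y' ?b \<in> ge \<delta>"
    using ge_mult[OF assms(2) y(1) assms(1) b] ge_mult[OF assms(2) y(2) assms(1) b] gb by auto
  show "(homog \<gamma> x \<otimes>\<^bsub>GR\<^esub> (k \<oplus>\<^bsub>GR\<^esub> k')) \<delta> = (homog \<gamma> x \<otimes>\<^bsub>GR\<^esub> k \<oplus>\<^bsub>GR\<^esub> homog \<gamma> x \<otimes>\<^bsub>GR\<^esub> k') \<delta>"
    unfolding GR_add[OF \<delta>] homog_mult_value[OF assms(1,2) GR_add_rep[OF r] \<delta>]
      homog_mult_value[OF assms(1,2) r(1) \<delta>] homog_mult_value[OF assms(1,2) r(2) \<delta>] piece_mult[OF \<delta> xy]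
    using ge_carrier[OF assms(2)] ge_carrier[OF y(1)] ge_carrier[OF y(2)] by (simp add: F.r_distr)
qed

lemma GR_r_distr:
  assumes "h \<in> carrier GR" "k \<in> carrier GR" "k' \<in> carrier GR"
  shows "h \<otimes>\<^bsub>GR\<^esub> (k \<oplus>\<^bsub>GR\<^esub> k') = h \<otimes>\<^bsub>GR\<^esub> k \<oplus>\<^bsub>GR\<^esub> h \<otimes>\<^bsub>GR\<^esub> k'"
proof -
  interpret A: abelian_group GR by (rule GR_abelian_group)
  have z: "\<zero>\<^bsub>GR\<^esub> = homog \<one>\<^bsub>G\<^esub> \<zero>" using homog_zero[OF G.one_closed zero_gt] by simp
  show ?thesis using assms(1)
  proof (induction h rule: GR_induct)
    case zero
    show ?case unfolding z using GR_r_distr_homog zero_ge assms(2,3) by simp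
  next
    case (homog \<gamma> x)
    then show ?case using GR_r_distr_homog assms(2,3) by simp
  next
    case (add h h')
    have c: "h \<otimes>\<^bsub>GR\<^esub> k \<in> carrier GR" "h' \<otimes>\<^bsub>GR\<^esub> k \<in> carrier GR" "h \<otimes>\<^bsub>GR\<^esub> k' \<in> carrier GR" "h' \<otimes>\<^bsub>GR\<^esub> k' \<in> carrier GR"
      using GR_mult_closed add assms(2,3) by auto
    have "(h \<oplus>\<^bsub>GR\<^esub> h') \<otimes>\<^bsub>GR\<^esub> (k \<oplus>\<^bsub>GR\<^esub> k')
      = (h \<otimes>\<^bsub>GR\<^esub> k \<oplus>\<^bsub>GR\<^esub> h \<otimes>\<^bsub>GR\<^esub> k') \<oplus>\<^bsub>GR\<^esub> (h' \<otimes>\<^bsub>GR\<^esub> k \<oplus>\<^bsub>GR\<^esub> h' \<otimes>\<^bsub>GR\<^esub> k')"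
      using GR_l_distr add assms(2,3) by simp
    also have "\<dots> = (h \<otimes>\<^bsub>GR\<^esub> k \<oplus>\<^bsub>GR\<^esub> h' \<otimes>\<^bsub>GR\<^esub> k) \<oplus>\<^bsub>GR\<^esub> (h \<otimes>\<^bsub>GR\<^esub> k' \<oplus>\<^bsub>GR\<^esub> h' \<otimes>\<^bsub>GR\<^esub> k')"
      using c by (simp add: A.a_ac)
    finally show ?case using GR_l_distr add(1,2) assms(2,3) by simp
  qed
qed

lemma homog_zero': "\<zero>\<^bsub>GR\<^esub> = homog \<one>\<^bsub>G\<^esub> \<zero>"
  using homog_zero[OF G.one_closed zero_gt] by simp

lemma GR_m_comm:
  assumes "h \<in> carrier GR" "k \<in> carrier GR"
  shows "h \<otimes>\<^bsub>GR\<^esub> k = k \<otimes>\<^bsub>GR\<^esub> h"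
proof -
  have hh: "homog \<gamma> x \<otimes>\<^bsub>GR\<^esub> homog \<delta> y = homog \<delta> y \<otimes>\<^bsub>GR\<^esub> homog \<gamma> x"
    if "\<gamma> \<in> carrier G" "x \<in> ge \<gamma>" "\<delta> \<in> carrier G" "y \<in> ge \<delta>" for \<gamma> x \<delta> y
    using that homog_mult G.m_comm F.m_comm ge_carrier by simp
  have hk: "homog \<gamma> x \<otimes>\<^bsub>GR\<^esub> k = k \<otimes>\<^bsub>GR\<^esub> homog \<gamma> x" if "\<gamma> \<in> carrier G" "x \<in> ge \<gamma>" for \<gamma> x
    using assms(2)
  proof (induction k rule: GR_induct)
    case zero
    show ?case unfolding homog_zero' using hh that zero_ge by simp
  next
    case (homog \<delta> y) then show ?case using hh that by simp
  next
    case (add k k')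
    then show ?case using GR_l_distr GR_r_distr homog_closed that by simp
  qed
  show ?thesis using assms(1)
  proof (induction h rule: GR_induct)
    case zero
    show ?case unfolding homog_zero' using hk zero_ge by simp
  next
    case (homog \<gamma> x) then show ?case using hk by simp
  next
    case (add h h')
    then show ?case using GR_l_distr GR_r_distr assms(2) by simp
  qed
qed

lemma GR_m_assoc:
  assumes "h \<in> carrier GR" "k \<in> carrier GR" "l \<in> carrier GR"
  shows "(h \<otimes>\<^bsub>GR\<^esub> k) \<otimes>\<^bsub>GR\<^esub> l = h \<otimes>\<^bsub>GR\<^esub> (k \<otimes>\<^bsub>GR\<^esub> l)"
proof -
  interpret A: abelian_group GR by (rule GR_abelian_group)
  have hhh: "(homog \<gamma> x \<otimes>\<^bsub>GR\<^esub> homog \<delta> y) \<otimes>\<^bsub>GR\<^esub> homog \<epsilon> z = homog \<gamma> x \<otimes>\<^bsub>GR\<^esub> (homog \<delta> y \<otimes>\<^bsub>GR\<^esub> homog \<epsilon> z)"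
    if "\<gamma> \<in> carrier G" "x \<in> ge \<gamma>" "\<delta> \<in> carrier G" "y \<in> ge \<delta>" "\<epsilon> \<in> carrier G" "z \<in> ge \<epsilon>" for \<gamma> x \<delta> y \<epsilon> z
    using that by (simp add: homog_mult ge_mult G.m_assoc F.m_assoc ge_carrier)
  have hhl: "(homog \<gamma> x \<otimes>\<^bsub>GR\<^esub> homog \<delta> y) \<otimes>\<^bsub>GR\<^esub> l = homog \<gamma> x \<otimes>\<^bsub>GR\<^esub> (homog \<delta> y \<otimes>\<^bsub>GR\<^esub> l)"
    if "\<gamma> \<in> carrier G" "x \<in> ge \<gamma>" "\<delta> \<in> carrier G" "y \<in> ge \<delta>" for \<gamma> x \<delta> y
    using assms(3)
  proof (induction l rule: GR_induct)
    case zero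
    show ?case unfolding homog_zero' using hhh that zero_ge by simp
  next
    case (homog \<epsilon> z) then show ?case using hhh that by simp
  next
    case (add l l')
    then show ?case using GR_r_distr homog_closed GR_mult_closed that by simp
  qed
  have hkl: "(homog \<gamma> x \<otimes>\<^bsub>GR\<^esub> k) \<otimes>\<^bsub>GR\<^esub> l = homog \<gamma> x \<otimes>\<^bsub>GR\<^esub> (k \<otimes>\<^bsub>GR\<^esub> l)"
    if "\<gamma> \<in> carrier G" "x \<in> ge \<gamma>" for \<gamma> x
    using assms(2)
  proof (induction k rule: GR_induct)
    case zero
    show ?case unfolding homog_zero' using hhl that zero_ge by simp
  next
    case (homog \<epsilon> z) then show ?case using hhl that by simp
  next
    case (add k k')
    then show ?case using GR_l_distr GR_r_distr homog_closed GR_mult_closed that assms(3) by simp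
  qed
  show ?thesis using assms(1)
  proof (induction h rule: GR_induct)
    case zero
    show ?case unfolding homog_zero' using hkl zero_ge by simp
  next
    case (homog \<gamma> x) then show ?case using hkl by simp
  next
    case (add h h')
    then show ?case using GR_l_distr GR_mult_closed assms(2,3) by simp
  qed
qed

lemma GR_l_one: "h \<in> carrier GR \<Longrightarrow> \<one>\<^bsub>GR\<^esub> \<otimes>\<^bsub>GR\<^esub> h = h"
proof (induction h rule: GR_induct)
  case zero
  show ?case unfolding homog_zero' GR_one using homog_mult one_ge zero_ge by simp
next
  case (homog \<gamma> x)
  then show ?case unfolding GR_one using homog_mult one_ge ge_carrier by simp
next
  case (add h k)
  then show ?case using GR_r_distr homog_closed[OF G.one_closed one_ge] by (simp add: GR_one)
qed

theorem gr_cring: "cring GR"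
proof (rule cringI[OF GR_abelian_group])
  show "comm_monoid GR"
    by (rule comm_monoidI)
      (use GR_mult_closed homog_closed[OF G.one_closed one_ge] GR_one GR_m_assoc GR_m_comm GR_l_one in auto)
qed (rule GR_l_distr)

end

section \<open>Bases adapted to a valuation\<close>

context valued_subring
begin

lemma GR_finsum_rep:
  "\<lbrakk>finite I; \<And>i. i \<in> I \<Longrightarrow> h i \<in> carrier GR; \<And>i. i \<in> I \<Longrightarrow> rep (h i) (x i)\<rbrakk> \<Longrightarrow>
    rep (finsum GR h I) (\<lambda>\<alpha>. \<Oplus>i\<in>I. x i \<alpha>)"
proof (induction I rule: finite_induct)
  case empty
  interpret A: abelian_group GR by (rule GR_abelian_group)
  show ?case by (simp add: rep_def GR_zero cl_zero zero_ge)
next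
  case (insert i I)
  interpret A: abelian_group GR by (rule GR_abelian_group)
  have s: "finsum GR h (insert i I) = h i \<oplus>\<^bsub>GR\<^esub> finsum GR h I"
    by (rule A.finsum_insert) (use insert in auto)
  have "rep (h i \<oplus>\<^bsub>GR\<^esub> finsum GR h I) (\<lambda>\<alpha>. x i \<alpha> \<oplus> (\<Oplus>i\<in>I. x i \<alpha>))"
    by (rule GR_add_rep) (use insert in auto)
  moreover have "(\<Oplus>i\<in>insert i I. x i \<alpha>) = x i \<alpha> \<oplus> (\<Oplus>i\<in>I. x i \<alpha>)" if "\<alpha> \<in> carrier G" for \<alpha>
  proof -
    have "x i' \<alpha> \<in> carrier F" if "i' \<in> insert i I" for i'
      using insert.prems(2)[OF that] \<open>\<alpha> \<in> carrier G\<close> ge_carrier unfolding rep_def by blast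
    then show ?thesis by (intro F.finsum_insert) (use insert in auto)
  qed
  ultimately show ?case unfolding s rep_def by simp
qed

lemma homog_finsum:
  "\<lbrakk>\<gamma> \<in> carrier G; finite I; \<And>i. i \<in> I \<Longrightarrow> x i \<in> ge \<gamma>\<rbrakk> \<Longrightarrow>
    (\<Oplus>i\<in>I. x i) \<in> ge \<gamma> \<and> homog \<gamma> (\<Oplus>i\<in>I. x i) = (\<Oplus>\<^bsub>GR\<^esub>i\<in>I. homog \<gamma> (x i))"
proof (induction I rule: infinite_finite_induct)
  case empty
  interpret A: abelian_group GR by (rule GR_abelian_group)
  show ?case using homog_zero zero_gt zero_ge empty by simp
next
  case (insert i I)
  interpret A: abelian_group GR by (rule GR_abelian_group)
  have IH: "(\<Oplus>i\<in>I. x i) \<in> ge \<gamma>" "homog \<gamma> (\<Oplus>i\<in>I. x i) = (\<Oplus>\<^bsub>GR\<^esub>i\<in>I. homog \<gamma> (x i))" using insert by auto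
  have "(\<Oplus>i\<in>insert i I. x i) = x i \<oplus> (\<Oplus>i\<in>I. x i)" by (rule F.finsum_insert) (use insert ge_carrier in auto)
  moreover have "(\<Oplus>\<^bsub>GR\<^esub>i\<in>insert i I. homog \<gamma> (x i)) = homog \<gamma> (x i) \<oplus>\<^bsub>GR\<^esub> (\<Oplus>\<^bsub>GR\<^esub>i\<in>I. homog \<gamma> (x i))"
    by (rule A.finsum_insert) (use insert homog_closed in auto)
  ultimately show ?case using IH insert ge_add homog_add by simp
qed simp

lemma homog_mult_rep:
  assumes \<gamma>: "\<gamma> \<in> carrier G" "x \<in> ge \<gamma>" and k: "rep k y"
  shows "rep (homog \<gamma> x \<otimes>\<^bsub>GR\<^esub> k) (\<lambda>\<delta>. x \<otimes> y (inv\<^bsub>G\<^esub> \<gamma> \<otimes>\<^bsub>G\<^esub> \<delta>))"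
  unfolding rep_def
proof (intro ballI conjI)
  fix \<delta> assume \<delta>: "\<delta> \<in> carrier G"
  let ?b = "inv\<^bsub>G\<^esub> \<gamma> \<otimes>\<^bsub>G\<^esub> \<delta>"
  have b: "?b \<in> carrier G" "\<gamma> \<otimes>\<^bsub>G\<^esub> ?b = \<delta>" using \<delta> \<gamma> by (simp_all flip: G.m_assoc)
  have "y ?b \<in> ge ?b" using k b(1) unfolding rep_def by blast
  from ge_mult[OF \<gamma>(2) this \<gamma>(1) b(1)] show "x \<otimes> y ?b \<in> ge \<delta>" unfolding b(2) .
  show "(homog \<gamma> x \<otimes>\<^bsub>GR\<^esub> k) \<delta> = cl \<delta> (x \<otimes> y ?b)" by (rule homog_mult_value[OF \<gamma> k \<delta>])
qed

end

locale gr_extension = A: valued_subring K \<Gamma>\<^sub>0 v\<^sub>0 A + B: valued_subring L \<Gamma> v B + j: ring_hom_cring K L j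
  for K :: "('a, 'm) ring_scheme" and \<Gamma>\<^sub>0 :: "'g ogroup" and v\<^sub>0 A
    and L :: "('b, 'n) ring_scheme" and \<Gamma> :: "'h ogroup" and v B and j +
  fixes \<iota>
  assumes embedding: "order_embedding \<Gamma>\<^sub>0 \<Gamma> \<iota>"
    and v_j: "\<lbrakk>a \<in> carrier K; a \<noteq> \<zero>\<^bsub>K\<^esub>\<rbrakk> \<Longrightarrow> v (j a) = \<iota> (v\<^sub>0 a)"
    and j_nonzero: "\<lbrakk>a \<in> carrier K; a \<noteq> \<zero>\<^bsub>K\<^esub>\<rbrakk> \<Longrightarrow> j a \<noteq> \<zero>\<^bsub>L\<^esub>"
    and j_A: "a \<in> A \<Longrightarrow> j a \<in> B"
begin

abbreviation \<Phi> where "\<Phi> \<equiv> gr_map \<Gamma>\<^sub>0 L \<Gamma> v B j \<iota>"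

lemma \<iota>_closed: "x \<in> carrier \<Gamma>\<^sub>0 \<Longrightarrow> \<iota> x \<in> carrier \<Gamma>"
  using embedding by (auto simp: order_embedding_def mon_def hom_def)

lemma \<iota>_mult: "\<lbrakk>x \<in> carrier \<Gamma>\<^sub>0; y \<in> carrier \<Gamma>\<^sub>0\<rbrakk> \<Longrightarrow> \<iota> (x \<otimes>\<^bsub>\<Gamma>\<^sub>0\<^esub> y) = \<iota> x \<otimes>\<^bsub>\<Gamma>\<^esub> \<iota> y"
  using embedding by (auto simp: order_embedding_def mon_def hom_def)

lemma \<iota>_inj: "inj_on \<iota> (carrier \<Gamma>\<^sub>0)"
  using embedding by (auto simp: order_embedding_def mon_def)

lemma \<iota>_eq_iff: "\<lbrakk>x \<in> carrier \<Gamma>\<^sub>0; y \<in> carrier \<Gamma>\<^sub>0\<rbrakk> \<Longrightarrow> \<iota> x = \<iota> y \<longleftrightarrow> x = y"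
  using \<iota>_inj by (auto simp: inj_on_def)

lemma \<iota>_leq: "\<lbrakk>x \<in> carrier \<Gamma>\<^sub>0; y \<in> carrier \<Gamma>\<^sub>0\<rbrakk> \<Longrightarrow> \<iota> x \<preceq>\<^bsub>\<Gamma>\<^esub> \<iota> y \<longleftrightarrow> x \<preceq>\<^bsub>\<Gamma>\<^sub>0\<^esub> y"
  using embedding by (simp add: order_embedding_def)

lemma \<iota>_one: "\<iota> \<one>\<^bsub>\<Gamma>\<^sub>0\<^esub> = \<one>\<^bsub>\<Gamma>\<^esub>"
  using \<iota>_mult[of "\<one>\<^bsub>\<Gamma>\<^sub>0\<^esub>" "\<one>\<^bsub>\<Gamma>\<^sub>0\<^esub>"] \<iota>_closed[of "\<one>\<^bsub>\<Gamma>\<^sub>0\<^esub>"] B.G.l_cancel_one by simp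

lemma \<iota>_inv: "\<delta> \<in> carrier \<Gamma>\<^sub>0 \<Longrightarrow> inv_into (carrier \<Gamma>\<^sub>0) \<iota> (\<iota> \<delta>) = \<delta>"
  using \<iota>_inj by simp

lemma j_ge: "\<lbrakk>x \<in> A.ge \<gamma>; \<gamma> \<in> carrier \<Gamma>\<^sub>0\<rbrakk> \<Longrightarrow> j x \<in> B.ge (\<iota> \<gamma>)"
  using A.R_carrier[of x] j_A[of x] v_j[of x] \<iota>_leq[of \<gamma> "v\<^sub>0 x"] A.w_closed[of x]
  by (cases "x = \<zero>\<^bsub>K\<^esub>") (auto simp: val_ge_def)

lemma j_gt: "\<lbrakk>x \<in> A.gt \<gamma>; \<gamma> \<in> carrier \<Gamma>\<^sub>0\<rbrakk> \<Longrightarrow> j x \<in> B.gt (\<iota> \<gamma>)"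
  using A.R_carrier[of x] j_A[of x] v_j[of x] \<iota>_leq[of \<gamma> "v\<^sub>0 x"] \<iota>_eq_iff[of \<gamma> "v\<^sub>0 x"] A.w_closed[of x]
  by (cases "x = \<zero>\<^bsub>K\<^esub>") (auto simp: val_gt_def)

lemma coset_image:
  assumes "\<gamma> \<in> carrier \<Gamma>\<^sub>0" "x \<in> carrier K"
  shows "B.gt (\<iota> \<gamma>) <+>\<^bsub>L\<^esub> j ` (A.cl \<gamma> x) = B.cl (\<iota> \<gamma>) (j x)"
proof
  have gA: "g \<in> carrier K" if "g \<in> A.gt \<gamma>" for g using that A.gt_ge A.ge_carrier by blast
  have gB: "g \<in> carrier L" if "g \<in> B.gt (\<iota> \<gamma>)" for g using that B.gt_ge B.ge_carrier by blast
  show "B.gt (\<iota> \<gamma>) <+>\<^bsub>L\<^esub> j ` (A.cl \<gamma> x) \<subseteq> B.cl (\<iota> \<gamma>) (j x)"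
  proof
    fix y assume "y \<in> B.gt (\<iota> \<gamma>) <+>\<^bsub>L\<^esub> j ` (A.cl \<gamma> x)"
    then obtain g s where gs: "g \<in> B.gt (\<iota> \<gamma>)" "s \<in> A.gt \<gamma>" "y = g \<oplus>\<^bsub>L\<^esub> j (s \<oplus>\<^bsub>K\<^esub> x)"
      by (auto simp: set_add_def' a_r_coset_def')
    have "y = (g \<oplus>\<^bsub>L\<^esub> j s) \<oplus>\<^bsub>L\<^esub> j x" using gs gA[OF gs(2)] gB[OF gs(1)] assms(2) by (simp add: B.F.a_assoc)
    moreover have "g \<oplus>\<^bsub>L\<^esub> j s \<in> B.gt (\<iota> \<gamma>)" using B.gt_add[OF gs(1) j_gt[OF gs(2) assms(1)]] \<iota>_closed assms(1) by blast
    ultimately show "y \<in> B.cl (\<iota> \<gamma>) (j x)" by (auto simp: a_r_coset_def')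
  qed
  show "B.cl (\<iota> \<gamma>) (j x) \<subseteq> B.gt (\<iota> \<gamma>) <+>\<^bsub>L\<^esub> j ` (A.cl \<gamma> x)"
  proof
    fix y assume "y \<in> B.cl (\<iota> \<gamma>) (j x)"
    then obtain g where g: "g \<in> B.gt (\<iota> \<gamma>)" "y = g \<oplus>\<^bsub>L\<^esub> j x" by (auto simp: a_r_coset_def')
    have "x \<in> A.cl \<gamma> x" unfolding a_r_coset_def' using A.zero_gt assms(2) by (auto intro!: bexI[of _ "\<zero>\<^bsub>K\<^esub>"])
    then show "y \<in> B.gt (\<iota> \<gamma>) <+>\<^bsub>L\<^esub> j ` (A.cl \<gamma> x)" using g by (auto simp: set_add_def')
  qed
qed

text \<open>
  The map of graded rings in terms of representatives.
\<close>

definition jrep :: "('g \<Rightarrow> 'a) \<Rightarrow> 'h \<Rightarrow> 'b" where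
  "jrep x \<delta> = (if \<delta> \<in> \<iota> ` carrier \<Gamma>\<^sub>0 then j (x (inv_into (carrier \<Gamma>\<^sub>0) \<iota> \<delta>)) else \<zero>\<^bsub>L\<^esub>)"

lemma jrep_\<iota>: "\<delta> \<in> carrier \<Gamma>\<^sub>0 \<Longrightarrow> jrep x (\<iota> \<delta>) = j (x \<delta>)"
  by (simp add: jrep_def \<iota>_inv)

lemma \<Phi>_rep:
  assumes "A.rep h x"
  shows "B.rep (\<Phi> h) (jrep x)"
  unfolding B.rep_def
proof
  fix \<delta> assume \<delta>: "\<delta> \<in> carrier \<Gamma>"
  show "jrep x \<delta> \<in> B.ge \<delta> \<and> \<Phi> h \<delta> = B.cl \<delta> (jrep x \<delta>)"
  proof (cases "\<delta> \<in> \<iota> ` carrier \<Gamma>\<^sub>0")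
    case True
    then obtain \<gamma> where \<gamma>: "\<gamma> \<in> carrier \<Gamma>\<^sub>0" "\<delta> = \<iota> \<gamma>" by blast
    have x: "x \<gamma> \<in> A.ge \<gamma>" "h \<gamma> = A.cl \<gamma> (x \<gamma>)" using assms \<gamma> unfolding A.rep_def by blast+
    have "\<Phi> h \<delta> = B.gt (\<iota> \<gamma>) <+>\<^bsub>L\<^esub> j ` (A.cl \<gamma> (x \<gamma>))"
      using \<delta> True x(2) \<gamma> by (simp add: gr_map_def \<iota>_inv)
    then show ?thesis using coset_image[OF \<gamma>(1) A.ge_carrier[OF x(1)]] j_ge[OF x(1) \<gamma>(1)] \<gamma> by (simp add: jrep_\<iota>)
  next
    case False
    then show ?thesis using \<delta> B.cl_zero B.zero_ge by (simp add: jrep_def gr_map_def)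
  qed
qed

lemma \<Phi>_closed:
  assumes h: "h \<in> carrier A.GR"
  shows "\<Phi> h \<in> carrier B.GR"
proof -
  obtain x where x: "A.rep h x" using A.rep_exists[OF h] by blast
  note r = \<Phi>_rep[OF x, unfolded B.rep_def]
  have "{\<delta> \<in> carrier \<Gamma>. \<Phi> h \<delta> \<noteq> B.gt \<delta>} \<subseteq> \<iota> ` {\<gamma> \<in> carrier \<Gamma>\<^sub>0. h \<gamma> \<noteq> A.gt \<gamma>}"
  proof
    fix \<delta> assume "\<delta> \<in> {\<delta> \<in> carrier \<Gamma>. \<Phi> h \<delta> \<noteq> B.gt \<delta>}"
    then have \<delta>: "\<delta> \<in> carrier \<Gamma>" "\<Phi> h \<delta> \<noteq> B.gt \<delta>" by auto
    then have "\<delta> \<in> \<iota> ` carrier \<Gamma>\<^sub>0" by (auto simp: gr_map_def split: if_splits)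
    then obtain \<gamma> where \<gamma>: "\<gamma> \<in> carrier \<Gamma>\<^sub>0" "\<delta> = \<iota> \<gamma>" by blast
    have xg: "x \<gamma> \<in> A.ge \<gamma>" "h \<gamma> = A.cl \<gamma> (x \<gamma>)" using x \<gamma> unfolding A.rep_def by blast+
    have "h \<gamma> \<noteq> A.gt \<gamma>"
    proof
      assume "h \<gamma> = A.gt \<gamma>"
      then have "x \<gamma> \<in> A.gt \<gamma>" using xg A.cl_eq_zero[OF \<gamma>(1) A.ge_carrier[OF xg(1)]] by simp
      then have "j (x \<gamma>) \<in> B.gt \<delta>" using j_gt \<gamma> by blast
      moreover have "\<Phi> h \<delta> = B.cl \<delta> (j (x \<gamma>))" using r \<delta> \<gamma> by (simp add: jrep_\<iota>)
      ultimately show False using \<delta> B.cl_eq_zero[OF \<delta>(1), of "j (x \<gamma>)"] A.ge_carrier[OF xg(1)] by simp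
    qed
    then show "\<delta> \<in> \<iota> ` {\<gamma> \<in> carrier \<Gamma>\<^sub>0. h \<gamma> \<noteq> A.gt \<gamma>}" using \<gamma> by blast
  qed
  moreover have "finite {\<gamma> \<in> carrier \<Gamma>\<^sub>0. h \<gamma> \<noteq> A.gt \<gamma>}" using h by (simp add: A.GR_carrier)
  ultimately have "finite {\<delta> \<in> carrier \<Gamma>. \<Phi> h \<delta> \<noteq> B.gt \<delta>}" by (meson finite_imageI finite_subset)
  moreover have "\<Phi> h \<delta> \<in> carrier (B.piece \<delta>)" if "\<delta> \<in> carrier \<Gamma>" for \<delta>
    using r that by (auto simp: B.piece_carrier)
  moreover have "\<Phi> h \<in> extensional (carrier \<Gamma>)" by (simp add: gr_map_def)
  ultimately show ?thesis by (simp add: B.GR_carrier PiE_def Pi_def)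
qed

lemma \<Phi>_add:
  assumes "h \<in> carrier A.GR" "k \<in> carrier A.GR"
  shows "\<Phi> (h \<oplus>\<^bsub>A.GR\<^esub> k) = \<Phi> h \<oplus>\<^bsub>B.GR\<^esub> \<Phi> k"
proof (rule B.GR_eqI)
  interpret GA: cring A.GR by (rule A.gr_cring)
  interpret GB: cring B.GR by (rule B.gr_cring)
  show "\<Phi> (h \<oplus>\<^bsub>A.GR\<^esub> k) \<in> carrier B.GR" "\<Phi> h \<oplus>\<^bsub>B.GR\<^esub> \<Phi> k \<in> carrier B.GR" using \<Phi>_closed assms by auto
  obtain x where x: "A.rep h x" using A.rep_exists[OF assms(1)] by blast
  obtain y where y: "A.rep k y" using A.rep_exists[OF assms(2)] by blast
  have xK: "x \<gamma> \<in> carrier K" "y \<gamma> \<in> carrier K" if "\<gamma> \<in> carrier \<Gamma>\<^sub>0" for \<gamma>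
    using x y that A.ge_carrier unfolding A.rep_def by blast+
  fix \<delta> assume \<delta>: "\<delta> \<in> carrier \<Gamma>"
  have "jrep (\<lambda>\<alpha>. x \<alpha> \<oplus>\<^bsub>K\<^esub> y \<alpha>) \<delta> = jrep x \<delta> \<oplus>\<^bsub>L\<^esub> jrep y \<delta>"
    using xK by (auto simp: jrep_def \<iota>_inv)
  then show "\<Phi> (h \<oplus>\<^bsub>A.GR\<^esub> k) \<delta> = (\<Phi> h \<oplus>\<^bsub>B.GR\<^esub> \<Phi> k) \<delta>"
    using \<Phi>_rep[OF A.GR_add_rep[OF x y]] B.GR_add_rep[OF \<Phi>_rep[OF x] \<Phi>_rep[OF y]] \<delta> by (simp add: B.rep_def)
qed

lemma \<Phi>_homog:
  assumes \<gamma>: "\<gamma> \<in> carrier \<Gamma>\<^sub>0" "x \<in> A.ge \<gamma>"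
  shows "\<Phi> (A.homog \<gamma> x) = B.homog (\<iota> \<gamma>) (j x)"
proof (rule B.GR_eqI[OF \<Phi>_closed[OF A.homog_closed[OF \<gamma>]] B.homog_closed[OF \<iota>_closed[OF \<gamma>(1)] j_ge[OF \<gamma>(2,1)]]])
  fix \<delta> assume \<delta>: "\<delta> \<in> carrier \<Gamma>"
  have "jrep (\<lambda>\<alpha>. if \<alpha> = \<gamma> then x else \<zero>\<^bsub>K\<^esub>) \<delta> = (if \<delta> = \<iota> \<gamma> then j x else \<zero>\<^bsub>L\<^esub>)"
    using \<gamma> by (auto simp: jrep_def \<iota>_inv)
  then show "\<Phi> (A.homog \<gamma> x) \<delta> = B.homog (\<iota> \<gamma>) (j x) \<delta>"
    using \<Phi>_rep[OF A.homog_rep[OF \<gamma>]] B.homog_rep[OF \<iota>_closed[OF \<gamma>(1)] j_ge[OF \<gamma>(2,1)]] \<delta> by (simp add: B.rep_def)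
qed

lemma \<Phi>_mult:
  assumes "h \<in> carrier A.GR" "k \<in> carrier A.GR"
  shows "\<Phi> (h \<otimes>\<^bsub>A.GR\<^esub> k) = \<Phi> h \<otimes>\<^bsub>B.GR\<^esub> \<Phi> k"
proof -
  interpret GA: cring A.GR by (rule A.gr_cring)
  interpret GB: cring B.GR by (rule B.gr_cring)
  have hh: "\<Phi> (A.homog \<gamma> x \<otimes>\<^bsub>A.GR\<^esub> A.homog \<delta> y) = \<Phi> (A.homog \<gamma> x) \<otimes>\<^bsub>B.GR\<^esub> \<Phi> (A.homog \<delta> y)"
    if "\<gamma> \<in> carrier \<Gamma>\<^sub>0" "x \<in> A.ge \<gamma>" "\<delta> \<in> carrier \<Gamma>\<^sub>0" "y \<in> A.ge \<delta>" for \<gamma> x \<delta> y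
    using that A.ge_carrier by (simp add: A.homog_mult \<Phi>_homog A.ge_mult B.homog_mult \<iota>_closed j_ge \<iota>_mult)
  have hk: "\<Phi> (A.homog \<gamma> x \<otimes>\<^bsub>A.GR\<^esub> k) = \<Phi> (A.homog \<gamma> x) \<otimes>\<^bsub>B.GR\<^esub> \<Phi> k"
    if \<gamma>: "\<gamma> \<in> carrier \<Gamma>\<^sub>0" "x \<in> A.ge \<gamma>" for \<gamma> x
    using assms(2)
  proof (induction k rule: A.GR_induct)
    case zero
    show ?case unfolding A.homog_zero' using hh \<gamma> A.zero_ge by simp
  next
    case (homog \<delta> y) then show ?case using hh \<gamma> by simp
  next
    case (add k k')
    then show ?case using A.homog_closed[OF \<gamma>] by (simp add: GA.r_distr GB.r_distr \<Phi>_add \<Phi>_closed)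
  qed
  show ?thesis using assms(1)
  proof (induction h rule: A.GR_induct)
    case zero
    show ?case unfolding A.homog_zero' using hk A.zero_ge by simp
  next
    case (homog \<delta> y) then show ?case using hk by simp
  next
    case (add h h')
    then show ?case using assms(2) by (simp add: GA.l_distr GB.l_distr \<Phi>_add \<Phi>_closed)
  qed
qed

theorem \<Phi>_ring_hom: "\<Phi> \<in> ring_hom A.GR B.GR"
proof (rule ring_hom_memI)
  show "\<Phi> \<one>\<^bsub>A.GR\<^esub> = \<one>\<^bsub>B.GR\<^esub>" unfolding A.GR_one B.GR_one using \<Phi>_homog A.one_ge \<iota>_one by simp
qed (use \<Phi>_closed \<Phi>_mult \<Phi>_add in auto)

end

text \<open>
  A basis of \<open>B\<close> over \<open>A\<close> with respect to which \<open>v\<close> of a sum is the minimum of the values of its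
  terms. This is expressed through arbitrary lower bounds \<open>z\<close>.
\<close>

locale gr_basis = gr_extension K \<Gamma>\<^sub>0 v\<^sub>0 A L \<Gamma> v B j \<iota>
  for K :: "('a, 'm) ring_scheme" and \<Gamma>\<^sub>0 :: "'g ogroup" and v\<^sub>0 A
    and L :: "('b, 'n) ring_scheme" and \<Gamma> :: "'h ogroup" and v B and j \<iota> +
  fixes n :: nat and E
  assumes E: "i < n \<Longrightarrow> E i \<in> B" "i < n \<Longrightarrow> E i \<noteq> \<zero>\<^bsub>L\<^esub>"
    and span: "b \<in> B \<Longrightarrow> \<exists>a. (\<forall>i<n. a i \<in> A) \<and> b = (\<Oplus>\<^bsub>L\<^esub>i\<in>{..<n}. j (a i) \<otimes>\<^bsub>L\<^esub> E i)"
    and indep: "\<lbrakk>\<And>i. i < n \<Longrightarrow> a i \<in> A; z \<in> carrier L; vle L \<Gamma> v z (\<Oplus>\<^bsub>L\<^esub>i\<in>{..<n}. j (a i) \<otimes>\<^bsub>L\<^esub> E i); i < n\<rbrakk> \<Longrightarrow>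
      vle L \<Gamma> v z (j (a i) \<otimes>\<^bsub>L\<^esub> E i)"
begin

definition \<epsilon> where "\<epsilon> i = B.homog (v (E i)) (E i)"

lemma E_carrier: "i < n \<Longrightarrow> E i \<in> carrier L" using E B.R_carrier by blast

lemma vE: "i < n \<Longrightarrow> v (E i) \<in> carrier \<Gamma>" using B.w_closed E E_carrier by blast

lemma E_ge: "i < n \<Longrightarrow> E i \<in> B.ge (v (E i))" using E vE B.leq_refl by (simp add: val_ge_def)

lemma \<epsilon>_closed: "i < n \<Longrightarrow> \<epsilon> i \<in> carrier B.GR" unfolding \<epsilon>_def using B.homog_closed vE E_ge by blast

lemma A_carrier: "a \<in> A \<Longrightarrow> a \<in> carrier K" by (rule A.R_carrier)

lemma term_dominates:
  assumes "\<And>i. i < n \<Longrightarrow> a i \<in> A" "i < n" and s: "s = (\<Oplus>\<^bsub>L\<^esub>i\<in>{..<n}. j (a i) \<otimes>\<^bsub>L\<^esub> E i)" and \<gamma>: "\<gamma> \<in> carrier \<Gamma>"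
  shows "s \<in> B.ge \<gamma> \<Longrightarrow> j (a i) \<otimes>\<^bsub>L\<^esub> E i \<in> B.ge \<gamma>" "s \<in> B.gt \<gamma> \<Longrightarrow> j (a i) \<otimes>\<^bsub>L\<^esub> E i \<in> B.gt \<gamma>"
proof -
  have tB: "j (a i) \<otimes>\<^bsub>L\<^esub> E i \<in> B" using subringE(6)[OF B.R] j_A E assms(1,2) by blast
  then have tL: "j (a i) \<otimes>\<^bsub>L\<^esub> E i \<in> carrier L" using B.R_carrier by blast
  have sL: "s \<in> carrier L" unfolding s using assms(1) E_carrier A_carrier by (intro B.F.finsum_closed) auto
  have "vle L \<Gamma> v s s" using B.le_refl sL by blast
  then have le: "vle L \<Gamma> v s (j (a i) \<otimes>\<^bsub>L\<^esub> E i)" using indep[OF assms(1) sL _ assms(2)] s by simp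
  show "j (a i) \<otimes>\<^bsub>L\<^esub> E i \<in> B.ge \<gamma>" if "s \<in> B.ge \<gamma>"
  proof (cases "j (a i) \<otimes>\<^bsub>L\<^esub> E i = \<zero>\<^bsub>L\<^esub>")
    case False
    then have "s \<noteq> \<zero>\<^bsub>L\<^esub>" "v s \<preceq>\<^bsub>\<Gamma>\<^esub> v (j (a i) \<otimes>\<^bsub>L\<^esub> E i)" using le by (auto simp: vle_def)
    then have "\<gamma> \<preceq>\<^bsub>\<Gamma>\<^esub> v (j (a i) \<otimes>\<^bsub>L\<^esub> E i)"
      using that B.G.leq_trans[OF \<gamma> B.w_closed[OF sL] B.w_closed[OF tL False]] by (auto simp: val_ge_def)
    then show ?thesis using tB by (simp add: val_ge_def)
  qed (use B.zero_ge in simp)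
  show "j (a i) \<otimes>\<^bsub>L\<^esub> E i \<in> B.gt \<gamma>" if "s \<in> B.gt \<gamma>"
  proof (cases "j (a i) \<otimes>\<^bsub>L\<^esub> E i = \<zero>\<^bsub>L\<^esub>")
    case False
    then have s0: "s \<noteq> \<zero>\<^bsub>L\<^esub>" "v s \<preceq>\<^bsub>\<Gamma>\<^esub> v (j (a i) \<otimes>\<^bsub>L\<^esub> E i)" using le by (auto simp: vle_def)
    then have "\<gamma> \<preceq>\<^bsub>\<Gamma>\<^esub> v s" "\<gamma> \<noteq> v s" using that by (auto simp: val_gt_def)
    then have "\<gamma> \<preceq>\<^bsub>\<Gamma>\<^esub> v (j (a i) \<otimes>\<^bsub>L\<^esub> E i) \<and> v (j (a i) \<otimes>\<^bsub>L\<^esub> E i) \<noteq> \<gamma>"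
      using B.lt_trans1[OF \<gamma> B.w_closed[OF sL s0(1)] B.w_closed[OF tL False]] s0(2) by blast
    then show ?thesis using tB by (simp add: val_gt_def)
  qed (use B.zero_gt in simp)
qed

text \<open>
  For a homogeneous element of degree \<open>\<gamma>\<close>, the initial form of \<open>b = \<Sum> a\<^sub>i E\<^sub>i\<close> is the sum of the
  initial forms of those terms that have value exactly \<open>\<gamma>\<close>. The other terms have larger values.
\<close>

theorem gr_span:
  assumes "s \<in> carrier B.GR"
  shows "\<exists>r. (\<forall>i<n. r i \<in> carrier A.GR) \<and> s = (\<Oplus>\<^bsub>B.GR\<^esub>i\<in>{..<n}. \<Phi> (r i) \<otimes>\<^bsub>B.GR\<^esub> \<epsilon> i)"
proof -
  interpret GA: cring A.GR by (rule A.gr_cring)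
  interpret GB: cring B.GR by (rule B.gr_cring)
  have \<Phi>0: "\<Phi> \<zero>\<^bsub>A.GR\<^esub> = \<zero>\<^bsub>B.GR\<^esub>"
    using ring_hom_cring.hom_zero[OF ring_hom_cringI[OF A.gr_cring B.gr_cring], of \<Phi>] \<Phi>_ring_hom
    by (simp add: ring_hom_cring_def ring_hom_cring_axioms_def A.gr_cring B.gr_cring)
  show ?thesis using assms
  proof (induction s rule: B.GR_induct)
    case zero
    have "(\<Oplus>\<^bsub>B.GR\<^esub>i\<in>{..<n}. \<Phi> \<zero>\<^bsub>A.GR\<^esub> \<otimes>\<^bsub>B.GR\<^esub> \<epsilon> i) = (\<Oplus>\<^bsub>B.GR\<^esub>i\<in>{..<n}. \<zero>\<^bsub>B.GR\<^esub>)"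
      by (rule GB.finsum_cong') (use \<epsilon>_closed \<Phi>0 in auto)
    then show ?case by (intro exI[of _ "\<lambda>_. \<zero>\<^bsub>A.GR\<^esub>"]) (simp add: GB.finsum_zero)
  next
    case (homog \<gamma> b)
    have bB: "b \<in> B" using homog(2) by (simp add: val_ge_def)
    from span[OF bB] obtain a where a: "\<And>i. i < n \<Longrightarrow> a i \<in> A" "b = (\<Oplus>\<^bsub>L\<^esub>i\<in>{..<n}. j (a i) \<otimes>\<^bsub>L\<^esub> E i)" by blast
    define t where "t i = j (a i) \<otimes>\<^bsub>L\<^esub> E i" for i
    have t: "t i \<in> B.ge \<gamma>" if "i < n" for i
      unfolding t_def using term_dominates(1)[OF a(1) that a(2) homog(1) homog(2)] .
    define r where "r i = (if t i \<in> B.gt \<gamma> then \<zero>\<^bsub>A.GR\<^esub> else A.homog (v\<^sub>0 (a i)) (a i))" for i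
    have main: "r i \<in> carrier A.GR \<and> \<Phi> (r i) \<otimes>\<^bsub>B.GR\<^esub> \<epsilon> i = B.homog \<gamma> (t i)" if i: "i < n" for i
    proof (cases "t i \<in> B.gt \<gamma>")
      case True
      then show ?thesis using B.homog_zero[OF homog(1)] \<epsilon>_closed[OF i] by (simp add: r_def \<Phi>0)
    next
      case False
      then have t0: "t i \<noteq> \<zero>\<^bsub>L\<^esub>" using B.zero_gt by metis
      have ai: "a i \<in> carrier K" "a i \<noteq> \<zero>\<^bsub>K\<^esub>" using a(1)[OF i] A_carrier t0 E_carrier[OF i] by (auto simp: t_def)
      have va: "v\<^sub>0 (a i) \<in> carrier \<Gamma>\<^sub>0" using A.w_closed ai by blast
      have age: "a i \<in> A.ge (v\<^sub>0 (a i))" using a(1)[OF i] A.leq_refl[OF va] by (simp add: val_ge_def)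
      have vt: "v (t i) = \<iota> (v\<^sub>0 (a i)) \<otimes>\<^bsub>\<Gamma>\<^esub> v (E i)"
        unfolding t_def using B.w_mult[of "j (a i)" "E i"] ai j_nonzero E(2)[OF i] E_carrier[OF i] v_j by simp
      have "v (t i) = \<gamma>" using t[OF i] False t0 by (auto simp: val_ge_def val_gt_def)
      then have "\<Phi> (r i) \<otimes>\<^bsub>B.GR\<^esub> \<epsilon> i = B.homog \<gamma> (t i)"
        using False vt B.homog_mult[OF \<iota>_closed[OF va] j_ge[OF age va] vE[OF i] E_ge[OF i]]
        by (simp add: r_def \<Phi>_homog[OF va age] \<epsilon>_def t_def)
      then show ?thesis using A.homog_closed[OF va age] False by (simp add: r_def)
    qed
    have "B.homog \<gamma> b = (\<Oplus>\<^bsub>B.GR\<^esub>i\<in>{..<n}. B.homog \<gamma> (t i))"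
      using B.homog_finsum[OF homog(1), of "{..<n}" t] t a(2) by (simp add: t_def)
    also have "\<dots> = (\<Oplus>\<^bsub>B.GR\<^esub>i\<in>{..<n}. \<Phi> (r i) \<otimes>\<^bsub>B.GR\<^esub> \<epsilon> i)"
      by (rule GB.finsum_cong') (use main \<Phi>_closed \<epsilon>_closed in auto)
    finally show ?case using main by blast
  next
    case (add s s')
    then obtain r r' where r: "\<And>i. i < n \<Longrightarrow> r i \<in> carrier A.GR" "s = (\<Oplus>\<^bsub>B.GR\<^esub>i\<in>{..<n}. \<Phi> (r i) \<otimes>\<^bsub>B.GR\<^esub> \<epsilon> i)"
      and r': "\<And>i. i < n \<Longrightarrow> r' i \<in> carrier A.GR" "s' = (\<Oplus>\<^bsub>B.GR\<^esub>i\<in>{..<n}. \<Phi> (r' i) \<otimes>\<^bsub>B.GR\<^esub> \<epsilon> i)" by blast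
    have "s \<oplus>\<^bsub>B.GR\<^esub> s' = (\<Oplus>\<^bsub>B.GR\<^esub>i\<in>{..<n}. \<Phi> (r i) \<otimes>\<^bsub>B.GR\<^esub> \<epsilon> i \<oplus>\<^bsub>B.GR\<^esub> \<Phi> (r' i) \<otimes>\<^bsub>B.GR\<^esub> \<epsilon> i)"
      unfolding r(2) r'(2) by (rule GB.finsum_addf[symmetric]) (use r(1) r'(1) \<Phi>_closed \<epsilon>_closed in auto)
    also have "\<dots> = (\<Oplus>\<^bsub>B.GR\<^esub>i\<in>{..<n}. \<Phi> (r i \<oplus>\<^bsub>A.GR\<^esub> r' i) \<otimes>\<^bsub>B.GR\<^esub> \<epsilon> i)"
      by (rule GB.finsum_cong') (use r(1) r'(1) \<Phi>_closed \<epsilon>_closed in \<open>auto simp: \<Phi>_add GB.l_distr\<close>)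
    finally show ?case using r(1) r'(1) by (intro exI[of _ "\<lambda>i. r i \<oplus>\<^bsub>A.GR\<^esub> r' i"]) auto
  qed
qed

text \<open>
  The component of the sum in degree \<open>\<gamma> = v(E\<^sub>k) + \<delta>\<close> is the class of some \<open>\<Sum> a\<^sub>i E\<^sub>i\<close> in which \<open>a\<^sub>k\<close>
  represents the component of \<open>r\<^sub>k\<close> in degree \<open>\<delta>\<close>. If the class is zero, then \<open>v(a\<^sub>k E\<^sub>k) > \<gamma>\<close>, so
  \<open>v(a\<^sub>k) > \<delta>\<close>.
\<close>

theorem gr_indep:
  assumes r: "\<And>i. i < n \<Longrightarrow> r i \<in> carrier A.GR" and sum: "(\<Oplus>\<^bsub>B.GR\<^esub>i\<in>{..<n}. \<Phi> (r i) \<otimes>\<^bsub>B.GR\<^esub> \<epsilon> i) = \<zero>\<^bsub>B.GR\<^esub>"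
    and k: "k < n"
  shows "r k = \<zero>\<^bsub>A.GR\<^esub>"
proof (rule A.GR_eqI[OF r[OF k]])
  interpret GA: cring A.GR by (rule A.gr_cring)
  interpret GB: cring B.GR by (rule B.gr_cring)
  show "\<zero>\<^bsub>A.GR\<^esub> \<in> carrier A.GR" by simp
  have "\<exists>x. \<forall>i<n. A.rep (r i) (x i)" using A.rep_exists[OF r] by metis
  then obtain x where x: "\<And>i. i < n \<Longrightarrow> A.rep (r i) (x i)" by blast
  fix \<delta> assume \<delta>: "\<delta> \<in> carrier \<Gamma>\<^sub>0"
  define \<gamma> where "\<gamma> = v (E k) \<otimes>\<^bsub>\<Gamma>\<^esub> \<iota> \<delta>"
  have \<gamma>: "\<gamma> \<in> carrier \<Gamma>" using vE[OF k] \<iota>_closed[OF \<delta>] by (simp add: \<gamma>_def)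
  define \<beta> where "\<beta> i = inv\<^bsub>\<Gamma>\<^esub> (v (E i)) \<otimes>\<^bsub>\<Gamma>\<^esub> \<gamma>" for i
  have \<beta>k: "\<beta> k = \<iota> \<delta>" using vE[OF k] \<iota>_closed[OF \<delta>] unfolding \<beta>_def \<gamma>_def by (simp flip: B.G.m_assoc)
  define a where "a i = (if \<beta> i \<in> \<iota> ` carrier \<Gamma>\<^sub>0 then x i (inv_into (carrier \<Gamma>\<^sub>0) \<iota> (\<beta> i)) else \<zero>\<^bsub>K\<^esub>)" for i
  have aA: "a i \<in> A" if "i < n" for i
  proof (cases "\<beta> i \<in> \<iota> ` carrier \<Gamma>\<^sub>0")
    case True
    then have "inv_into (carrier \<Gamma>\<^sub>0) \<iota> (\<beta> i) \<in> carrier \<Gamma>\<^sub>0" by (rule inv_into_into)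
    then show ?thesis using x[OF that] True unfolding A.rep_def a_def val_ge_def by auto
  qed (use subringE(2)[OF A.R] in \<open>simp add: a_def\<close>)
  have ja: "jrep (x i) (\<beta> i) = j (a i)" for i by (simp add: jrep_def a_def)
  let ?t = "\<lambda>i. \<Phi> (r i) \<otimes>\<^bsub>B.GR\<^esub> \<epsilon> i"
  have t: "?t i \<in> carrier B.GR" "B.rep (?t i) (\<lambda>\<delta>. E i \<otimes>\<^bsub>L\<^esub> jrep (x i) (inv\<^bsub>\<Gamma>\<^esub> (v (E i)) \<otimes>\<^bsub>\<Gamma>\<^esub> \<delta>))" if "i < n" for i
  proof -
    show "?t i \<in> carrier B.GR" using \<Phi>_closed r \<epsilon>_closed that by simp
    have "?t i = B.homog (v (E i)) (E i) \<otimes>\<^bsub>B.GR\<^esub> \<Phi> (r i)"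
      using \<Phi>_closed[OF r[OF that]] \<epsilon>_closed[OF that] by (simp add: GB.m_comm \<epsilon>_def)
    then show "B.rep (?t i) (\<lambda>\<delta>. E i \<otimes>\<^bsub>L\<^esub> jrep (x i) (inv\<^bsub>\<Gamma>\<^esub> (v (E i)) \<otimes>\<^bsub>\<Gamma>\<^esub> \<delta>))"
      using B.homog_mult_rep[OF vE[OF that] E_ge[OF that] \<Phi>_rep[OF x[OF that]]] by simp
  qed
  have "B.rep (\<Oplus>\<^bsub>B.GR\<^esub>i\<in>{..<n}. ?t i) (\<lambda>\<delta>. \<Oplus>\<^bsub>L\<^esub>i\<in>{..<n}. E i \<otimes>\<^bsub>L\<^esub> jrep (x i) (inv\<^bsub>\<Gamma>\<^esub> (v (E i)) \<otimes>\<^bsub>\<Gamma>\<^esub> \<delta>))"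
    by (rule B.GR_finsum_rep) (use t in auto)
  then have c: "(\<Oplus>\<^bsub>L\<^esub>i\<in>{..<n}. E i \<otimes>\<^bsub>L\<^esub> jrep (x i) (\<beta> i)) \<in> B.ge \<gamma>"
    "B.gt \<gamma> = B.cl \<gamma> (\<Oplus>\<^bsub>L\<^esub>i\<in>{..<n}. E i \<otimes>\<^bsub>L\<^esub> jrep (x i) (\<beta> i))"
    using \<gamma> B.GR_zero[OF \<gamma>] unfolding sum B.rep_def \<beta>_def by auto
  have eq: "(\<Oplus>\<^bsub>L\<^esub>i\<in>{..<n}. E i \<otimes>\<^bsub>L\<^esub> jrep (x i) (\<beta> i)) = (\<Oplus>\<^bsub>L\<^esub>i\<in>{..<n}. j (a i) \<otimes>\<^bsub>L\<^esub> E i)"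
    by (rule B.F.finsum_cong') (use E_carrier aA A_carrier in \<open>auto simp: ja B.F.m_comm\<close>)
  have "(\<Oplus>\<^bsub>L\<^esub>i\<in>{..<n}. j (a i) \<otimes>\<^bsub>L\<^esub> E i) \<in> B.gt \<gamma>"
    using c B.cl_eq_zero[OF \<gamma> B.ge_carrier[OF c(1)]] unfolding eq by simp
  from term_dominates(2)[OF aA k refl \<gamma> this] have tk: "j (a k) \<otimes>\<^bsub>L\<^esub> E k \<in> B.gt \<gamma>" by simp
  have ak: "a k = x k \<delta>" using \<delta> by (simp add: a_def \<beta>k \<iota>_inv)
  have xk: "x k \<delta> \<in> A.ge \<delta>" "r k \<delta> = A.cl \<delta> (x k \<delta>)" using x[OF k] \<delta> unfolding A.rep_def by blast+
  have "x k \<delta> \<in> A.gt \<delta>"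
  proof (rule ccontr)
    assume n: "x k \<delta> \<notin> A.gt \<delta>"
    then have x0: "x k \<delta> \<noteq> \<zero>\<^bsub>K\<^esub>" using A.zero_gt by metis
    have vx: "v\<^sub>0 (x k \<delta>) = \<delta>" using n xk(1) x0 by (auto simp: val_ge_def val_gt_def)
    have xK: "x k \<delta> \<in> carrier K" using A.ge_carrier[OF xk(1)] .
    have "v (j (a k) \<otimes>\<^bsub>L\<^esub> E k) = \<iota> \<delta> \<otimes>\<^bsub>\<Gamma>\<^esub> v (E k)"
      unfolding ak using B.w_mult[of "j (x k \<delta>)" "E k"] xK x0 j_nonzero E(2)[OF k] E_carrier[OF k] v_j vx by simp
    then have "v (j (a k) \<otimes>\<^bsub>L\<^esub> E k) = \<gamma>" using vE[OF k] \<iota>_closed[OF \<delta>] by (simp add: \<gamma>_def B.G.m_comm)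
    moreover have "j (a k) \<otimes>\<^bsub>L\<^esub> E k \<noteq> \<zero>\<^bsub>L\<^esub>"
      unfolding ak using xK x0 j_nonzero E(2)[OF k] E_carrier[OF k] by (simp add: B.F.integral_iff)
    ultimately show False using tk by (auto simp: val_gt_def)
  qed
  then show "r k \<delta> = \<zero>\<^bsub>A.GR\<^esub> \<delta>"
    using xk A.cl_eq_zero[OF \<delta> A.ge_carrier[OF xk(1)]] A.GR_zero[OF \<delta>] by simp
qed

end

text \<open>
  The value of \<open>\<Sum> a\<^sub>i E\<^sub>i\<close> is the value of one of its terms.
\<close>

lemma (in gr_basis) value_semigroup_finitely_generated:
  "finitely_generated_over \<Gamma> (\<iota> ` value_semigroup K v\<^sub>0 A) (value_semigroup L v B)"
proof -
  let ?S = "\<iota> ` value_semigroup K v\<^sub>0 A" and ?T = "value_semigroup L v B" and ?Z = "(\<lambda>i. v (E i)) ` {..<n}"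
  have j0: "a \<noteq> \<zero>\<^bsub>K\<^esub>" if "a \<in> A" "j a \<noteq> \<zero>\<^bsub>L\<^esub>" for a using that by auto
  have T: "v b \<in> ?T" if "b \<in> B" "b \<noteq> \<zero>\<^bsub>L\<^esub>" for b
    using that by (auto simp: value_semigroup_def)
  have S: "v (j a) \<in> ?S" if "a \<in> A" "a \<noteq> \<zero>\<^bsub>K\<^esub>" for a
    using that v_j[OF A_carrier] by (auto simp: value_semigroup_def)
  have SD: "\<exists>a\<in>A. a \<noteq> \<zero>\<^bsub>K\<^esub> \<and> s = v (j a)" if s: "s \<in> ?S" for s
  proof -
    from s obtain a where "a \<in> A" "a \<noteq> \<zero>\<^bsub>K\<^esub>" "s = \<iota> (v\<^sub>0 a)" by (auto simp: value_semigroup_def)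
    thus ?thesis using v_j[OF A_carrier] by (intro bexI[of _ a]) auto
  qed
  have vm: "v (j a \<otimes>\<^bsub>L\<^esub> E i) = v (j a) \<otimes>\<^bsub>\<Gamma>\<^esub> v (E i)" if "a \<in> A" "a \<noteq> \<zero>\<^bsub>K\<^esub>" "i < n" for a i
    using B.w_mult[of "j a" "E i"] that j_nonzero A_carrier E_carrier E(2) j.hom_closed by blast
  have "?S \<subseteq> ?T"
  proof
    fix s assume "s \<in> ?S"
    from SD[OF this] obtain a where a: "a \<in> A" "a \<noteq> \<zero>\<^bsub>K\<^esub>" "s = v (j a)" by blast
    show "s \<in> ?T" unfolding a(3) by (rule T) (use a j_A j_nonzero A_carrier in auto)
  qed
  moreover have "?Z \<subseteq> ?T" using T E by blast
  moreover have "?T = (\<Union>z\<in>?Z. ?S #>\<^bsub>\<Gamma>\<^esub> z)"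
  proof
    show "?T \<subseteq> (\<Union>z\<in>?Z. ?S #>\<^bsub>\<Gamma>\<^esub> z)"
    proof
      fix t assume "t \<in> ?T"
      then obtain b where b: "b \<in> B" "b \<noteq> \<zero>\<^bsub>L\<^esub>" "t = v b" by (auto simp: value_semigroup_def)
      from span[OF b(1)] obtain a where a: "\<And>i. i < n \<Longrightarrow> a i \<in> A"
        and beq: "b = (\<Oplus>\<^bsub>L\<^esub>i\<in>{..<n}. j (a i) \<otimes>\<^bsub>L\<^esub> E i)" by blast
      have tc: "j (a i) \<otimes>\<^bsub>L\<^esub> E i \<in> carrier L" if "i < n" for i
        using that a A_carrier E_carrier by simp
      have bc: "b \<in> carrier L" using b(1) B.R_carrier by blast
      have n: "{..<n} \<noteq> {}" using b(2) beq by auto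
      obtain i where i: "i < n" "vle L \<Gamma> v (j (a i) \<otimes>\<^bsub>L\<^esub> E i) b"
        using B.finsum_ge_some_term[OF _ n, of "\<lambda>i. j (a i) \<otimes>\<^bsub>L\<^esub> E i"] tc unfolding beq by auto
      have "vle L \<Gamma> v b (\<Oplus>\<^bsub>L\<^esub>i\<in>{..<n}. j (a i) \<otimes>\<^bsub>L\<^esub> E i)" using B.le_refl[OF bc] unfolding beq[symmetric] .
      from indep[OF a bc this i(1)] have le: "vle L \<Gamma> v b (j (a i) \<otimes>\<^bsub>L\<^esub> E i)" by simp
      have nz: "j (a i) \<otimes>\<^bsub>L\<^esub> E i \<noteq> \<zero>\<^bsub>L\<^esub>" using i(2) b(2) by (auto simp: vle_def)
      have "v b = v (j (a i) \<otimes>\<^bsub>L\<^esub> E i)"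
        using i(2) le nz b(2) B.G.leq_antisym[OF B.w_closed[OF bc b(2)] B.w_closed[OF tc[OF i(1)] nz]]
        by (auto simp: vle_def)
      moreover have a0: "a i \<noteq> \<zero>\<^bsub>K\<^esub>" using nz i(1) E_carrier by auto
      ultimately have "t = v (j (a i)) \<otimes>\<^bsub>\<Gamma>\<^esub> v (E i)" using b(3) vm a i(1) by simp
      thus "t \<in> (\<Union>z\<in>?Z. ?S #>\<^bsub>\<Gamma>\<^esub> z)" using S[OF a[OF i(1)] a0] i(1) unfolding r_coset_def by blast
    qed
    show "(\<Union>z\<in>?Z. ?S #>\<^bsub>\<Gamma>\<^esub> z) \<subseteq> ?T"
    proof
      fix t assume "t \<in> (\<Union>z\<in>?Z. ?S #>\<^bsub>\<Gamma>\<^esub> z)"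
      then obtain i s where t: "i < n" "s \<in> ?S" "t = s \<otimes>\<^bsub>\<Gamma>\<^esub> v (E i)" unfolding r_coset_def by blast
      from SD[OF t(2)] obtain a where a: "a \<in> A" "a \<noteq> \<zero>\<^bsub>K\<^esub>" "s = v (j a)" by blast
      have "j a \<otimes>\<^bsub>L\<^esub> E i \<in> B" using subringE(6)[OF B.R] j_A E a t(1) by blast
      moreover have "j a \<otimes>\<^bsub>L\<^esub> E i \<noteq> \<zero>\<^bsub>L\<^esub>"
        using B.F.integral[of "j a" "E i"] j_nonzero a A_carrier E(2) E_carrier t(1) j.hom_closed by blast
      ultimately show "t \<in> ?T" using T vm[OF a(1,2) t(1)] unfolding t(3) a(3) by metis
    qed
  qed
  ultimately show ?thesis unfolding finitely_generated_over_def by (intro conjI exI[of _ ?Z]) auto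
qed

section \<open>Finite free algebras are finitely presented\<close>

lemma finite_submultisets: "finite {u. u \<subseteq># m}"
proof (induction m)
  case (add x m)
  have "u \<in> {u. u \<subseteq># m} \<union> add_mset x ` {u. u \<subseteq># m}" if "u \<subseteq># add_mset x m" for u
  proof (cases "x \<in># u")
    case True
    then obtain w where w: "u = add_mset x w" using multi_member_split by metis
    thus ?thesis using that by simp
  next
    case False
    have "u \<subseteq># m"
    proof (rule mset_subset_eqI)
      fix a show "count u a \<le> count m a"
        using mset_subset_eq_count[OF that, of a] False by (cases "a = x") (auto simp: not_in_iff)
    qed
    thus ?thesis by simp
  qed
  hence "{u. u \<subseteq># add_mset x m} \<subseteq> {u. u \<subseteq># m} \<union> add_mset x ` {u. u \<subseteq># m}" by blast
  thus ?case using finite_subset add.IH by blast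
qed simp

context cring
begin

text \<open>
  The product of \<open>mpoly_ring\<close>, which does not depend on the set of variables.
\<close>

definition conv :: "('c multiset \<Rightarrow> 'a) \<Rightarrow> ('c multiset \<Rightarrow> 'a) \<Rightarrow> 'c multiset \<Rightarrow> 'a" where
  "conv P Q = (\<lambda>m. \<Oplus>u \<in> {u. u \<subseteq># m}. P u \<otimes> Q (m - u))"

lemma conv_coeff: "\<lbrakk>carrier_coeff P; carrier_coeff Q\<rbrakk> \<Longrightarrow> carrier_coeff (conv P Q)"
  by (auto simp: carrier_coeff_def conv_def intro!: finsum_closed)

lemma conv_const:
  assumes "carrier_coeff Q" "k \<in> carrier R"
  shows "conv (indexed_const k) Q = (\<lambda>m. k \<otimes> Q m)"
proof
  fix m
  have "conv (indexed_const k) Q m = (\<Oplus>u \<in> {u. u \<subseteq># m}. if {#} = u then k \<otimes> Q (m - u) else \<zero>)"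
    unfolding conv_def using assms by (intro finsum_cong') (auto simp: indexed_const_def carrier_coeff_def)
  also have "\<dots> = k \<otimes> Q (m - {#})"
    using assms by (intro add.finprod_singleton) (auto simp: finite_submultisets carrier_coeff_def)
  finally show "conv (indexed_const k) Q m = k \<otimes> Q m" by simp
qed

lemma conv_padd:
  assumes "carrier_coeff P" "carrier_coeff P'" "carrier_coeff Q"
  shows "conv (indexed_padd P P') Q = indexed_padd (conv P Q) (conv P' Q)"
proof
  fix m
  have c: "\<And>m. P m \<in> carrier R" "\<And>m. P' m \<in> carrier R" "\<And>m. Q m \<in> carrier R"
    using assms by (auto simp: carrier_coeff_def)
  have "conv (indexed_padd P P') Q m = (\<Oplus>u \<in> {u. u \<subseteq># m}. P u \<otimes> Q (m - u) \<oplus> P' u \<otimes> Q (m - u))"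
    unfolding conv_def using c by (intro finsum_cong') (auto simp: indexed_padd_def l_distr)
  also have "\<dots> = conv P Q m \<oplus> conv P' Q m" unfolding conv_def using c by (intro finsum_addf) auto
  finally show "conv (indexed_padd P P') Q m = indexed_padd (conv P Q) (conv P' Q) m"
    by (simp add: indexed_padd_def)
qed

text \<open>
  The inductive description of the polynomial ring builds polynomials from constants by addition
  and multiplication with variables. Together with the rules for constants and sums, this rule
  reduces statements on products to that description.
\<close>

lemma conv_pmult:
  assumes "carrier_coeff P" "carrier_coeff Q"
  shows "conv (indexed_pmult P i) Q = indexed_pmult (conv P Q) i"
proof
  fix m
  have c: "\<And>m. P m \<in> carrier R" "\<And>m. Q m \<in> carrier R"
    using assms by (auto simp: carrier_coeff_def)
  show "conv (indexed_pmult P i) Q m = indexed_pmult (conv P Q) i m"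
  proof (cases "i \<in># m")
    case False
    have "indexed_pmult P i u \<otimes> Q (m - u) = \<zero>" if "u \<subseteq># m" for u
      using False that c mset_subset_eqD[OF that] by (auto simp: indexed_pmult_def)
    hence "conv (indexed_pmult P i) Q m = \<zero>" unfolding conv_def by (intro add.finprod_one_eqI) simp
    thus ?thesis using False by (simp add: indexed_pmult_def)
  next
    case True
    then obtain m' where m: "m = add_mset i m'" using multi_member_split by metis
    have "(\<Oplus>u \<in> add_mset i ` {u. u \<subseteq># m'}. indexed_pmult P i u \<otimes> Q (m - u)) = conv (indexed_pmult P i) Q m"
      unfolding conv_def
    proof (rule add.finprod_mono_neutral_cong_left)
      show "finite {u. u \<subseteq># m}" by (rule finite_submultisets)
      show "add_mset i ` {u. u \<subseteq># m'} \<subseteq> {u. u \<subseteq># m}" unfolding m by auto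
      fix u assume u: "u \<in> {u. u \<subseteq># m} - add_mset i ` {u. u \<subseteq># m'}"
      have "i \<notin># u"
      proof
        assume "i \<in># u"
        then obtain w where w: "u = add_mset i w" using multi_member_split by metis
        thus False using u unfolding m by auto
      qed
      thus "indexed_pmult P i u \<otimes> Q (m - u) = \<zero>" using c by (simp add: indexed_pmult_def)
    qed (use c in \<open>auto simp: indexed_pmult_def\<close>)
    moreover have "(\<Oplus>u \<in> add_mset i ` {u. u \<subseteq># m'}. indexed_pmult P i u \<otimes> Q (m - u))
       = (\<Oplus>u \<in> {u. u \<subseteq># m'}. indexed_pmult P i (add_mset i u) \<otimes> Q (m - add_mset i u))"
      by (rule finsum_reindex) (use c in \<open>auto simp: indexed_pmult_def inj_on_def\<close>)
    moreover have "\<dots> = conv P Q m'" unfolding m conv_def by (simp add: indexed_pmult_def)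
    ultimately show ?thesis unfolding m by (simp add: indexed_pmult_def)
  qed
qed

lemma conv_comm:
  fixes P Q :: "'c multiset \<Rightarrow> 'a"
  assumes "carrier_coeff P" "carrier_coeff Q"
  shows "conv P Q = conv Q P"
proof
  fix m :: "'c multiset"
  have c: "\<And>m. P m \<in> carrier R" "\<And>m. Q m \<in> carrier R"
    using assms by (auto simp: carrier_coeff_def)
  have dd: "m - (m - u) = u" if "u \<subseteq># m" for u
  proof -
    from that obtain w where "m = u + w" by (auto simp: mset_subset_eq_exists_conv)
    thus ?thesis by simp
  qed
  have im: "(\<lambda>u. m - u) ` {u. u \<subseteq># m} = {u. u \<subseteq># m}"
  proof
    show "{u. u \<subseteq># m} \<subseteq> (\<lambda>u. m - u) ` {u. u \<subseteq># m}"
    proof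
      fix u assume "u \<in> {u. u \<subseteq># m}"
      hence "u = m - (m - u)" "m - u \<in> {u. u \<subseteq># m}" using dd by simp_all
      thus "u \<in> (\<lambda>u. m - u) ` {u. u \<subseteq># m}" by (rule image_eqI)
    qed
  qed auto
  have inj: "inj_on (\<lambda>u. m - u) {u. u \<subseteq># m}" by (rule inj_on_inverseI[of _ "\<lambda>u. m - u"]) (simp add: dd)
  have "conv P Q m = (\<Oplus>u \<in> (\<lambda>u. m - u) ` {u. u \<subseteq># m}. P u \<otimes> Q (m - u))" by (simp only: im conv_def)
  also have "\<dots> = (\<Oplus>u \<in> {u. u \<subseteq># m}. P (m - u) \<otimes> Q (m - (m - u)))"
    by (rule finsum_reindex) (use c inj in auto)
  also have "\<dots> = conv Q P m"
    unfolding conv_def using c by (intro finsum_cong') (auto simp: dd m_comm)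
  finally show "conv P Q m = conv Q P m" .
qed

lemma pset_coeff: "P \<in> indexed_pset I (carrier R) \<Longrightarrow> carrier_coeff P"
  using indexed_pset_in_carrier by blast

lemma const_coeff: "k \<in> carrier R \<Longrightarrow> carrier_coeff (indexed_const k)"
  using pset_coeff indexed_pset.indexed_const by blast

lemma conv_assoc:
  assumes "P \<in> indexed_pset I (carrier R)" "carrier_coeff Q" "carrier_coeff T"
  shows "conv (conv P Q) T = conv P (conv Q T)"
  using assms(1)
proof induction
  case (indexed_const k)
  have c: "\<And>m. T m \<in> carrier R" "\<And>m. Q m \<in> carrier R"
    using assms by (auto simp: carrier_coeff_def)
  have "conv (\<lambda>m. k \<otimes> Q m) T = (\<lambda>m. k \<otimes> conv Q T m)"
  proof
    fix m
    have "conv (\<lambda>m. k \<otimes> Q m) T m = (\<Oplus>u \<in> {u. u \<subseteq># m}. k \<otimes> (Q u \<otimes> T (m - u)))"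
      unfolding conv_def using c indexed_const by (intro finsum_cong') (auto simp: m_assoc)
    also have "\<dots> = k \<otimes> conv Q T m"
      unfolding conv_def using c indexed_const by (intro finsum_rdistr[symmetric]) (auto simp: finite_submultisets)
    finally show "conv (\<lambda>m. k \<otimes> Q m) T m = k \<otimes> conv Q T m" .
  qed
  thus ?case
    by (simp only: conv_const[OF assms(2) indexed_const] conv_const[OF conv_coeff[OF assms(2,3)] indexed_const])
next
  case (indexed_padd P P')
  note p = pset_coeff[OF indexed_padd(1)] pset_coeff[OF indexed_padd(2)]
  show ?case
    by (simp only: conv_padd[OF p assms(2)] conv_padd[OF conv_coeff conv_coeff assms(3)] p assms(2)
        conv_padd[OF p conv_coeff[OF assms(2,3)]] indexed_padd)
next
  case (indexed_pmult P i)
  note p = pset_coeff[OF indexed_pmult(1)]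
  show ?case
    by (simp only: conv_pmult[OF p assms(2)] conv_pmult[OF conv_coeff[OF p assms(2)] assms(3)]
        conv_pmult[OF p conv_coeff[OF assms(2,3)]] indexed_pmult)
qed

lemma conv_const_closed:
  fixes I :: "'c set"
  assumes "k \<in> carrier R" "Q \<in> indexed_pset I (carrier R)"
  shows "conv (indexed_const k) Q \<in> indexed_pset I (carrier R)"
  using assms(2)
proof induction
  case (indexed_const q)
  have "conv (indexed_const k) (indexed_const q :: 'c multiset \<Rightarrow> 'a) = indexed_const (k \<otimes> q)"
    unfolding conv_const[OF const_coeff[OF indexed_const] assms(1)] using assms(1) by (auto simp: indexed_const_def)
  thus ?case using assms(1) indexed_const by (simp add: indexed_pset.indexed_const)
next
  case (indexed_padd P P')
  note p = pset_coeff[OF indexed_padd(1)] pset_coeff[OF indexed_padd(2)] and k = const_coeff[OF assms(1)]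
  have "conv (indexed_const k) (indexed_padd P P') = indexed_padd (conv (indexed_const k) P) (conv (indexed_const k) P')"
    by (simp only: conv_comm[OF k indexed_padd_in_carrier[OF p]] conv_padd[OF p k] conv_comm[OF p(1) k] conv_comm[OF p(2) k])
  thus ?case using indexed_pset.indexed_padd indexed_padd.IH by simp
next
  case (indexed_pmult P i)
  note p = pset_coeff[OF indexed_pmult(1)] and k = const_coeff[OF assms(1)]
  have "conv (indexed_const k) (indexed_pmult P i) = indexed_pmult (conv (indexed_const k) P) i"
    by (simp only: conv_comm[OF k indexed_pmult_in_carrier[OF p]] conv_pmult[OF p k] conv_comm[OF p(1) k])
  thus ?case using indexed_pset.indexed_pmult indexed_pmult by simp
qed

lemma conv_closed:
  assumes "P \<in> indexed_pset I (carrier R)" "Q \<in> indexed_pset I (carrier R)"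
  shows "conv P Q \<in> indexed_pset I (carrier R)"
  using assms(1)
proof induction
  case (indexed_const k)
  thus ?case using conv_const_closed assms(2) by blast
next
  case (indexed_padd P P')
  thus ?case
    by (simp only: conv_padd[OF pset_coeff pset_coeff pset_coeff[OF assms(2)]] indexed_pset.indexed_padd)
next
  case (indexed_pmult P i)
  thus ?case
    by (simp only: conv_pmult[OF pset_coeff pset_coeff[OF assms(2)]] indexed_pset.indexed_pmult)
qed

lemma mpoly_simps:
  "carrier (mpoly_ring R I) = indexed_pset I (carrier R)"
  "P \<otimes>\<^bsub>mpoly_ring R I\<^esub> Q = conv P Q"
  "P \<oplus>\<^bsub>mpoly_ring R I\<^esub> Q = indexed_padd P Q"
  "\<one>\<^bsub>mpoly_ring R I\<^esub> = indexed_const \<one>"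
  "\<zero>\<^bsub>mpoly_ring R I\<^esub> = indexed_const \<zero>"
  by (simp_all add: mpoly_ring_def conv_def)

lemma mpoly_cring: "cring (mpoly_ring R I)"
proof (rule cringI)
  let ?P = "indexed_pset I (carrier R)"
  note c = pset_coeff[unfolded carrier_coeff_def, rule_format]
  have neg: "\<exists>y\<in>?P. indexed_padd y x = indexed_const \<zero>" if x: "x \<in> ?P" for x
  proof (intro bexI)
    show "conv (indexed_const (\<ominus> \<one>)) x \<in> ?P" using conv_const_closed[OF _ x] by simp
    show "indexed_padd (conv (indexed_const (\<ominus> \<one>)) x) x = indexed_const \<zero>"
      using c[OF x] by (subst conv_const) (auto simp: pset_coeff[OF x] indexed_padd_def indexed_const_def l_minus l_neg)
  qed
  show "abelian_group (mpoly_ring R I)"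
  proof (rule abelian_groupI; unfold mpoly_simps)
    show "indexed_padd x y \<in> ?P" if "x \<in> ?P" "y \<in> ?P" for x y
      using that by (rule indexed_pset.indexed_padd)
    show "indexed_padd (indexed_padd x y) z = indexed_padd x (indexed_padd y z)"
      if "x \<in> ?P" "y \<in> ?P" "z \<in> ?P" for x y z
      using that by (auto simp: indexed_padd_def a_assoc c)
    show "indexed_padd x y = indexed_padd y x" if "x \<in> ?P" "y \<in> ?P" for x y
      using that by (auto simp: indexed_padd_def a_comm c)
    show "indexed_padd (indexed_const \<zero>) x = x" if "x \<in> ?P" for x
      using that by (rule indexed_padd_zero(2)[OF pset_coeff])
  qed (use neg in \<open>auto simp: indexed_pset.indexed_const\<close>)
  show "comm_monoid (mpoly_ring R I)"
  proof (rule comm_monoidI; unfold mpoly_simps)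
    show "conv x y \<in> ?P" if "x \<in> ?P" "y \<in> ?P" for x y using that by (rule conv_closed)
    show "conv (conv x y) z = conv x (conv y z)" if "x \<in> ?P" "y \<in> ?P" "z \<in> ?P" for x y z
      using conv_assoc[OF that(1) pset_coeff[OF that(2)] pset_coeff[OF that(3)]] .
    show "conv x y = conv y x" if "x \<in> ?P" "y \<in> ?P" for x y
      using conv_comm[OF pset_coeff[OF that(1)] pset_coeff[OF that(2)]] .
    show "conv (indexed_const \<one>) x = x" if "x \<in> ?P" for x
      using conv_const[OF pset_coeff[OF that] one_closed] c[OF that] by simp
  qed (auto simp: indexed_pset.indexed_const)
  show "(x \<oplus>\<^bsub>mpoly_ring R I\<^esub> y) \<otimes>\<^bsub>mpoly_ring R I\<^esub> z = x \<otimes>\<^bsub>mpoly_ring R I\<^esub> z \<oplus>\<^bsub>mpoly_ring R I\<^esub> y \<otimes>\<^bsub>mpoly_ring R I\<^esub> z"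
    if "x \<in> carrier (mpoly_ring R I)" "y \<in> carrier (mpoly_ring R I)" "z \<in> carrier (mpoly_ring R I)" for x y z
    using that conv_padd[OF pset_coeff pset_coeff pset_coeff] unfolding mpoly_simps by blast
qed

end

locale mpoly_eval = R: cring R + S: cring S
  for R :: "('a, 'm) ring_scheme" and S :: "('b, 'n) ring_scheme" +
  fixes \<phi> and I :: "'c set" and \<epsilon> :: "'c \<Rightarrow> 'b"
  assumes \<phi>: "\<phi> \<in> ring_hom R S" and finite_I: "finite I" and \<epsilon>: "i \<in> I \<Longrightarrow> \<epsilon> i \<in> carrier S"
begin

abbreviation M where "M \<equiv> mpoly_ring R I"

sublocale M: cring M by (rule R.mpoly_cring)
sublocale \<phi>: ring_hom_cring R S \<phi> using \<phi> by unfold_locales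

definition supp where "supp P = {m. P m \<noteq> \<zero>\<^bsub>R\<^esub>}"
definition mon where "mon m = (\<Otimes>\<^bsub>S\<^esub>i\<in>I. \<epsilon> i [^]\<^bsub>S\<^esub> count m i)"
definition ev where "ev P = (\<Oplus>\<^bsub>S\<^esub>m\<in>supp P. \<phi> (P m) \<otimes>\<^bsub>S\<^esub> mon m)"

lemma mon_closed: "mon m \<in> carrier S"
  unfolding mon_def using \<epsilon> by (intro S.finprod_closed) auto

lemma mon_empty: "mon {#} = \<one>\<^bsub>S\<^esub>"
  unfolding mon_def by simp

lemma mon_add: assumes "i \<in> I" shows "mon (add_mset i m) = mon m \<otimes>\<^bsub>S\<^esub> \<epsilon> i"
proof -
  have "mon (add_mset i m) = (\<Otimes>\<^bsub>S\<^esub>k\<in>I. \<epsilon> k [^]\<^bsub>S\<^esub> count m k \<otimes>\<^bsub>S\<^esub> (if i = k then \<epsilon> k else \<one>\<^bsub>S\<^esub>))"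
    unfolding mon_def using \<epsilon> by (intro S.finprod_cong') (auto simp: S.nat_pow_Suc)
  also have "\<dots> = mon m \<otimes>\<^bsub>S\<^esub> (\<Otimes>\<^bsub>S\<^esub>k\<in>I. if i = k then \<epsilon> k else \<one>\<^bsub>S\<^esub>)"
    unfolding mon_def using \<epsilon> by (intro S.finprod_multf) auto
  also have "(\<Otimes>\<^bsub>S\<^esub>k\<in>I. if i = k then \<epsilon> k else \<one>\<^bsub>S\<^esub>) = \<epsilon> i"
    using \<epsilon> by (intro S.finprod_singleton assms finite_I) auto
  finally show ?thesis .
qed

lemma coeff: "P \<in> carrier M \<Longrightarrow> P m \<in> carrier R"
  using R.pset_coeff[unfolded R.carrier_coeff_def] unfolding R.mpoly_simps by blast

lemma finite_supp: assumes "P \<in> carrier M" shows "finite (supp P)"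
  using assms unfolding R.mpoly_simps
proof induction
  case (indexed_const k)
  have "supp (R.indexed_const k) \<subseteq> {{#}}" by (auto simp: supp_def R.indexed_const_def)
  thus ?case using finite_subset by auto
next
  case (indexed_padd P Q)
  have "supp (R.indexed_padd P Q) \<subseteq> supp P \<union> supp Q" by (auto simp: supp_def R.indexed_padd_def)
  thus ?case using finite_subset indexed_padd by auto
next
  case (indexed_pmult P i)
  have "supp (R.indexed_pmult P i) \<subseteq> add_mset i ` supp P"
  proof
    fix m assume m: "m \<in> supp (R.indexed_pmult P i)"
    hence i: "i \<in># m" by (auto simp: supp_def R.indexed_pmult_def split: if_splits)
    hence "m - {#i#} \<in> supp P" using m by (auto simp: supp_def R.indexed_pmult_def)
    moreover have "m = add_mset i (m - {#i#})" using i by simp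
    ultimately show "m \<in> add_mset i ` supp P" by blast
  qed
  thus ?case using finite_subset indexed_pmult by auto
qed

lemma ev_eq:
  assumes "P \<in> carrier M" "finite T" "supp P \<subseteq> T"
  shows "ev P = (\<Oplus>\<^bsub>S\<^esub>m\<in>T. \<phi> (P m) \<otimes>\<^bsub>S\<^esub> mon m)"
  unfolding ev_def
  by (rule S.add.finprod_mono_neutral_cong_left) (use assms mon_closed coeff in \<open>auto simp: supp_def\<close>)

lemma ev_closed: "P \<in> carrier M \<Longrightarrow> ev P \<in> carrier S"
  unfolding ev_def by (intro S.finsum_closed) (use mon_closed coeff in auto)

lemma const_closed: "k \<in> carrier R \<Longrightarrow> R.indexed_const k \<in> carrier M"
  unfolding R.mpoly_simps by (rule ring.indexed_pset.indexed_const[OF R.ring_axioms])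

lemma ev_const: assumes "k \<in> carrier R" shows "ev (R.indexed_const k) = \<phi> k"
proof -
  have "ev (R.indexed_const k) = (\<Oplus>\<^bsub>S\<^esub>m\<in>{{#}}. \<phi> (R.indexed_const k m) \<otimes>\<^bsub>S\<^esub> mon m)"
    by (rule ev_eq[OF const_closed[OF assms]]) (auto simp: supp_def R.indexed_const_def)
  also have "\<dots> = \<phi> k"
    using assms by (simp add: mon_closed mon_empty R.indexed_const_def)
  finally show ?thesis .
qed

lemma ev_add: assumes "P \<in> carrier M" "Q \<in> carrier M"
  shows "ev (P \<oplus>\<^bsub>M\<^esub> Q) = ev P \<oplus>\<^bsub>S\<^esub> ev Q"
proof -
  let ?T = "supp P \<union> supp Q"
  have fin: "finite ?T" using finite_supp assms by simp
  have "ev (P \<oplus>\<^bsub>M\<^esub> Q) = (\<Oplus>\<^bsub>S\<^esub>m\<in>?T. \<phi> ((P \<oplus>\<^bsub>M\<^esub> Q) m) \<otimes>\<^bsub>S\<^esub> mon m)"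
    by (rule ev_eq[OF M.a_closed[OF assms] fin]) (use assms in \<open>auto simp: supp_def R.mpoly_simps(3) R.indexed_padd_def\<close>)
  also have "\<dots> = (\<Oplus>\<^bsub>S\<^esub>m\<in>?T. \<phi> (P m) \<otimes>\<^bsub>S\<^esub> mon m \<oplus>\<^bsub>S\<^esub> \<phi> (Q m) \<otimes>\<^bsub>S\<^esub> mon m)"
    using assms mon_closed coeff
    by (intro S.finsum_cong') (auto simp: R.mpoly_simps(3) R.indexed_padd_def S.l_distr)
  also have "\<dots> = (\<Oplus>\<^bsub>S\<^esub>m\<in>?T. \<phi> (P m) \<otimes>\<^bsub>S\<^esub> mon m) \<oplus>\<^bsub>S\<^esub> (\<Oplus>\<^bsub>S\<^esub>m\<in>?T. \<phi> (Q m) \<otimes>\<^bsub>S\<^esub> mon m)"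
    using assms mon_closed coeff by (intro S.finsum_addf) auto
  finally show ?thesis using ev_eq[OF assms(1) fin] ev_eq[OF assms(2) fin] by simp
qed

lemma pmult_closed: "\<lbrakk>P \<in> carrier M; i \<in> I\<rbrakk> \<Longrightarrow> R.indexed_pmult P i \<in> carrier M"
  unfolding R.mpoly_simps by (rule ring.indexed_pset.indexed_pmult[OF R.ring_axioms])

lemma ev_pmult: assumes "P \<in> carrier M" "i \<in> I"
  shows "ev (R.indexed_pmult P i) = ev P \<otimes>\<^bsub>S\<^esub> \<epsilon> i"
proof -
  have "supp (R.indexed_pmult P i) \<subseteq> add_mset i ` supp P"
  proof
    fix m assume m: "m \<in> supp (R.indexed_pmult P i)"
    hence i: "i \<in># m" by (auto simp: supp_def R.indexed_pmult_def split: if_splits)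
    hence "m - {#i#} \<in> supp P" using m by (auto simp: supp_def R.indexed_pmult_def)
    moreover have "m = add_mset i (m - {#i#})" using i by simp
    ultimately show "m \<in> add_mset i ` supp P" by blast
  qed
  hence "ev (R.indexed_pmult P i) = (\<Oplus>\<^bsub>S\<^esub>m\<in>add_mset i ` supp P. \<phi> (R.indexed_pmult P i m) \<otimes>\<^bsub>S\<^esub> mon m)"
    using assms finite_supp by (intro ev_eq pmult_closed) auto
  also have "\<dots> = (\<Oplus>\<^bsub>S\<^esub>m\<in>supp P. \<phi> (R.indexed_pmult P i (add_mset i m)) \<otimes>\<^bsub>S\<^esub> mon (add_mset i m))"
    by (rule S.finsum_reindex)
      (use assms coeff[OF pmult_closed[OF assms]] mon_closed in \<open>auto simp: inj_on_def\<close>)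
  also have "\<dots> = (\<Oplus>\<^bsub>S\<^esub>m\<in>supp P. \<phi> (P m) \<otimes>\<^bsub>S\<^esub> mon m \<otimes>\<^bsub>S\<^esub> \<epsilon> i)"
    using assms coeff mon_closed \<epsilon>
    by (intro S.finsum_cong') (auto simp: R.indexed_pmult_def mon_add S.m_assoc)
  also have "\<dots> = ev P \<otimes>\<^bsub>S\<^esub> \<epsilon> i"
    unfolding ev_def using assms coeff mon_closed \<epsilon> finite_supp
    by (intro S.finsum_ldistr[symmetric]) auto
  finally show ?thesis .
qed

lemma const_mult:
  assumes "Q \<in> carrier M" "k \<in> carrier R"
  shows "R.indexed_const k \<otimes>\<^bsub>M\<^esub> Q = (\<lambda>m. k \<otimes>\<^bsub>R\<^esub> Q m)"
  using assms unfolding R.mpoly_simps by (intro R.conv_const R.pset_coeff)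

lemma pmult_mult:
  assumes "P \<in> carrier M" "Q \<in> carrier M"
  shows "R.indexed_pmult P i \<otimes>\<^bsub>M\<^esub> Q = R.indexed_pmult (P \<otimes>\<^bsub>M\<^esub> Q) i"
  using assms unfolding R.mpoly_simps by (intro R.conv_pmult R.pset_coeff)

lemma mpoly_induct [consumes 1, case_names const add pmult]:
  assumes "P \<in> carrier M"
    and "\<And>k. k \<in> carrier R \<Longrightarrow> T (R.indexed_const k)"
    and "\<And>P Q. \<lbrakk>P \<in> carrier M; Q \<in> carrier M; T P; T Q\<rbrakk> \<Longrightarrow> T (P \<oplus>\<^bsub>M\<^esub> Q)"
    and "\<And>P i. \<lbrakk>P \<in> carrier M; T P; i \<in> I\<rbrakk> \<Longrightarrow> T (R.indexed_pmult P i)"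
  shows "T P"
  using assms(1) unfolding R.mpoly_simps(1)
  by (induction rule: ring.indexed_pset.induct[OF R.ring_axioms, consumes 1])
    (use assms(2-) in \<open>auto simp: R.mpoly_simps(1,3)\<close>)

lemma ev_mult: assumes "P \<in> carrier M" "Q \<in> carrier M"
  shows "ev (P \<otimes>\<^bsub>M\<^esub> Q) = ev P \<otimes>\<^bsub>S\<^esub> ev Q"
  using assms(1)
proof (induction rule: mpoly_induct)
  case (const k)
  have c: "R.indexed_const k \<otimes>\<^bsub>M\<^esub> Q \<in> carrier M" using const_closed[OF const] assms by simp
  have "ev (R.indexed_const k \<otimes>\<^bsub>M\<^esub> Q) = (\<Oplus>\<^bsub>S\<^esub>m\<in>supp Q. \<phi> ((R.indexed_const k \<otimes>\<^bsub>M\<^esub> Q) m) \<otimes>\<^bsub>S\<^esub> mon m)"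
    by (rule ev_eq[OF c finite_supp[OF assms(2)]]) (use const in \<open>auto simp: const_mult assms supp_def\<close>)
  also have "\<dots> = (\<Oplus>\<^bsub>S\<^esub>m\<in>supp Q. \<phi> k \<otimes>\<^bsub>S\<^esub> (\<phi> (Q m) \<otimes>\<^bsub>S\<^esub> mon m))"
    using assms coeff mon_closed const
    by (intro S.finsum_cong') (auto simp: const_mult S.m_assoc)
  also have "\<dots> = \<phi> k \<otimes>\<^bsub>S\<^esub> ev Q"
    unfolding ev_def using assms coeff mon_closed finite_supp const
    by (intro S.finsum_rdistr[symmetric]) auto
  finally show ?case using ev_const[OF const] by simp
next
  case (add P P')
  thus ?case using assms(2) by (simp add: M.l_distr ev_add S.l_distr ev_closed)
next
  case (pmult P i)
  thus ?case using assms(2) by (simp add: pmult_mult ev_pmult ev_closed \<epsilon> S.m_ac)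
qed

lemma ev_ring_hom: "ev \<in> ring_hom M S"
proof (rule ring_hom_memI)
  show "ev \<one>\<^bsub>M\<^esub> = \<one>\<^bsub>S\<^esub>" by (simp add: R.mpoly_simps(4) ev_const)
qed (use ev_closed ev_mult ev_add in auto)

sublocale ev: ring_hom_cring M S ev using ev_ring_hom by unfold_locales

abbreviation var where "var i \<equiv> R.indexed_pmult \<one>\<^bsub>M\<^esub> i"
abbreviation const where "const k \<equiv> R.indexed_const k"

lemma var_closed: "i \<in> I \<Longrightarrow> var i \<in> carrier M" using pmult_closed by simp

lemma ev_var: "i \<in> I \<Longrightarrow> ev (var i) = \<epsilon> i" by (simp add: ev_pmult \<epsilon>)

lemma pmult_var: "P \<in> carrier M \<Longrightarrow> R.indexed_pmult P i = var i \<otimes>\<^bsub>M\<^esub> P"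
  by (simp add: pmult_mult)

lemma const_ring_hom: "const \<in> ring_hom R M"
proof (rule ring_hom_memI)
  show "const (x \<otimes>\<^bsub>R\<^esub> y) = const x \<otimes>\<^bsub>M\<^esub> const y" if "x \<in> carrier R" "y \<in> carrier R" for x y
    using that by (subst const_mult[OF const_closed]) (auto simp: R.indexed_const_def)
qed (auto simp: const_closed R.mpoly_simps(3,4) R.indexed_padd_const)

sublocale const: ring_hom_cring R M const using const_ring_hom by unfold_locales

end

locale finite_free = mpoly_eval R S \<phi> "{..<n}" \<epsilon>
  for R :: "('a, 'm) ring_scheme" and S :: "('b, 'n) ring_scheme" and \<phi> and n :: nat and \<epsilon> +
  assumes span: "s \<in> carrier S \<Longrightarrow> \<exists>r. (\<forall>i<n. r i \<in> carrier R) \<and> s = (\<Oplus>\<^bsub>S\<^esub>i\<in>{..<n}. \<phi> (r i) \<otimes>\<^bsub>S\<^esub> \<epsilon> i)"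
    and indep: "\<lbrakk>\<And>i. i < n \<Longrightarrow> r i \<in> carrier R; (\<Oplus>\<^bsub>S\<^esub>i\<in>{..<n}. \<phi> (r i) \<otimes>\<^bsub>S\<^esub> \<epsilon> i) = \<zero>\<^bsub>S\<^esub>; k < n\<rbrakk> \<Longrightarrow> r k = \<zero>\<^bsub>R\<^esub>"
begin

definition coords where
  "coords s = (SOME r. (\<forall>i<n. r i \<in> carrier R) \<and> s = (\<Oplus>\<^bsub>S\<^esub>i\<in>{..<n}. \<phi> (r i) \<otimes>\<^bsub>S\<^esub> \<epsilon> i))"

lemma coords:
  assumes "s \<in> carrier S"
  shows "i < n \<Longrightarrow> coords s i \<in> carrier R" "s = (\<Oplus>\<^bsub>S\<^esub>i\<in>{..<n}. \<phi> (coords s i) \<otimes>\<^bsub>S\<^esub> \<epsilon> i)"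
  using someI_ex[OF span[OF assms]] unfolding coords_def by blast+

definition lin where "lin r = (\<Oplus>\<^bsub>M\<^esub>i\<in>{..<n}. const (r i) \<otimes>\<^bsub>M\<^esub> var i)"

lemma lin_closed: "(\<And>i. i < n \<Longrightarrow> r i \<in> carrier R) \<Longrightarrow> lin r \<in> carrier M"
  unfolding lin_def using var_closed by (intro M.finsum_closed) auto

lemma ev_lin:
  assumes "\<And>i. i < n \<Longrightarrow> r i \<in> carrier R"
  shows "ev (lin r) = (\<Oplus>\<^bsub>S\<^esub>i\<in>{..<n}. \<phi> (r i) \<otimes>\<^bsub>S\<^esub> \<epsilon> i)"
proof -
  have "ev (lin r) = (\<Oplus>\<^bsub>S\<^esub>i\<in>{..<n}. (ev \<circ> (\<lambda>i. const (r i) \<otimes>\<^bsub>M\<^esub> var i)) i)"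
    unfolding lin_def using assms var_closed by (subst ev.hom_finsum) (auto simp: comp_def)
  also have "\<dots> = (\<Oplus>\<^bsub>S\<^esub>i\<in>{..<n}. \<phi> (r i) \<otimes>\<^bsub>S\<^esub> \<epsilon> i)"
    using assms var_closed \<epsilon> by (intro S.finsum_cong') (auto simp: ev_const ev_var)
  finally show ?thesis .
qed

text \<open>
  The multiplication table of the basis. The unit of \<open>S\<close> need not belong to the basis, so its
  expression in the basis is one more relation.
\<close>

definition relations where
  "relations = insert (\<one>\<^bsub>M\<^esub> \<ominus>\<^bsub>M\<^esub> lin (coords \<one>\<^bsub>S\<^esub>))
     ((\<lambda>(i, k). var i \<otimes>\<^bsub>M\<^esub> var k \<ominus>\<^bsub>M\<^esub> lin (coords (\<epsilon> i \<otimes>\<^bsub>S\<^esub> \<epsilon> k))) ` ({..<n} \<times> {..<n}))"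

lemma relations_closed: "relations \<subseteq> carrier M"
  unfolding relations_def using \<epsilon> by (auto intro!: M.minus_closed M.m_closed var_closed lin_closed coords)

lemma ev_relation: "p \<in> relations \<Longrightarrow> ev p = \<zero>\<^bsub>S\<^esub>"
  unfolding relations_def using \<epsilon> coords lin_closed var_closed
  by (auto simp: a_minus_def ev_lin ev_var S.r_neg simp flip: coords(2))

abbreviation Rel where "Rel \<equiv> Idl\<^bsub>M\<^esub> relations"

sublocale Rel: ideal Rel M by (rule M.genideal_ideal[OF relations_closed])

lemma Rel_kernel: "Rel \<subseteq> a_kernel M S ev"
proof (rule M.genideal_minimal)
  show "ideal (a_kernel M S ev) M" 
    using ring_hom_ring.kernel_is_ideal ring_hom_ringI2[OF M.ring_axioms S.ring_axioms ev_ring_hom] by blast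
  show "relations \<subseteq> a_kernel M S ev" 
    unfolding a_kernel_def' using ev_relation relations_closed by blast
qed

definition linear_mod where
  "linear_mod P \<longleftrightarrow> P \<in> carrier M \<and> (\<exists>r. (\<forall>i<n. r i \<in> carrier R) \<and> P \<ominus>\<^bsub>M\<^esub> lin r \<in> Rel)"

lemma linear_mod_add:
  assumes "linear_mod P" "linear_mod Q" shows "linear_mod (P \<oplus>\<^bsub>M\<^esub> Q)"
proof -
  obtain r s where r: "\<And>i. i < n \<Longrightarrow> r i \<in> carrier R" "P \<ominus>\<^bsub>M\<^esub> lin r \<in> Rel"
    and s: "\<And>i. i < n \<Longrightarrow> s i \<in> carrier R" "Q \<ominus>\<^bsub>M\<^esub> lin s \<in> Rel"
    using assms unfolding linear_mod_def by blast
  have c: "P \<in> carrier M" "Q \<in> carrier M" "lin r \<in> carrier M" "lin s \<in> carrier M"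
    using assms lin_closed r(1) s(1) unfolding linear_mod_def by auto
  have "lin (\<lambda>i. r i \<oplus>\<^bsub>R\<^esub> s i) = (\<Oplus>\<^bsub>M\<^esub>i\<in>{..<n}. const (r i) \<otimes>\<^bsub>M\<^esub> var i \<oplus>\<^bsub>M\<^esub> const (s i) \<otimes>\<^bsub>M\<^esub> var i)"
    unfolding lin_def using r(1) s(1) var_closed by (intro M.finsum_cong') (auto simp: M.l_distr)
  also have "\<dots> = lin r \<oplus>\<^bsub>M\<^esub> lin s"
    unfolding lin_def using r(1) s(1) var_closed by (intro M.finsum_addf) auto
  finally have "(P \<oplus>\<^bsub>M\<^esub> Q) \<ominus>\<^bsub>M\<^esub> lin (\<lambda>i. r i \<oplus>\<^bsub>R\<^esub> s i) = (P \<ominus>\<^bsub>M\<^esub> lin r) \<oplus>\<^bsub>M\<^esub> (Q \<ominus>\<^bsub>M\<^esub> lin s)"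
    using c by (simp add: a_minus_def M.minus_add M.a_ac)
  hence "(P \<oplus>\<^bsub>M\<^esub> Q) \<ominus>\<^bsub>M\<^esub> lin (\<lambda>i. r i \<oplus>\<^bsub>R\<^esub> s i) \<in> Rel" using Rel.a_closed r(2) s(2) by simp
  moreover have "\<forall>i<n. r i \<oplus>\<^bsub>R\<^esub> s i \<in> carrier R" using r(1) s(1) by simp
  ultimately show ?thesis unfolding linear_mod_def using c by (intro conjI exI[of _ "\<lambda>i. r i \<oplus>\<^bsub>R\<^esub> s i"]) auto
qed

lemma linear_mod_scale:
  assumes "k \<in> carrier R" "linear_mod P" shows "linear_mod (const k \<otimes>\<^bsub>M\<^esub> P)"
proof -
  obtain r where r: "\<And>i. i < n \<Longrightarrow> r i \<in> carrier R" "P \<ominus>\<^bsub>M\<^esub> lin r \<in> Rel"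
    using assms unfolding linear_mod_def by blast
  have c: "P \<in> carrier M" "lin r \<in> carrier M" "const k \<in> carrier M"
    using assms lin_closed r(1) unfolding linear_mod_def by auto
  have "lin (\<lambda>i. k \<otimes>\<^bsub>R\<^esub> r i) = (\<Oplus>\<^bsub>M\<^esub>i\<in>{..<n}. const k \<otimes>\<^bsub>M\<^esub> (const (r i) \<otimes>\<^bsub>M\<^esub> var i))"
    unfolding lin_def using r(1) assms(1) var_closed by (intro M.finsum_cong') (auto simp: M.m_assoc)
  also have "\<dots> = const k \<otimes>\<^bsub>M\<^esub> lin r"
    unfolding lin_def using r(1) assms(1) var_closed by (intro M.finsum_rdistr[symmetric]) auto
  finally have "const k \<otimes>\<^bsub>M\<^esub> P \<ominus>\<^bsub>M\<^esub> lin (\<lambda>i. k \<otimes>\<^bsub>R\<^esub> r i) = const k \<otimes>\<^bsub>M\<^esub> (P \<ominus>\<^bsub>M\<^esub> lin r)"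
    using c by (simp add: a_minus_def M.r_distr M.r_minus)
  hence "const k \<otimes>\<^bsub>M\<^esub> P \<ominus>\<^bsub>M\<^esub> lin (\<lambda>i. k \<otimes>\<^bsub>R\<^esub> r i) \<in> Rel" using Rel.I_l_closed r(2) c by simp
  moreover have "\<forall>i<n. k \<otimes>\<^bsub>R\<^esub> r i \<in> carrier R" using r(1) assms(1) by simp
  ultimately show ?thesis unfolding linear_mod_def using c by (intro conjI exI[of _ "\<lambda>i. k \<otimes>\<^bsub>R\<^esub> r i"]) auto
qed

lemma linear_mod_Rel: assumes "P \<in> Rel" shows "linear_mod P"
proof -
  have "lin (\<lambda>i. \<zero>\<^bsub>R\<^esub>) = \<zero>\<^bsub>M\<^esub>"
    unfolding lin_def using var_closed by (intro M.add.finprod_one_eqI) simp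
  hence "P \<ominus>\<^bsub>M\<^esub> lin (\<lambda>i. \<zero>\<^bsub>R\<^esub>) = P" using Rel.Icarr[OF assms] by (simp add: a_minus_def)
  hence "(\<forall>i<n. \<zero>\<^bsub>R\<^esub> \<in> carrier R) \<and> P \<ominus>\<^bsub>M\<^esub> lin (\<lambda>i. \<zero>\<^bsub>R\<^esub>) \<in> Rel" using assms by simp
  thus ?thesis unfolding linear_mod_def using Rel.Icarr[OF assms]
    by (intro conjI exI[of _ "\<lambda>i. \<zero>\<^bsub>R\<^esub>"]) auto
qed

lemma linear_mod_sum:
  assumes "\<And>i. i < k \<Longrightarrow> linear_mod (p i)"
  shows "linear_mod (\<Oplus>\<^bsub>M\<^esub>i\<in>{..<k::nat}. p i)"
  using assms
proof (induction k)
  case 0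
  show ?case using linear_mod_Rel[OF Rel.zero_closed] by simp
next
  case (Suc k)
  have "(\<Oplus>\<^bsub>M\<^esub>i\<in>{..<Suc k}. p i) = p k \<oplus>\<^bsub>M\<^esub> (\<Oplus>\<^bsub>M\<^esub>i\<in>{..<k}. p i)"
    unfolding lessThan_Suc using Suc.prems by (intro M.finsum_insert) (auto simp: linear_mod_def)
  thus ?case using linear_mod_add Suc by simp
qed

lemma linear_mod_eqI:
  assumes "P \<in> carrier M" "\<And>i. i < n \<Longrightarrow> r i \<in> carrier R" "P \<ominus>\<^bsub>M\<^esub> lin r \<in> relations"
  shows "linear_mod P"
  unfolding linear_mod_def
  using assms(1,2) subsetD[OF M.genideal_self[OF relations_closed] assms(3)] by (intro conjI exI[of _ r]) auto

text \<open>
  Products of a variable with a linear form are congruent to linear forms by the multiplication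
  table, and constants are by the relation for the unit.
\<close>

lemma linear_mod_all: "P \<in> carrier M \<Longrightarrow> linear_mod P"
proof (induction rule: mpoly_induct)
  case (const k)
  have "linear_mod \<one>\<^bsub>M\<^esub>"
    by (rule linear_mod_eqI[of _ "coords \<one>\<^bsub>S\<^esub>"]) (auto simp: relations_def coords)
  thus ?case using linear_mod_scale[OF const, of "\<one>\<^bsub>M\<^esub>"] const by simp
next
  case (add P Q)
  thus ?case using linear_mod_add by blast
next
  case (pmult P i)
  then obtain r where r: "\<And>k. k < n \<Longrightarrow> r k \<in> carrier R" "P \<ominus>\<^bsub>M\<^esub> lin r \<in> Rel"
    unfolding linear_mod_def by blast
  have i: "i < n" and x: "var i \<in> carrier M" and l: "lin r \<in> carrier M"
    using pmult var_closed lin_closed r(1) by auto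
  have quad: "linear_mod (var i \<otimes>\<^bsub>M\<^esub> var k)" if "k < n" for k
    by (rule linear_mod_eqI[of _ "coords (\<epsilon> i \<otimes>\<^bsub>S\<^esub> \<epsilon> k)"])
      (use that i x var_closed \<epsilon> in \<open>auto simp: relations_def coords\<close>)
  have "var i \<otimes>\<^bsub>M\<^esub> lin r = (\<Oplus>\<^bsub>M\<^esub>k\<in>{..<n}. var i \<otimes>\<^bsub>M\<^esub> (const (r k) \<otimes>\<^bsub>M\<^esub> var k))"
    unfolding lin_def using x r(1) var_closed by (intro M.finsum_rdistr) auto
  also have "\<dots> = (\<Oplus>\<^bsub>M\<^esub>k\<in>{..<n}. const (r k) \<otimes>\<^bsub>M\<^esub> (var i \<otimes>\<^bsub>M\<^esub> var k))"
    using x r(1) var_closed by (intro M.finsum_cong') (auto simp: M.m_ac)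
  finally have "linear_mod (var i \<otimes>\<^bsub>M\<^esub> lin r)"
    using linear_mod_sum linear_mod_scale quad r(1) by simp
  moreover have "linear_mod (var i \<otimes>\<^bsub>M\<^esub> (P \<ominus>\<^bsub>M\<^esub> lin r))"
    using linear_mod_Rel Rel.I_l_closed r(2) x by blast
  moreover have "R.indexed_pmult P i = var i \<otimes>\<^bsub>M\<^esub> (P \<ominus>\<^bsub>M\<^esub> lin r) \<oplus>\<^bsub>M\<^esub> var i \<otimes>\<^bsub>M\<^esub> lin r"
    unfolding pmult_var[OF pmult(1)] using x l pmult(1)
    by (simp add: a_minus_def M.r_distr M.r_minus M.a_assoc M.l_neg)
  ultimately show ?case using linear_mod_add by simp
qed

text \<open>
  A polynomial in the kernel is congruent to a linear form that is also in the kernel. This form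
  vanishes, because the basis is free.
\<close>

theorem finitely_presented: "finitely_presented_algebra R S \<phi>"
proof -
  have onto: "ev ` carrier M = carrier S"
  proof
    show "carrier S \<subseteq> ev ` carrier M"
    proof
      fix s assume "s \<in> carrier S"
      hence "s = ev (lin (coords s))" "lin (coords s) \<in> carrier M"
        using coords ev_lin lin_closed by auto
      thus "s \<in> ev ` carrier M" by blast
    qed
  qed (use ev_closed in blast)
  have "a_kernel M S ev \<subseteq> Rel"
  proof (rule subsetI)
    fix P assume P: "P \<in> a_kernel M S ev"
    hence Pc: "P \<in> carrier M" "ev P = \<zero>\<^bsub>S\<^esub>" unfolding a_kernel_def' by blast+
    obtain r where r: "\<And>k. k < n \<Longrightarrow> r k \<in> carrier R" "P \<ominus>\<^bsub>M\<^esub> lin r \<in> Rel"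
      using linear_mod_all[OF Pc(1)] unfolding linear_mod_def by blast
    have l: "lin r \<in> carrier M" using lin_closed r(1) by blast
    have "ev (P \<ominus>\<^bsub>M\<^esub> lin r) = \<zero>\<^bsub>S\<^esub>" 
      using subsetD[OF Rel_kernel r(2)] unfolding a_kernel_def' by blast
    hence "\<ominus>\<^bsub>S\<^esub> ev (lin r) = \<zero>\<^bsub>S\<^esub>" using Pc l by (simp add: a_minus_def)
    hence "ev (lin r) = \<zero>\<^bsub>S\<^esub>" using S.add.inv_eq_1_iff[OF ev_closed[OF l]] by (simp add: a_inv_def)
    hence "(\<Oplus>\<^bsub>S\<^esub>i\<in>{..<n}. \<phi> (r i) \<otimes>\<^bsub>S\<^esub> \<epsilon> i) = \<zero>\<^bsub>S\<^esub>" using ev_lin[OF r(1)] by simp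
    hence "\<And>k. k < n \<Longrightarrow> r k = \<zero>\<^bsub>R\<^esub>" using indep[of r] r(1) by blast
    hence "lin r = \<zero>\<^bsub>M\<^esub>" unfolding lin_def using var_closed by (intro M.add.finprod_one_eqI) auto
    thus "P \<in> Rel" using r(2) Pc by (simp add: a_minus_def)
  qed
  hence "a_kernel M S ev = Rel" using Rel_kernel by (rule subset_antisym)
  moreover have "finite relations" unfolding relations_def by simp
  ultimately have "\<exists>J. finite J \<and> J \<subseteq> carrier M \<and> a_kernel M S ev = Idl\<^bsub>M\<^esub> J"
    using relations_closed by (intro exI[of _ relations] conjI)
  moreover have "\<forall>r\<in>carrier R. ev (const r) = \<phi> r" using ev_const by blast
  ultimately have "\<exists>\<psi>. \<psi> \<in> ring_hom M S \<and> (\<forall>r\<in>carrier R. \<psi> (const r) = \<phi> r) \<and> \<psi> ` carrier M = carrier S \<and>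
      (\<exists>J. finite J \<and> J \<subseteq> carrier M \<and> a_kernel M S \<psi> = Idl\<^bsub>M\<^esub> J)"
    using onto ev_ring_hom by (intro exI[of _ ev] conjI)
  thus ?thesis
    unfolding finitely_presented_algebra_def
    using R.is_cring S.is_cring \<phi> by (intro conjI exI[of _ n])
qed

end

theorem (in gr_basis) gr_finitely_presented: "finitely_presented_algebra A.GR B.GR \<Phi>"
proof -
  interpret GA: cring A.GR by (rule A.gr_cring)
  interpret GB: cring B.GR by (rule B.gr_cring)
  interpret finite_free A.GR B.GR \<Phi> n \<epsilon>
  proof
    show "\<Phi> \<in> ring_hom A.GR B.GR" by (rule \<Phi>_ring_hom)
    show "\<And>i. i \<in> {..<n} \<Longrightarrow> \<epsilon> i \<in> carrier B.GR" using \<epsilon>_closed by simp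
    show "\<And>s. s \<in> carrier B.GR \<Longrightarrow> \<exists>r. (\<forall>i<n. r i \<in> carrier A.GR) \<and> s = (\<Oplus>\<^bsub>B.GR\<^esub>i\<in>{..<n}. \<Phi> (r i) \<otimes>\<^bsub>B.GR\<^esub> \<epsilon> i)"
      by (rule gr_span)
    show "r k = \<zero>\<^bsub>A.GR\<^esub>" if "\<And>i. i < n \<Longrightarrow> r i \<in> carrier A.GR"
      "(\<Oplus>\<^bsub>B.GR\<^esub>i\<in>{..<n}. \<Phi> (r i) \<otimes>\<^bsub>B.GR\<^esub> \<epsilon> i) = \<zero>\<^bsub>B.GR\<^esub>" "k < n" for r k
      by (rule gr_indep) (use that in auto)
  qed simp
  show ?thesis by (rule finitely_presented)
qed

section \<open>Univariate polynomials and local rings\<close>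

definition (in ring) monic :: "'a list \<Rightarrow> bool" where
  "monic p \<longleftrightarrow> p \<noteq> [] \<and> lead_coeff p = \<one>"

context field
begin

lemma poly_ops:
  "p \<otimes>\<^bsub>univ_poly R A\<^esub> q = poly_mult p q" "p \<oplus>\<^bsub>univ_poly R A\<^esub> q = poly_add p q"
  "\<one>\<^bsub>univ_poly R A\<^esub> = [\<one>]" "\<zero>\<^bsub>univ_poly R A\<^esub> = []"
  by (simp_all add: univ_poly_def)

lemma poly_carrierD:
  assumes "p \<in> carrier (poly_ring R)"
  shows "polynomial (carrier R) p" "set p \<subseteq> carrier R" "p \<noteq> [] \<Longrightarrow> lead_coeff p \<noteq> \<zero>"
  using assms univ_poly_carrier[of R "carrier R" p] by (auto simp: polynomial_def)

lemma poly_carrierI: "\<lbrakk>set p \<subseteq> carrier R; p \<noteq> [] \<Longrightarrow> lead_coeff p \<noteq> \<zero>\<rbrakk> \<Longrightarrow> p \<in> carrier (poly_ring R)"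
  using univ_poly_carrier[of R "carrier R" p] by (auto simp: polynomial_def)

lemma poly_add_lead:
  assumes "p \<in> carrier (poly_ring R)" "q \<in> carrier (poly_ring R)" "length (poly_add p q) = Suc d"
  shows "lead_coeff (poly_add p q) = coeff p d \<oplus> coeff q d"
proof -
  have "poly_add p q \<noteq> []" using assms(3) by auto
  hence "lead_coeff (poly_add p q) = coeff (poly_add p q) d"
    using lead_coeff_simp[of "poly_add p q"] assms(3) by simp
  thus ?thesis using poly_add_coeff[OF poly_carrierD(2)[OF assms(1)] poly_carrierD(2)[OF assms(2)]] by simp
qed

lemma poly_monic_ring: "monic_ring (poly_ring R) length monic"
proof -
  interpret P: domain "poly_ring R" by (rule univ_poly_is_domain[OF carrier_is_subring])
  note sub = carrier_is_subring
  show ?thesis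
  proof
    fix p assume p: "p \<in> carrier (poly_ring R)"
    show "length p = 0 \<longleftrightarrow> p = \<zero>\<^bsub>poly_ring R\<^esub>" by (simp add: poly_ops)
    show "length (\<ominus>\<^bsub>poly_ring R\<^esub> p) = length p" by (rule univ_poly_a_inv_length[OF sub p])
    show "\<exists>c'\<in>carrier (poly_ring R). length c' = 1 \<and> p \<otimes>\<^bsub>poly_ring R\<^esub> c' = \<one>\<^bsub>poly_ring R\<^esub>" if l: "length p = 1"
    proof -
      obtain a where a: "p = [a]" using l by (auto simp: length_Suc_conv)
      hence ac: "a \<in> carrier R" "a \<noteq> \<zero>" using poly_carrierD[OF p] by auto
      hence u: "a \<in> Units R" using field_Units by blast
      have "inv a \<in> carrier R" "a \<otimes> inv a = \<one>" using u by auto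
      moreover have "inv a \<noteq> \<zero>" using calculation ac by auto
      ultimately show ?thesis unfolding a poly_ops
        using poly_mult_const'(1)[of "[inv a]" a] ac by (intro bexI[of _ "[inv a]"] poly_carrierI) auto
    qed
    show "\<exists>c\<in>carrier (poly_ring R). \<exists>q\<in>carrier (poly_ring R). length c = 1 \<and> monic q \<and> length q = length p
        \<and> p = c \<otimes>\<^bsub>poly_ring R\<^esub> q" if "p \<noteq> \<zero>\<^bsub>poly_ring R\<^esub>"
    proof -
      from that obtain a p' where p': "p = a # p'" by (cases p) (auto simp: poly_ops)
      have c: "a \<in> carrier R" "a \<noteq> \<zero>" "set p' \<subseteq> carrier R" using poly_carrierD[OF p] p' by auto
      hence u: "a \<in> Units R" using field_Units by blast
      have i: "inv a \<in> carrier R" "inv a \<otimes> a = \<one>" "a \<otimes> inv a = \<one>" using u by auto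
      let ?q = "map (\<lambda>b. inv a \<otimes> b) p"
      have q: "?q \<in> carrier (poly_ring R)" using c i by (intro poly_carrierI) (auto simp: p')
      have "a \<otimes> (inv a \<otimes> b) = b" if "b \<in> carrier R" for b
        using m_assoc[OF c(1) i(1) that] i(3) that by simp
      hence "map (\<lambda>b. a \<otimes> b) ?q = p" using poly_carrierD(2)[OF p] by (auto intro!: map_idI)
      hence "poly_mult [a] ?q = p"
        using poly_mult_const'(1)[OF poly_carrierD(2)[OF q] c(1)] normalize_polynomial[OF poly_carrierD(1)[OF p]] by simp
      moreover have "monic ?q" using i by (simp add: monic_def p')
      moreover have "[a] \<in> carrier (poly_ring R)" using c by (intro poly_carrierI) auto
      ultimately show ?thesis unfolding poly_ops using q
        by (intro bexI[of _ "[a]"] bexI[of _ ?q]) auto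
    qed
    fix q assume q: "q \<in> carrier (poly_ring R)"
    show "length (p \<oplus>\<^bsub>poly_ring R\<^esub> q) \<le> max (length p) (length q)"
      unfolding poly_ops by (rule poly_add_length_le)
    show "Suc (length (p \<otimes>\<^bsub>poly_ring R\<^esub> q)) = length p + length q"
      if "p \<noteq> \<zero>\<^bsub>poly_ring R\<^esub>" "q \<noteq> \<zero>\<^bsub>poly_ring R\<^esub>"
    proof -
      have nz: "poly_mult p q \<noteq> []" using P.integral[OF _ p q] that unfolding poly_ops by blast
      have "length (poly_mult p q) - 1 = (length p - 1) + (length q - 1)"
        using poly_mult_degree_eq[OF sub poly_carrierD(1)[OF p] poly_carrierD(1)[OF q]] that by (simp add: poly_ops)
      moreover have "length p > 0" "length q > 0" "length (poly_mult p q) > 0" using that nz by (simp_all add: poly_ops)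
      ultimately show ?thesis unfolding poly_ops by linarith
    qed
    show "monic (p \<otimes>\<^bsub>poly_ring R\<^esub> q)" if "monic p" "monic q"
    proof -
      have ne: "p \<noteq> []" "q \<noteq> []" using that by (auto simp: monic_def)
      have "poly_mult p q \<noteq> []" using P.integral[OF _ p q] ne unfolding poly_ops by blast
      moreover have "lead_coeff (poly_mult p q) = \<one>"
        using poly_mult_lead_coeff[OF sub poly_carrierD(1)[OF p] poly_carrierD(1)[OF q] ne] that by (simp add: monic_def)
      ultimately show ?thesis by (simp add: monic_def poly_ops)
    qed
    show "monic (p \<oplus>\<^bsub>poly_ring R\<^esub> q)" if "monic p" "length q < length p"
    proof -
      have l: "length (poly_add p q) = length p"
        using poly_add_length_eq[OF sub poly_carrierD(1)[OF p] poly_carrierD(1)[OF q]] that by simp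
      have ne: "p \<noteq> []" using that by auto
      then obtain d where d: "length p = Suc d" by (cases p) auto
      have "lead_coeff (poly_add p q) = coeff p d \<oplus> coeff q d" using poly_add_lead[OF p q] l d by simp
      moreover have "coeff p d = \<one>" using lead_coeff_simp[OF ne] d that by (simp add: monic_def)
      moreover have "coeff q d = \<zero>" using coeff_length[of q d] that d by simp
      moreover have "poly_add p q \<noteq> []" using l ne by auto
      ultimately show ?thesis by (simp add: monic_def poly_ops)
    qed
    show "length (p \<ominus>\<^bsub>poly_ring R\<^esub> q) < length p" if m: "monic p" "monic q" "length p = length q"
    proof (rule ccontr)
      let ?q = "\<ominus>\<^bsub>poly_ring R\<^esub> q"
      assume "\<not> length (p \<ominus>\<^bsub>poly_ring R\<^esub> q) < length p"
      moreover have qm: "?q = map (\<lambda>a. \<ominus> a) q" by (rule univ_poly_a_inv_def'[OF sub q])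
      moreover have "length (poly_add p ?q) \<le> max (length p) (length ?q)" by (rule poly_add_length_le)
      ultimately have l: "length (poly_add p ?q) = length p"
        using m(3) by (simp add: a_minus_def poly_ops)
      have ne: "p \<noteq> []" "q \<noteq> []" "?q \<noteq> []" using m qm by (auto simp: monic_def)
      then obtain d where d: "length p = Suc d" by (cases p) auto
      have dq: "length q = Suc d" "length ?q = Suc d" using d m qm by auto
      have "lead_coeff (poly_add p ?q) = coeff p d \<oplus> coeff ?q d"
        using poly_add_lead[OF p _, of ?q] q l d by simp
      moreover have "coeff p d = \<one>" using lead_coeff_simp[OF ne(1)] d m by (simp add: monic_def)
      moreover have "coeff ?q d = lead_coeff ?q" using lead_coeff_simp[OF ne(3)] dq by simp
      moreover have "lead_coeff ?q = \<ominus> \<one>" using m ne by (simp add: qm monic_def hd_map)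
      ultimately have "lead_coeff (poly_add p ?q) = \<zero>" by (simp add: r_neg)
      moreover have "poly_add p ?q \<in> carrier (poly_ring R)" using P.a_closed[OF p, of ?q] q unfolding poly_ops by simp
      moreover have "poly_add p ?q \<noteq> []" using l ne by auto
      ultimately show False using poly_carrierD(3) by blast
    qed
  qed (auto simp: poly_ops monic_def)
qed

lemma univ_poly_subset: "subring A R \<Longrightarrow> carrier (univ_poly R A) \<subseteq> carrier (poly_ring R)"
  using subringE(1) by (fastforce simp: univ_poly_def polynomial_def)

lemma poly_monic_subring:
  assumes A: "subring A R"
  shows "monic_ring.monic_subring (poly_ring R) length monic (carrier (univ_poly R A))"
proof -
  interpret M: monic_ring "poly_ring R" length monic by (rule poly_monic_ring)
  interpret AX: domain "univ_poly R A" by (rule univ_poly_is_domain[OF A])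
  note sub = subsetD[OF univ_poly_subset[OF A]]
  have "subring (carrier (univ_poly R A)) (poly_ring R)"
  proof (rule M.subringI)
    show "carrier (univ_poly R A) \<subseteq> carrier (poly_ring R)" by (rule univ_poly_subset[OF A])
    show "\<one>\<^bsub>poly_ring R\<^esub> \<in> carrier (univ_poly R A)" using AX.one_closed by (simp add: poly_ops)
    fix p assume p: "p \<in> carrier (univ_poly R A)"
    have "\<ominus>\<^bsub>poly_ring R\<^esub> p = map (\<lambda>a. \<ominus> a) p" by (rule univ_poly_a_inv_def'[OF carrier_is_subring sub[OF p]])
    also have "\<dots> = \<ominus>\<^bsub>univ_poly R A\<^esub> p" by (rule univ_poly_a_inv_def'[OF A p, symmetric])
    finally show "\<ominus>\<^bsub>poly_ring R\<^esub> p \<in> carrier (univ_poly R A)" using p by simp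
    fix q assume q: "q \<in> carrier (univ_poly R A)"
    show "p \<otimes>\<^bsub>poly_ring R\<^esub> q \<in> carrier (univ_poly R A)" using AX.m_closed[OF p q] by (simp add: poly_ops)
    show "p \<oplus>\<^bsub>poly_ring R\<^esub> q \<in> carrier (univ_poly R A)" using AX.a_closed[OF p q] by (simp add: poly_ops)
  qed
  moreover have "\<exists>q\<in>carrier (univ_poly R A). \<exists>r\<in>carrier (univ_poly R A).
      p = g \<otimes>\<^bsub>poly_ring R\<^esub> q \<oplus>\<^bsub>poly_ring R\<^esub> r \<and> length r < length g"
    if g: "g \<in> carrier (univ_poly R A)" and p: "p \<in> carrier (univ_poly R A)" and m: "monic g" for g p
  proof -
    have "lead_coeff g \<in> Units (R\<lparr>carrier := A\<rparr>)"
      using m subringE(3)[OF A] by (auto simp: monic_def Units_def intro!: bexI[of _ \<one>])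
    then obtain q r where "polynomial A q" "polynomial A r" "p = g \<otimes>\<^bsub>univ_poly R A\<^esub> q \<oplus>\<^bsub>univ_poly R A\<^esub> r"
      "r = [] \<or> degree r < degree g"
      using long_division_theorem[OF A, of p g] p g m univ_poly_carrier[of R A] by (auto simp: monic_def)
    thus ?thesis using m
      by (intro bexI[of _ q] bexI[of _ r]) (auto simp: univ_poly_carrier[symmetric] poly_ops monic_def)
  qed
  ultimately show ?thesis unfolding M.monic_subring_def by blast
qed

lemma monic_power_exists:
  assumes A: "subring A R"
  shows "\<exists>x\<in>carrier (univ_poly R A). monic x \<and> length x = Suc d"
proof (intro bexI conjI)
  show "monic (monom \<one> d)" "length (monom \<one> d) = Suc d" by (simp_all add: monic_def monom_def)
  have "polynomial A (monom \<one> d)" using subringE(3)[OF A] by (intro monom_is_polynomial[OF A]) auto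
  thus "monom \<one> d \<in> carrier (univ_poly R A)" using univ_poly_carrier by blast
qed

end

text \<open>
  Krull's theorem, by Zorn's lemma.
\<close>

lemma (in cring) proper_ideal_in_maximal:
  assumes I: "ideal I R" "\<one> \<notin> I"
  shows "\<exists>M. maximalideal M R \<and> I \<subseteq> M"
proof -
  let ?S = "{J. ideal J R \<and> I \<subseteq> J \<and> \<one> \<notin> J}"
  have "\<exists>M\<in>?S. \<forall>J\<in>?S. M \<subseteq> J \<longrightarrow> J = M"
  proof (rule subset_Zorn_nonempty)
    show "?S \<noteq> {}" using I by blast
    fix C assume C: "C \<noteq> {}" "subset.chain ?S C"
    have "subset.chain {J. ideal J R} C" using C(2) by (auto simp: pred_on.chain_def)
    hence "ideal (\<Union>C) R" using chain_Union_is_ideal[of C] C(1) by simp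
    moreover have "\<And>J. J \<in> C \<Longrightarrow> I \<subseteq> J \<and> \<one> \<notin> J" using C(2) by (auto simp: pred_on.chain_def)
    ultimately show "\<Union>C \<in> ?S" using C(1) by blast
  qed
  then obtain M where MS: "M \<in> ?S" and max: "\<forall>J\<in>?S. M \<subseteq> J \<longrightarrow> J = M" ..
  have M: "ideal M R" "I \<subseteq> M" "\<one> \<notin> M" using MS by auto
  have "maximalideal M R"
  proof (rule maximalidealI[OF M(1)])
    show "carrier R \<noteq> M" using M(3) by blast
    fix J assume J: "ideal J R" "M \<subseteq> J" "J \<subseteq> carrier R"
    show "J = M \<or> J = carrier R"
    proof (cases "\<one> \<in> J")
      case True
      thus ?thesis using ideal.one_imp_carrier[OF J(1)] by blast
    next
      case False
      hence "J \<in> ?S" using J(1,2) M(2) by auto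
      thus ?thesis using max J(2) by auto
    qed
  qed
  thus ?thesis using M(2) by blast
qed

lemma local_ring_unit:
  fixes R (structure)
  assumes loc: "local_ring R" and x: "x \<in> carrier R" "x \<notin> max_ideal R"
  shows "x \<in> Units R"
proof (rule ccontr)
  interpret cring R using loc by (simp add: local_ring_def)
  assume nu: "x \<notin> Units R"
  have "\<one> \<notin> PIdl x"
  proof
    assume "\<one> \<in> PIdl x"
    then obtain y where "y \<in> carrier R" "y \<otimes> x = \<one>" unfolding cgenideal_def by force
    hence "x \<in> Units R" using x(1) m_comm[of x y] unfolding Units_def by auto
    thus False using nu by blast
  qed
  from proper_ideal_in_maximal[OF cgenideal_ideal[OF x(1)] this]
  obtain M where M: "maximalideal M R" "PIdl x \<subseteq> M" by auto
  have "\<exists>!M. maximalideal M R" using loc by (simp add: local_ring_def)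
  hence "M = max_ideal R" unfolding max_ideal_def using M(1) by (rule the1_equality[symmetric])
  thus False using cgenideal_self[OF x(1)] M(2) x(2) by blast
qed

text \<open>
  If \<open>m \<cdot> 1\<close> were in the maximal ideal, then the characteristic of the residue field would divide
  \<open>m\<close>, and hence \<open>n\<close>.
\<close>

lemma natmult_unit_of_local_ring:
  fixes R (structure)
  assumes loc: "local_ring R" and n: "\<not> characteristic (residue_field R) dvd n" "m dvd n"
  shows "add_pow R (m::nat) \<one> \<in> Units R"
proof (rule local_ring_unit[OF loc])
  interpret cring R using loc by (simp add: local_ring_def)
  have ex: "\<exists>!M. maximalideal M R" using loc by (simp add: local_ring_def)
  have "maximalideal (max_ideal R) R" unfolding max_ideal_def by (rule theI'[OF ex])
  then interpret M: maximalideal "max_ideal R" R .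
  interpret Q: ring "R Quot max_ideal R" by (rule M.quotient_is_ring)
  interpret h: ring_hom_ring R "R Quot max_ideal R" "\<lambda>x. max_ideal R +> x"
    by (rule M.rcos_ring_hom_ring)
  show "add_pow R m \<one> \<in> carrier R" by simp
  show "add_pow R m \<one> \<notin> max_ideal R"
  proof
    assume m: "add_pow R m \<one> \<in> max_ideal R"
    have hom: "max_ideal R +> add_pow R k \<one> = add_pow (R Quot max_ideal R) k \<one>\<^bsub>R Quot max_ideal R\<^esub>" for k :: nat
      by (induction k) auto
    have "\<zero>\<^bsub>R Quot max_ideal R\<^esub> = max_ideal R" unfolding FactRing_def by (simp only: ring.simps)
    hence "add_pow (R Quot max_ideal R) m \<one>\<^bsub>R Quot max_ideal R\<^esub> = \<zero>\<^bsub>R Quot max_ideal R\<^esub>"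
      by (simp only: hom[symmetric] M.a_rcos_const[OF m])
    hence "characteristic (residue_field R) dvd m"
      using group.pow_eq_id[OF Q.a_group, of "\<one>\<^bsub>R Quot max_ideal R\<^esub>" m]
      by (simp add: characteristic_def residue_field_def add_pow_def)
    thus False using n dvd_trans by blast
  qed
qed

lemma ring_hom_cring_natmult:
  assumes "ring_hom_cring R S h"
  shows "h (add_pow R (m::nat) \<one>\<^bsub>R\<^esub>) = add_pow S m \<one>\<^bsub>S\<^esub>"
proof -
  interpret ring_hom_cring R S h by fact
  show ?thesis by (induction m) auto
qed

section \<open>The extension defined by a monic irreducible polynomial\<close>

lemma (in ring) eval_eq_horner:
  assumes "cring R" "x \<in> carrier R" "set p \<subseteq> carrier R"
  shows "eval p x = cring.horner R x (rev p)"
proof -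
  interpret cring R by fact
  show ?thesis using assms(3)
  proof (induction p)
    case (Cons a p)
    have "horner x (rev (a # p)) = horner x (rev p) \<oplus> x [^] length p \<otimes> a"
      using Cons.prems assms(2) by (simp add: horner_append)
    thus ?case using Cons assms(2) eval_in_carrier[of p x] by (simp add: m_comm a_comm)
  qed simp
qed

locale rupture_extension = field K for K :: "('a, 'm) ring_scheme" (structure) +
  fixes f
  assumes f: "f \<in> carrier (poly_ring K)" "monic f" and irr: "pirreducible\<^bsub>K\<^esub> (carrier K) f"
begin

abbreviation P where "P \<equiv> poly_ring K"
abbreviation L where "L \<equiv> rupture K (carrier K) f"
abbreviation e where "e \<equiv> rupture_surj (carrier K) f"
abbreviation j where "j \<equiv> rupture_const K f"

lemma monic_ring_P: "monic_ring P length monic" by (rule poly_monic_ring)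

lemma L_field: "field L"
  using rupture_is_field_iff_pirreducible[OF carrier_is_subfield f(1)] irr by simp

lemma e_hom: "ring_hom_cring P L e"
proof -
  interpret L: field L by (rule L_field)
  interpret P: domain P by (rule univ_poly_is_domain[OF carrier_is_subring])
  show ?thesis using rupture_surj_hom(1)[OF carrier_is_subring f(1)] by unfold_locales
qed

lemma degree_pos: "degree f > 0"
  using pirreducible_degree[OF carrier_is_subfield f(1) irr] by simp

lemma e_kernel: assumes "p \<in> carrier P" "e p = \<zero>\<^bsub>L\<^esub>" shows "\<exists>q\<in>carrier P. p = f \<otimes>\<^bsub>P\<^esub> q"
proof -
  interpret P: domain P by (rule univ_poly_is_domain[OF carrier_is_subring])
  interpret I: ideal "PIdl\<^bsub>P\<^esub> f" P using P.cgenideal_ideal[OF f(1)] .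
  have L0: "\<zero>\<^bsub>L\<^esub> = PIdl\<^bsub>P\<^esub> f" unfolding rupture_def FactRing_def by (simp only: ring.simps)
  have "p \<in> PIdl\<^bsub>P\<^esub> f" using I.a_rcos_self[OF assms(1)] assms(2) L0 by simp
  then obtain q where q: "q \<in> carrier P" "p = q \<otimes>\<^bsub>P\<^esub> f" unfolding cgenideal_def by blast
  thus ?thesis using P.m_comm[OF q(1) f(1)] by blast
qed

lemma e_f: "e f = \<zero>\<^bsub>L\<^esub>"
proof -
  interpret P: domain P by (rule univ_poly_is_domain[OF carrier_is_subring])
  interpret I: ideal "PIdl\<^bsub>P\<^esub> f" P using P.cgenideal_ideal[OF f(1)] .
  have L0: "\<zero>\<^bsub>L\<^esub> = PIdl\<^bsub>P\<^esub> f" unfolding rupture_def FactRing_def by (simp only: ring.simps)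
  show ?thesis unfolding L0 by (rule I.a_rcos_const[OF P.cgenideal_self[OF f(1)]])
qed

lemma e_inj: assumes "p \<in> carrier P" "length p \<le> degree f" "e p = \<zero>\<^bsub>L\<^esub>" shows "p = \<zero>\<^bsub>P\<^esub>"
proof (rule ccontr)
  interpret M: monic_ring P length monic by (rule monic_ring_P)
  assume p: "p \<noteq> \<zero>\<^bsub>P\<^esub>"
  obtain q where q: "q \<in> carrier P" "p = f \<otimes>\<^bsub>P\<^esub> q" using e_kernel assms by blast
  have "f \<noteq> \<zero>\<^bsub>P\<^esub>" using f(2) M.mon_nonzero by blast
  moreover have q0: "q \<noteq> \<zero>\<^bsub>P\<^esub>" using p q f(1) by auto
  ultimately have "Suc (length p) = length f + length q" using M.len_mult[OF f(1) q(1)] q(2) by simp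
  moreover have "length q > 0" using q0 M.len_zero[OF q(1)] by blast
  ultimately show False using assms(2) degree_pos by linarith
qed

lemma const_closed: "\<lbrakk>subring A K; c \<in> A\<rbrakk> \<Longrightarrow> poly_of_const c \<in> carrier (univ_poly K A)"
  by (auto simp: poly_of_const_def univ_poly_carrier[symmetric] polynomial_def)

lemma const_length: "length (poly_of_const c) \<le> 1" by (simp add: poly_of_const_def)

lemma short_is_const:
  assumes "subring A K" "p \<in> carrier (univ_poly K A)" "length p \<le> 1"
  shows "\<exists>c\<in>A. p = poly_of_const c"
proof (cases p)
  case Nil
  thus ?thesis using subringE(2)[OF assms(1)] by (intro bexI[of _ \<zero>]) (simp_all add: poly_of_const_def)
next
  case (Cons c q)
  hence "p = [c]" "c \<in> A" "c \<noteq> \<zero>"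
    using assms(2,3) by (auto simp: univ_poly_carrier[symmetric] polynomial_def)
  thus ?thesis by (intro bexI[of _ c]) (simp_all add: poly_of_const_def)
qed

lemma const_hom: "ring_hom_cring K P poly_of_const"
proof -
  interpret P: domain P by (rule univ_poly_is_domain[OF carrier_is_subring])
  have "poly_of_const \<in> ring_hom (K\<lparr>carrier := carrier K\<rparr>) P"
    by (rule canonical_embedding_is_hom[OF carrier_is_subring])
  hence "poly_of_const \<in> ring_hom K P" by simp
  thus ?thesis by unfold_locales
qed

lemma j_eq: "j a = e (poly_of_const a)" by (simp add: rupture_const_def)

lemma j_hom: "ring_hom_cring K L j"
proof -
  interpret L: field L by (rule L_field)
  interpret c: ring_hom_cring K P poly_of_const by (rule const_hom)
  interpret e: ring_hom_cring P L e by (rule e_hom)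
  have "j \<in> ring_hom K L"
    by (rule ring_hom_memI) (simp_all add: j_eq del: c.hom_closed, simp_all)
  thus ?thesis by unfold_locales
qed

text \<open>
  The quotient has finite dimension over the image of \<open>K\<close>, so every element satisfies a nontrivial
  equation over this image; the coefficients are pulled back along \<open>j\<close>.
\<close>

lemma algebraic_relation:
  assumes y: "y \<in> carrier L"
  shows "\<exists>ps. set ps \<subseteq> carrier K \<and> (\<exists>q\<in>set ps. q \<noteq> \<zero>) \<and> cring.horner L y (map j ps) = \<zero>\<^bsub>L\<^esub>"
proof -
  interpret L: field L by (rule L_field)
  interpret j: ring_hom_cring K L j by (rule j_hom)
  have jr: "ring_hom_ring K L j" using ring_hom_ringI2[OF ring_axioms L.ring_axioms] j.homh by blast
  let ?F = "j ` carrier K"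
  have F: "subfield ?F L" using ring_hom_ring.img_is_subfield(2)[OF jr carrier_is_subfield] by simp
  have "(e ` poly_of_const ` carrier K) = ?F" by (auto simp: j_eq)
  hence "ring.dimension L (degree f) ?F (carrier L)"
    using rupture_dimension[OF carrier_is_subfield f(1) degree_pos] by simp
  hence fd: "L.finite_dimension ?F (carrier L)" by (rule L.finite_dimensionI)
  note alg = L.finite_dimension_imp_algebraic[OF F L.carrier_is_subring fd y]
  obtain p where p: "p \<in> carrier (univ_poly L ?F)" "p \<noteq> []" "L.eval p y = \<zero>\<^bsub>L\<^esub>"
    by (rule L.algebraicE[OF subfieldE(1)[OF F] y alg])
  have pF: "set p \<subseteq> ?F" "lead_coeff p \<noteq> \<zero>\<^bsub>L\<^esub>"
    using p(1,2) by (auto simp: univ_poly_carrier[symmetric] polynomial_def)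
  have "\<exists>ps. set ps \<subseteq> carrier K \<and> map j ps = rev p"
  proof -
    have "set (rev p) \<subseteq> ?F" using pF(1) by simp
    thus ?thesis
    proof (induction "rev p" arbitrary: p)
      case Nil thus ?case by (intro exI[of _ "[]"]) simp
    next
      case (Cons a as)
      have "set (rev (rev as)) \<subseteq> ?F" using Cons by (metis rev_rev_ident set_subset_Cons subset_trans)
      then obtain ps where ps: "set ps \<subseteq> carrier K" "map j ps = as" using Cons(1)[of "rev as"] by auto
      have "a \<in> ?F" using Cons by (metis list.set_intros(1) subsetD)
      then obtain b where "b \<in> carrier K" "a = j b" by blast
      thus ?case using ps Cons(2) by (intro exI[of _ "b # ps"]) auto
    qed
  qed
  then obtain ps where ps: "set ps \<subseteq> carrier K" "map j ps = rev p" by blast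
  have "lead_coeff p \<in> set (map j ps)" using p(2) by (simp add: ps(2))
  then obtain q where q: "q \<in> set ps" "lead_coeff p = j q" by auto
  have q0: "q \<noteq> \<zero>" using pF(2) unfolding q(2) using j.hom_zero by metis
  have "set p \<subseteq> carrier L" using pF(1) j.hom_closed by blast
  hence "cring.horner L y (map j ps) = \<zero>\<^bsub>L\<^esub>"
    using L.eval_eq_horner[OF L.is_cring y, of p] unfolding p(3) ps(2) by simp
  thus ?thesis using ps(1) q(1) q0 by (intro exI[of _ ps] conjI bexI[of _ q])
qed

end

locale tame_extension = rupture_extension K f + U: unique_ext K \<Gamma>\<^sub>0 v\<^sub>0 "rupture K (carrier K) f" \<Gamma> v "rupture_const K f" \<iota>
  for K :: "('a, 'm) ring_scheme" (structure) and f and \<Gamma>\<^sub>0 :: "'g ogroup" and v\<^sub>0 and \<Gamma> :: "'h ogroup" and v and \<iota> +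
  fixes A
  assumes A: "subring A K" and fA: "f \<in> carrier (univ_poly K A)" and loc: "local_ring (K\<lparr>carrier := A\<rparr>)"
    and dom: "dominates K \<Gamma>\<^sub>0 v\<^sub>0 A"
    and char: "\<not> characteristic (residue_field (K\<lparr>carrier := A\<rparr>)) dvd degree f"
begin

abbreviation S where "S \<equiv> carrier (univ_poly K A)"
abbreviation B where "B \<equiv> rupture_subring K A f"

lemma B_eq: "B = e ` S" by (simp add: rupture_subring_def)

text \<open>
  The inverse of \<open>m\<close> lies in \<open>A\<close>, and the elements of \<open>A\<close> have nonnegative values.
\<close>

lemma divisor_unit:
  assumes m: "m dvd degree f"
  shows "\<exists>u\<in>S. u \<otimes>\<^bsub>P\<^esub> add_pow P m \<one>\<^bsub>P\<^esub> = \<one>\<^bsub>P\<^esub> \<and> U.le \<one>\<^bsub>L\<^esub> (e u)"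
proof -
  interpret c: ring_hom_cring K P poly_of_const by (rule const_hom)
  have "add_pow (K\<lparr>carrier := A\<rparr>) m \<one>\<^bsub>K\<lparr>carrier := A\<rparr>\<^esub> \<in> Units (K\<lparr>carrier := A\<rparr>)"
    by (rule natmult_unit_of_local_ring[OF loc char m])
  moreover have "add_pow (K\<lparr>carrier := A\<rparr>) m \<one>\<^bsub>K\<lparr>carrier := A\<rparr>\<^esub> = add_pow K m \<one>"
    by (simp add: add_pow_def nat_pow_def)
  ultimately obtain b where b: "b \<in> A" "b \<otimes> add_pow K m \<one> = \<one>" by (auto simp: Units_def)
  have bK: "b \<in> carrier K" using subringE(1)[OF A] b(1) by blast
  have u: "poly_of_const b \<otimes>\<^bsub>P\<^esub> add_pow P m \<one>\<^bsub>P\<^esub> = \<one>\<^bsub>P\<^esub>"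
  proof -
    have "poly_of_const b \<otimes>\<^bsub>P\<^esub> add_pow P m \<one>\<^bsub>P\<^esub> = poly_of_const (b \<otimes> add_pow K m \<one>)"
      using ring_hom_cring_natmult[OF const_hom, of m] bK c.hom_mult[of b "add_pow K m \<one>"] by simp
    thus ?thesis unfolding b(2) c.hom_one .
  qed
  have "b \<in> valuation_ring K \<Gamma>\<^sub>0 v\<^sub>0" using dom b(1) by (auto simp: dominates_def)
  hence "U.le0 \<one> b" using U.V0.w_one by (auto simp: valuation_ring_def val_ge_def vle_def)
  hence "U.le (j \<one>) (j b)" using U.le_j[OF one_closed bK] by blast
  hence "U.le \<one>\<^bsub>L\<^esub> (e (poly_of_const b))" by (simp only: j_eq[symmetric] U.j.hom_one)
  thus ?thesis using u const_closed[OF A b(1)] by (intro bexI[of _ "poly_of_const b"] conjI)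
qed

lemma tame: "tame_quotient P length monic L U.le e (degree f) f S"
proof -
  interpret M: monic_ring P length monic by (rule monic_ring_P)
  have len: "length f = Suc (degree f)" using degree_pos by simp
  have rel: "\<exists>N a. (\<forall>i<N. a i \<in> carrier P \<and> length (a i) \<le> 1 \<and> U.le (y [^]\<^bsub>L\<^esub> N) (e (a i) \<otimes>\<^bsub>L\<^esub> y [^]\<^bsub>L\<^esub> i))
      \<and> y [^]\<^bsub>L\<^esub> N = (\<Oplus>\<^bsub>L\<^esub>i\<in>{..<(N::nat)}. e (a i) \<otimes>\<^bsub>L\<^esub> y [^]\<^bsub>L\<^esub> i)"
    if y: "y \<in> carrier L" "y \<noteq> \<zero>\<^bsub>L\<^esub>" for y
  proof -
    from algebraic_relation[OF y(1)] obtain ps q where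
      ps: "set ps \<subseteq> carrier K" "q \<in> set ps" "q \<noteq> \<zero>" "cring.horner L y (map j ps) = \<zero>\<^bsub>L\<^esub>" by blast
    from U.integral_relation[OF y ps] obtain N a where
      a: "\<And>i. i < N \<Longrightarrow> a i \<in> carrier K" "\<And>i. i < N \<Longrightarrow> U.le (y [^]\<^bsub>L\<^esub> N) (j (a i) \<otimes>\<^bsub>L\<^esub> y [^]\<^bsub>L\<^esub> i)"
        "y [^]\<^bsub>L\<^esub> N = (\<Oplus>\<^bsub>L\<^esub>i\<in>{..<(N::nat)}. j (a i) \<otimes>\<^bsub>L\<^esub> y [^]\<^bsub>L\<^esub> i)" by blast
    have "\<forall>i<N. poly_of_const (a i) \<in> carrier P \<and> length (poly_of_const (a i)) \<le> 1
        \<and> U.le (y [^]\<^bsub>L\<^esub> N) (e (poly_of_const (a i)) \<otimes>\<^bsub>L\<^esub> y [^]\<^bsub>L\<^esub> i)"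
      using const_closed[OF carrier_is_subring a(1)] const_length a(2) unfolding j_eq by blast
    thus ?thesis using a(3) unfolding j_eq by (intro exI[of _ N] exI[of _ "\<lambda>i. poly_of_const (a i)"] conjI)
  qed
  show ?thesis
    by (intro tame_quotient.intro valued_quotient.intro valued_quotient_axioms.intro tame_quotient_axioms.intro
        monic_ring_P U.V.valuative_field_axioms e_hom poly_monic_subring[OF carrier_is_subring] poly_monic_subring[OF A]
        degree_pos f fA len e_inj e_kernel rel monic_power_exists[OF A] divisor_unit)
qed

sublocale T: tame_quotient P length monic L U.le e "degree f" f S by (rule tame)

lemma S_carrier: "S \<subseteq> carrier P" by (rule univ_poly_subset[OF A])

lemma const_term:
  assumes "subring C K" "\<And>i. i < k \<Longrightarrow> c i \<in> carrier (univ_poly K C) \<and> length (c i) \<le> 1" "\<And>i. i < k \<Longrightarrow> E i \<in> carrier P"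
  shows "\<exists>a. (\<forall>i<k. a i \<in> C) \<and> e (\<Oplus>\<^bsub>P\<^esub>i\<in>{..<k}. c i \<otimes>\<^bsub>P\<^esub> E i) = (\<Oplus>\<^bsub>L\<^esub>i\<in>{..<(k::nat)}. j (a i) \<otimes>\<^bsub>L\<^esub> e (E i))"
proof -
  have "\<forall>i. \<exists>a. i < k \<longrightarrow> a \<in> C \<and> c i = poly_of_const a" using short_is_const[OF assms(1)] assms(2) by blast
  then obtain a where a: "\<And>i. i < k \<Longrightarrow> a i \<in> C \<and> c i = poly_of_const (a i)" by metis
  have cc: "c i \<in> carrier P" if "i < k" for i using assms(2)[OF that] univ_poly_subset[OF assms(1)] by blast
  have "e (\<Oplus>\<^bsub>P\<^esub>i\<in>{..<k}. c i \<otimes>\<^bsub>P\<^esub> E i) = (\<Oplus>\<^bsub>L\<^esub>i\<in>{..<k}. (e \<circ> (\<lambda>i. c i \<otimes>\<^bsub>P\<^esub> E i)) i)"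
    using cc assms(3) by (subst T.e.hom_finsum) (auto simp: comp_def)
  also have "\<dots> = (\<Oplus>\<^bsub>L\<^esub>i\<in>{..<k}. j (a i) \<otimes>\<^bsub>L\<^esub> e (E i))"
  proof (rule U.V.F.finsum_cong')
    show "(e \<circ> (\<lambda>i. c i \<otimes>\<^bsub>P\<^esub> E i)) i = j (a i) \<otimes>\<^bsub>L\<^esub> e (E i)" if "i \<in> {..<k}" for i
      using T.e.hom_mult[OF cc assms(3)] a that by (simp add: j_eq)
    show "(\<lambda>i. j (a i) \<otimes>\<^bsub>L\<^esub> e (E i)) \<in> {..<k} \<rightarrow> carrier L"
      using a assms(3) cc by (auto simp: j_eq)
  qed simp
  finally show ?thesis using a by blast
qed

text \<open>
  The classes of the monic polynomials of maximal value are a basis adapted to \<open>v\<close>. Division by \<open>f\<close>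
  represents the elements of \<open>B\<close> by polynomials of degree below \<open>n\<close>.
\<close>

theorem basis_exists: "\<exists>E. gr_basis K \<Gamma>\<^sub>0 v\<^sub>0 A L \<Gamma> v B j \<iota> (degree f) E"
proof -
  let ?n = "degree f"
  have "\<forall>i. \<exists>E. i < ?n \<longrightarrow> T.max_mon i E" using T.max_mon_exists by blast
  then obtain E where E: "\<And>i. i < ?n \<Longrightarrow> T.max_mon i (E i)" by metis
  have ES: "E i \<in> S" "monic (E i)" "length (E i) = Suc i" if "i < ?n" for i
    using E[OF that] by (auto simp: T.max_mon_def T.mon_deg_def)
  have EP: "E i \<in> carrier P" if "i < ?n" for i using ES(1)[OF that] S_carrier by blast
  have er: "ring_hom_ring P L e" using ring_hom_ringI2[OF T.ring_axioms U.V.F.ring_axioms] T.e.homh by blast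
  have SP: "subring S P" using T.S(1) unfolding T.monic_subring_def by blast
  have B: "subring B L" unfolding B_eq by (rule ring_hom_ring.img_is_subring[OF er SP])
  have ext: "extends_valuation K \<Gamma>\<^sub>0 v\<^sub>0 L j \<Gamma> v \<iota>" using U.unique by (simp add: unique_extension_def)
  have span: "\<exists>a. (\<forall>i<?n. a i \<in> A) \<and> b = (\<Oplus>\<^bsub>L\<^esub>i\<in>{..<?n}. j (a i) \<otimes>\<^bsub>L\<^esub> e (E i))" if b: "b \<in> B" for b
  proof -
    from b obtain p where p: "p \<in> S" "b = e p" unfolding B_eq by blast
    obtain q r where qr: "q \<in> S" "r \<in> S" "p = f \<otimes>\<^bsub>P\<^esub> q \<oplus>\<^bsub>P\<^esub> r" "length r < length f"
      using T.S f(2) p(1) unfolding T.monic_subring_def by blast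
    have qrP: "q \<in> carrier P" "r \<in> carrier P" using qr S_carrier by auto
    have "b = e r" unfolding p(2) qr(3) using f(1) qrP by (simp add: e_f)
    moreover have "length r \<le> ?n" using qr(4) by simp
    from T.max_mon_span[OF E qr(2) this] obtain c where
      c: "\<forall>i<?n. c i \<in> S \<and> length (c i) \<le> 1" "r = (\<Oplus>\<^bsub>P\<^esub>i\<in>{..<?n}. c i \<otimes>\<^bsub>P\<^esub> E i)" by blast
    ultimately show ?thesis using const_term[OF A, of ?n c E] c(1) EP unfolding c(2) by auto
  qed
  have indep: "U.le z (j (a i) \<otimes>\<^bsub>L\<^esub> e (E i))"
    if a: "\<And>i. i < ?n \<Longrightarrow> a i \<in> A" and z: "z \<in> carrier L" "U.le z (\<Oplus>\<^bsub>L\<^esub>i\<in>{..<?n}. j (a i) \<otimes>\<^bsub>L\<^esub> e (E i))" and i: "i < ?n" for a z i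
  proof -
    let ?c = "\<lambda>i. poly_of_const (a i)"
    have c: "?c i \<in> carrier P" if "i < ?n" for i using const_closed[OF A a[OF that]] S_carrier by blast
    have "e (\<Oplus>\<^bsub>P\<^esub>i\<in>{..<?n}. ?c i \<otimes>\<^bsub>P\<^esub> E i) = (\<Oplus>\<^bsub>L\<^esub>i\<in>{..<?n}. (e \<circ> (\<lambda>i. ?c i \<otimes>\<^bsub>P\<^esub> E i)) i)"
      using c EP by (subst T.e.hom_finsum) (auto simp: comp_def)
    also have "\<dots> = (\<Oplus>\<^bsub>L\<^esub>i\<in>{..<?n}. j (a i) \<otimes>\<^bsub>L\<^esub> e (E i))"
    proof (rule U.V.F.finsum_cong')
      show "(e \<circ> (\<lambda>i. ?c i \<otimes>\<^bsub>P\<^esub> E i)) i = j (a i) \<otimes>\<^bsub>L\<^esub> e (E i)" if "i \<in> {..<?n}" for i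
        using T.e.hom_mult[OF c EP] that by (simp add: j_eq)
      show "(\<lambda>i. j (a i) \<otimes>\<^bsub>L\<^esub> e (E i)) \<in> {..<?n} \<rightarrow> carrier L"
        using c EP by (auto simp: j_eq)
    qed simp
    finally have "U.le z (e (\<Oplus>\<^bsub>P\<^esub>i\<in>{..<?n}. ?c i \<otimes>\<^bsub>P\<^esub> E i))" using z(2) by simp
    from T.max_mon_independent[OF E c const_length z(1) this i] show ?thesis
      using T.e.hom_mult[OF c[OF i] EP[OF i]] by (simp add: j_eq)
  qed
  have "gr_basis K \<Gamma>\<^sub>0 v\<^sub>0 A L \<Gamma> v B j \<iota> ?n (\<lambda>i. e (E i))"
  proof (intro gr_basis.intro gr_extension.intro gr_basis_axioms.intro gr_extension_axioms.intro
      valued_subring.intro valued_subring_axioms.intro U.V0.valued_field_axioms U.V.valued_field_axioms A B j_hom)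
    show "order_embedding \<Gamma>\<^sub>0 \<Gamma> \<iota>" using ext by (simp add: extends_valuation_def)
    show "\<And>a. \<lbrakk>a \<in> carrier K; a \<noteq> \<zero>\<rbrakk> \<Longrightarrow> v (j a) = \<iota> (v\<^sub>0 a)" by (rule U.v_j)
    show "\<And>a. \<lbrakk>a \<in> carrier K; a \<noteq> \<zero>\<rbrakk> \<Longrightarrow> j a \<noteq> \<zero>\<^bsub>L\<^esub>" by (rule U.j_nonzero)
    show "\<And>a. a \<in> A \<Longrightarrow> j a \<in> B" unfolding B_eq j_eq using const_closed[OF A] by blast
    show "\<And>i. i < ?n \<Longrightarrow> e (E i) \<in> B" unfolding B_eq using ES(1) by blast
    show "e (E i) \<noteq> \<zero>\<^bsub>L\<^esub>" if "i < ?n" for i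
    proof
      assume "e (E i) = \<zero>\<^bsub>L\<^esub>"
      hence "E i = \<zero>\<^bsub>P\<^esub>" using e_inj[OF EP[OF that]] ES(3)[OF that] that by simp
      thus False using ES(2)[OF that] T.mon_nonzero by simp
    qed
  qed (erule span, (rule indep; assumption))
  thus ?thesis by blast
qed

end

theorem corollary4p3:
  fixes K :: "('a, 'm) ring_scheme" and A :: "'a set"
    and \<Gamma>\<^sub>0 :: "'g ogroup" and v\<^sub>0 :: "'a \<Rightarrow> 'g"
    and f :: "'a list"
    and \<Gamma> :: "'h ogroup" and v :: "'a list set \<Rightarrow> 'h" and \<iota> :: "'g \<Rightarrow> 'h"
  defines "L \<equiv> rupture K (carrier K) f"
    and "B \<equiv> rupture_subring K A f"
    and "j \<equiv> rupture_const K f"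
  assumes "quotient_field_of K A"
    and "local_ring (K\<lparr>carrier := A\<rparr>)"
    and "valuation K \<Gamma>\<^sub>0 v\<^sub>0"
    and "dominates K \<Gamma>\<^sub>0 v\<^sub>0 A"
    and "f \<in> carrier (univ_poly K A)"
    and "lead_coeff f = \<one>\<^bsub>K\<^esub>"
    and "pirreducible\<^bsub>K\<^esub> (carrier K) f"
    and "\<not> characteristic (residue_field (K\<lparr>carrier := A\<rparr>)) dvd degree f"
    and "unique_extension K \<Gamma>\<^sub>0 v\<^sub>0 L j \<Gamma> v \<iota>"
  shows "finitely_presented_algebra (gr K \<Gamma>\<^sub>0 v\<^sub>0 A) (gr L \<Gamma> v B) (gr_map \<Gamma>\<^sub>0 L \<Gamma> v B j \<iota>)
      \<and> finitely_generated_over \<Gamma> (\<iota> ` value_semigroup K v\<^sub>0 A) (value_semigroup L v B)"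
proof -
  have "field K" and A: "subring A K"
    using assms(4) subdomainE(1) by (auto simp: quotient_field_of_def subdomain_def subcring_def)
  interpret K: field K by fact
  have fK: "f \<in> carrier (poly_ring K)" using assms(8) K.univ_poly_subset[OF A] by blast
  have "f \<noteq> []" using K.pirreducible_degree[OF K.carrier_is_subfield fK assms(10)] by auto
  hence "rupture_extension K f"
    using fK assms(9,10) by unfold_locales (auto simp: K.monic_def)
  then interpret R: rupture_extension K f .
  have V0: "valued_field K \<Gamma>\<^sub>0 v\<^sub>0" using assms(6) valuation_iff_valued_field by blast
  have "valuation L \<Gamma> v" using assms(12) by (simp add: unique_extension_def extends_valuation_def)
  hence V: "valued_field L \<Gamma> v" using valuation_iff_valued_field by blast
  have "unique_ext K \<Gamma>\<^sub>0 v\<^sub>0 L \<Gamma> v j \<iota>"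
    unfolding L_def j_def
    using V0 V R.j_hom assms(12) unfolding L_def j_def by (intro unique_ext.intro unique_ext_axioms.intro)
  hence "tame_extension K f \<Gamma>\<^sub>0 v\<^sub>0 \<Gamma> v \<iota> A"
    unfolding L_def j_def using R.rupture_extension_axioms A assms(5,7,8,11)
    by (intro tame_extension.intro tame_extension_axioms.intro)
  then obtain E where "gr_basis K \<Gamma>\<^sub>0 v\<^sub>0 A L \<Gamma> v B j \<iota> (degree f) E"
    using tame_extension.basis_exists unfolding L_def B_def j_def by blast
  then interpret G: gr_basis K \<Gamma>\<^sub>0 v\<^sub>0 A L \<Gamma> v B j \<iota> "degree f" E .
  show ?thesis using G.gr_finitely_presented G.value_semigroup_finitely_generated by blast
qed

end
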